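(* Let $\mathfrak g$ be a finite-dimensional Lie algebra, simple or abelian, equipped with a nondegenerate symmetric invariant bilinear form $(\cdot|\cdot)$ (normalized so that long roots have square length $2$ when $\mathfrak g$ is simple), let $\varphi$ be an automorphism of $\mathfrak g$ preserving $(\cdot|\cdot)$, and let $\kappa\in\mathbb C$. Then every $\varphi$-twisted $V^\kappa(\mathfrak g)$-module is a restricted $\hat{\mathfrak g}_\varphi$-module of level $\kappa$ (with $at^m$ acting as the mode $a_{(m+\mathcal N)}$ for $a\in\mathfrak g_\alpha$, $m\in\alpha$). Conversely, every restricted $\hat{\mathfrak g}_\varphi$-module of level $\kappa$ uniquely extends to a $\varphi$-twisted $V^\kappa(\mathfrak g)$-module, i.e. it carries a unique structure of a $\varphi$-twisted $V^\kappa(\mathfrak g)$-module such that $a_{(m+\mathcal N)}=at^m$ for all $\alpha\in\mathbb C/\mathbb Z$, $a\in\mathfrak g_\alpha$, $m\in\alpha$.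
   Context: All vector spaces are over $\mathbb C$, $\mathrm i=\sqrt{-1}$; $D^{(k)}=D^k/k!$ for an operator $D$. $z,z_1,z_2,\dots$ are commuting formal variables, $\zeta,\zeta_1,\zeta_2,\dots$ are further formal variables (thought of as $\zeta=\log z$, $\zeta_i=\log z_i$), and $z_{ij}=z_i-z_j$. Put $D_z=\partial_z+z^{-1}\partial_\zeta$, $D_\zeta=z\partial_z+\partial_\zeta$, and similarly $D_{z_i},D_{\zeta_i}$. Logarithmic fields. For a vector space $W$ and $\alpha\in\mathbb C/\mathbb Z$, $W[\zeta][[z]]z^{-\alpha}$ is the space of formal series $\sum_{i\ge0}w_i(\zeta)z^{i-m}$ with $w_i(\zeta)\in W[\zeta]$, $m\in\alpha$. Let $\mathrm{LFie}_\alpha(W)=\mathrm{Hom}_{\mathbb C}(W,W[\zeta][[z]]z^{-\alpha})$ and $\mathrm{LFie}(W)=\bigoplus_{\alpha\in\mathbb C/\mathbb Z}\mathrm{LFie}_\alpha(W)$; its elements are called logarithmic fields. Two logarithmic fields $a,b$ are local if $z_{12}^N a(z_1)b(z_2)=z_{12}^N b(z_2)a(z_1)$ for some integer $N\ge0$. For local $a,b$ and $n\in\mathbb Z$, the $n$-th product is the logarithmic field given by $(a_{(n)}b)(z)v=D_{z_1}^{(N-1-n)}\bigl(z_{12}^N a(z_1)b(z_2)v\bigr)\big|_{z_1=z_2=z,\ \zeta_1=\zeta_2=\zeta}$ ($v\in W$) for $n\le N-1$, and $a_{(n)}b=0$ for $n\ge N$ (independent of the choice of $N$). A local collection is a set of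 logarithmic fields in which every pair is local. Twisted modules. For a vertex algebra $V$ with vacuum $\mathbf 1$ and $\varphi\in\mathrm{Aut}(V)$, a $\varphi$-twisted $V$-module is a vector space $W$ with a linear map $Y\colon V\to\mathrm{LFie}(W)$ such that $Y(\mathbf 1)=I$, $Y(V)$ is a local collection, $Y(\varphi a,z)=e^{2\pi\mathrm iD_\zeta}Y(a,z)$, and $Y(a_{(n)}b,z)=Y(a,z)_{(n)}Y(b,z)$ for all $a,b\in V$, $n\in\mathbb Z$. Here $e^{2\pi\mathrm iD_\zeta}$ sends $\zeta\mapsto\zeta+2\pi\mathrm i$, $z^\gamma\mapsto e^{2\pi\mathrm i\gamma}z^\gamma$. Affine vertex algebra. $\hat{\mathfrak g}=\mathfrak g[t,t^{-1}]\oplus\mathbb CK$ has brackets $[at^m,bt^n]=[a,b]t^{m+n}+m\delta_{m,-n}(a|b)K$, $K$ central. $V^\kappa(\mathfrak g)=\mathrm{Ind}^{\hat{\mathfrak g}}_{\mathfrak g[t]\oplus\mathbb CK}\mathbb C$ (with $\mathfrak g[t]$ acting by $0$ and $K$ by $\kappa$ on $\mathbb C$, $\mathbf 1$ the image of $1\in\mathbb C$) is the universal affine vertex algebra of level $\kappa$, with vacuum $\mathbf 1$, generated by the fields $Y((at^{-1})\mathbf 1,z)=\sum_{m\in\mathbb Z}(at^m)z^{-m-1}$, $a\in\mathfrak g$. One identifies $a\in\mathfrak g$ with $(at^{-1})\mathbf 1\in V^\kappa(\mathfrak g)$. The automorphism $\varphi$ of $\mathfrak g$ induces an automorphism of $V^\kappa(\mathfrak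 g)$, also denoted $\varphi$, which is locally finite. Write $\varphi=\sigma e^{-2\pi\mathrm i\mathcal N}$ uniquely with $\sigma$ semisimple, $\mathcal N$ (locally) nilpotent, $\sigma\mathcal N=\mathcal N\sigma$ (on $V^\kappa(\mathfrak g)$, compatibly with $\mathfrak g$); then $\sigma\in\mathrm{Aut}(\mathfrak g)$, $\mathcal N\in\mathrm{Der}(\mathfrak g)$. Let $\mathfrak g_\alpha=\{a\in\mathfrak g\mid\sigma a=e^{-2\pi\mathrm i\alpha}a\}$, $\alpha\in\mathbb C/\mathbb Z$. For $a\in\mathfrak g_\alpha$, $m\in\alpha$, and a $\varphi$-twisted module $W$, the mode is $a_{(m+\mathcal N)}=\mathrm{Res}_z\,z^mY(e^{\zeta\mathcal N}a,z)\in\mathrm{End}(W)$, where $\mathrm{Res}_z$ is the coefficient of $z^{-1}$ ($Y$ being extended linearly over $\mathbb C[\zeta]$; $Y(e^{\zeta\mathcal N}a,z)$ is independent of $\zeta$). The $\varphi$-twisted affinization $\hat{\mathfrak g}_\varphi$ is the Lie algebra spanned by a central element $K$ and elements $at^m$ ($a\in\mathfrak g_\alpha$, $m\in\alpha$, $\alpha\in\mathbb C/\mathbb Z$) with bracket $[at^m,bt^n]=[a,b]t^{m+n}+\delta_{m,-n}((m+\mathcal N)a|b)K$. A $\hat{\mathfrak g}_\varphi$-module $W$ is restricted if for every $a\in\mathfrak g_\alpha$, $m\in\alpha$, $v\in W$ there is an integer $L$ with $(at^{m+i})v=0$ for all integers $i\ge L$; it has level $\kappa$ if $K$ acts as $\kappa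 I$. *)

theory Defs
  imports Complex_Main "HOL-Library.Poly_Mapping" "HOL-Library.Product_Plus"
begin

section \<open>Complex vector spaces\<close>

class complex_vector = ab_group_add +
  fixes scaleC :: "complex \<Rightarrow> 'a \<Rightarrow> 'a"  (infixr "*\<^sub>C" 75)
  assumes scaleC_add_right: "c *\<^sub>C (x + y) = c *\<^sub>C x + c *\<^sub>C y"
    and scaleC_add_left: "(c + d) *\<^sub>C x = c *\<^sub>C x + d *\<^sub>C x"
    and scaleC_scaleC: "c *\<^sub>C d *\<^sub>C x = (c * d) *\<^sub>C x"
    and scaleC_one: "1 *\<^sub>C x = x"

global_interpretation complex_vector:
  vector_space "scaleC :: complex \<Rightarrow> 'a \<Rightarrow> 'a::complex_vector"
  by unfold_locales
    (simp_all add: scaleC_add_right scaleC_add_left scaleC_scaleC scaleC_one)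

abbreviation cspan :: "'a::complex_vector set \<Rightarrow> 'a set"
  where "cspan \<equiv> module.span scaleC"

abbreviation csubspace :: "'a::complex_vector set \<Rightarrow> bool"
  where "csubspace \<equiv> module.subspace scaleC"

abbreviation clinear :: "('a::complex_vector \<Rightarrow> 'b::complex_vector) \<Rightarrow> bool"
  where "clinear \<equiv> Vector_Spaces.linear scaleC scaleC"

definition cbilinear ::
  "('a::complex_vector \<Rightarrow> 'b::complex_vector \<Rightarrow> 'c::complex_vector) \<Rightarrow> bool"
  where "cbilinear f \<longleftrightarrow> (\<forall>a. clinear (f a)) \<and> (\<forall>b. clinear (\<lambda>a. f a b))"

instantiation complex :: complex_vector
begin
definition scaleC_complex :: "complex \<Rightarrow> complex \<Rightarrow> complex"
  where "scaleC_complex c x = c * x"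
instance by standard (simp_all add: scaleC_complex_def algebra_simps)
end

instantiation prod :: (complex_vector, complex_vector) complex_vector
begin
definition scaleC_prod :: "complex \<Rightarrow> 'a \<times> 'b \<Rightarrow> 'a \<times> 'b"
  where "scaleC_prod c x = (c *\<^sub>C fst x, c *\<^sub>C snd x)"
instance by standard
  (simp_all add: scaleC_prod_def prod_eq_iff scaleC_add_right scaleC_add_left
    scaleC_scaleC scaleC_one)
end

instantiation poly_mapping :: (type, complex_vector) complex_vector
begin
definition scaleC_poly_mapping :: "complex \<Rightarrow> ('a \<Rightarrow>\<^sub>0 'b) \<Rightarrow> ('a \<Rightarrow>\<^sub>0 'b)"
  where "scaleC_poly_mapping c p = Poly_Mapping.map (scaleC c) p"
lemma lookup_scaleC: "Poly_Mapping.lookup (c *\<^sub>C p) k = c *\<^sub>C Poly_Mapping.lookup p k"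
  for p :: "'a \<Rightarrow>\<^sub>0 'b"
  by (simp add: scaleC_poly_mapping_def Poly_Mapping.map.rep_eq when_def)
instance by standard
  (simp_all add: poly_mapping_eq_iff fun_eq_iff lookup_scaleC lookup_add
    scaleC_add_right scaleC_add_left scaleC_scaleC scaleC_one)
end


section \<open>Lie algebras\<close>

definition lie_algebra :: "('g::complex_vector \<Rightarrow> 'g \<Rightarrow> 'g) \<Rightarrow> bool"
  where "lie_algebra br \<longleftrightarrow> cbilinear br \<and> (\<forall>x. br x x = 0) \<and>
    (\<forall>x y z. br x (br y z) + br y (br z x) + br z (br x y) = 0)"

definition finite_dimensional :: "'g::complex_vector itself \<Rightarrow> bool"
  where "finite_dimensional _ \<longleftrightarrow> (\<exists>B::'g set. finite B \<and> cspan B = UNIV)"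

definition lie_abelian :: "('g::complex_vector \<Rightarrow> 'g \<Rightarrow> 'g) \<Rightarrow> bool"
  where "lie_abelian br \<longleftrightarrow> (\<forall>x y. br x y = 0)"

definition lie_ideal :: "('g::complex_vector \<Rightarrow> 'g \<Rightarrow> 'g) \<Rightarrow> 'g set \<Rightarrow> bool"
  where "lie_ideal br I \<longleftrightarrow> csubspace I \<and> (\<forall>x. \<forall>y\<in>I. br x y \<in> I)"

definition lie_simple :: "('g::complex_vector \<Rightarrow> 'g \<Rightarrow> 'g) \<Rightarrow> bool"
  where "lie_simple br \<longleftrightarrow>
    \<not> lie_abelian br \<and> (\<forall>I. lie_ideal br I \<longrightarrow> I = {0} \<or> I = UNIV)"

definition lie_automorphism ::
  "('g::complex_vector \<Rightarrow> 'g \<Rightarrow> 'g) \<Rightarrow> ('g \<Rightarrow> 'g) \<Rightarrow> bool"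
  where "lie_automorphism br f \<longleftrightarrow>
    clinear f \<and> bij f \<and> (\<forall>x y. f (br x y) = br (f x) (f y))"

definition invariant_form ::
  "('g::complex_vector \<Rightarrow> 'g \<Rightarrow> 'g) \<Rightarrow> ('g \<Rightarrow> 'g \<Rightarrow> complex) \<Rightarrow> bool"
  where "invariant_form br form \<longleftrightarrow> cbilinear form \<and>
    (\<forall>a b. form a b = form b a) \<and> (\<forall>a b c. form (br a b) c = form a (br b c))"

definition nondegenerate :: "('g::complex_vector \<Rightarrow> 'g \<Rightarrow> complex) \<Rightarrow> bool"
  where "nondegenerate form \<longleftrightarrow> (\<forall>a. (\<forall>b. form a b = 0) \<longrightarrow> a = 0)"

text \<open>A representation of the Lie algebra with carrier \<open>L\<close>; the values of \<open>\<rho>\<close> outside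
  \<open>L\<close> are irrelevant.\<close>

definition lie_module ::
  "'l::complex_vector set \<Rightarrow> ('l \<Rightarrow> 'l \<Rightarrow> 'l) \<Rightarrow> ('l \<Rightarrow> 'w::complex_vector \<Rightarrow> 'w) \<Rightarrow> bool"
  where "lie_module L br \<rho> \<longleftrightarrow>
    (\<forall>x\<in>L. clinear (\<rho> x)) \<and>
    (\<forall>x\<in>L. \<forall>y\<in>L. \<forall>v. \<rho> (x + y) v = \<rho> x v + \<rho> y v) \<and>
    (\<forall>c. \<forall>x\<in>L. \<forall>v. \<rho> (c *\<^sub>C x) v = c *\<^sub>C \<rho> x v) \<and>
    (\<forall>x\<in>L. \<forall>y\<in>L. \<forall>v. \<rho> (br x y) v = \<rho> x (\<rho> y v) - \<rho> y (\<rho> x v))"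


subsection \<open>Normalization of the form by long roots\<close>

fun lower_central :: "('g::complex_vector \<Rightarrow> 'g \<Rightarrow> 'g) \<Rightarrow> 'g set \<Rightarrow> nat \<Rightarrow> 'g set"
  where
    "lower_central br H 0 = H"
  | "lower_central br H (Suc n) = cspan {br x y | x y. x \<in> H \<and> y \<in> lower_central br H n}"

definition cartan_subalgebra ::
  "('g::complex_vector \<Rightarrow> 'g \<Rightarrow> 'g) \<Rightarrow> 'g set \<Rightarrow> bool"
  where "cartan_subalgebra br H \<longleftrightarrow> csubspace H \<and> (\<forall>x\<in>H. \<forall>y\<in>H. br x y \<in> H) \<and>
    (\<exists>n. lower_central br H n = {0}) \<and>
    (\<forall>x. (\<forall>y\<in>H. br x y \<in> H) \<longrightarrow> x \<in> H)"

text \<open>Roots are functionals on \<open>H\<close>; only the restriction of \<open>\<alpha>\<close> to \<open>H\<close> is used.\<close>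

definition is_root ::
  "('g::complex_vector \<Rightarrow> 'g \<Rightarrow> 'g) \<Rightarrow> 'g set \<Rightarrow> ('g \<Rightarrow> complex) \<Rightarrow> bool"
  where "is_root br H \<alpha> \<longleftrightarrow> (\<exists>y\<in>H. \<alpha> y \<noteq> 0) \<and>
    (\<exists>x. x \<noteq> 0 \<and> (\<forall>y\<in>H. br y x = \<alpha> y *\<^sub>C x))"

definition root_square_length ::
  "('g::complex_vector \<Rightarrow> 'g \<Rightarrow> complex) \<Rightarrow> 'g set \<Rightarrow> ('g \<Rightarrow> complex) \<Rightarrow> complex"
  where "root_square_length form H \<alpha> =
    (let t = (THE t. t \<in> H \<and> (\<forall>y\<in>H. form t y = \<alpha> y)) in form t t)"

text \<open>On a simple Lie algebra an invariant form is a complex multiple of the Killing form, so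
  before normalization the square lengths are common complex multiples of positive numbers
  and have to be compared by absolute value.\<close>

definition long_root ::
  "('g::complex_vector \<Rightarrow> 'g \<Rightarrow> 'g) \<Rightarrow> ('g \<Rightarrow> 'g \<Rightarrow> complex) \<Rightarrow> 'g set \<Rightarrow> ('g \<Rightarrow> complex) \<Rightarrow> bool"
  where "long_root br form H \<alpha> \<longleftrightarrow> is_root br H \<alpha> \<and>
    (\<forall>\<beta>. is_root br H \<beta> \<longrightarrow>
      cmod (root_square_length form H \<beta>) \<le> cmod (root_square_length form H \<alpha>))"

definition normalized_form ::
  "('g::complex_vector \<Rightarrow> 'g \<Rightarrow> 'g) \<Rightarrow> ('g \<Rightarrow> 'g \<Rightarrow> complex) \<Rightarrow> bool"
  where "normalized_form br form \<longleftrightarrow>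
    (\<forall>H \<alpha>. cartan_subalgebra br H \<and> long_root br form H \<alpha> \<longrightarrow>
      root_square_length form H \<alpha> = 2)"


subsection \<open>The decomposition \<open>\<phi> = \<sigma> e\<^sup>-\<^sup>2\<^sup>\<pi>\<^sup>i\<^sup>N\<close>\<close>

text \<open>\<open>exp_nilp c N\<close> is $e^{cN}$ for (locally) nilpotent \<open>N\<close>; the sum is then finite.\<close>

definition exp_nilp :: "complex \<Rightarrow> ('g::complex_vector \<Rightarrow> 'g) \<Rightarrow> 'g \<Rightarrow> 'g"
  where "exp_nilp c N a = Sum_any (\<lambda>j. (c ^ j / fact j) *\<^sub>C (N ^^ j) a)"

definition diagonalizable :: "('g::complex_vector \<Rightarrow> 'g) \<Rightarrow> bool"
  where "diagonalizable s \<longleftrightarrow> clinear s \<and> cspan {a. \<exists>c. s a = c *\<^sub>C a} = UNIV"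

definition nilpotent_op :: "('g::complex_vector \<Rightarrow> 'g) \<Rightarrow> bool"
  where "nilpotent_op N \<longleftrightarrow> clinear N \<and> (\<exists>n. \<forall>a. (N ^^ n) a = 0)"

definition jordan_decomposition ::
  "('g::complex_vector \<Rightarrow> 'g) \<Rightarrow> ('g \<Rightarrow> 'g) \<Rightarrow> ('g \<Rightarrow> 'g) \<Rightarrow> bool"
  where "jordan_decomposition \<phi> \<sigma> N \<longleftrightarrow>
    diagonalizable \<sigma> \<and> nilpotent_op N \<and> (\<forall>a. \<sigma> (N a) = N (\<sigma> a)) \<and>
    (\<forall>a. \<phi> a = \<sigma> (exp_nilp (- 2 * of_real pi * \<i>) N a))"

text \<open>The space $\mathfrak g_\alpha$, where $\alpha \in \mathbb C/\mathbb Z$ is given by any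
  representative \<open>m\<close>. Quantifying over a class $\alpha$ and $m \in \alpha$ therefore amounts
  to quantifying over the complex number \<open>m\<close>.\<close>

definition graded_part :: "('g::complex_vector \<Rightarrow> 'g) \<Rightarrow> complex \<Rightarrow> 'g set"
  where "graded_part \<sigma> m = {a. \<sigma> a = exp (- 2 * of_real pi * \<i> * m) *\<^sub>C a}"


section \<open>Affinizations\<close>

text \<open>Both affinizations are instances of this bracket. The pair \<open>(x, c)\<close> stands for $\sum_m x_m t^m + cK$, where $x_m$ is
  \<open>Poly_Mapping.lookup x m\<close>. \<open>\<omega> m a n b\<close> is the coefficient of $K$ in $[at^m, bt^n]$.\<close>

definition loop_bracket ::
  "('g::complex_vector \<Rightarrow> 'g \<Rightarrow> 'g) \<Rightarrow> ('i::ab_group_add \<Rightarrow> 'g \<Rightarrow> 'i \<Rightarrow> 'g \<Rightarrow> complex) \<Rightarrow>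
    ('i \<Rightarrow>\<^sub>0 'g) \<times> complex \<Rightarrow> ('i \<Rightarrow>\<^sub>0 'g) \<times> complex \<Rightarrow> ('i \<Rightarrow>\<^sub>0 'g) \<times> complex"
  where "loop_bracket br \<omega> X Y =
    ((\<Sum>m\<in>Poly_Mapping.keys (fst X). \<Sum>n\<in>Poly_Mapping.keys (fst Y).
        Poly_Mapping.single (m + n)
          (br (Poly_Mapping.lookup (fst X) m) (Poly_Mapping.lookup (fst Y) n))),
     (\<Sum>m\<in>Poly_Mapping.keys (fst X). \<Sum>n\<in>Poly_Mapping.keys (fst Y).
        \<omega> m (Poly_Mapping.lookup (fst X) m) n (Poly_Mapping.lookup (fst Y) n)))"

abbreviation loop_elem :: "'g::complex_vector \<Rightarrow> 'i \<Rightarrow> ('i \<Rightarrow>\<^sub>0 'g) \<times> complex"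
  where "loop_elem a m \<equiv> (Poly_Mapping.single m a, 0)"

abbreviation central_elem :: "('i \<Rightarrow>\<^sub>0 'g::complex_vector) \<times> complex"
  where "central_elem \<equiv> (0, 1)"

definition affine_bracket ::
  "('g::complex_vector \<Rightarrow> 'g \<Rightarrow> 'g) \<Rightarrow> ('g \<Rightarrow> 'g \<Rightarrow> complex) \<Rightarrow>
    (int \<Rightarrow>\<^sub>0 'g) \<times> complex \<Rightarrow> (int \<Rightarrow>\<^sub>0 'g) \<times> complex \<Rightarrow> (int \<Rightarrow>\<^sub>0 'g) \<times> complex"
  where "affine_bracket br form =
    loop_bracket br (\<lambda>m a n b. if m = - n then of_int m * form a b else 0)"

definition twisted_bracket ::
  "('g::complex_vector \<Rightarrow> 'g \<Rightarrow> 'g) \<Rightarrow> ('g \<Rightarrow> 'g \<Rightarrow> complex) \<Rightarrow> ('g \<Rightarrow> 'g) \<Rightarrow>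
    (complex \<Rightarrow>\<^sub>0 'g) \<times> complex \<Rightarrow> (complex \<Rightarrow>\<^sub>0 'g) \<times> complex \<Rightarrow> (complex \<Rightarrow>\<^sub>0 'g) \<times> complex"
  where "twisted_bracket br form N =
    loop_bracket br (\<lambda>m a n b. if m = - n then form (m *\<^sub>C a + N a) b else 0)"

definition twisted_carrier ::
  "('g::complex_vector \<Rightarrow> 'g) \<Rightarrow> ((complex \<Rightarrow>\<^sub>0 'g) \<times> complex) set"
  where "twisted_carrier \<sigma> = {X. \<forall>m. Poly_Mapping.lookup (fst X) m \<in> graded_part \<sigma> m}"

definition restricted_twisted_affine_module ::
  "('g::complex_vector \<Rightarrow> 'g \<Rightarrow> 'g) \<Rightarrow> ('g \<Rightarrow> 'g \<Rightarrow> complex) \<Rightarrow> ('g \<Rightarrow> 'g) \<Rightarrow> ('g \<Rightarrow> 'g) \<Rightarrow>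
    complex \<Rightarrow> ((complex \<Rightarrow>\<^sub>0 'g) \<times> complex \<Rightarrow> 'w::complex_vector \<Rightarrow> 'w) \<Rightarrow> bool"
  where "restricted_twisted_affine_module br form \<sigma> N \<kappa> \<rho> \<longleftrightarrow>
    lie_module (twisted_carrier \<sigma>) (twisted_bracket br form N) \<rho> \<and>
    (\<forall>m. \<forall>a\<in>graded_part \<sigma> m. \<forall>v. \<exists>L::int. \<forall>i\<ge>L. \<rho> (loop_elem a (m + of_int i)) v = 0) \<and>
    (\<forall>v. \<rho> central_elem v = \<kappa> *\<^sub>C v)"


section \<open>Induced modules\<close>

text \<open>For a Lie algebra $L$, a subalgebra $H$ and a character $\chi$ of $H$, the induced module
  $U(L) \otimes_{U(H)} \mathbb C_\chi$ is the quotient of the tensor algebra of $L$, i.e. of the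
  free vector space on words in $L$ modulo multilinearity, by the ideal generated by all
  $xy - yx - [x,y]$ and the left ideal generated by all $x - \chi(x)$ with $x \in H$.\<close>

abbreviation word :: "'l list \<Rightarrow> ('l list \<Rightarrow>\<^sub>0 complex)"
  where "word w \<equiv> Poly_Mapping.single w 1"

definition induced_relations ::
  "('l::complex_vector \<Rightarrow> 'l \<Rightarrow> 'l) \<Rightarrow> 'l set \<Rightarrow> ('l \<Rightarrow> complex) \<Rightarrow> ('l list \<Rightarrow>\<^sub>0 complex) set"
  where "induced_relations br H \<chi> =
    {word (u @ [x + y] @ w) - word (u @ [x] @ w) - word (u @ [y] @ w) | u x y w. True} \<union>
    {word (u @ [c *\<^sub>C x] @ w) - c *\<^sub>C word (u @ [x] @ w) | u c x w. True} \<union>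
    {word (u @ [x, y] @ w) - word (u @ [y, x] @ w) - word (u @ [br x y] @ w) | u x y w. True} \<union>
    {word (u @ [x]) - \<chi> x *\<^sub>C word u | u x. x \<in> H}"

definition word_eval ::
  "('l \<Rightarrow> 'v::complex_vector \<Rightarrow> 'v) \<Rightarrow> 'v \<Rightarrow> ('l list \<Rightarrow>\<^sub>0 complex) \<Rightarrow> 'v"
  where "word_eval \<rho> v p =
    (\<Sum>w\<in>Poly_Mapping.keys p. Poly_Mapping.lookup p w *\<^sub>C foldr \<rho> w v)"

text \<open>The representation \<open>\<rho>\<close> on \<open>'v\<close>, with \<open>v\<close> as the image of $1 \in \mathbb C_\chi$, is a copy of
  the induced module: acting on \<open>v\<close> identifies the above quotient with \<open>'v\<close>.\<close>

definition is_induced_module ::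
  "('l::complex_vector \<Rightarrow> 'l \<Rightarrow> 'l) \<Rightarrow> 'l set \<Rightarrow> ('l \<Rightarrow> complex) \<Rightarrow>
    ('l \<Rightarrow> 'v::complex_vector \<Rightarrow> 'v) \<Rightarrow> 'v \<Rightarrow> bool"
  where "is_induced_module br H \<chi> \<rho> v \<longleftrightarrow>
    lie_module UNIV br \<rho> \<and> surj (word_eval \<rho> v) \<and>
    {p. word_eval \<rho> v p = 0} = cspan (induced_relations br H \<chi>)"


section \<open>Vertex algebras\<close>

text \<open>\<open>pr n a b\<close> is $a_{(n)}b$, so that $Y(a,z)b = \sum_n a_{(n)}b\,z^{-n-1}$. The last conjunct
  is the Borcherds identity; its sums are finite by the field condition.\<close>

definition vertex_algebra ::
  "'v::complex_vector \<Rightarrow> (int \<Rightarrow> 'v \<Rightarrow> 'v \<Rightarrow> 'v) \<Rightarrow> bool"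
  where "vertex_algebra vac pr \<longleftrightarrow>
    (\<forall>n. cbilinear (pr n)) \<and>
    (\<forall>a b. \<exists>M. \<forall>n\<ge>M. pr n a b = 0) \<and>
    (\<forall>n a. pr n vac a = (if n = - 1 then a else 0)) \<and>
    (\<forall>a. pr (- 1) a vac = a) \<and>
    (\<forall>n\<ge>0. \<forall>a. pr n a vac = 0) \<and>
    (\<forall>m n k a b c.
      Sum_any (\<lambda>j::nat. (of_int m gchoose j) *\<^sub>C pr (m + k - int j) (pr (n + int j) a b) c) =
      Sum_any (\<lambda>j::nat. ((- 1) ^ j * (of_int n gchoose j)) *\<^sub>C
        pr (m + n - int j) a (pr (k + int j) b c)) -
      Sum_any (\<lambda>j::nat. ((- 1) ^ j * ((- 1) powi n) * (of_int n gchoose j)) *\<^sub>C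
        pr (n + k - int j) b (pr (m + int j) a c)))"

definition va_automorphism ::
  "'v::complex_vector \<Rightarrow> (int \<Rightarrow> 'v \<Rightarrow> 'v \<Rightarrow> 'v) \<Rightarrow> ('v \<Rightarrow> 'v) \<Rightarrow> bool"
  where "va_automorphism vac pr f \<longleftrightarrow> clinear f \<and> bij f \<and> f vac = vac \<and>
    (\<forall>n a b. f (pr n a b) = pr n (f a) (f b))"

text \<open>The identification of $\mathfrak g$ with $(\mathfrak g t^{-1})\mathbf 1$.\<close>

definition affine_incl ::
  "((int \<Rightarrow>\<^sub>0 'g::complex_vector) \<times> complex \<Rightarrow> 'v \<Rightarrow> 'v) \<Rightarrow> 'v \<Rightarrow> 'g \<Rightarrow> 'v"
  where "affine_incl \<rho> vac a = \<rho> (loop_elem a (- 1)) vac"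

text \<open>\<open>'v\<close> with vacuum \<open>vac\<close>, products \<open>pr\<close> and action \<open>\<rho>\<close> of $\hat{\mathfrak g}$ is (a copy of)
  $V^\kappa(\mathfrak g)$: the underlying module is induced from
  $\mathfrak g[t] \oplus \mathbb CK$, and the vertex algebra structure is the one with
  $Y((at^{-1})\mathbf 1, z) = \sum_m (at^m) z^{-m-1}$. Both are unique up to unique isomorphism.\<close>

definition universal_affine_vertex_algebra ::
  "('g::complex_vector \<Rightarrow> 'g \<Rightarrow> 'g) \<Rightarrow> ('g \<Rightarrow> 'g \<Rightarrow> complex) \<Rightarrow> complex \<Rightarrow>
    'v::complex_vector \<Rightarrow> (int \<Rightarrow> 'v \<Rightarrow> 'v \<Rightarrow> 'v) \<Rightarrow>
    ((int \<Rightarrow>\<^sub>0 'g) \<times> complex \<Rightarrow> 'v \<Rightarrow> 'v) \<Rightarrow> bool"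
  where "universal_affine_vertex_algebra br form \<kappa> vac pr \<rho> \<longleftrightarrow>
    is_induced_module (affine_bracket br form)
      {X. \<forall>m<0. Poly_Mapping.lookup (fst X) m = 0} (\<lambda>X. \<kappa> * snd X) \<rho> vac \<and>
    vertex_algebra vac pr \<and>
    (\<forall>a m v. pr m (affine_incl \<rho> vac a) v = \<rho> (loop_elem a m) v)"


section \<open>Logarithmic fields\<close>

text \<open>A formal series \<open>f\<close> in $z$ and $\zeta$ is given by its coefficients: \<open>f \<gamma> k\<close> is the
  coefficient of $z^\gamma \zeta^k$. Similarly \<open>F \<gamma>\<^sub>1 k\<^sub>1 \<gamma>\<^sub>2 k\<^sub>2\<close> is the coefficient of
  $z_1^{\gamma_1} \zeta_1^{k_1} z_2^{\gamma_2} \zeta_2^{k_2}$.\<close>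

type_synonym 'w lseries = "complex \<Rightarrow> nat \<Rightarrow> 'w"
type_synonym 'w lseries2 = "complex \<Rightarrow> nat \<Rightarrow> complex \<Rightarrow> nat \<Rightarrow> 'w"
type_synonym 'w lfield = "'w \<Rightarrow> 'w lseries"

text \<open>$W[\zeta][[z]]z^{-\alpha}$ and $\mathrm{LFie}_\alpha(W)$, with $\alpha \in \mathbb C/\mathbb Z$ given
  by a representative.\<close>

definition lseries_space :: "complex \<Rightarrow> 'w::complex_vector lseries set"
  where "lseries_space \<alpha> = {f. (\<forall>\<gamma>. finite {k. f \<gamma> k \<noteq> 0}) \<and>
    (\<exists>m. m - \<alpha> \<in> \<int> \<and> (\<forall>\<gamma> k. f \<gamma> k \<noteq> 0 \<longrightarrow> (\<exists>i::nat. \<gamma> = of_nat i - m)))}"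

definition LFie_part :: "complex \<Rightarrow> 'w::complex_vector lfield set"
  where "LFie_part \<alpha> =
    {a. (\<forall>\<gamma> k. clinear (\<lambda>v. a v \<gamma> k)) \<and> (\<forall>v. a v \<in> lseries_space \<alpha>)}"

definition LFie :: "'w::complex_vector lfield set"
  where "LFie = {a. \<exists>S b. finite S \<and> (\<forall>\<alpha>\<in>S. b \<alpha> \<in> LFie_part \<alpha>) \<and>
    (\<forall>v \<gamma> k. a v \<gamma> k = (\<Sum>\<alpha>\<in>S. b \<alpha> v \<gamma> k))}"

definition id_field :: "'w::complex_vector lfield"
  where "id_field v \<gamma> k = (if \<gamma> = 0 \<and> k = 0 then v else 0)"

definition mult_z12 :: "'w::complex_vector lseries2 \<Rightarrow> 'w lseries2"
  where "mult_z12 F \<gamma>\<^sub>1 k\<^sub>1 \<gamma>\<^sub>2 k\<^sub>2 = F (\<gamma>\<^sub>1 - 1) k\<^sub>1 \<gamma>\<^sub>2 k\<^sub>2 - F \<gamma>\<^sub>1 k\<^sub>1 (\<gamma>\<^sub>2 - 1) k\<^sub>2"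

text \<open>The series $z_{12}^N a(z_1) b(z_2) v$ and $z_{12}^N b(z_2) a(z_1) v$.\<close>

definition z12_ab ::
  "nat \<Rightarrow> 'w::complex_vector lfield \<Rightarrow> 'w lfield \<Rightarrow> 'w \<Rightarrow> 'w lseries2"
  where "z12_ab N a b v = (mult_z12 ^^ N) (\<lambda>\<gamma>\<^sub>1 k\<^sub>1 \<gamma>\<^sub>2 k\<^sub>2. a (b v \<gamma>\<^sub>2 k\<^sub>2) \<gamma>\<^sub>1 k\<^sub>1)"

definition z12_ba ::
  "nat \<Rightarrow> 'w::complex_vector lfield \<Rightarrow> 'w lfield \<Rightarrow> 'w \<Rightarrow> 'w lseries2"
  where "z12_ba N a b v = (mult_z12 ^^ N) (\<lambda>\<gamma>\<^sub>1 k\<^sub>1 \<gamma>\<^sub>2 k\<^sub>2. b (a v \<gamma>\<^sub>1 k\<^sub>1) \<gamma>\<^sub>2 k\<^sub>2)"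

definition local_of_order :: "nat \<Rightarrow> 'w::complex_vector lfield \<Rightarrow> 'w lfield \<Rightarrow> bool"
  where "local_of_order N a b \<longleftrightarrow> (\<forall>v. z12_ab N a b v = z12_ba N a b v)"

definition mutually_local :: "'w::complex_vector lfield \<Rightarrow> 'w lfield \<Rightarrow> bool"
  where "mutually_local a b \<longleftrightarrow> (\<exists>N. local_of_order N a b)"

definition local_collection :: "'w::complex_vector lfield set \<Rightarrow> bool"
  where "local_collection C \<longleftrightarrow> C \<subseteq> LFie \<and> (\<forall>a\<in>C. \<forall>b\<in>C. mutually_local a b)"

text \<open>$D_{z_1} = \partial_{z_1} + z_1^{-1}\partial_{\zeta_1}$ on coefficients\<close>

definition D_z1 :: "'w::complex_vector lseries2 \<Rightarrow> 'w lseries2"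
  where "D_z1 F \<gamma>\<^sub>1 k\<^sub>1 \<gamma>\<^sub>2 k\<^sub>2 =
    (\<gamma>\<^sub>1 + 1) *\<^sub>C F (\<gamma>\<^sub>1 + 1) k\<^sub>1 \<gamma>\<^sub>2 k\<^sub>2 + of_nat (k\<^sub>1 + 1) *\<^sub>C F (\<gamma>\<^sub>1 + 1) (k\<^sub>1 + 1) \<gamma>\<^sub>2 k\<^sub>2"

text \<open>The restriction to $z_1 = z_2 = z$, $\zeta_1 = \zeta_2 = \zeta$. When \<open>F\<close> is as in
  \<open>nth_product\<close> below, its exponents in each variable are bounded below in finitely many
  classes modulo $\mathbb Z$, so that all sums are finite.\<close>

definition diag :: "'w::complex_vector lseries2 \<Rightarrow> 'w lseries"
  where "diag F \<gamma> k = (\<Sum>k\<^sub>1\<le>k. Sum_any (\<lambda>\<gamma>\<^sub>1. F \<gamma>\<^sub>1 k\<^sub>1 (\<gamma> - \<gamma>\<^sub>1) (k - k\<^sub>1)))"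

text \<open>The products of local fields do not depend on the order of locality \<open>N\<close> that is used to
  compute them; we take the least one.\<close>

definition nth_product_order ::
  "nat \<Rightarrow> 'w::complex_vector lfield \<Rightarrow> int \<Rightarrow> 'w lfield \<Rightarrow> 'w lfield"
  where "nth_product_order N a n b v \<gamma> k =
    (if n \<le> int N - 1 then
       (let p = nat (int N - 1 - n)
        in (1 / fact p) *\<^sub>C diag ((D_z1 ^^ p) (z12_ab N a b v)) \<gamma> k)
     else 0)"

definition nth_product ::
  "'w::complex_vector lfield \<Rightarrow> int \<Rightarrow> 'w lfield \<Rightarrow> 'w lfield"
  where "nth_product a n b = nth_product_order (LEAST N. local_of_order N a b) a n b"

text \<open>$e^{2\pi i D_\zeta}$, i.e. $\zeta \mapsto \zeta + 2\pi i$ and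
  $z^\gamma \mapsto e^{2\pi i\gamma} z^\gamma$\<close>

definition monodromy :: "'w::complex_vector lfield \<Rightarrow> 'w lfield"
  where "monodromy a v \<gamma> k = exp (2 * of_real pi * \<i> * \<gamma>) *\<^sub>C
    Sum_any (\<lambda>l. (of_nat (l choose k) * (2 * of_real pi * \<i>) ^ (l - k)) *\<^sub>C a v \<gamma> l)"


section \<open>Twisted modules\<close>

definition twisted_module ::
  "'v::complex_vector \<Rightarrow> (int \<Rightarrow> 'v \<Rightarrow> 'v \<Rightarrow> 'v) \<Rightarrow> ('v \<Rightarrow> 'v) \<Rightarrow>
    ('v \<Rightarrow> 'w::complex_vector lfield) \<Rightarrow> bool"
  where "twisted_module vac pr \<phi> Y \<longleftrightarrow>
    (\<forall>a. Y a \<in> LFie) \<and>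
    (\<forall>v \<gamma> k. clinear (\<lambda>a. Y a v \<gamma> k)) \<and>
    Y vac = id_field \<and>
    local_collection (range Y) \<and>
    (\<forall>a. Y (\<phi> a) = monodromy (Y a)) \<and>
    (\<forall>a n b. Y (pr n a b) = nth_product (Y a) n (Y b))"

text \<open>$Y(e^{\zeta N}a, z) = \sum_j \zeta^j Y(N^j a, z)/j!$ for $a \in \mathfrak g$, where
  \<open>\<iota>\<close> embeds $\mathfrak g$ into the vertex algebra\<close>

definition Y_exp ::
  "('v \<Rightarrow> 'w::complex_vector lfield) \<Rightarrow> ('g \<Rightarrow> 'v) \<Rightarrow> ('g \<Rightarrow> 'g) \<Rightarrow> 'g \<Rightarrow> 'w lfield"
  where "Y_exp Y \<iota> N a v \<gamma> k =
    (\<Sum>j\<le>k. (1 / fact j) *\<^sub>C Y (\<iota> ((N ^^ j) a)) v \<gamma> (k - j))"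

text \<open>$\mathrm{Res}_z\, z^m Y(e^{\zeta N}a, z)v$ as an element of $W[\zeta]$, given by its
  coefficients\<close>

definition mode_series ::
  "('v \<Rightarrow> 'w::complex_vector lfield) \<Rightarrow> ('g \<Rightarrow> 'v) \<Rightarrow> ('g \<Rightarrow> 'g) \<Rightarrow> 'g \<Rightarrow> complex \<Rightarrow> 'w \<Rightarrow> nat \<Rightarrow> 'w"
  where "mode_series Y \<iota> N a m v k = Y_exp Y \<iota> N a v (- 1 - m) k"

text \<open>$at^m$ acts as the mode $a_{(m+N)}$, for all $a \in \mathfrak g_\alpha$, $m \in \alpha$. The mode,
  a priori a polynomial in $\zeta$, is required to be the constant polynomial.\<close>

definition acts_by_modes ::
  "('v \<Rightarrow> 'w::complex_vector lfield) \<Rightarrow> ('g::complex_vector \<Rightarrow> 'v) \<Rightarrow> ('g \<Rightarrow> 'g) \<Rightarrow> ('g \<Rightarrow> 'g) \<Rightarrow>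
    ((complex \<Rightarrow>\<^sub>0 'g) \<times> complex \<Rightarrow> 'w \<Rightarrow> 'w) \<Rightarrow> bool"
  where "acts_by_modes Y \<iota> \<sigma> N \<rho> \<longleftrightarrow>
    (\<forall>m. \<forall>a\<in>graded_part \<sigma> m. \<forall>v k.
      mode_series Y \<iota> N a m v k = (if k = 0 then \<rho> (loop_elem a m) v else 0))"

end

theory Submission
  imports Defs "HOL-Library.Function_Algebras"
begin

text \<open>
  The correspondence is a statement about the fields \<open>X a = Y(a, z)\<close> with \<open>a\<close> in the Lie algebra.
  Since the vertex algebra is generated by them, a twisted module is determined by these
  fields, and three facts about them give the theorem.

  \<^item> Twisted fields have a fixed shape. Write $\varphi = \sigma e^{-2\pi i N}$. If \<open>a\<close> lies in
    \<open>graded_part \<sigma> m\<close> and the monodromy of \<open>X a\<close> is \<open>X (\<phi> a)\<close>, then $X(a, z) = X^0(z^{-N} a, z)$ where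
    $X^0$ is free of logarithms and has exponents in $-m + \mathbb Z$ (\<open>twisted_log_form\<close>). Hence the
    modes $a_{(m+N)}$ determine the field, and conversely any operators $at^m$ that kill
    each vector for large \<open>m\<close> define fields with the correct monodromy.

  \<^item> The commutation relations of the modes in the twisted affinization are equivalent to the operator
    product expansion, that is, to locality together with $a_{(0)}b = [a,b]$, $a_{(1)}b = \kappa(a|b)$
    and $a_{(n)}b = 0$ for $n \ge 2$ (\<open>commutators_imp_ope\<close>, \<open>ope_imp_commutators\<close>). The
    non-negative products of \<open>a\<close> and \<open>b\<close> are those of the polar part of the commutator $[a(z_1), b(z_2)]$
    (\<open>nth_product_commutator\<close>), and that commutator is a combination of derivatives of delta functions
    which its residue products determine. The central term is the cocycle $((m+N)a|b)$ because
    \<open>\<sigma>\<close> preserves bracket and form while \<open>N\<close> is a skew derivation, which follows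
    from comparing the eigenspaces of \<open>\<sigma>\<close> with the generalized eigenspaces of \<open>\<phi>\<close>.

  \<^item> Products of local logarithmic fields satisfy the identities of a vertex algebra: Dong's
    lemma (\<open>Dong\<close>), the iterate formula (\<open>iterate_formula\<close>) and the commutator formula
    (\<open>commutator_formula\<close>). All three are about residue products of a series in three variables.
    For the two formulas, after multiplication by a high power of $z_{12}z_{13}z_{23}$ every product becomes a Taylor coefficient
    at $z_1 = z_2 = z_3$, where the identities are elementary; the factors are then removed
    by difference equations in the indices of the products.

  In one direction, the products $a_{(n)}b$ of the vertex algebra give the operator product expansion
  of the fields, hence the commutation relations of the modes. In the other direction, the commutator formula lets the
  untwisted affinization act on the logarithmic fields local to all \<open>X a\<close>, with $at^m$ acting as the
  product \<open>c \<mapsto> nth_product (X a) m c\<close>. The identity field satisfies the relations of the vacuum, so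
  the universal property of the induced module yields a map \<open>Y\<close>. It respects
  all products by the iterate formula, its values are mutually local by Dong's lemma, and its monodromy is
  correct because monodromy respects products.
\<close>

section \<open>Linear algebra\<close>

text \<open>Pointwise operations make functions a vector space. A series in two variables is then a series in
  the first variable whose coefficients are series in the second, and operators on series in one
  variable apply to the outermost variable of a series in several variables.\<close>

instantiation "fun" :: (type, complex_vector) complex_vector
begin
definition scaleC_fun :: "complex \<Rightarrow> ('a \<Rightarrow> 'b) \<Rightarrow> 'a \<Rightarrow> 'b"
  where "scaleC_fun c f x = c *\<^sub>C f x"
instance by standard
  (simp_all add: scaleC_fun_def fun_eq_iff scaleC_add_right scaleC_add_left scaleC_scaleC scaleC_one)
end

lemma scaleC_fun_apply [simp]: "(c *\<^sub>C f) x = c *\<^sub>C f x"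
  by (simp add: scaleC_fun_def)

lemma scaleC_zero_left [simp]: "0 *\<^sub>C x = 0" for x :: "'a::complex_vector"
  by (rule complex_vector.scale_zero_left)

lemma scaleC_zero_right [simp]: "c *\<^sub>C (0::'a::complex_vector) = 0"
  by (rule complex_vector.scale_zero_right)

lemma scaleC_one' [simp]: "1 *\<^sub>C x = x" for x :: "'a::complex_vector"
  by (rule scaleC_one)

lemma scaleC_minus_left [simp]: "(- c) *\<^sub>C x = - (c *\<^sub>C x)" for x :: "'a::complex_vector"
  by (rule complex_vector.scale_minus_left)

lemma scaleC_diff_right: "c *\<^sub>C (x - y) = c *\<^sub>C x - c *\<^sub>C y" for x :: "'a::complex_vector"
  by (rule complex_vector.scale_right_diff_distrib)

lemma scaleC_diff_left: "(c - d) *\<^sub>C x = c *\<^sub>C x - d *\<^sub>C x" for x :: "'a::complex_vector"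
  by (rule complex_vector.scale_left_diff_distrib)

lemma scaleC_sum_right: "c *\<^sub>C sum f A = (\<Sum>i\<in>A. c *\<^sub>C f i)" for f :: "'i \<Rightarrow> 'a::complex_vector"
  by (rule complex_vector.scale_sum_right)

lemma scaleC_sum_left: "sum f A *\<^sub>C x = (\<Sum>i\<in>A. f i *\<^sub>C x)" for x :: "'a::complex_vector"
  by (rule complex_vector.scale_sum_left)

lemma scaleC_cancel [simp]: "c *\<^sub>C x = c *\<^sub>C y \<longleftrightarrow> c = 0 \<or> x = y" for x :: "'a::complex_vector"
  by (metis complex_vector.scale_cancel_left)

lemmas scaleC_distribs = scaleC_add_right scaleC_add_left scaleC_diff_right scaleC_diff_left

lemma clinear_iff: "clinear f \<longleftrightarrow>
    (\<forall>x y. f (x + y) = f x + f y) \<and> (\<forall>c x. f (c *\<^sub>C x) = c *\<^sub>C f x)"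
  by (auto simp: Vector_Spaces.linear_def module_hom_def module_hom_axioms_def
      complex_vector.vector_space_axioms complex_vector.module_axioms)

lemma clinearI:
  assumes "\<And>x y. f (x + y) = f x + f y" "\<And>c x. f (c *\<^sub>C x) = c *\<^sub>C f x"
  shows "clinear f"
  using assms by (simp add: clinear_iff)

lemma clinear_add: "clinear f \<Longrightarrow> f (x + y) = f x + f y"
  by (simp add: clinear_iff)

lemma clinear_scaleC: "clinear f \<Longrightarrow> f (c *\<^sub>C x) = c *\<^sub>C f x"
  by (simp add: clinear_iff)

lemma clinear_0: "clinear f \<Longrightarrow> f 0 = 0"
  by (metis clinear_scaleC scaleC_zero_left)

lemma clinear_neg: "clinear f \<Longrightarrow> f (- x) = - f x"
  by (metis clinear_scaleC scaleC_minus_left scaleC_one')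

lemma clinear_diff: "clinear f \<Longrightarrow> f (x - y) = f x - f y"
  by (metis clinear_add clinear_neg diff_conv_add_uminus)

lemma clinear_sum: "clinear f \<Longrightarrow> f (sum g A) = (\<Sum>i\<in>A. f (g i))"
  by (induction A rule: infinite_finite_induct) (simp_all add: clinear_0 clinear_add)

lemma clinear_Sum_any:
  assumes "clinear f" "finite {i. g i \<noteq> 0}"
  shows "f (Sum_any g) = Sum_any (\<lambda>i. f (g i))"
proof -
  have "Sum_any (\<lambda>i. f (g i)) = (\<Sum>i\<in>{i. g i \<noteq> 0}. f (g i))"
    using assms by (intro Sum_any.expand_superset) (auto simp: clinear_0)
  then show ?thesis
    using assms by (simp add: Sum_any.expand_set clinear_sum)
qed

lemma clinear_compose: "clinear f \<Longrightarrow> clinear g \<Longrightarrow> clinear (\<lambda>x. f (g x))"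
  by (simp add: clinear_iff)

lemma clinear_funpow: "clinear f \<Longrightarrow> clinear (f ^^ n)" for f :: "'a::complex_vector \<Rightarrow> 'a"
proof (induction n)
  case 0
  show ?case by (simp add: clinear_iff)
next
  case (Suc n)
  from clinear_compose [OF Suc.prems Suc.IH [OF Suc.prems]] show ?case
    by (simp add: o_def)
qed

lemma sum_fun_apply: "sum f A x = (\<Sum>i\<in>A. f i x)"
  by (induction A rule: infinite_finite_induct) simp_all

lemma Sum_any_translate: "Sum_any (\<lambda>x::complex. f (x + c)) = Sum_any f"
proof -
  have "bij (\<lambda>x::complex. x + c)"
    by (rule o_bij [where g = "\<lambda>x. x - c"]) auto
  then show ?thesis
    by (intro Sum_any.reindex_cong [symmetric]) auto
qed

lemma Sum_any_translate_diff: "Sum_any (\<lambda>x::complex. f (x - c)) = Sum_any f"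
  using Sum_any_translate [of f "- c"] by simp

lemma finite_shift: "finite {x::complex. P (x + c)}" if "finite {x. P x}"
proof -
  have "{x. P (x + c)} \<subseteq> (\<lambda>x. x - c) ` {x. P x}"
    by (auto simp: image_iff) (metis add_diff_cancel_right')
  then show ?thesis using that by (meson finite_imageI finite_subset)
qed

section \<open>Formal series in one and two variables\<close>

definition shiftz :: "'u::complex_vector lseries \<Rightarrow> 'u lseries"
  where "shiftz f e k = f (e - 1) k"

definition der :: "'u::complex_vector lseries \<Rightarrow> 'u lseries"
  where "der f e k = (e + 1) *\<^sub>C f (e + 1) k + of_nat (k + 1) *\<^sub>C f (e + 1) (k + 1)"

text \<open>Lets an operator on series act on the second variable instead of the first.\<close>

definition inner :: "('u lseries \<Rightarrow> 'u lseries) \<Rightarrow> 'u::complex_vector lseries2 \<Rightarrow> 'u lseries2"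
  where "inner f F = (\<lambda>e k. f (F e k))"

text \<open>Applies a linear map to the coefficients. Everything below commutes with this, which makes it possible
  to evaluate nested products one variable at a time.\<close>

definition map2 :: "('u \<Rightarrow> 'w) \<Rightarrow> 'u lseries2 \<Rightarrow> 'w lseries2"
  where "map2 L F = (\<lambda>e1 k1 e2 k2. L (F e1 k1 e2 k2))"

lemma D_z1_eq: "D_z1 = der"
  by (simp add: fun_eq_iff D_z1_def der_def)

lemma mult_z12_eq: "mult_z12 F = shiftz F - inner shiftz F"
  by (simp add: fun_eq_iff mult_z12_def shiftz_def inner_def)

lemma clinear_shiftz: "clinear shiftz"
  by (simp add: clinear_iff fun_eq_iff shiftz_def)

lemma clinear_der: "clinear der"
  by (simp add: clinear_iff fun_eq_iff der_def scaleC_distribs scaleC_scaleC algebra_simps)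

lemma clinear_inner: "clinear f \<Longrightarrow> clinear (inner f)"
  by (auto simp: clinear_iff fun_eq_iff inner_def)

lemma clinear_mult_z12: "clinear mult_z12"
  by (simp add: clinear_iff fun_eq_iff mult_z12_def scaleC_distribs algebra_simps)

lemmas mult_z12_pow_linear = clinear_funpow [OF clinear_mult_z12]
lemmas der_pow_linear = clinear_funpow [OF clinear_der]

lemma mult_z12_map2: "clinear L \<Longrightarrow> mult_z12 (map2 L F) = map2 L (mult_z12 F)"
  by (simp add: fun_eq_iff mult_z12_def map2_def clinear_diff)

lemma mult_z12_pow_map2: "clinear L \<Longrightarrow> (mult_z12 ^^ n) (map2 L F) = map2 L ((mult_z12 ^^ n) F)"
  by (induction n) (simp_all add: mult_z12_map2)

lemma der_map2: "clinear L \<Longrightarrow> der (map2 L F) = map2 L (der F)"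
  by (simp add: fun_eq_iff der_def map2_def clinear_add clinear_scaleC)

lemma der_pow_map2: "clinear L \<Longrightarrow> (der ^^ n) (map2 L F) = map2 L ((der ^^ n) F)"
  by (induction n) (simp_all add: der_map2)

lemma der_mult_z12: "der (mult_z12 F) = mult_z12 (der F) + F"
  by (simp add: fun_eq_iff der_def mult_z12_def scaleC_distribs algebra_simps)

lemma der_pow_mult_z12:
  "(der ^^ n) (mult_z12 F) = mult_z12 ((der ^^ n) F) + of_nat n *\<^sub>C (der ^^ (n - 1)) F"
proof (induction n)
  case (Suc n)
  have "(der ^^ Suc n) (mult_z12 F) = der (mult_z12 ((der ^^ n) F) + of_nat n *\<^sub>C (der ^^ (n - 1)) F)"
    by (simp only: funpow.simps o_apply Suc)
  also have "\<dots> = mult_z12 ((der ^^ Suc n) F) + (der ^^ n) F + of_nat n *\<^sub>C der ((der ^^ (n - 1)) F)"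
    by (simp add: clinear_add[OF clinear_der] clinear_scaleC[OF clinear_der] der_mult_z12)
  also have "of_nat n *\<^sub>C der ((der ^^ (n - 1)) F) = of_nat n *\<^sub>C (der ^^ n) F"
    by (cases n) simp_all
  finally show ?case
    by (simp add: scaleC_add_left algebra_simps)
qed simp

lemma inner_shiftz_mult_z12: "inner shiftz (mult_z12 F) = mult_z12 (inner shiftz F)"
  by (simp add: fun_eq_iff inner_def shiftz_def mult_z12_def)

lemma inner_shiftz_mult_z12_pow: "inner shiftz ((mult_z12 ^^ n) F) = (mult_z12 ^^ n) (inner shiftz F)"
  by (induction n) (simp_all add: inner_shiftz_mult_z12)

lemma inner_shiftz_der: "inner shiftz (der F) = der (inner shiftz F)"
  by (simp add: fun_eq_iff inner_def shiftz_def der_def)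

lemma inner_shiftz_der_pow: "inner shiftz ((der ^^ n) F) = (der ^^ n) (inner shiftz F)"
  by (induction n) (simp_all add: inner_shiftz_der)

subsection \<open>Restriction to the diagonal\<close>

text \<open>All coefficients of the restriction to the diagonal are finite sums. The set of exponents is
  required to be finite uniformly in the powers of the logarithms, because \<open>der\<close> mixes these powers.\<close>

definition nice2 :: "'u::complex_vector lseries2 \<Rightarrow> bool"
  where "nice2 F \<longleftrightarrow> (\<forall>e. finite {e1. \<exists>k1 k2. F e1 k1 (e - e1) k2 \<noteq> 0})"

lemma nice2D: "nice2 F \<Longrightarrow> finite {e1. \<exists>k1 k2. F e1 k1 (e - e1) k2 \<noteq> 0}"
  by (simp add: nice2_def)

lemma nice2_finite: "nice2 F \<Longrightarrow> finite {e1. F e1 k1 (e - e1) k2 \<noteq> 0}"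
  by (rule finite_subset [OF _ nice2D]) auto

lemma nice2_add: "nice2 F \<Longrightarrow> nice2 G \<Longrightarrow> nice2 (F + G)"
  unfolding nice2_def
proof safe
  fix e
  assume "\<forall>e. finite {e1. \<exists>k1 k2. F e1 k1 (e - e1) k2 \<noteq> 0}"
    "\<forall>e. finite {e1. \<exists>k1 k2. G e1 k1 (e - e1) k2 \<noteq> 0}"
  then have "finite ({e1. \<exists>k1 k2. F e1 k1 (e - e1) k2 \<noteq> 0} \<union> {e1. \<exists>k1 k2. G e1 k1 (e - e1) k2 \<noteq> 0})"
    by blast
  then show "finite {e1. \<exists>k1 k2. (F + G) e1 k1 (e - e1) k2 \<noteq> 0}"
    by (rule rev_finite_subset) fastforce
qed

lemma nice2_0 [simp]: "nice2 0"
  by (simp add: nice2_def)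

lemma nice2_mono:
  assumes "nice2 F" and "\<And>e1 k1 e2 k2. G e1 k1 e2 k2 \<noteq> 0 \<Longrightarrow> \<exists>k1 k2. F e1 k1 e2 k2 \<noteq> 0"
  shows "nice2 G"
  unfolding nice2_def
proof
  fix e
  show "finite {e1. \<exists>k1 k2. G e1 k1 (e - e1) k2 \<noteq> 0}"
    by (rule finite_subset [OF _ nice2D [OF assms(1), of e]]) (use assms(2) in blast)
qed

lemma nice2_map2: "clinear L \<Longrightarrow> nice2 F \<Longrightarrow> nice2 (map2 L F)"
  by (rule nice2_mono [of F]) (auto simp: map2_def, metis clinear_0)

lemma nice2_scaleC: "nice2 F \<Longrightarrow> nice2 (c *\<^sub>C F)"
  by (rule nice2_mono [of F]) auto

lemma nice2_diff: "nice2 F \<Longrightarrow> nice2 G \<Longrightarrow> nice2 (F - G)"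
  using nice2_add [of F "(-1) *\<^sub>C G"] nice2_scaleC [of G "-1"] by simp

lemma nice2_inner_shiftz: "nice2 (inner shiftz F)" if "nice2 F"
  unfolding nice2_def
proof
  fix e
  show "finite {e1. \<exists>k1 k2. inner shiftz F e1 k1 (e - e1) k2 \<noteq> 0}"
    using nice2D [OF that, of "e - 1"] by (simp add: inner_def shiftz_def algebra_simps)
qed

lemma nice2_shiftz: "nice2 (shiftz F)" if "nice2 F"
  unfolding nice2_def
proof
  fix e
  show "finite {e1. \<exists>k1 k2. shiftz F e1 k1 (e - e1) k2 \<noteq> 0}"
    using finite_shift [OF nice2D [OF that, of "e - 1"], of "-1"]
    by (simp add: shiftz_def algebra_simps)
qed

lemma nice2_unshift: "nice2 (\<lambda>e1 k1 e2 k2. F (e1 + 1) k1 e2 k2)" if "nice2 F"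
  unfolding nice2_def
proof
  fix e
  show "finite {e1. \<exists>k1 k2. F (e1 + 1) k1 (e - e1) k2 \<noteq> 0}"
    using finite_shift [OF nice2D [OF that, of "e + 1"], of "1"]
    by (simp add: algebra_simps)
qed

lemma nice2_inner_unshift: "nice2 (\<lambda>e1 k1 e2 k2. F e1 k1 (e2 + 1) k2)" if "nice2 F"
  unfolding nice2_def
proof
  fix e
  show "finite {e1. \<exists>k1 k2. F e1 k1 (e - e1 + 1) k2 \<noteq> 0}"
    using nice2D [OF that, of "e + 1"] by (simp add: algebra_simps)
qed

lemma nice2_mult_z12: "nice2 F \<Longrightarrow> nice2 (mult_z12 F)"
  by (simp add: mult_z12_eq nice2_diff nice2_shiftz nice2_inner_shiftz)

lemma nice2_mult_z12_pow: "nice2 F \<Longrightarrow> nice2 ((mult_z12 ^^ n) F)"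
  by (induction n) (simp_all add: nice2_mult_z12)

lemma nice2_der: "nice2 F \<Longrightarrow> nice2 (der F)"
proof (rule nice2_mono [OF nice2_unshift], assumption)
  fix e1 k1 e2 k2
  assume "der F e1 k1 e2 k2 \<noteq> 0"
  then have "F (e1 + 1) k1 e2 k2 \<noteq> 0 \<or> F (e1 + 1) (k1 + 1) e2 k2 \<noteq> 0"
    by (auto simp: der_def)
  then show "\<exists>k1 k2. F (e1 + 1) k1 e2 k2 \<noteq> 0" by blast
qed

lemma nice2_inner_der: "nice2 F \<Longrightarrow> nice2 (inner der F)"
proof (rule nice2_mono [OF nice2_inner_unshift], assumption)
  fix e1 k1 e2 k2
  assume "inner der F e1 k1 e2 k2 \<noteq> 0"
  then have "F e1 k1 (e2 + 1) k2 \<noteq> 0 \<or> F e1 k1 (e2 + 1) (k2 + 1) \<noteq> 0"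
    by (auto simp: der_def inner_def)
  then show "\<exists>k1 k2. F e1 k1 (e2 + 1) k2 \<noteq> 0" by blast
qed

lemma nice2_der_pow: "nice2 F \<Longrightarrow> nice2 ((der ^^ n) F)"
  by (induction n) (simp_all add: nice2_der)

lemma diag_add: "nice2 F \<Longrightarrow> nice2 G \<Longrightarrow> diag (F + G) = diag F + diag G"
  by (simp add: fun_eq_iff diag_def Sum_any.distrib nice2_finite sum.distrib)

lemma diag_map2: "clinear L \<Longrightarrow> nice2 F \<Longrightarrow> diag (map2 L F) = (\<lambda>e k. L (diag F e k))"
  by (simp add: fun_eq_iff diag_def map2_def clinear_sum clinear_Sum_any nice2_finite)

lemma clinear_scale: "clinear (\<lambda>x. c *\<^sub>C x)"
  by (simp add: clinear_iff scaleC_distribs scaleC_scaleC mult.commute)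

lemma diag_scaleC: "nice2 F \<Longrightarrow> diag (c *\<^sub>C F) = c *\<^sub>C diag F"
proof -
  assume "nice2 F"
  have "c *\<^sub>C F = map2 (\<lambda>x. c *\<^sub>C x) F" by (simp add: fun_eq_iff map2_def)
  then have "diag (c *\<^sub>C F) = diag (map2 (\<lambda>x. c *\<^sub>C x) F)" by (rule arg_cong)
  then show ?thesis
    by (simp only: diag_map2 [OF clinear_scale \<open>nice2 F\<close>]) (simp add: fun_eq_iff)
qed

lemma diag_diff: "nice2 F \<Longrightarrow> nice2 G \<Longrightarrow> diag (F - G) = diag F - diag G"
  using diag_add [of F "(-1) *\<^sub>C G"] diag_scaleC [of G "-1"] nice2_scaleC [of G "-1"] by simp

lemma diag_0 [simp]: "diag 0 = 0"
  by (simp add: fun_eq_iff diag_def)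

lemma diag_inner_shiftz: "diag (inner shiftz F) = shiftz (diag F)"
  by (simp add: fun_eq_iff diag_def inner_def shiftz_def algebra_simps)

lemma diag_shiftz: "diag (shiftz F) = shiftz (diag F)"
proof -
  have "Sum_any (\<lambda>e1. F (e1 - 1) k1 (e - e1) k2) = Sum_any (\<lambda>e1. F e1 k1 (e - 1 - e1) k2)" for e k1 k2
    using Sum_any_translate_diff [of "\<lambda>e1. F e1 k1 (e - 1 - e1) k2" 1] by (simp add: algebra_simps)
  then show ?thesis
    by (simp add: fun_eq_iff diag_def shiftz_def)
qed

lemma diag_mult_z12: "nice2 F \<Longrightarrow> diag (mult_z12 F) = 0"
  by (simp add: mult_z12_eq diag_diff nice2_shiftz nice2_inner_shiftz diag_shiftz diag_inner_shiftz)

text \<open>The chain rule for the restriction of $F(z_1, z_2)$ to $z_1 = z_2$.\<close>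

lemma der_diag:
  assumes "nice2 F"
  shows "der (diag F) = diag (der F) + diag (inner der F)"
proof (intro ext)
  fix e :: complex and k :: nat
  define s where "s k1 k2 = Sum_any (\<lambda>e1. F e1 k1 (e + 1 - e1) k2)" for k1 k2
  define s' where "s' k1 k2 = Sum_any (\<lambda>e1. e1 *\<^sub>C F e1 k1 (e + 1 - e1) k2)" for k1 k2
  have fin: "finite {e1. F e1 k1 (e + 1 - e1) k2 \<noteq> 0}" for k1 k2
    by (rule nice2_finite [OF assms])
  have fin': "finite {e1. c e1 *\<^sub>C F e1 k1 (e + 1 - e1) k2 \<noteq> 0}" for k1 k2 and c :: "complex \<Rightarrow> complex"
    by (rule finite_subset [OF _ fin [of k1 k2]]) auto
  have scale: "Sum_any (\<lambda>e1. c *\<^sub>C F e1 k1 (e + 1 - e1) k2) = c *\<^sub>C s k1 k2" for c k1 k2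
    unfolding s_def by (rule clinear_Sum_any [symmetric, OF clinear_scale fin])
  have 1: "diag (der F) e k = (\<Sum>k1\<le>k. s' k1 (k - k1) + of_nat (k1 + 1) *\<^sub>C s (k1 + 1) (k - k1))"
  proof -
    have "Sum_any (\<lambda>e1. der F e1 k1 (e - e1) k2) = s' k1 k2 + of_nat (k1 + 1) *\<^sub>C s (k1 + 1) k2" for k1 k2
    proof -
      have "Sum_any (\<lambda>e1. der F e1 k1 (e - e1) k2) = Sum_any (\<lambda>e1. e1 *\<^sub>C F e1 k1 (e + 1 - e1) k2 +
          of_nat (k1 + 1) *\<^sub>C F e1 (k1 + 1) (e + 1 - e1) k2)"
        using Sum_any_translate [of "\<lambda>e1. e1 *\<^sub>C F e1 k1 (e + 1 - e1) k2 +
          of_nat (k1 + 1) *\<^sub>C F e1 (k1 + 1) (e + 1 - e1) k2" 1]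
        by (simp add: der_def)
      then show ?thesis
        by (simp only: Sum_any.distrib [OF fin' fin'] scale s'_def)
    qed
    then show ?thesis by (simp add: diag_def)
  qed
  have 2: "diag (inner der F) e k = (\<Sum>k1\<le>k. (e + 1) *\<^sub>C s k1 (k - k1) - s' k1 (k - k1)
     + of_nat (k - k1 + 1) *\<^sub>C s k1 (k - k1 + 1))"
  proof -
    have "Sum_any (\<lambda>e1. inner der F e1 k1 (e - e1) k2) =
       (e + 1) *\<^sub>C s k1 k2 - s' k1 k2 + of_nat (k2 + 1) *\<^sub>C s k1 (k2 + 1)" for k1 k2
    proof -
      have "Sum_any (\<lambda>e1. inner der F e1 k1 (e - e1) k2) = Sum_any (\<lambda>e1. (e + 1 - e1) *\<^sub>C F e1 k1 (e + 1 - e1) k2 +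
          of_nat (k2 + 1) *\<^sub>C F e1 k1 (e + 1 - e1) (k2 + 1))"
        by (simp add: der_def inner_def algebra_simps)
      also have "\<dots> = Sum_any (\<lambda>e1. (e + 1 - e1) *\<^sub>C F e1 k1 (e + 1 - e1) k2) + of_nat (k2 + 1) *\<^sub>C s k1 (k2 + 1)"
        by (simp only: Sum_any.distrib [OF fin' fin'] scale)
      also have "Sum_any (\<lambda>e1. (e + 1 - e1) *\<^sub>C F e1 k1 (e + 1 - e1) k2) = (e + 1) *\<^sub>C s k1 k2 - s' k1 k2"
      proof -
        have "Sum_any (\<lambda>e1. (e + 1 - e1) *\<^sub>C F e1 k1 (e + 1 - e1) k2) + s' k1 k2 =
           Sum_any (\<lambda>e1. (e + 1 - e1) *\<^sub>C F e1 k1 (e + 1 - e1) k2 + e1 *\<^sub>C F e1 k1 (e + 1 - e1) k2)"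
          by (simp only: Sum_any.distrib [OF fin' fin'] s'_def)
        also have "\<dots> = (e + 1) *\<^sub>C s k1 k2"
          by (simp add: scaleC_add_left [symmetric] scale)
        finally show ?thesis by (simp add: algebra_simps)
      qed
      finally show ?thesis .
    qed
    then show ?thesis by (simp add: diag_def)
  qed
  have 3: "der (diag F) e k = (e + 1) *\<^sub>C (\<Sum>k1\<le>k. s k1 (k - k1)) + of_nat (k + 1) *\<^sub>C (\<Sum>k1\<le>Suc k. s k1 (Suc k - k1))"
    by (simp add: der_def diag_def s_def)
  have "of_nat (k + 1) *\<^sub>C (\<Sum>k1\<le>Suc k. s k1 (Suc k - k1)) =
      (\<Sum>k1\<le>Suc k. of_nat k1 *\<^sub>C s k1 (Suc k - k1)) + (\<Sum>k1\<le>Suc k. of_nat (Suc k - k1) *\<^sub>C s k1 (Suc k - k1))"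
    unfolding sum.distrib [symmetric] scaleC_sum_right scaleC_add_left [symmetric]
    by (intro sum.cong refl) (simp flip: of_nat_add)
  also have "(\<Sum>k1\<le>Suc k. of_nat k1 *\<^sub>C s k1 (Suc k - k1)) = (\<Sum>k1\<le>k. of_nat (k1 + 1) *\<^sub>C s (k1 + 1) (k - k1))"
    by (subst sum.atMost_Suc_shift) simp
  also have "(\<Sum>k1\<le>Suc k. of_nat (Suc k - k1) *\<^sub>C s k1 (Suc k - k1)) = (\<Sum>k1\<le>k. of_nat (k - k1 + 1) *\<^sub>C s k1 (k - k1 + 1))"
    by (simp add: sum.atMost_Suc) (intro sum.cong refl, simp add: Suc_diff_le of_nat_diff algebra_simps)
  finally have "der (diag F) e k = (e + 1) *\<^sub>C (\<Sum>k1\<le>k. s k1 (k - k1)) +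
      ((\<Sum>k1\<le>k. of_nat (k1 + 1) *\<^sub>C s (k1 + 1) (k - k1)) + (\<Sum>k1\<le>k. of_nat (k - k1 + 1) *\<^sub>C s k1 (k - k1 + 1)))"
    using 3 by simp
  then show "der (diag F) e k = (diag (der F) + diag (inner der F)) e k"
    by (simp only: 1 2 plus_fun_apply sum.distrib sum_subtractf scaleC_sum_right) (simp add: algebra_simps)
qed

subsection \<open>Residue products of series in two variables\<close>

text \<open>The coefficient of $z_{12}^p$ in the expansion of \<open>F\<close> around $z_1 = z_2$.\<close>

definition taylor :: "int \<Rightarrow> 'u::complex_vector lseries2 \<Rightarrow> 'u lseries"
  where "taylor p F = (if p < 0 then 0 else (1 / fact (nat p)) *\<^sub>C diag ((der ^^ nat p) F))"

lemma taylor_neg [simp]: "p < 0 \<Longrightarrow> taylor p F = 0"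
  by (simp add: taylor_def)

lemma taylor_0 [simp]: "taylor 0 F = diag F"
  by (simp add: taylor_def)

lemma taylor_1 [simp]: "taylor 1 F = diag (der F)"
  by (simp add: taylor_def)

lemma taylor_nat: "taylor (int p) F = (1 / fact p) *\<^sub>C diag ((der ^^ p) F)"
  by (simp add: taylor_def)

text \<open>$D_{z_1} z_{12} = 1$ and $z_{12}$ vanishes on the diagonal.\<close>

lemma taylor_mult_z12:
  assumes "nice2 F"
  shows "taylor p (mult_z12 F) = taylor (p - 1) F"
proof (cases "p \<le> 0")
  case True
  then show ?thesis using assms by (cases "p = 0") (simp_all add: diag_mult_z12)
next
  case False
  then obtain q where p: "p = int (Suc q)" by (metis not_le zero_less_imp_eq_int gr0_implies_Suc of_nat_0_less_iff)
  have "diag ((der ^^ Suc q) (mult_z12 F)) = of_nat (Suc q) *\<^sub>C diag ((der ^^ q) F)"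
    using nice2_der_pow [OF assms] unfolding der_pow_mult_z12 [of "Suc q"]
    by (subst diag_add) (simp_all add: nice2_scaleC diag_scaleC diag_mult_z12 nice2_mult_z12 nice2_der del: funpow.simps(2))
  moreover have "int (Suc q) - 1 = int q" by simp
  ultimately show ?thesis
    unfolding p using taylor_nat [of q F]
    by (simp only: taylor_nat [of "Suc q"] scaleC_scaleC) (simp add: scaleC_scaleC del: of_nat_Suc)
qed

lemma taylor_mult_z12_pow: "nice2 F \<Longrightarrow> taylor p ((mult_z12 ^^ n) F) = taylor (p - int n) F"
proof (induction n arbitrary: p)
  case (Suc n)
  then show ?case
    by (simp add: taylor_mult_z12 nice2_mult_z12_pow algebra_simps)
qed simp

lemma taylor_add: "nice2 F \<Longrightarrow> nice2 G \<Longrightarrow> taylor p (F + G) = taylor p F + taylor p G"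
  by (simp add: taylor_def clinear_add [OF der_pow_linear] diag_add nice2_der_pow scaleC_add_right)

lemma taylor_map2: "clinear L \<Longrightarrow> nice2 F \<Longrightarrow> taylor p (map2 L F) = (\<lambda>e k. L (taylor p F e k))"
  by (auto simp: taylor_def der_pow_map2 diag_map2 nice2_der_pow clinear_scaleC clinear_0 fun_eq_iff)

lemma taylor_scaleC: "nice2 F \<Longrightarrow> taylor p (c *\<^sub>C F) = c *\<^sub>C taylor p F"
  by (simp add: taylor_def clinear_scaleC [OF der_pow_linear] diag_scaleC nice2_der_pow scaleC_scaleC mult.commute)

lemma taylor_inner_shiftz: "taylor p (inner shiftz F) = shiftz (taylor p F)"
  by (simp add: taylor_def inner_shiftz_der_pow [symmetric] diag_inner_shiftz
      clinear_scaleC [OF clinear_shiftz] clinear_0 [OF clinear_shiftz])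

text \<open>\<open>adm\<close> abstracts from locality: some power of $z_{12}$ makes the series restrictable to the diagonal.
  For such a series \<open>resprod n\<close> is the formula that defines $a_{(n)}b$; multiplication
  by $z_{12}$ shifts Taylor coefficients, so the choice of the power is immaterial (\<open>resprod_eq\<close>)
  and $z_{12}$ raises \<open>n\<close> by one (\<open>resprod_mult_z12\<close>).\<close>

definition adm :: "'u::complex_vector lseries2 \<Rightarrow> bool"
  where "adm F \<longleftrightarrow> (\<exists>N. nice2 ((mult_z12 ^^ N) F))"

definition resprod :: "int \<Rightarrow> 'u::complex_vector lseries2 \<Rightarrow> 'u lseries"
  where "resprod n F = (let N = (SOME N. nice2 ((mult_z12 ^^ N) F))
      in taylor (int N - 1 - n) ((mult_z12 ^^ N) F))"

lemma resprod_eq: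
  assumes "nice2 ((mult_z12 ^^ N) F)"
  shows "resprod n F = taylor (int N - 1 - n) ((mult_z12 ^^ N) F)"
proof -
  define M where "M = (SOME N. nice2 ((mult_z12 ^^ N) F))"
  have M: "nice2 ((mult_z12 ^^ M) F)"
    unfolding M_def by (rule someI) (rule assms)
  have *: "taylor (int N - 1 - n) ((mult_z12 ^^ N) F) = taylor (int (N + j) - 1 - n) ((mult_z12 ^^ (N + j)) F)"
    if "nice2 ((mult_z12 ^^ N) F)" for N j
  proof -
    have "(mult_z12 ^^ (N + j)) F = (mult_z12 ^^ j) ((mult_z12 ^^ N) F)"
      by (simp add: funpow_add add.commute [of N])
    then show ?thesis
      by (simp add: taylor_mult_z12_pow [OF that] algebra_simps)
  qed
  show ?thesis
    unfolding resprod_def Let_def M_def [symmetric]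
    using * [OF M, of N] * [OF assms, of M] by (simp add: add.commute)
qed

lemma nice2_imp_adm: "nice2 F \<Longrightarrow> adm F"
  unfolding adm_def by (intro exI [of _ 0]) simp

lemma resprod_nice2: "nice2 F \<Longrightarrow> resprod n F = taylor (- 1 - n) F"
  using resprod_eq [of 0 F] by simp

lemma mult_z12_pow_pow: "(mult_z12 ^^ m) ((mult_z12 ^^ n) F) = (mult_z12 ^^ (m + n)) F"
  by (simp add: funpow_add)

lemma adm_common:
  assumes "adm F" "adm G"
  obtains N where "nice2 ((mult_z12 ^^ N) F)" "nice2 ((mult_z12 ^^ N) G)"
proof -
  obtain M where M: "nice2 ((mult_z12 ^^ M) F)" using assms by (auto simp: adm_def)
  obtain K where K: "nice2 ((mult_z12 ^^ K) G)" using assms by (auto simp: adm_def)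
  show ?thesis
    using nice2_mult_z12_pow [OF M, of K] nice2_mult_z12_pow [OF K, of M]
    by (intro that [of "M + K"]) (simp_all add: mult_z12_pow_pow add.commute)
qed

lemma adm_add: "adm F \<Longrightarrow> adm G \<Longrightarrow> adm (F + G)"
  by (erule (1) adm_common) (auto simp: adm_def clinear_add [OF mult_z12_pow_linear] intro: nice2_add)

lemma resprod_add:
  assumes "adm F" "adm G"
  shows "resprod n (F + G) = resprod n F + resprod n G"
proof -
  obtain N where N: "nice2 ((mult_z12 ^^ N) F)" "nice2 ((mult_z12 ^^ N) G)"
    using assms by (rule adm_common)
  then have "nice2 ((mult_z12 ^^ N) (F + G))"
    by (simp add: clinear_add [OF mult_z12_pow_linear] nice2_add)
  then show ?thesis
    using N by (simp add: resprod_eq clinear_add [OF mult_z12_pow_linear] taylor_add)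
qed

lemma adm_scaleC: "adm F \<Longrightarrow> adm (c *\<^sub>C F)"
  by (auto simp: adm_def clinear_scaleC [OF mult_z12_pow_linear] intro: nice2_scaleC)

lemma resprod_scaleC:
  assumes "adm F"
  shows "resprod n (c *\<^sub>C F) = c *\<^sub>C resprod n F"
proof -
  obtain N where N: "nice2 ((mult_z12 ^^ N) F)" using assms by (auto simp: adm_def)
  then have "nice2 ((mult_z12 ^^ N) (c *\<^sub>C F))"
    by (simp add: clinear_scaleC [OF mult_z12_pow_linear] nice2_scaleC)
  then show ?thesis
    using N by (simp add: resprod_eq clinear_scaleC [OF mult_z12_pow_linear] taylor_scaleC)
qed

lemma adm_diff: "adm F \<Longrightarrow> adm G \<Longrightarrow> adm (F - G)"
  using adm_add [of F "(-1) *\<^sub>C G"] adm_scaleC [of G "-1"] by simp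

lemma resprod_diff: "adm F \<Longrightarrow> adm G \<Longrightarrow> resprod n (F - G) = resprod n F - resprod n G"
  using resprod_add [of F "(-1) *\<^sub>C G"] adm_scaleC [of G "-1"] resprod_scaleC [of G n "-1"] by simp

lemma adm_map2: "clinear L \<Longrightarrow> adm F \<Longrightarrow> adm (map2 L F)"
  by (auto simp: adm_def mult_z12_pow_map2 intro: nice2_map2)

lemma resprod_map2:
  assumes "clinear L" "adm F"
  shows "resprod n (map2 L F) = (\<lambda>e k. L (resprod n F e k))"
proof -
  obtain N where N: "nice2 ((mult_z12 ^^ N) F)" using assms by (auto simp: adm_def)
  then have "nice2 ((mult_z12 ^^ N) (map2 L F))"
    using assms by (simp add: mult_z12_pow_map2 nice2_map2)
  then show ?thesis
    using N assms by (simp add: resprod_eq mult_z12_pow_map2 taylor_map2)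
qed

lemma adm_mult_z12: "adm (mult_z12 F) \<longleftrightarrow> adm F"
proof
  assume "adm (mult_z12 F)"
  then obtain N where "nice2 ((mult_z12 ^^ N) (mult_z12 F))" by (auto simp: adm_def)
  then have "nice2 ((mult_z12 ^^ Suc N) F)" by (simp add: funpow_swap1)
  then show "adm F" unfolding adm_def by blast
next
  assume "adm F"
  then obtain N where "nice2 ((mult_z12 ^^ N) F)" by (auto simp: adm_def)
  then have "nice2 ((mult_z12 ^^ N) (mult_z12 F))"
    using nice2_mult_z12 by (simp add: funpow_swap1 [symmetric])
  then show "adm (mult_z12 F)" unfolding adm_def by blast
qed

lemma resprod_mult_z12:
  assumes "adm F"
  shows "resprod n (mult_z12 F) = resprod (n + 1) F"
proof -
  obtain N where N: "nice2 ((mult_z12 ^^ N) F)" using assms by (auto simp: adm_def)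
  have eq: "(mult_z12 ^^ N) (mult_z12 F) = mult_z12 ((mult_z12 ^^ N) F)"
    by (simp add: funpow_swap1)
  have "nice2 ((mult_z12 ^^ N) (mult_z12 F))"
    using N nice2_mult_z12 by (simp add: eq)
  then show ?thesis
    using N by (simp add: resprod_eq [of N] eq taylor_mult_z12 algebra_simps)
qed

lemma resprod_mult_z12_pow: "adm F \<Longrightarrow> resprod n ((mult_z12 ^^ j) F) = resprod (n + int j) F"
proof (induction j arbitrary: F)
  case (Suc j)
  have "resprod n ((mult_z12 ^^ Suc j) F) = resprod n ((mult_z12 ^^ j) (mult_z12 F))"
    by (simp add: funpow_swap1)
  then show ?case
    using Suc.IH [of "mult_z12 F"] Suc.prems by (simp add: adm_mult_z12 resprod_mult_z12 algebra_simps)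
qed simp

lemma adm_inner_shiftz: "adm F \<Longrightarrow> adm (inner shiftz F)"
  by (auto simp: adm_def inner_shiftz_mult_z12_pow [symmetric] intro: nice2_inner_shiftz)

lemma resprod_inner_shiftz:
  assumes "adm F"
  shows "resprod n (inner shiftz F) = shiftz (resprod n F)"
proof -
  obtain N where N: "nice2 ((mult_z12 ^^ N) F)" using assms by (auto simp: adm_def)
  then have "nice2 ((mult_z12 ^^ N) (inner shiftz F))"
    by (simp add: inner_shiftz_mult_z12_pow [symmetric] nice2_inner_shiftz)
  then show ?thesis
    using N by (simp add: resprod_eq inner_shiftz_mult_z12_pow [symmetric] taylor_inner_shiftz)
qed

lemma resprod_bound: "nice2 ((mult_z12 ^^ N) F) \<Longrightarrow> int N \<le> n \<Longrightarrow> resprod n F = 0"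
  by (simp add: resprod_eq)

lemma resprod_0 [simp]: "resprod n 0 = 0"
  using resprod_scaleC [OF nice2_imp_adm [OF nice2_0], of n 0] by simp

section \<open>Series in three variables\<close>

definition mult_z23 :: "'u::complex_vector lseries2 lseries \<Rightarrow> 'u lseries2 lseries"
  where "mult_z23 F = (\<lambda>e k. mult_z12 (F e k))"

definition mult_z13 :: "'u::complex_vector lseries2 lseries \<Rightarrow> 'u lseries2 lseries"
  where "mult_z13 F e1 k1 e2 k2 e3 k3 = F (e1 - 1) k1 e2 k2 e3 k3 - F e1 k1 e2 k2 (e3 - 1) k3"

text \<open>Fixing the third variable leaves a series in the first two, which is how a product of
  $z_1$ and $z_2$ is formed inside a series in three variables.\<close>

definition slice :: "complex \<Rightarrow> nat \<Rightarrow> 'u::complex_vector lseries2 lseries \<Rightarrow> 'u lseries2"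
  where "slice e3 k3 F e1 k1 e2 k2 = F e1 k1 e2 k2 e3 k3"

definition swap12 :: "'u lseries2 \<Rightarrow> 'u lseries2"
  where "swap12 F e2 k2 e1 k1 = F e1 k1 e2 k2"

lemma mult_z13_eq: "mult_z13 F = mult_z12 F + mult_z23 F"
  by (simp add: fun_eq_iff mult_z12_def mult_z13_def mult_z23_def)

lemma mult_z12_eq_diff: "mult_z12 F = mult_z13 F - mult_z23 F"
  by (simp add: mult_z13_eq)

subsection \<open>Iterated residue products\<close>

text \<open>A series $F(z_1,z_2,z_3)$ that stands for $a(z_1)b(z_2)c(z_3)v$ has two kinds of iterated products.
  \<open>res_inner\<close> multiplies the second and third variable, as in $a_{(m)}(b_{(n)}c)$;
  \<open>res_outer\<close> multiplies the first and second, as in $(a_{(n)}b)_{(k)}c$.\<close>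

definition res_inner :: "int \<Rightarrow> 'u::complex_vector lseries2 lseries \<Rightarrow> 'u lseries2"
  where "res_inner n F = (\<lambda>e k. resprod n (F e k))"

definition res_outer :: "int \<Rightarrow> 'u::complex_vector lseries2 lseries \<Rightarrow> 'u lseries2"
  where "res_outer n F = (\<lambda>e2 k2 e3 k3. resprod n (slice e3 k3 F) e2 k2)"

definition adm_inner :: "'u::complex_vector lseries2 lseries \<Rightarrow> bool"
  where "adm_inner F \<longleftrightarrow> (\<forall>e k. adm (F e k)) \<and> (\<forall>n. adm (res_inner n F))"

definition adm_outer :: "'u::complex_vector lseries2 lseries \<Rightarrow> bool"
  where "adm_outer F \<longleftrightarrow> (\<forall>e3 k3. adm (slice e3 k3 F)) \<and> (\<forall>n. adm (res_outer n F))"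

lemma slice_z12: "slice e3 k3 (mult_z12 F) = mult_z12 (slice e3 k3 F)"
  by (simp add: fun_eq_iff slice_def mult_z12_def)

lemma res_inner_z23: "(\<And>e k. adm (F e k)) \<Longrightarrow> res_inner n (mult_z23 F) = res_inner (n + 1) F"
  by (simp add: res_inner_def mult_z23_def resprod_mult_z12)

lemma mult_z13_inner: "mult_z13 F e k = F (e - 1) k - inner shiftz (F e k)"
  by (simp add: fun_eq_iff mult_z13_def inner_def shiftz_def)

lemma res_inner_z13:
  assumes "\<And>e k. adm (F e k)"
  shows "res_inner n (mult_z13 F) = mult_z12 (res_inner n F)"
proof -
  have "resprod n (mult_z13 F e k) = resprod n (F (e - 1) k) - shiftz (resprod n (F e k))" for e k
    by (simp add: mult_z13_inner resprod_diff assms adm_inner_shiftz resprod_inner_shiftz)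
  then show ?thesis
    by (simp add: fun_eq_iff res_inner_def mult_z12_def shiftz_def)
qed

lemma adm_z13_pointwise: "(\<And>e k. adm (F e k)) \<Longrightarrow> adm (mult_z13 F e k)"
  by (simp add: mult_z13_inner adm_diff adm_inner_shiftz)

lemma adm_z23_pointwise: "(\<And>e k. adm (F e k)) \<Longrightarrow> adm (mult_z23 F e k)"
  by (simp add: mult_z23_def adm_mult_z12)

lemma adm_z12_pointwise: "(\<And>e k. adm (F e k)) \<Longrightarrow> adm (mult_z12 F e k)"
  unfolding mult_z12_eq_diff using adm_z13_pointwise [of F] adm_z23_pointwise [of F]
  by (simp add: adm_diff)

lemma res_inner_z12:
  assumes "\<And>e k. adm (F e k)"
  shows "res_inner n (mult_z12 F) = mult_z12 (res_inner n F) - res_inner (n + 1) F"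
proof -
  have "res_inner n (mult_z12 F) = res_inner n (mult_z13 F) - res_inner n (mult_z23 F)"
    unfolding mult_z12_eq_diff
    by (simp add: fun_eq_iff res_inner_def resprod_diff assms adm_z13_pointwise adm_z23_pointwise)
  then show ?thesis using assms by (simp add: res_inner_z13 res_inner_z23)
qed

lemma adm_inner_z23: "adm_inner F \<Longrightarrow> adm_inner (mult_z23 F)"
  by (simp add: adm_inner_def res_inner_z23 adm_z23_pointwise)

lemma adm_inner_z13: "adm_inner F \<Longrightarrow> adm_inner (mult_z13 F)"
  by (simp add: adm_inner_def res_inner_z13 adm_z13_pointwise adm_mult_z12)

lemma adm_inner_z12: "adm_inner F \<Longrightarrow> adm_inner (mult_z12 F)"
  by (simp add: adm_inner_def res_inner_z12 adm_z12_pointwise adm_mult_z12 adm_diff)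

lemma slice_z23: "slice e3 k3 (mult_z23 F) =
   inner shiftz (slice e3 k3 F) - slice (e3 - 1) k3 F"
  by (simp add: fun_eq_iff slice_def mult_z23_def mult_z12_def inner_def shiftz_def)

lemma res_outer_z12: "(\<And>e3 k3. adm (slice e3 k3 F)) \<Longrightarrow>
    res_outer n (mult_z12 F) = res_outer (n + 1) F"
  by (simp add: res_outer_def slice_z12 resprod_mult_z12)

lemma res_outer_z23:
  assumes "\<And>e3 k3. adm (slice e3 k3 F)"
  shows "res_outer n (mult_z23 F) = mult_z12 (res_outer n F)"
proof -
  have "resprod n (slice e3 k3 (mult_z23 F)) = shiftz (resprod n (slice e3 k3 F))
     - resprod n (slice (e3 - 1) k3 F)" for e3 k3
    by (simp add: slice_z23 resprod_diff assms adm_inner_shiftz resprod_inner_shiftz)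
  then show ?thesis
    by (simp add: fun_eq_iff res_outer_def mult_z12_def shiftz_def)
qed

lemma adm_outer_slice_z12: "adm (slice e3 k3 F) \<Longrightarrow> adm (slice e3 k3 (mult_z12 F))"
  by (simp add: slice_z12 adm_mult_z12)

lemma adm_outer_slice_z23: "(\<And>e3 k3. adm (slice e3 k3 F)) \<Longrightarrow> adm (slice e3 k3 (mult_z23 F))"
  by (simp add: slice_z23 adm_diff adm_inner_shiftz)

lemma slice_add: "slice e3 k3 (F + G) = slice e3 k3 F + slice e3 k3 G"
  by (simp add: fun_eq_iff slice_def)

lemma res_outer_z13:
  assumes "\<And>e3 k3. adm (slice e3 k3 F)"
  shows "res_outer n (mult_z13 F) = res_outer (n + 1) F + mult_z12 (res_outer n F)"
proof -
  have "res_outer n (mult_z13 F) = res_outer n (mult_z12 F) + res_outer n (mult_z23 F)"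
    unfolding mult_z13_eq
    by (simp add: fun_eq_iff res_outer_def slice_add resprod_add assms adm_outer_slice_z12 adm_outer_slice_z23)
  then show ?thesis using assms by (simp add: res_outer_z12 res_outer_z23)
qed

lemma adm_outer_slice_z13: "(\<And>e3 k3. adm (slice e3 k3 F)) \<Longrightarrow> adm (slice e3 k3 (mult_z13 F))"
  by (simp add: mult_z13_eq slice_add adm_add adm_outer_slice_z12 adm_outer_slice_z23)

lemma adm_outer_z12: "adm_outer F \<Longrightarrow> adm_outer (mult_z12 F)"
  by (simp add: adm_outer_def res_outer_z12 adm_outer_slice_z12)

lemma adm_outer_z23: "adm_outer F \<Longrightarrow> adm_outer (mult_z23 F)"
  by (simp add: adm_outer_def res_outer_z23 adm_outer_slice_z23 adm_mult_z12)

lemma adm_outer_z13: "adm_outer F \<Longrightarrow> adm_outer (mult_z13 F)"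
  by (simp add: adm_outer_def res_outer_z13 adm_outer_slice_z13 adm_mult_z12 adm_add)

definition prod_inner :: "'u::complex_vector lseries2 lseries \<Rightarrow> int \<Rightarrow> int \<Rightarrow> 'u lseries"
  where "prod_inner F m n = resprod m (res_inner n F)"

definition prod_outer :: "'u::complex_vector lseries2 lseries \<Rightarrow> int \<Rightarrow> int \<Rightarrow> 'u lseries"
  where "prod_outer F n k = resprod k (res_outer n F)"

text \<open>The effect of $z_{12}$ on the products $(m, n) \mapsto a_{(m)}(b_{(n)}c)$: as $z_{13}$ raises \<open>m\<close> and $z_{23}$
  raises \<open>n\<close>, the difference $z_{12} = z_{13} - z_{23}$ acts by \<open>Delta\<close>. Dually, on $(n, k) \mapsto (a_{(n)}b)_{(k)}c$ the
  sum $z_{13} = z_{12} + z_{23}$ acts by \<open>Theta\<close>.\<close>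

definition Delta :: "(int \<Rightarrow> int \<Rightarrow> 'v::ab_group_add) \<Rightarrow> int \<Rightarrow> int \<Rightarrow> 'v"
  where "Delta P m n = P (m + 1) n - P m (n + 1)"

definition Theta :: "(int \<Rightarrow> int \<Rightarrow> 'v::ab_group_add) \<Rightarrow> int \<Rightarrow> int \<Rightarrow> 'v"
  where "Theta R n k = R (n + 1) k + R n (k + 1)"

lemma prod_inner_z23: "adm_inner F \<Longrightarrow> prod_inner (mult_z23 F) m n = prod_inner F m (n + 1)"
  by (simp add: prod_inner_def adm_inner_def res_inner_z23)

lemma prod_inner_z13: "adm_inner F \<Longrightarrow> prod_inner (mult_z13 F) m n = prod_inner F (m + 1) n"
  by (simp add: prod_inner_def adm_inner_def res_inner_z13 resprod_mult_z12)

lemma prod_inner_z12: "adm_inner F \<Longrightarrow> prod_inner (mult_z12 F) = Delta (prod_inner F)"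
  by (simp add: fun_eq_iff Delta_def prod_inner_def adm_inner_def res_inner_z12 resprod_mult_z12
      resprod_diff adm_mult_z12)

lemma prod_outer_z12: "adm_outer F \<Longrightarrow> prod_outer (mult_z12 F) n k = prod_outer F (n + 1) k"
  by (simp add: prod_outer_def adm_outer_def res_outer_z12)

lemma prod_outer_z23: "adm_outer F \<Longrightarrow> prod_outer (mult_z23 F) n k = prod_outer F n (k + 1)"
  by (simp add: prod_outer_def adm_outer_def res_outer_z23 resprod_mult_z12)

lemma prod_outer_z13: "adm_outer F \<Longrightarrow> prod_outer (mult_z13 F) = Theta (prod_outer F)"
  by (simp add: fun_eq_iff Theta_def prod_outer_def adm_outer_def res_outer_z13 resprod_mult_z12
      resprod_add adm_mult_z12)

lemma prod_inner_z23_pow: "adm_inner F \<Longrightarrow>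
    adm_inner ((mult_z23 ^^ N) F) \<and> prod_inner ((mult_z23 ^^ N) F) m n = prod_inner F m (n + int N)"
  by (induction N arbitrary: n) (simp_all add: adm_inner_z23 prod_inner_z23 algebra_simps)

lemma prod_inner_z13_pow: "adm_inner F \<Longrightarrow>
    adm_inner ((mult_z13 ^^ N) F) \<and> prod_inner ((mult_z13 ^^ N) F) m n = prod_inner F (m + int N) n"
  by (induction N arbitrary: m) (simp_all add: adm_inner_z13 prod_inner_z13 algebra_simps)

lemma prod_inner_z12_pow: "adm_inner F \<Longrightarrow>
    adm_inner ((mult_z12 ^^ N) F) \<and> prod_inner ((mult_z12 ^^ N) F) = (Delta ^^ N) (prod_inner F)"
  by (induction N) (simp_all add: adm_inner_z12 prod_inner_z12)

lemma prod_outer_z12_pow: "adm_outer F \<Longrightarrow>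
    adm_outer ((mult_z12 ^^ N) F) \<and> prod_outer ((mult_z12 ^^ N) F) n k = prod_outer F (n + int N) k"
  by (induction N arbitrary: n) (simp_all add: adm_outer_z12 prod_outer_z12 algebra_simps)

lemma prod_outer_z23_pow: "adm_outer F \<Longrightarrow>
    adm_outer ((mult_z23 ^^ N) F) \<and> prod_outer ((mult_z23 ^^ N) F) n k = prod_outer F n (k + int N)"
  by (induction N arbitrary: k) (simp_all add: adm_outer_z23 prod_outer_z23 algebra_simps)

lemma prod_outer_z13_pow: "adm_outer F \<Longrightarrow>
    adm_outer ((mult_z13 ^^ N) F) \<and> prod_outer ((mult_z13 ^^ N) F) = (Theta ^^ N) (prod_outer F)"
  by (induction N) (simp_all add: adm_outer_z13 prod_outer_z13)

lemma Delta_pow_shift: "(Delta ^^ N) (\<lambda>m n. P (m + a) (n + b)) m n = (Delta ^^ N) P (m + a) (n + b)"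
  by (induction N arbitrary: m n) (simp_all add: Delta_def algebra_simps)

lemma Theta_pow_shift: "(Theta ^^ N) (\<lambda>m n. P (m + a) (n + b)) m n = (Theta ^^ N) P (m + a) (n + b)"
  by (induction N arbitrary: m n) (simp_all add: Theta_def algebra_simps)

definition mult_all :: "nat \<Rightarrow> 'u::complex_vector lseries2 lseries \<Rightarrow> 'u lseries2 lseries"
  where "mult_all N F = (mult_z12 ^^ N) ((mult_z13 ^^ N) ((mult_z23 ^^ N) F))"

lemma prod_inner_mult_all:
  assumes "adm_inner F"
  shows "prod_inner (mult_all N F) m n = (Delta ^^ N) (prod_inner F) (m + int N) (n + int N)"
proof -
  have "prod_inner ((mult_z13 ^^ N) ((mult_z23 ^^ N) F)) = (\<lambda>m n. prod_inner F (m + int N) (n + int N))"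
    using assms by (simp add: fun_eq_iff prod_inner_z13_pow prod_inner_z23_pow)
  then show ?thesis
    unfolding mult_all_def using assms
    by (simp add: prod_inner_z13_pow prod_inner_z23_pow prod_inner_z12_pow Delta_pow_shift)
qed

lemma mult_z12_z13: "mult_z12 (mult_z13 F) = mult_z13 (mult_z12 F)"
  by (simp add: fun_eq_iff mult_z12_def mult_z13_def)

lemma mult_z12_z23: "mult_z12 (mult_z23 F) = mult_z23 (mult_z12 F)"
  by (simp add: fun_eq_iff mult_z12_def mult_z23_def)

lemma mult_z13_z23: "mult_z13 (mult_z23 F) = mult_z23 (mult_z13 F)"
  by (simp add: fun_eq_iff mult_z12_def mult_z13_def mult_z23_def)

lemma funpow_commute:
  fixes f g :: "'a \<Rightarrow> 'a"
  assumes "\<And>x. f (g x) = g (f x)"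
  shows "(f ^^ m) ((g ^^ n) x) = (g ^^ n) ((f ^^ m) x)"
proof -
  have *: "f ((g ^^ n) x) = (g ^^ n) (f x)" for x by (induction n) (simp_all add: assms)
  show ?thesis by (induction m) (simp_all add: *)
qed

lemmas z12_z13_pow = funpow_commute [where f = mult_z12 and g = mult_z13, OF mult_z12_z13]
lemmas z12_z23_pow = funpow_commute [where f = mult_z12 and g = mult_z23, OF mult_z12_z23]
lemmas z13_z23_pow = funpow_commute [where f = mult_z13 and g = mult_z23, OF mult_z13_z23]

lemma prod_outer_mult_all:
  assumes "adm_outer F"
  shows "prod_outer (mult_all N F) n k = (Theta ^^ N) (prod_outer F) (n + int N) (k + int N)"
proof -
  have "prod_outer ((mult_z12 ^^ N) ((mult_z23 ^^ N) F)) = (\<lambda>n k. prod_outer F (n + int N) (k + int N))"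
    using assms by (simp add: fun_eq_iff prod_outer_z12_pow prod_outer_z23_pow)
  then show ?thesis
    unfolding mult_all_def z12_z13_pow using assms
    by (simp add: prod_outer_z13_pow prod_outer_z23_pow prod_outer_z12_pow Theta_pow_shift)
qed

subsection \<open>The diagonal of a series in three variables\<close>

text \<open>The analogue of \<open>nice2\<close> for $z_1 = z_2 = z_3$.\<close>

definition nice3 :: "'u::complex_vector lseries2 lseries \<Rightarrow> bool"
  where "nice3 F \<longleftrightarrow> (\<forall>e. finite {(e1, e2). \<exists>k1 k2 k3. F e1 k1 e2 k2 (e - e1 - e2) k3 \<noteq> 0})"

definition diag3 :: "'u::complex_vector lseries2 lseries \<Rightarrow> 'u lseries"
  where "diag3 F = diag (\<lambda>e k. diag (F e k))"

definition diag_outer :: "'u::complex_vector lseries2 lseries \<Rightarrow> 'u lseries2"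
  where "diag_outer F = (\<lambda>e2 k2 e3 k3. diag (slice e3 k3 F) e2 k2)"

lemma nice3D: "nice3 F \<Longrightarrow> finite {(e1, e2). \<exists>k1 k2 k3. F e1 k1 e2 k2 (e - e1 - e2) k3 \<noteq> 0}"
  by (simp add: nice3_def)

lemma nice3_inner: "nice2 (F e1 k1)" if "nice3 F"
  unfolding nice2_def
proof
  fix e
  have "{e2. \<exists>k2 k3. F e1 k1 e2 k2 (e - e2) k3 \<noteq> 0} \<subseteq>
     snd ` {(e1', e2). \<exists>k1 k2 k3. F e1' k1 e2 k2 (e + e1 - e1' - e2) k3 \<noteq> 0}"
  proof (rule subsetI, clarify)
    fix e2 k2 k3 assume "F e1 k1 e2 k2 (e - e2) k3 \<noteq> 0"
    then show "e2 \<in> snd ` {(e1', e2). \<exists>k1 k2 k3. F e1' k1 e2 k2 (e + e1 - e1' - e2) k3 \<noteq> 0}"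
      by (intro image_eqI [of _ _ "(e1, e2)"]) auto
  qed
  then show "finite {e2. \<exists>k2 k3. F e1 k1 e2 k2 (e - e2) k3 \<noteq> 0}"
    by (rule finite_subset) (intro finite_imageI nice3D that)
qed

lemma nice3_outer: "nice2 (slice e3 k3 F)" if "nice3 F"
  unfolding nice2_def
proof
  fix e
  have "{e1. \<exists>k1 k2. F e1 k1 (e - e1) k2 e3 k3 \<noteq> 0} \<subseteq>
     fst ` {(e1, e2). \<exists>k1 k2 k3. F e1 k1 e2 k2 (e + e3 - e1 - e2) k3 \<noteq> 0}"
  proof
    fix e1 assume "e1 \<in> {e1. \<exists>k1 k2. F e1 k1 (e - e1) k2 e3 k3 \<noteq> 0}"
    then have "(e1, e - e1) \<in> {(e1, e2). \<exists>k1 k2 k3. F e1 k1 e2 k2 (e + e3 - e1 - e2) k3 \<noteq> 0}"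
      by auto
    then show "e1 \<in> fst ` {(e1, e2). \<exists>k1 k2 k3. F e1 k1 e2 k2 (e + e3 - e1 - e2) k3 \<noteq> 0}"
      by (metis (no_types, lifting) fst_conv imageI)
  qed
  then show "finite {e1. \<exists>k1 k2. slice e3 k3 F e1 k1 (e - e1) k2 \<noteq> 0}"
    unfolding slice_def by (rule finite_subset) (intro finite_imageI nice3D that)
qed

lemma diag_nonzero:
  assumes "diag F e k \<noteq> 0"
  obtains e1 k1 k2 where "F e1 k1 (e - e1) k2 \<noteq> 0"
proof -
  have "\<exists>k1\<le>k. Sum_any (\<lambda>e1. F e1 k1 (e - e1) (k - k1)) \<noteq> 0"
    using assms unfolding diag_def by (metis (no_types, lifting) atMost_iff sum.neutral)
  then obtain k1 where "Sum_any (\<lambda>e1. F e1 k1 (e - e1) (k - k1)) \<noteq> 0" by blast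
  then obtain e1 where "F e1 k1 (e - e1) (k - k1) \<noteq> 0"
    by (rule Sum_any.not_neutral_obtains_not_neutral)
  then show ?thesis by (rule that)
qed

lemma nice3_diag_inner: "nice2 (\<lambda>e k. diag (F e k))" if "nice3 F"
  unfolding nice2_def
proof
  fix e
  have "{e1. \<exists>k1 k2. diag (F e1 k1) (e - e1) k2 \<noteq> 0} \<subseteq>
     fst ` {(e1, e2). \<exists>k1 k2 k3. F e1 k1 e2 k2 (e - e1 - e2) k3 \<noteq> 0}"
    by (force simp: image_iff elim: diag_nonzero)
  then show "finite {e1. \<exists>k1 k2. diag (F e1 k1) (e - e1) k2 \<noteq> 0}"
    by (rule finite_subset) (intro finite_imageI nice3D that)
qed

lemma nice3_diag_outer: "nice2 (diag_outer F)" if "nice3 F"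
  unfolding nice2_def
proof
  fix e
  have "{e2. \<exists>k1 k2. diag_outer F e2 k1 (e - e2) k2 \<noteq> 0} \<subseteq>
     (\<lambda>(e1, e2). e1 + e2) ` {(e1, e2). \<exists>k1 k2 k3. F e1 k1 e2 k2 (e - e1 - e2) k3 \<noteq> 0}"
  proof
    fix e2 assume "e2 \<in> {e2. \<exists>k1 k2. diag_outer F e2 k1 (e - e2) k2 \<noteq> 0}"
    then obtain k1 k2 where "diag_outer F e2 k1 (e - e2) k2 \<noteq> 0" by blast
    then obtain e1 k3 k4 where "F e1 k3 (e2 - e1) k4 (e - e2) k2 \<noteq> 0"
      unfolding diag_outer_def slice_def by (rule diag_nonzero)
    then have "(e1, e2 - e1) \<in> {(e1, e2). \<exists>k1 k2 k3. F e1 k1 e2 k2 (e - e1 - e2) k3 \<noteq> 0}"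
      by auto
    then show "e2 \<in> (\<lambda>(e1, e2). e1 + e2) ` {(e1, e2). \<exists>k1 k2 k3. F e1 k1 e2 k2 (e - e1 - e2) k3 \<noteq> 0}"
      by (rule rev_image_eqI) simp
  qed
  then show "finite {e2. \<exists>k1 k2. diag_outer F e2 k1 (e - e2) k2 \<noteq> 0}"
    by (rule finite_subset) (intro finite_imageI nice3D that)
qed

lemma Sum_any_sum:
  assumes "\<And>i. i \<in> A \<Longrightarrow> finite {x. f i x \<noteq> 0}"
  shows "Sum_any (\<lambda>x. \<Sum>i\<in>A. f i x) = (\<Sum>i\<in>A. Sum_any (f i))"
  using assms
proof (induction A rule: infinite_finite_induct)
  case (insert i A)
  have "{x. (\<Sum>i\<in>A. f i x) \<noteq> 0} \<subseteq> (\<Union>i\<in>A. {x. f i x \<noteq> 0})"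
    by (auto elim: sum.not_neutral_contains_not_neutral)
  then have "finite {x. (\<Sum>i\<in>A. f i x) \<noteq> 0}"
    by (rule finite_subset) (use insert in auto)
  then show ?case using insert by (simp add: Sum_any.distrib)
qed simp_all

lemma finite_Sum_any_support:
  assumes "finite {(x, y). g x y \<noteq> 0}"
  shows "finite {x. Sum_any (g x) \<noteq> 0}" "finite {y. Sum_any (\<lambda>x. g x y) \<noteq> 0}"
    "finite {y. g x y \<noteq> 0}" "finite {x. g x y \<noteq> 0}"
proof -
  have "{x. Sum_any (g x) \<noteq> 0} \<subseteq> fst ` {(x, y). g x y \<noteq> 0}"
    by (force elim: Sum_any.not_neutral_obtains_not_neutral)
  then show "finite {x. Sum_any (g x) \<noteq> 0}" by (rule finite_subset) (intro finite_imageI assms)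
  have "{y. Sum_any (\<lambda>x. g x y) \<noteq> 0} \<subseteq> snd ` {(x, y). g x y \<noteq> 0}"
    by (force elim: Sum_any.not_neutral_obtains_not_neutral)
  then show "finite {y. Sum_any (\<lambda>x. g x y) \<noteq> 0}" by (rule finite_subset) (intro finite_imageI assms)
  have "{y. g x y \<noteq> 0} \<subseteq> snd ` {(x, y). g x y \<noteq> 0}" by force
  then show "finite {y. g x y \<noteq> 0}" by (rule finite_subset) (intro finite_imageI assms)
  have "{x. g x y \<noteq> 0} \<subseteq> fst ` {(x, y). g x y \<noteq> 0}" by force
  then show "finite {x. g x y \<noteq> 0}" by (rule finite_subset) (intro finite_imageI assms)
qed

lemma Sum_any_swap':
  assumes "finite {(x, y). g x y \<noteq> 0}"
  shows "Sum_any (\<lambda>x. Sum_any (\<lambda>y. g x y)) = Sum_any (\<lambda>y. Sum_any (\<lambda>x. g x y))"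
proof (rule Sum_any.swap)
  let ?S = "{(x, y). g x y \<noteq> 0}"
  show "finite (fst ` ?S \<times> snd ` ?S)" using assms by blast
  show "{x. \<exists>y. g x y \<noteq> 0} \<times> {y. \<exists>x. g x y \<noteq> 0} \<subseteq> fst ` ?S \<times> snd ` ?S" by force
qed

text \<open>A symmetric description of the coefficients of \<open>diag3\<close>, used to see that the order in which the
  variables are identified does not matter.\<close>

definition total :: "'u::complex_vector lseries2 lseries \<Rightarrow> complex \<Rightarrow> nat \<Rightarrow> nat \<Rightarrow> nat \<Rightarrow> 'u"
  where "total F e k1 k2 k3 = Sum_any (\<lambda>e1. Sum_any (\<lambda>e2. F e1 k1 e2 k2 (e - e1 - e2) k3))"

lemma nice3_pair: "nice3 F \<Longrightarrow> finite {(e1, e2). F e1 k1 e2 k2 (e - e1 - e2) k3 \<noteq> 0}"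
  by (rule finite_subset [OF _ nice3D [of F e]]) auto

lemma diag3_total:
  assumes "nice3 F"
  shows "diag3 F e k = (\<Sum>k1\<le>k. \<Sum>k2\<le>k - k1. total F e k1 k2 (k - k1 - k2))"
  unfolding diag3_def diag_def total_def
  by (intro sum.cong refl Sum_any_sum finite_Sum_any_support(1) nice3_pair assms)

lemma total_outer:
  assumes "nice3 F"
  shows "Sum_any (\<lambda>e12. Sum_any (\<lambda>e1. F e1 k1 (e12 - e1) k2 (e - e12) k3)) = total F e k1 k2 k3"
    and "finite {(e12, e1). F e1 k1 (e12 - e1) k2 (e - e12) k3 \<noteq> 0}"
proof -
  have "{(e12, e1). F e1 k1 (e12 - e1) k2 (e - e12) k3 \<noteq> 0} \<subseteq>
     (\<lambda>(e1, e2). (e1 + e2, e1)) ` {(e1, e2). F e1 k1 e2 k2 (e - e1 - e2) k3 \<noteq> 0}"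
  proof safe
    fix a b assume "F b k1 (a - b) k2 (e - a) k3 \<noteq> 0"
    then show "(a, b) \<in> (\<lambda>(e1, e2). (e1 + e2, e1)) ` {(e1, e2). F e1 k1 e2 k2 (e - e1 - e2) k3 \<noteq> 0}"
      by (intro image_eqI [of _ _ "(b, a - b)"]) auto
  qed
  then show fin: "finite {(e12, e1). F e1 k1 (e12 - e1) k2 (e - e12) k3 \<noteq> 0}"
    by (rule finite_subset) (intro finite_imageI nice3_pair assms)
  have "Sum_any (\<lambda>e12. Sum_any (\<lambda>e1. F e1 k1 (e12 - e1) k2 (e - e12) k3)) =
     Sum_any (\<lambda>e1. Sum_any (\<lambda>e12. F e1 k1 (e12 - e1) k2 (e - e12) k3))"
    by (rule Sum_any_swap' [OF fin])
  also have "\<dots> = total F e k1 k2 k3"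
    unfolding total_def
  proof (rule Sum_any.cong)
    fix e1
    show "Sum_any (\<lambda>e12. F e1 k1 (e12 - e1) k2 (e - e12) k3) =
       Sum_any (\<lambda>e2. F e1 k1 e2 k2 (e - e1 - e2) k3)"
      using Sum_any_translate_diff [of "\<lambda>e2. F e1 k1 e2 k2 (e - e1 - e2) k3" e1] by simp
  qed
  finally show "Sum_any (\<lambda>e12. Sum_any (\<lambda>e1. F e1 k1 (e12 - e1) k2 (e - e12) k3)) = total F e k1 k2 k3" .
qed

lemma diag_diag_outer:
  assumes "nice3 F"
  shows "diag (diag_outer F) = diag3 F"
proof (intro ext)
  fix e k
  have "diag (diag_outer F) e k = (\<Sum>k12\<le>k. \<Sum>k1\<le>k12. total F e k1 (k12 - k1) (k - k12))"
    unfolding diag_def [of "diag_outer F"] unfolding diag_outer_def diag_def slice_def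
    by (intro sum.cong refl, subst Sum_any_sum)
      (intro finite_Sum_any_support(1) total_outer(2) assms, simp add: total_outer(1) [OF assms])
  also have "\<dots> = (\<Sum>k12\<le>k. \<Sum>k1\<le>k12. total F e k1 (k12 - k1) (k - k1 - (k12 - k1)))"
    by (intro sum.cong refl) simp
  also have "\<dots> = (\<Sum>(k1, k2)\<in>{(i, j). i + j \<le> k}. total F e k1 k2 (k - k1 - k2))"
    by (rule sum.triangle_reindex_eq [symmetric])
  also have "{(i, j). i + j \<le> k} = Sigma {..k} (\<lambda>i. {..k - i})"
    by auto
  also have "(\<Sum>(k1, k2)\<in>Sigma {..k} (\<lambda>i. {..k - i}). total F e k1 k2 (k - k1 - k2)) =
      (\<Sum>k1\<le>k. \<Sum>k2\<le>k - k1. total F e k1 k2 (k - k1 - k2))"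
    by (simp add: sum.Sigma)
  finally show "diag (diag_outer F) e k = diag3 F e k"
    by (simp add: diag3_total assms)
qed

lemma nice3_swap12: "nice3 (swap12 F)" if "nice3 F"
  unfolding nice3_def
proof
  fix e
  have "{(e1, e2). \<exists>k1 k2 k3. swap12 F e1 k1 e2 k2 (e - e1 - e2) k3 \<noteq> 0} \<subseteq>
      prod.swap ` {(e1, e2). \<exists>k1 k2 k3. F e1 k1 e2 k2 (e - e1 - e2) k3 \<noteq> 0}"
  proof (rule subsetI, clarify)
    fix a b k1 k2 k3 assume "swap12 F a k1 b k2 (e - a - b) k3 \<noteq> 0"
    then show "(a, b) \<in> prod.swap ` {(e1, e2). \<exists>k1 k2 k3. F e1 k1 e2 k2 (e - e1 - e2) k3 \<noteq> 0}"
      by (intro image_eqI [of _ _ "(b, a)"]) (auto simp: swap12_def diff_diff_eq add.commute)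
  qed
  then show "finite {(e1, e2). \<exists>k1 k2 k3. swap12 F e1 k1 e2 k2 (e - e1 - e2) k3 \<noteq> 0}"
    by (rule finite_subset) (intro finite_imageI nice3D that)
qed

lemma diag3_swap12:
  assumes "nice3 F"
  shows "diag3 (swap12 F) = diag3 F"
proof (intro ext)
  fix e k
  have tot: "total (swap12 F) e k1 k2 k3 = total F e k2 k1 k3" for k1 k2 k3
  proof -
    have "total F e k2 k1 k3 = Sum_any (\<lambda>y. Sum_any (\<lambda>x. F x k2 y k1 (e - x - y) k3))"
      unfolding total_def by (rule Sum_any_swap' [OF nice3_pair [OF assms]])
    then show ?thesis
      by (simp add: total_def swap12_def diff_diff_eq add.commute)
  qed
  have "diag3 (swap12 F) e k = (\<Sum>k1\<le>k. \<Sum>k2\<le>k - k1. total F e k2 k1 (k - k1 - k2))"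
    by (simp add: diag3_total nice3_swap12 assms tot)
  also have "\<dots> = (\<Sum>(k1, k2)\<in>Sigma {..k} (\<lambda>i. {..k - i}). total F e k2 k1 (k - k1 - k2))"
    by (simp add: sum.Sigma)
  also have "\<dots> = (\<Sum>(k1, k2)\<in>Sigma {..k} (\<lambda>i. {..k - i}). total F e k1 k2 (k - k1 - k2))"
    by (rule sum.reindex_bij_witness [of _ prod.swap prod.swap]) (auto simp: diff_diff_eq add.commute)
  also have "\<dots> = (\<Sum>k1\<le>k. \<Sum>k2\<le>k - k1. total F e k1 k2 (k - k1 - k2))"
    by (simp add: sum.Sigma)
  finally show "diag3 (swap12 F) e k = diag3 F e k"
    by (simp add: diag3_total assms)
qed

lemma nice3_der: "nice3 (der F)" if "nice3 F"
  unfolding nice3_def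
proof
  fix e
  have "{(e1, e2). \<exists>k1 k2 k3. der F e1 k1 e2 k2 (e - e1 - e2) k3 \<noteq> 0} \<subseteq>
     (\<lambda>(x, y). (x - 1, y)) ` {(e1, e2). \<exists>k1 k2 k3. F e1 k1 e2 k2 (e + 1 - e1 - e2) k3 \<noteq> 0}"
  proof (rule subsetI, clarify)
    fix a b k1 k2 k3 assume *: "der F a k1 b k2 (e - a - b) k3 \<noteq> 0"
    have "\<exists>k1 k2 k3. F (a + 1) k1 b k2 (e - a - b) k3 \<noteq> 0"
    proof (rule ccontr)
      assume "\<not> ?thesis"
      then show False using * by (simp add: der_def)
    qed
    then show "(a, b) \<in> (\<lambda>(x, y). (x - 1, y)) ` {(e1, e2). \<exists>k1 k2 k3. F e1 k1 e2 k2 (e + 1 - e1 - e2) k3 \<noteq> 0}"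
      by (intro image_eqI [of _ _ "(a + 1, b)"]) auto
  qed
  then show "finite {(e1, e2). \<exists>k1 k2 k3. der F e1 k1 e2 k2 (e - e1 - e2) k3 \<noteq> 0}"
    by (rule finite_subset) (intro finite_imageI nice3D that)
qed

lemma swap12_swap12 [simp]: "swap12 (swap12 F) = F"
  by (simp add: fun_eq_iff swap12_def)

lemma inner_der_swap12: "inner der F = swap12 (der (swap12 F))"
  by (simp add: fun_eq_iff swap12_def inner_def der_def)

lemma nice3_inner_der: "nice3 F \<Longrightarrow> nice3 (inner der F)"
  by (simp add: inner_der_swap12 nice3_swap12 nice3_der)

lemma nice3_der_pow: "nice3 F \<Longrightarrow> nice3 ((der ^^ n) F)"
  by (induction n) (simp_all add: nice3_der)

lemma nice3_inner_der_pow: "nice3 F \<Longrightarrow> nice3 ((inner der ^^ n) F)"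
  by (induction n) (simp_all add: nice3_inner_der)

lemma nice3_add: "nice3 F \<Longrightarrow> nice3 G \<Longrightarrow> nice3 (F + G)"
  unfolding nice3_def
proof safe
  fix e
  assume "\<forall>e. finite {(e1, e2). \<exists>k1 k2 k3. F e1 k1 e2 k2 (e - e1 - e2) k3 \<noteq> 0}"
    "\<forall>e. finite {(e1, e2). \<exists>k1 k2 k3. G e1 k1 e2 k2 (e - e1 - e2) k3 \<noteq> 0}"
  then have "finite ({(e1, e2). \<exists>k1 k2 k3. F e1 k1 e2 k2 (e - e1 - e2) k3 \<noteq> 0} \<union>
     {(e1, e2). \<exists>k1 k2 k3. G e1 k1 e2 k2 (e - e1 - e2) k3 \<noteq> 0})"
    by blast
  then show "finite {(e1, e2). \<exists>k1 k2 k3. (F + G) e1 k1 e2 k2 (e - e1 - e2) k3 \<noteq> 0}"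
    by (rule rev_finite_subset) fastforce
qed

lemma diag3_add: "nice3 F \<Longrightarrow> nice3 G \<Longrightarrow> diag3 (F + G) = diag3 F + diag3 G"
proof -
  assume *: "nice3 F" "nice3 G"
  have "(\<lambda>e k. diag ((F + G) e k)) = (\<lambda>e k. diag (F e k)) + (\<lambda>e k. diag (G e k))"
    using * by (simp add: fun_eq_iff diag_add nice3_inner)
  then show ?thesis
    unfolding diag3_def using * by (simp only: diag_add nice3_diag_inner)
qed

lemma der_diag_inner:
  assumes "nice3 F"
  shows "der (\<lambda>e k. diag (F e k)) = (\<lambda>e k. diag (der F e k))"
proof (intro ext)
  fix e1 k1 e2 k2
  have "der F e1 k1 = (e1 + 1) *\<^sub>C F (e1 + 1) k1 + of_nat (k1 + 1) *\<^sub>C F (e1 + 1) (k1 + 1)"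
    by (simp add: fun_eq_iff der_def)
  then have "diag (der F e1 k1) = (e1 + 1) *\<^sub>C diag (F (e1 + 1) k1) + of_nat (k1 + 1) *\<^sub>C diag (F (e1 + 1) (k1 + 1))"
    using nice3_inner [OF assms] by (simp only: diag_add nice2_scaleC diag_scaleC)
  then show "der (\<lambda>e k. diag (F e k)) e1 k1 e2 k2 = diag (der F e1 k1) e2 k2"
    by (simp add: der_def)
qed

lemma der_pow_diag_inner:
  "nice3 F \<Longrightarrow> (der ^^ p) (\<lambda>e k. diag (F e k)) = (\<lambda>e k. diag ((der ^^ p) F e k))"
  by (induction p) (simp_all add: der_diag_inner nice3_der_pow)

lemma inner_pow: "(inner f ^^ q) F = (\<lambda>e k. (f ^^ q) (F e k))"
  by (induction q) (simp_all add: inner_def)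

lemma slice_der: "slice e3 k3 (der F) = der (slice e3 k3 F)"
  by (simp add: fun_eq_iff slice_def der_def)

lemma slice_inner_der: "slice e3 k3 (inner der F) = inner der (slice e3 k3 F)"
  by (simp add: fun_eq_iff slice_def der_def inner_def)

text \<open>Differentiating after $z_1 = z_2$ has been imposed means differentiating in both variables before.\<close>

definition der12 :: "'u::complex_vector lseries2 lseries \<Rightarrow> 'u lseries2 lseries"
  where "der12 F = der F + inner der F"

lemma nice3_der12: "nice3 F \<Longrightarrow> nice3 (der12 F)"
  by (simp add: der12_def nice3_add nice3_der nice3_inner_der)

lemma nice3_der12_pow: "nice3 F \<Longrightarrow> nice3 ((der12 ^^ n) F)"
  by (induction n) (simp_all add: nice3_der12)

lemma der_diag_outer:
  assumes "nice3 F"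
  shows "der (diag_outer F) = diag_outer (der12 F)"
proof (intro ext)
  fix e2 k2 e3 k3
  have "der (diag_outer F) e2 k2 e3 k3 = der (diag (slice e3 k3 F)) e2 k2"
    by (simp add: der_def diag_outer_def)
  also have "\<dots> = diag_outer (der12 F) e2 k2 e3 k3"
    using nice3_outer [OF assms]
    by (simp add: der_diag diag_outer_def der12_def slice_add slice_der slice_inner_der
       diag_add nice2_der nice2_inner_der)
  finally show "der (diag_outer F) e2 k2 e3 k3 = diag_outer (der12 F) e2 k2 e3 k3" .
qed

lemma der_pow_diag_outer:
  "nice3 F \<Longrightarrow> (der ^^ q) (diag_outer F) = diag_outer ((der12 ^^ q) F)"
  by (induction q) (simp_all add: der_diag_outer nice3_der12_pow)

lemma der_inner_der: "der (inner der F) = inner der (der F)"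
  by (simp add: fun_eq_iff der_def inner_def scaleC_distribs scaleC_scaleC algebra_simps)

lemma inner_der_der_pow: "inner der ((der ^^ i) F) = (der ^^ i) (inner der F)"
  by (induction i) (simp_all add: der_inner_der [symmetric])

lemma clinear_der12: "clinear der12"
  by (rule clinearI) (simp_all only: der12_def clinear_add [OF clinear_der] clinear_scaleC [OF clinear_der]
    clinear_add [OF clinear_inner [OF clinear_der]] clinear_scaleC [OF clinear_inner [OF clinear_der]]
    scaleC_add_right ac_simps)

lemma diag3_der12_pow:
  assumes "nice3 F"
  shows "diag3 ((der12 ^^ q) ((der ^^ i) ((inner der ^^ j) F))) =
    (\<Sum>t\<le>q. of_nat (q choose t) *\<^sub>C diag3 ((der ^^ (i + t)) ((inner der ^^ (j + (q - t))) F)))"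
proof (induction q arbitrary: i j)
  case (Suc q)
  define e where "e i j = diag3 ((der ^^ i) ((inner der ^^ j) F))" for i j
  have nice: "nice3 ((der ^^ i) ((inner der ^^ j) F))" for i j
    by (intro nice3_der_pow nice3_inner_der_pow assms)
  have "(der12 ^^ Suc q) ((der ^^ i) ((inner der ^^ j) F)) =
     (der12 ^^ q) (der ((der ^^ i) ((inner der ^^ j) F)) + inner der ((der ^^ i) ((inner der ^^ j) F)))"
    by (simp only: funpow_Suc_right o_apply der12_def)
  also have "\<dots> = (der12 ^^ q) ((der ^^ Suc i) ((inner der ^^ j) F) + (der ^^ i) ((inner der ^^ Suc j) F))"
    by (simp only: funpow.simps o_apply inner_der_der_pow)
  also have "\<dots> = (der12 ^^ q) ((der ^^ Suc i) ((inner der ^^ j) F)) + (der12 ^^ q) ((der ^^ i) ((inner der ^^ Suc j) F))"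
    by (rule clinear_add [OF clinear_funpow [OF clinear_der12]])
  finally have "diag3 ((der12 ^^ Suc q) ((der ^^ i) ((inner der ^^ j) F))) =
     (\<Sum>t\<le>q. of_nat (q choose t) *\<^sub>C e (Suc i + t) (j + (q - t))) +
     (\<Sum>t\<le>q. of_nat (q choose t) *\<^sub>C e (i + t) (Suc j + (q - t)))"
    unfolding e_def Suc.IH [symmetric]
    by (simp only: diag3_add nice3_der12_pow nice)
  also have "(\<Sum>t\<le>q. of_nat (q choose t) *\<^sub>C e (i + t) (Suc j + (q - t))) =
     (\<Sum>t\<le>Suc q. of_nat (q choose t) *\<^sub>C e (i + t) (j + (Suc q - t)))"
    by (simp add: Suc_diff_le)
  also have "\<dots> = e i (j + Suc q) + (\<Sum>t\<le>q. of_nat (q choose Suc t) *\<^sub>C e (i + Suc t) (j + (q - t)))"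
    by (subst sum.atMost_Suc_shift) simp
  also have "(\<Sum>t\<le>q. of_nat (q choose t) *\<^sub>C e (Suc i + t) (j + (q - t))) +
     (e i (j + Suc q) + (\<Sum>t\<le>q. of_nat (q choose Suc t) *\<^sub>C e (i + Suc t) (j + (q - t)))) =
     e i (j + Suc q) + (\<Sum>t\<le>q. of_nat (Suc q choose Suc t) *\<^sub>C e (i + Suc t) (j + (q - t)))"
    by (simp add: scaleC_add_left sum.distrib)
  also have "\<dots> = (\<Sum>t\<le>Suc q. of_nat (Suc q choose t) *\<^sub>C e (i + t) (j + (Suc q - t)))"
    by (subst sum.atMost_Suc_shift) (simp del: binomial_Suc_Suc)
  finally show ?case by (simp only: e_def)
qed simp

text \<open>The Taylor coefficients of \<open>F\<close> at the point $z_1 = z_2 = z_3$ in powers of $z_{13}$ and $z_{23}$. For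
  \<open>nice3\<close> series, both kinds of iterated products are combinations of them.\<close>

definition psi :: "'u::complex_vector lseries2 lseries \<Rightarrow> int \<Rightarrow> int \<Rightarrow> 'u lseries"
  where "psi F p q = (if p < 0 \<or> q < 0 then 0
     else (1 / (fact (nat p) * fact (nat q))) *\<^sub>C diag3 ((der ^^ nat p) ((inner der ^^ nat q) F)))"

lemma psi_nat: "psi F (int p) (int q) = (1 / (fact p * fact q)) *\<^sub>C diag3 ((der ^^ p) ((inner der ^^ q) F))"
  by (simp add: psi_def)

lemma prod_inner_nice3:
  assumes "nice3 F"
  shows "prod_inner F m n = psi F (- 1 - m) (- 1 - n)"
proof (cases "n < 0")
  case True
  obtain q where q: "- 1 - n = int q"
    by (rule nonneg_int_cases [of "- 1 - n"]) (use True in auto)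
  have nice: "nice3 ((inner der ^^ q) F)" by (intro nice3_inner_der_pow assms)
  have inn: "res_inner n F = (1 / fact q) *\<^sub>C (\<lambda>e k. diag ((inner der ^^ q) F e k))"
    unfolding res_inner_def inner_pow
    by (simp add: fun_eq_iff resprod_nice2 nice3_inner assms q taylor_nat)
  have n2: "nice2 (\<lambda>e k. diag ((inner der ^^ q) F e k))"
    by (rule nice3_diag_inner [OF nice])
  show ?thesis
  proof (cases "m < 0")
    case True
    obtain p where p: "- 1 - m = int p"
      by (rule nonneg_int_cases [of "- 1 - m"]) (use True in auto)
    have "prod_inner F m n = taylor (int p) ((1 / fact q) *\<^sub>C (\<lambda>e k. diag ((inner der ^^ q) F e k)))"
      unfolding prod_inner_def inn using p by (simp only: resprod_nice2 nice2_scaleC n2)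
    also have "\<dots> = (1 / fact q) *\<^sub>C (1 / fact p) *\<^sub>C diag ((der ^^ p) (\<lambda>e k. diag ((inner der ^^ q) F e k)))"
      by (simp only: taylor_scaleC [OF n2] taylor_nat)
    also have "diag ((der ^^ p) (\<lambda>e k. diag ((inner der ^^ q) F e k))) = diag3 ((der ^^ p) ((inner der ^^ q) F))"
      by (simp only: der_pow_diag_inner [OF nice] diag3_def)
    finally show ?thesis
      unfolding p q psi_nat scaleC_scaleC by (simp only: mult.commute times_divide_times_eq mult_1)
  next
    case False
    have "nice2 (res_inner n F)" unfolding inn by (rule nice2_scaleC [OF n2])
    then show ?thesis using False
      by (simp add: prod_inner_def resprod_nice2 psi_def)
  qed
next
  case False
  have "res_inner n F = 0"
    using False by (simp add: fun_eq_iff res_inner_def resprod_nice2 nice3_inner assms)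
  then show ?thesis using False
    by (simp add: prod_inner_def psi_def)
qed

text \<open>In $(a_{(n)}b)_{(k)}c$ the expansion is in $z_{12}$ and $z_{23}$. Rewriting it in
  $z_{13}$ and $z_{23}$ produces the binomial coefficients, here through the binomial expansion of a power of \<open>der12\<close>.\<close>

lemma prod_outer_nice3:
  assumes "nice3 F"
  shows "prod_outer F (- 1 - int p) (- 1 - int q) =
      (\<Sum>t\<le>q. of_nat ((p + t) choose t) *\<^sub>C psi F (int (p + t)) (int (q - t)))"
    and "n \<ge> 0 \<or> k \<ge> 0 \<Longrightarrow> prod_outer F n k = 0"
proof -
  have nice: "nice3 ((der ^^ p) F)" for p by (intro nice3_der_pow assms)
  have out: "res_outer (- 1 - int p) F = (1 / fact p) *\<^sub>C diag_outer ((der ^^ p) F)" for p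
  proof -
    have *: "slice e3 k3 ((der ^^ p) F) = (der ^^ p) (slice e3 k3 F)" for e3 k3
      by (induction p) (simp_all add: slice_der)
    show ?thesis
      unfolding res_outer_def diag_outer_def *
      by (intro ext) (simp add: resprod_nice2 nice3_outer assms taylor_nat)
  qed
  have n2: "nice2 (diag_outer ((der ^^ p) F))" for p
    by (rule nice3_diag_outer [OF nice])
  have "prod_outer F (- 1 - int p) (- 1 - int q) = taylor (int q) ((1 / fact p) *\<^sub>C diag_outer ((der ^^ p) F))"
    unfolding prod_outer_def out by (simp add: resprod_nice2 nice2_scaleC n2)
  also have "\<dots> = (1 / fact p) *\<^sub>C (1 / fact q) *\<^sub>C diag ((der ^^ q) (diag_outer ((der ^^ p) F)))"
    by (simp only: taylor_scaleC [OF n2] taylor_nat)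
  also have "diag ((der ^^ q) (diag_outer ((der ^^ p) F))) = diag3 ((der12 ^^ q) ((der ^^ p) F))"
    by (simp only: der_pow_diag_outer nice diag_diag_outer nice3_der12_pow)
  also have "\<dots> = (\<Sum>t\<le>q. of_nat (q choose t) *\<^sub>C diag3 ((der ^^ (p + t)) ((inner der ^^ (q - t)) F)))"
    using diag3_der12_pow [OF assms, of q p 0] by simp
  also have "(1 / fact p) *\<^sub>C (1 / fact q) *\<^sub>C (\<Sum>t\<le>q. of_nat (q choose t) *\<^sub>C diag3 ((der ^^ (p + t)) ((inner der ^^ (q - t)) F))) =
      (\<Sum>t\<le>q. of_nat ((p + t) choose t) *\<^sub>C psi F (int (p + t)) (int (q - t)))"
    unfolding scaleC_sum_right scaleC_scaleC psi_nat
    by (intro sum.cong refl arg_cong2 [where f = scaleC]) (simp add: binomial_fact)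
  finally show "prod_outer F (- 1 - int p) (- 1 - int q) =
      (\<Sum>t\<le>q. of_nat ((p + t) choose t) *\<^sub>C psi F (int (p + t)) (int (q - t)))" .
  show "prod_outer F n k = 0" if "n \<ge> 0 \<or> k \<ge> 0"
  proof (cases "n \<ge> 0")
    case True
    then have "res_outer n F = 0"
      by (simp add: fun_eq_iff res_outer_def resprod_nice2 nice3_outer assms)
    then show ?thesis
      by (simp add: prod_outer_def)
  next
    case False
    obtain p where "- n - 1 = int p"
      by (rule nonneg_int_cases [of "- n - 1"]) (use False in auto)
    then have "n = - 1 - int p" by simp
    then have "nice2 (res_outer n F)" by (simp add: out nice2_scaleC n2)
    then show ?thesis using that False by (simp add: prod_outer_def resprod_nice2)
  qed
qed

section \<open>Difference calculus for the Borcherds identity\<close>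

text \<open>These conditions make the sums in \<open>iter\<close> finite. For products of fields they hold since
  $b_{(n)}c = 0$ and $a_{(m)}c = 0$ for large indices.\<close>

definition bounded_snd :: "(int \<Rightarrow> int \<Rightarrow> 'v::zero) \<Rightarrow> bool"
  where "bounded_snd P \<longleftrightarrow> (\<exists>n0. \<forall>m n. n0 \<le> n \<longrightarrow> P m n = 0)"

definition bounded_fst :: "(int \<Rightarrow> int \<Rightarrow> 'v::zero) \<Rightarrow> bool"
  where "bounded_fst Q \<longleftrightarrow> (\<exists>m0. \<forall>m n. m0 \<le> m \<longrightarrow> Q m n = 0)"

text \<open>\<open>iter P Q n k\<close> is the right hand side of the Borcherds identity with $m = 0$, where \<open>P m n\<close> stands for
  $a_{(m)}(b_{(n)}c)$ and \<open>Q m n\<close> for $b_{(n)}(a_{(m)}c)$; the left hand side is then the single term $(a_{(n)}b)_{(k)}c$.\<close>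

definition iter_left :: "(int \<Rightarrow> int \<Rightarrow> 'v::complex_vector) \<Rightarrow> int \<Rightarrow> int \<Rightarrow> 'v"
  where "iter_left P n k = Sum_any (\<lambda>j::nat. ((- 1) ^ j * (of_int n gchoose j)) *\<^sub>C P (n - int j) (k + int j))"

definition iter_right :: "(int \<Rightarrow> int \<Rightarrow> 'v::complex_vector) \<Rightarrow> int \<Rightarrow> int \<Rightarrow> 'v"
  where "iter_right Q n k = Sum_any (\<lambda>j::nat. ((- 1) ^ j * ((- 1) powi n) * (of_int n gchoose j)) *\<^sub>C Q (int j) (n + k - int j))"

definition iter :: "(int \<Rightarrow> int \<Rightarrow> 'v::complex_vector) \<Rightarrow> (int \<Rightarrow> int \<Rightarrow> 'v) \<Rightarrow> int \<Rightarrow> int \<Rightarrow> 'v"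
  where "iter P Q n k = iter_left P n k - iter_right Q n k"

lemma iter_left_sum:
  assumes "\<And>m n. n0 \<le> n \<Longrightarrow> P m n = 0" "n0 \<le> k + int B"
  shows "iter_left P n k = (\<Sum>j<B. ((- 1) ^ j * (of_int n gchoose j)) *\<^sub>C P (n - int j) (k + int j))"
  unfolding iter_left_def
  by (rule Sum_any.expand_superset) (use assms in \<open>auto intro: ccontr simp: not_less[symmetric]\<close>)

lemma iter_right_sum:
  assumes "\<And>m n. m0 \<le> m \<Longrightarrow> Q m n = 0" "m0 \<le> int B"
  shows "iter_right Q n k = (\<Sum>j<B. ((- 1) ^ j * ((- 1) powi n) * (of_int n gchoose j)) *\<^sub>C Q (int j) (n + k - int j))"
  unfolding iter_right_def
  by (rule Sum_any.expand_superset) (use assms in \<open>auto intro: ccontr simp: not_less[symmetric]\<close>)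

lemma bounded_snd_Delta: "bounded_snd P \<Longrightarrow> bounded_snd (Delta P)"
  unfolding bounded_snd_def Delta_def by (metis add.commute diff_self zle_add1_eq_le zless_add1_eq order_less_imp_le)

lemma bounded_fst_Delta: "bounded_fst P \<Longrightarrow> bounded_fst (Delta P)"
  unfolding bounded_fst_def Delta_def by (metis add.commute diff_self zle_add1_eq_le zless_add1_eq order_less_imp_le)

lemma bounded_snd_Delta_pow: "bounded_snd P \<Longrightarrow> bounded_snd ((Delta ^^ j) P)"
  by (induction j) (simp_all add: bounded_snd_Delta)

lemma bounded_fst_Delta_pow: "bounded_fst P \<Longrightarrow> bounded_fst ((Delta ^^ j) P)"
  by (induction j) (simp_all add: bounded_fst_Delta)

lemma bounded_snd_shift: "bounded_snd P \<Longrightarrow> bounded_snd (\<lambda>m n. P (m + a) (n + b))"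
  unfolding bounded_snd_def by (metis add_le_cancel_right diff_add_cancel)

lemma bounded_fst_shift: "bounded_fst P \<Longrightarrow> bounded_fst (\<lambda>m n. P (m + a) (n + b))"
  unfolding bounded_fst_def by (metis add_le_cancel_right diff_add_cancel)

text \<open>Pascal's rule for $\binom nj$ turns \<open>Delta\<close> into a shift of \<open>n\<close>. This mirrors $z_{12} \cdot z_{12}^n = z_{12}^{n+1}$.\<close>

lemma iter_left_Delta:
  assumes "bounded_snd P"
  shows "iter_left (Delta P) n k = iter_left P (n + 1) k"
proof -
  obtain n0 where n0: "\<And>m n. n0 \<le> n \<Longrightarrow> P m n = 0" using assms by (auto simp: bounded_snd_def)
  define B where "B = nat (n0 - k)"
  have B: "n0 \<le> k + int B" by (simp add: B_def)
  define c where "c n j = (- 1) ^ j * (of_int n gchoose j :: complex)" for n :: int and j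
  have c: "c (n + 1) (Suc j) = c n (Suc j) - c n j" for j
    using gbinomial_Suc_Suc [of "of_int n :: complex" j] by (simp add: c_def algebra_simps)
  have "iter_left (Delta P) n k = (\<Sum>j<B. c n j *\<^sub>C (P (n - int j + 1) (k + int j) - P (n - int j) (k + int j + 1)))"
    using iter_left_sum [of n0 "Delta P" k B n] n0 B by (simp add: Delta_def c_def)
  also have "\<dots> = (\<Sum>j<B. c n j *\<^sub>C P (n - int j + 1) (k + int j)) - (\<Sum>j<B. c n j *\<^sub>C P (n - int j) (k + int j + 1))"
    by (simp add: scaleC_diff_right sum_subtractf)
  also have "(\<Sum>j<B. c n j *\<^sub>C P (n - int j + 1) (k + int j)) = (\<Sum>j<Suc B. c n j *\<^sub>C P (n - int j + 1) (k + int j))"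
    using n0 B by simp
  also have "\<dots> = c n 0 *\<^sub>C P (n + 1) k + (\<Sum>j<B. c n (Suc j) *\<^sub>C P (n - int j) (k + int j + 1))"
    by (subst sum.lessThan_Suc_shift) (simp add: algebra_simps)
  also have "c n 0 *\<^sub>C P (n + 1) k + (\<Sum>j<B. c n (Suc j) *\<^sub>C P (n - int j) (k + int j + 1)) - (\<Sum>j<B. c n j *\<^sub>C P (n - int j) (k + int j + 1))
    = c (n + 1) 0 *\<^sub>C P (n + 1) k + (\<Sum>j<B. c (n + 1) (Suc j) *\<^sub>C P (n - int j) (k + int j + 1))"
    by (simp add: c scaleC_diff_left sum_subtractf) (simp add: c_def)
  also have "\<dots> = (\<Sum>j<Suc B. c (n + 1) j *\<^sub>C P (n + 1 - int j) (k + int j))"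
    by (subst sum.lessThan_Suc_shift) (simp add: algebra_simps)
  also have "\<dots> = iter_left P (n + 1) k"
    using iter_left_sum [of n0 P k "Suc B" "n + 1"] n0 B by (simp add: c_def del: sum.lessThan_Suc)
  finally show ?thesis .
qed

lemma iter_right_Delta:
  assumes "bounded_fst Q"
  shows "iter_right (Delta Q) n k = iter_right Q (n + 1) k"
proof -
  obtain n0 where n0: "\<And>m n. n0 \<le> m \<Longrightarrow> Q m n = 0" using assms by (auto simp: bounded_fst_def)
  define B where "B = nat n0"
  have B: "n0 \<le> int B" by (simp add: B_def)
  define c where "c n j = (- 1) ^ j * ((- 1) powi n) * (of_int n gchoose j :: complex)" for n :: int and j
  have pw: "(- 1) powi (n + 1) = - ((- 1) powi n :: complex)" by (simp add: power_int_add)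
  have c: "c (n + 1) (Suc j) = c n j - c n (Suc j)" for j
    unfolding c_def pw of_int_add of_int_1 gbinomial_Suc_Suc by (simp add: algebra_simps)
  have c0: "c (n + 1) 0 = - c n 0" by (simp add: c_def pw)
  have "iter_right (Delta Q) n k = (\<Sum>j<B. c n j *\<^sub>C (Q (int j + 1) (n + k - int j) - Q (int j) (n + k - int j + 1)))"
    using iter_right_sum [of n0 "Delta Q" B n k] n0 B by (simp add: Delta_def c_def)
  also have "\<dots> = (\<Sum>j<B. c n j *\<^sub>C Q (int j + 1) (n + k - int j)) - (\<Sum>j<B. c n j *\<^sub>C Q (int j) (n + k - int j + 1))"
    by (simp add: scaleC_diff_right sum_subtractf)
  also have "(\<Sum>j<B. c n j *\<^sub>C Q (int j) (n + k - int j + 1)) = (\<Sum>j<Suc B. c n j *\<^sub>C Q (int j) (n + k - int j + 1))"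
    using n0 B by simp
  also have "\<dots> = c n 0 *\<^sub>C Q 0 (n + k + 1) + (\<Sum>j<B. c n (Suc j) *\<^sub>C Q (int j + 1) (n + k - int j))"
    by (subst sum.lessThan_Suc_shift) (simp add: algebra_simps)
  also have "(\<Sum>j<B. c n j *\<^sub>C Q (int j + 1) (n + k - int j)) - (c n 0 *\<^sub>C Q 0 (n + k + 1) + (\<Sum>j<B. c n (Suc j) *\<^sub>C Q (int j + 1) (n + k - int j)))
    = c (n + 1) 0 *\<^sub>C Q 0 (n + k + 1) + (\<Sum>j<B. c (n + 1) (Suc j) *\<^sub>C Q (int j + 1) (n + k - int j))"
    by (simp add: c c0 scaleC_diff_left sum_subtractf)
  also have "\<dots> = (\<Sum>j<Suc B. c (n + 1) j *\<^sub>C Q (int j) (n + 1 + k - int j))"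
    by (subst sum.lessThan_Suc_shift) (simp add: algebra_simps)
  also have "\<dots> = iter_right Q (n + 1) k"
    using iter_right_sum [of n0 Q "Suc B" "n + 1" k] n0 B by (simp add: c_def del: sum.lessThan_Suc)
  finally show ?thesis .
qed

lemma iter_left_add:
  assumes "bounded_snd P" "bounded_snd P'"
  shows "iter_left (\<lambda>m n. P m n + P' m n) n k = iter_left P n k + iter_left P' n k"
proof -
  obtain n0 where n0: "\<And>m n. n0 \<le> n \<Longrightarrow> P m n = 0" using assms by (auto simp: bounded_snd_def)
  obtain n1 where n1: "\<And>m n. n1 \<le> n \<Longrightarrow> P' m n = 0" using assms by (auto simp: bounded_snd_def)
  define B where "B = nat (n0 - k) + nat (n1 - k)"
  have B: "max n0 n1 \<le> k + int B"
    using nat_le_iff [of "n0 - k" B] nat_le_iff [of "n1 - k" B] by (simp add: B_def)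
  show ?thesis
    using iter_left_sum [of "max n0 n1" "\<lambda>m n. P m n + P' m n" k B n] iter_left_sum [of "max n0 n1" P k B n]
      iter_left_sum [of "max n0 n1" P' k B n] B n0 n1
    by (simp add: scaleC_add_right sum.distrib)
qed

lemma iter_right_add:
  assumes "bounded_fst P" "bounded_fst P'"
  shows "iter_right (\<lambda>m n. P m n + P' m n) n k = iter_right P n k + iter_right P' n k"
proof -
  obtain n0 where n0: "\<And>m n. n0 \<le> m \<Longrightarrow> P m n = 0" using assms by (auto simp: bounded_fst_def)
  obtain n1 where n1: "\<And>m n. n1 \<le> m \<Longrightarrow> P' m n = 0" using assms(2) by (auto simp: bounded_fst_def)
  define B where "B = nat n0 + nat n1"
  have B: "max n0 n1 \<le> int B"
    using nat_le_iff [of n0 B] nat_le_iff [of n1 B] by (simp add: B_def)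
  show ?thesis
    using iter_right_sum [of "max n0 n1" "\<lambda>m n. P m n + P' m n" B n k] iter_right_sum [of "max n0 n1" P B n k]
      iter_right_sum [of "max n0 n1" P' B n k] B n0 n1
    by (simp add: scaleC_add_right sum.distrib)
qed

lemma iter_Delta_pow:
  assumes "bounded_snd P" "bounded_fst Q"
  shows "iter ((Delta ^^ N) P) ((Delta ^^ N) Q) n k = iter P Q (n + int N) k"
proof (induction N arbitrary: n)
  case (Suc N)
  have "iter ((Delta ^^ Suc N) P) ((Delta ^^ Suc N) Q) n k = iter ((Delta ^^ N) P) ((Delta ^^ N) Q) (n + 1) k"
    by (simp add: iter_def iter_left_Delta iter_right_Delta bounded_snd_Delta_pow bounded_fst_Delta_pow assms)
  then show ?case using Suc [of "n + 1"] by (simp add: add.assoc)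
qed simp

lemma iter_shift_snd: "iter (\<lambda>m n. P m (n + a)) (\<lambda>m n. Q m (n + a)) n k = iter P Q n (k + a)"
  by (simp add: iter_def iter_left_def iter_right_def algebra_simps)

lemma iter_shift_fst:
  assumes "bounded_snd P" "bounded_fst Q"
  shows "iter (\<lambda>m n. P (m + 1) n) (\<lambda>m n. Q (m + 1) n) = Theta (iter P Q)"
proof (intro ext)
  fix n k
  have P: "(\<lambda>m n. P (m + 1) n) = (\<lambda>m n. Delta P m n + P m (n + 1))"
    and Q: "(\<lambda>m n. Q (m + 1) n) = (\<lambda>m n. Delta Q m n + Q m (n + 1))"
    by (simp_all add: Delta_def)
  have b: "bounded_snd (\<lambda>m n. P m (n + 1))" "bounded_fst (\<lambda>m n. Q m (n + 1))"
    using bounded_snd_shift [OF assms(1), of 0 1] bounded_fst_shift [OF assms(2), of 0 1] by simp_all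
  have "iter (\<lambda>m n. P (m + 1) n) (\<lambda>m n. Q (m + 1) n) n k = iter (Delta P) (Delta Q) n k +
      iter (\<lambda>m n. P m (n + 1)) (\<lambda>m n. Q m (n + 1)) n k"
    unfolding P Q iter_def
    by (subst iter_left_add, use assms b bounded_snd_Delta in blast, use assms b in blast)
     (subst iter_right_add, use assms b bounded_fst_Delta in blast, use assms b in blast, simp)
  then show "iter (\<lambda>m n. P (m + 1) n) (\<lambda>m n. Q (m + 1) n) n k = Theta (iter P Q) n k"
    using iter_Delta_pow [OF assms, of 1 n k] by (simp add: iter_shift_snd Theta_def)
qed

lemma iter_shift_fst_pow:
  assumes "bounded_snd P" "bounded_fst Q"
  shows "iter (\<lambda>m n. P (m + int N) n) (\<lambda>m n. Q (m + int N) n) = (Theta ^^ N) (iter P Q)"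
proof (induction N)
  case (Suc N)
  have b: "bounded_snd (\<lambda>m n. P (m + int N) n)" "bounded_fst (\<lambda>m n. Q (m + int N) n)"
    using bounded_snd_shift [OF assms(1), of "int N" 0] bounded_fst_shift [OF assms(2), of "int N" 0] by simp_all
  show ?case
    using iter_shift_fst [OF b] Suc by (simp add: algebra_simps)
qed simp

lemma iter_0: "iter P Q 0 k = P 0 k - Q 0 k"
proof -
  have *: "((0::complex) gchoose j) = (if j = 0 then 1 else 0)" for j
    by (cases j) simp_all
  have "iter_left P 0 k = Sum_any (\<lambda>j::nat. if j = 0 then P 0 k else 0)"
    unfolding iter_left_def by (rule Sum_any.cong) (simp add: *)
  moreover have "iter_right Q 0 k = Sum_any (\<lambda>j::nat. if j = 0 then Q 0 k else 0)"
    unfolding iter_right_def by (rule Sum_any.cong) (simp add: *)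
  ultimately show ?thesis by (simp add: iter_def)
qed

lemma iter_nat:
  assumes "bounded_snd P" "bounded_fst Q"
  shows "iter P Q (int j) k = (Delta ^^ j) P 0 k - (Delta ^^ j) Q 0 k"
  using iter_Delta_pow [OF assms, of j 0 k] by (simp add: iter_0)

text \<open>For a polar array, i.e. one supported on negative indices, the two halves of \<open>iter\<close> degenerate:
  the second vanishes and the first becomes the sum that occurs in \<open>prod_outer_nice3\<close>.\<close>

lemma iter_polar:
  assumes "\<And>m n. 0 \<le> m \<or> 0 \<le> n \<Longrightarrow> \<Phi> m n = 0"
  shows "0 \<le> n \<or> 0 \<le> k \<Longrightarrow> iter \<Phi> \<Phi> n k = 0"
    and "iter \<Phi> \<Phi> (- 1 - int p) (- 1 - int q) =
      (\<Sum>t\<le>q. of_nat ((p + t) choose t) *\<^sub>C \<Phi> (- 1 - int (p + t)) (- 1 - int (q - t)))"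
proof -
  have b: "bounded_snd \<Phi>" "bounded_fst \<Phi>"
    using assms unfolding bounded_snd_def bounded_fst_def by blast+
  have r: "iter_right \<Phi> n k = 0" for n k
    using iter_right_sum [of 0 \<Phi> 0] assms by simp
  show "iter \<Phi> \<Phi> n k = 0" if "0 \<le> n \<or> 0 \<le> k"
  proof (cases "0 \<le> n")
    case True
    then obtain j where "n = int j" by (metis nonneg_int_cases)
    then show ?thesis by (simp add: iter_nat b)
  next
    case False
    then show ?thesis using that iter_left_sum [of 0 \<Phi> k 0] assms by (simp add: iter_def r)
  qed
  have c: "(- 1) ^ j * (of_int (- 1 - int p) gchoose j) = (of_nat ((p + j) choose j) :: complex)" for j
  proof -
    have "(of_int (- 1 - int p) gchoose j :: complex) = ((- of_nat (Suc p)) gchoose j)"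
      by (simp add: algebra_simps)
    also have "\<dots> = (- 1) ^ j * ((of_nat (Suc p) + of_nat j - 1) gchoose j)"
      by (rule gbinomial_minus)
    also have "(of_nat (Suc p) + of_nat j - 1 :: complex) = of_nat (p + j)" by simp
    finally show ?thesis
      by (simp add: binomial_gbinomial mult.assoc [symmetric] power_mult_distrib [symmetric])
  qed
  have "iter \<Phi> \<Phi> (- 1 - int p) (- 1 - int q) = (\<Sum>j<Suc q. of_nat ((p + j) choose j) *\<^sub>C
      \<Phi> (- 1 - int p - int j) (- 1 - int q + int j))"
    using iter_left_sum [of 0 \<Phi> "- 1 - int q" "Suc q" "- 1 - int p"] assms
    by (simp only: iter_def r c) simp
  also have "\<dots> = (\<Sum>t\<le>q. of_nat ((p + t) choose t) *\<^sub>C \<Phi> (- 1 - int (p + t)) (- 1 - int (q - t)))"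
    unfolding lessThan_Suc_atMost
    by (intro sum.cong refl arg_cong2 [where f = scaleC] arg_cong2 [where f = \<Phi>]) auto
  finally show "iter \<Phi> \<Phi> (- 1 - int p) (- 1 - int q) =
      (\<Sum>t\<le>q. of_nat ((p + t) choose t) *\<^sub>C \<Phi> (- 1 - int (p + t)) (- 1 - int (q - t)))" .
qed

lemma Theta_pow_diff: "(Theta ^^ N) (\<lambda>n k. R n k - S n k) n k = (Theta ^^ N) R n k - (Theta ^^ N) S n k"
  by (induction N arbitrary: n k) (simp_all add: Theta_def)

text \<open>\<open>Theta E = 0\<close> determines \<open>E n\<close> from \<open>E (n + 1)\<close>, so vanishing propagates from large \<open>n\<close> downwards.\<close>

lemma Theta_inj:
  assumes "\<And>n k. Theta E n k = 0" "\<And>n k. n0 \<le> n \<Longrightarrow> E n k = 0"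
  shows "E n k = 0"
proof (cases "n0 \<le> n")
  case False
  then have "n \<le> n0" by simp
  then show ?thesis
  proof (induction n arbitrary: k rule: int_le_induct)
    case base
    then show ?case using assms(2) by simp
  next
    case (step i)
    have "Theta E (i - 1) (k - 1) = 0" by (rule assms)
    then show ?case using step.IH by (simp add: Theta_def)
  qed
qed (use assms in simp)

lemma Theta_pow_inj:
  assumes "\<And>n k. (Theta ^^ N) E n k = 0" "\<And>n k. n0 \<le> n \<Longrightarrow> E n k = 0"
  shows "E n k = 0"
  using assms(1)
proof (induction N arbitrary: n k)
  case (Suc N)
  have van: "(Theta ^^ j) E n k = 0" if "n0 \<le> n" for j n k
    using that by (induction j arbitrary: n k) (simp_all add: assms(2) Theta_def)
  have "(Theta ^^ N) E n k = 0" for n k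
    by (rule Theta_inj [of _ n0]) (use Suc.prems van in auto)
  then show ?case by (rule Suc.IH)
qed simp

text \<open>\<open>R\<close> and \<open>iter P Q\<close> satisfy the same equation after \<open>Theta ^^ N\<close>, and both vanish for large \<open>n\<close>: the
  first by assumption, the second because \<open>P\<close> and \<open>Q\<close> become equal after \<open>Delta ^^ N\<close>.
  Thus \<open>Theta_pow_inj\<close> applies to the difference.\<close>

theorem iterate_formula_abstract:
  assumes P: "bounded_snd P" and Q: "bounded_fst Q"
    and PF: "\<And>m n. (Delta ^^ N) P (m + int N) (n + int N) = \<Phi> m n"
    and QF: "\<And>m n. (Delta ^^ N) Q (m + int N) (n + int N) = \<Phi> m n"
    and RF: "\<And>n k. (Theta ^^ N) R (n + int N) (k + int N) = iter \<Phi> \<Phi> n k"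
    and R: "\<And>n k. n0 \<le> n \<Longrightarrow> R n k = 0"
  shows "R n k = iter P Q n k"
proof -
  have PQ: "(Delta ^^ N) P = (Delta ^^ N) Q"
  proof (intro ext)
    fix m n
    show "(Delta ^^ N) P m n = (Delta ^^ N) Q m n"
      using PF [of "m - int N" "n - int N"] QF [of "m - int N" "n - int N"] by simp
  qed
(* For n >= N, N of the n differences in iter are used to identify P with Q. *)
  have van: "iter P Q n k = 0" if n: "int N \<le> n" for n k
  proof -
    define j where "j = nat (n - int N)"
    then have j: "n = int j + int N" using n by simp
    have "iter P Q n k = iter ((Delta ^^ N) P) ((Delta ^^ N) Q) (int j) k"
      using iter_Delta_pow [OF P Q, of N "int j" k] j by simp
    also have "\<dots> = 0"
      using bounded_snd_Delta_pow [OF P, of N] bounded_fst_Delta_pow [OF Q, of N] unfolding PQ [symmetric]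
      by (subst iter_nat) (simp_all add: PQ)
    finally show ?thesis .
  qed
  have "iter \<Phi> \<Phi> n k = (Theta ^^ N) (iter P Q) (n + int N) (k + int N)" for n k
  proof -
    have "\<Phi> = (\<lambda>m n. (Delta ^^ N) P (m + int N) (n + int N))" "\<Phi> = (\<lambda>m n. (Delta ^^ N) Q (m + int N) (n + int N))"
      by (simp_all add: PF QF)
    then have "iter \<Phi> \<Phi> = iter (\<lambda>m n. (Delta ^^ N) P (m + int N) (n + int N)) (\<lambda>m n. (Delta ^^ N) Q (m + int N) (n + int N))"
      by metis
    also have "\<dots> = (Theta ^^ N) (iter (\<lambda>m n. (Delta ^^ N) P m (n + int N)) (\<lambda>m n. (Delta ^^ N) Q m (n + int N)))"
      using bounded_snd_shift [OF bounded_snd_Delta_pow [OF P, of N], of 0 "int N"]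
        bounded_fst_shift [OF bounded_fst_Delta_pow [OF Q, of N], of 0 "int N"]
      by (subst iter_shift_fst_pow [symmetric]) simp_all
    also have "iter (\<lambda>m n. (Delta ^^ N) P m (n + int N)) (\<lambda>m n. (Delta ^^ N) Q m (n + int N)) = (\<lambda>n k. iter P Q (n + int N) (k + int N))"
      by (intro ext) (simp add: iter_shift_snd iter_Delta_pow P Q)
    finally show ?thesis by (simp add: Theta_pow_shift)
  qed
  then have *: "(Theta ^^ N) (\<lambda>n k. R n k - iter P Q n k) n k = 0" for n k
    using RF [of "n - int N" "k - int N"] by (simp add: Theta_pow_diff)
  have "R n k - iter P Q n k = 0"
    by (rule Theta_pow_inj [OF *, of "max n0 (int N)"]) (simp add: R van)
  then show ?thesis by simp
qed

lemma Delta_zero_imp: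
  assumes "\<And>m n. Delta D m n = X (m + n)"
  shows "D m n = D 0 (m + n) + of_int m *\<^sub>C X (m + n - 1)"
proof (induction m arbitrary: n rule: int_induct [where k = 0])
  case (step1 i)
  have "D (i + 1) n = D i (n + 1) + X (i + n)" using assms [of i n] by (simp add: Delta_def algebra_simps)
  also have "\<dots> = D 0 (i + 1 + n) + of_int i *\<^sub>C X (i + n) + X (i + n)"
    using step1.IH [of "n + 1"] by (simp add: algebra_simps)
  finally show ?case by (simp add: scaleC_add_left algebra_simps)
next
  case (step2 i)
  have "D (i - 1) n = D i (n - 1) - X (i - 1 + (n - 1))" using assms [of "i - 1" "n - 1"] by (simp add: Delta_def algebra_simps)
  also have "\<dots> = D 0 (i - 1 + n) + of_int i *\<^sub>C X (i + n - 2) - X (i + n - 2)"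
    using step2.IH [of "n - 1"] by (simp add: algebra_simps)
  finally show ?case by (simp add: scaleC_diff_left algebra_simps)
qed simp

text \<open>A function killed by \<open>Delta ^^ N\<close> is determined by the initial values of its iterated differences
  on the line \<open>m = 0\<close>. In terms of fields: a combination of derivatives of delta functions is
  determined by its residues.\<close>

lemma Delta_pow_zero:
  fixes D :: "int \<Rightarrow> int \<Rightarrow> 'v::complex_vector"
  assumes "\<And>m n. (Delta ^^ N) D m n = 0" "\<And>j k. (Delta ^^ j) D 0 k = 0"
  shows "D m n = 0"
  using assms
proof (induction N arbitrary: D m n)
  case (Suc N)
  have "Delta D m n = 0" for m n
  proof (rule Suc.IH)
    show "(Delta ^^ N) (Delta D) m n = 0" for m n
      using Suc.prems(1) [of m n] by (simp add: funpow_swap1)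
    show "(Delta ^^ j) (Delta D) 0 k = 0" for j k
      using Suc.prems(2) [of "Suc j" k] by (simp add: funpow_swap1)
  qed
  then have "D m n = D 0 (m + n)"
    using Delta_zero_imp [of D "\<lambda>_. 0" m n] by simp
  then show ?case using Suc.prems(2) [of 0] by simp
qed simp

text \<open>For \<open>j \<ge> 0\<close>, \<open>iter P Q j k\<close> is the \<open>j\<close>-th difference of \<open>P - Q\<close> at \<open>m = 0\<close>. If these vanish
  for \<open>j \<ge> 2\<close>, then \<open>P - Q\<close> depends on \<open>m\<close> linearly along the lines \<open>m + n = const\<close>.\<close>

theorem commutator_formula_abstract:
  assumes P: "bounded_snd P" and Q: "bounded_fst Q" and PQ: "(Delta ^^ N) P = (Delta ^^ N) Q"
    and van: "\<And>j k. 2 \<le> j \<Longrightarrow> iter P Q j k = 0"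
  shows "P m n - Q m n = iter P Q 0 (m + n) + of_int m *\<^sub>C iter P Q 1 (m + n - 1)"
proof -
  define D where "D m n = P m n - Q m n" for m n
  have pow: "(Delta ^^ j) D m n = (Delta ^^ j) P m n - (Delta ^^ j) Q m n" for j m n
    by (induction j arbitrary: m n) (simp_all add: D_def Delta_def)
  have it: "iter P Q (int j) k = (Delta ^^ j) D 0 k" for j k
    by (simp add: iter_nat P Q pow)
  have "Delta (Delta D) m n = 0" for m n
  proof (rule Delta_pow_zero [where N = N])
    have "(Delta ^^ N) (Delta (Delta D)) = Delta (Delta ((Delta ^^ N) D))"
      by (metis funpow_swap1)
    then show "(Delta ^^ N) (Delta (Delta D)) m n = 0" for m n
      by (simp only:) (simp add: Delta_def pow PQ)
    show "(Delta ^^ j) (Delta (Delta D)) 0 k = 0" for j k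
    proof -
      have "(Delta ^^ j) (Delta (Delta D)) = (Delta ^^ (Suc (Suc j))) D"
        by (simp add: funpow_swap1)
      then show ?thesis using it [of "Suc (Suc j)" k] van by simp
    qed
  qed
  then have "Delta D m n = Delta D 0 (m + n)" for m n
    using Delta_zero_imp [of "Delta D" "\<lambda>_. 0" m n] by simp
  from Delta_zero_imp [of D, OF this] have "D m n = D 0 (m + n) + of_int m *\<^sub>C Delta D 0 (m + n - 1)" .
  then show ?thesis using it [of 0 "m + n"] it [of 1 "m + n - 1"] by (simp add: D_def)
qed

section \<open>The identities for nice series\<close>

lemma psi_polar: "0 \<le> m \<or> 0 \<le> n \<Longrightarrow> psi F (- 1 - m) (- 1 - n) = 0"
  by (auto simp: psi_def)

lemma prod_outer_nice3_iter:
  assumes "nice3 F"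
  defines "\<Phi> \<equiv> \<lambda>m n. psi F (- 1 - m) (- 1 - n)"
  shows "prod_outer F n k = iter \<Phi> \<Phi> n k"
proof (cases "0 \<le> n \<or> 0 \<le> k")
  case True
  have "iter \<Phi> \<Phi> n k = 0"
    by (rule iter_polar(1) [OF _ True]) (simp add: \<Phi>_def psi_polar)
  then show ?thesis
    using prod_outer_nice3(2) [OF assms(1) True] by simp
next
  case False
  define p where "p = nat (- 1 - n)"
  have p: "n = - 1 - int p" using False by (simp add: p_def)
  define q where "q = nat (- 1 - k)"
  have q: "k = - 1 - int q" using False by (simp add: q_def)
  have "iter \<Phi> \<Phi> n k = (\<Sum>t\<le>q. of_nat ((p + t) choose t) *\<^sub>C \<Phi> (- 1 - int (p + t)) (- 1 - int (q - t)))"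
    unfolding p q by (rule iter_polar(2)) (simp add: \<Phi>_def psi_polar)
  then show ?thesis
    unfolding p q prod_outer_nice3(1) [OF assms(1)] by (simp add: \<Phi>_def)
qed

text \<open>\<open>F\<close> stands for $a(z_1)b(z_2)c(z_3)v$ and \<open>G\<close> for $b(z_1)a(z_2)c(z_3)v$. Multiplied by
  $z_{12}^Nz_{13}^Nz_{23}^N$ they agree up to exchange of the first two variables, and their products become Taylor
  coefficients of one series \<open>H\<close>; this provides the hypotheses of \<open>iterate_formula_abstract\<close>.\<close>

theorem prod_outer_iterate:
  assumes F: "adm_inner F" "adm_outer F" and G: "adm_inner G"
    and nice: "nice3 (mult_all N F)"
    and swap: "mult_all N G = (-1) ^ N *\<^sub>C swap12 (mult_all N F)"
    and bF: "bounded_snd (prod_inner F)" and bG: "bounded_snd (prod_inner G)"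
    and bR: "\<And>n k. n0 \<le> n \<Longrightarrow> prod_outer F n k = 0"
  shows "(Delta ^^ N) (prod_inner F) = (Delta ^^ N) (\<lambda>m n. prod_inner G n m)"
    and "prod_outer F n k = iter (prod_inner F) (\<lambda>m n. prod_inner G n m) n k"
proof -
  define H where "H = mult_all N F"
  define Q where "Q = (\<lambda>m n. prod_inner G n m)"
  have niceH: "nice3 H" using nice by (simp add: H_def)
  have PF: "(Delta ^^ N) (prod_inner F) (m + int N) (n + int N) = psi H (- 1 - m) (- 1 - n)" for m n
    by (simp add: prod_inner_mult_all [OF F(1), symmetric] prod_inner_nice3 nice H_def)
  have scale: "psi (c *\<^sub>C swap12 H) p q = c *\<^sub>C psi H q p" for c p q
  proof -
    have 1: "(der ^^ p) ((inner der ^^ q) (c *\<^sub>C swap12 H)) = c *\<^sub>C swap12 ((der ^^ q) ((inner der ^^ p) H))" for p q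
    proof -
      have d: "inner der (swap12 F) = swap12 (der F)" "der (swap12 F) = swap12 (inner der F)" for F :: "'a lseries2 lseries"
        by (simp_all add: inner_der_swap12)
      have s1: "(inner der ^^ q) (swap12 H) = swap12 ((der ^^ q) H)"
        by (induction q) (simp_all add: d)
      have s2: "(der ^^ p) (swap12 X) = swap12 ((inner der ^^ p) X)" for X :: "'a lseries2 lseries"
        by (induction p) (simp_all add: d)
      have "(inner der ^^ q) (c *\<^sub>C swap12 H) = c *\<^sub>C swap12 ((der ^^ q) H)"
        by (simp only: clinear_scaleC [OF clinear_funpow [OF clinear_inner [OF clinear_der]]] s1)
      moreover have "(der ^^ p) (c *\<^sub>C swap12 X) = c *\<^sub>C swap12 ((inner der ^^ p) X)" for X :: "'a lseries2 lseries"
        by (simp only: clinear_scaleC [OF der_pow_linear] s2)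
      moreover have "(inner der ^^ p) ((der ^^ q) H) = (der ^^ q) ((inner der ^^ p) H)"
        by (induction p) (simp_all add: inner_der_der_pow)
      ultimately show ?thesis by (simp only:)
    qed
    have 2: "diag3 (c *\<^sub>C swap12 X) = c *\<^sub>C diag3 X" if "nice3 X" for X :: "'a lseries2 lseries"
    proof -
      have n: "nice3 (swap12 X)" using that by (rule nice3_swap12)
      have "diag ((c *\<^sub>C swap12 X) e k) = c *\<^sub>C diag (swap12 X e k)" for e k
        using diag_scaleC [OF nice3_inner [OF n]] by simp
      then have "diag3 (c *\<^sub>C swap12 X) = diag (c *\<^sub>C (\<lambda>e k. diag (swap12 X e k)))"
        unfolding diag3_def by (intro arg_cong [where f = diag] ext) simp
      also have "\<dots> = c *\<^sub>C diag3 (swap12 X)"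
        unfolding diag3_def by (rule diag_scaleC [OF nice3_diag_inner [OF n]])
      finally show ?thesis using that by (simp only: diag3_swap12)
    qed
    show ?thesis
      unfolding psi_def 1 by (auto simp: 2 nice3_der_pow nice3_inner_der_pow niceH scaleC_scaleC mult.commute)
  qed
  have QF: "(Delta ^^ N) Q (m + int N) (n + int N) = psi H (- 1 - m) (- 1 - n)" for m n
  proof -
(* Exchanging the indices changes the sign of Delta, just as exchanging z1 and z2 changes the sign of z12; the two signs cancel. *)
    have flip: "(Delta ^^ N) (\<lambda>m n. X n m) m n = (-1) ^ N *\<^sub>C (Delta ^^ N) X n m" for X :: "int \<Rightarrow> int \<Rightarrow> 'a lseries" and m n
      by (induction N arbitrary: m n) (simp_all add: Delta_def scaleC_diff_right)
    have nG: "nice3 (mult_all N G)"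
    proof -
      have *: "nice3 (c *\<^sub>C X)" if "nice3 X" for c and X :: "'a lseries2 lseries"
        unfolding nice3_def
      proof
        fix e
        show "finite {(e1, e2). \<exists>k1 k2 k3. (c *\<^sub>C X) e1 k1 e2 k2 (e - e1 - e2) k3 \<noteq> 0}"
          by (rule finite_subset [OF _ nice3D [OF that, of e]]) auto
      qed
      show ?thesis unfolding swap by (rule * [OF nice3_swap12 [OF nice]])
    qed
    have "(Delta ^^ N) (prod_inner G) (n + int N) (m + int N) = psi (mult_all N G) (- 1 - n) (- 1 - m)"
      by (simp add: prod_inner_mult_all [OF G, symmetric] prod_inner_nice3 nG)
    also have "\<dots> = (-1) ^ N *\<^sub>C psi H (- 1 - m) (- 1 - n)"
      unfolding swap H_def [symmetric] by (rule scale)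
    finally have "(Delta ^^ N) Q (m + int N) (n + int N) = (-1) ^ N *\<^sub>C (-1) ^ N *\<^sub>C psi H (- 1 - m) (- 1 - n)"
      unfolding Q_def flip [of "prod_inner G"] by (simp only:)
    then show ?thesis
      by (simp only: scaleC_scaleC power_mult_distrib [symmetric]) simp
  qed
  have bQ: "bounded_fst Q" using bG by (auto simp: bounded_snd_def bounded_fst_def Q_def)
  have "prod_outer F n k = iter (prod_inner F) Q n k"
  proof (rule iterate_formula_abstract [OF bF bQ PF QF _ bR])
    fix n k
    show "(Theta ^^ N) (prod_outer F) (n + int N) (k + int N) =
        iter (\<lambda>m n. psi H (- 1 - m) (- 1 - n)) (\<lambda>m n. psi H (- 1 - m) (- 1 - n)) n k"
      using prod_outer_mult_all [OF F(2), of N n k] prod_outer_nice3_iter [OF nice, of n k]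
      by (simp add: H_def)
  qed
  then show "prod_outer F n k = iter (prod_inner F) (\<lambda>m n. prod_inner G n m) n k"
    by (simp add: Q_def)
  have "(Delta ^^ N) (prod_inner F) m n = (Delta ^^ N) Q m n" for m n
    using PF [of "m - int N" "n - int N"] QF [of "m - int N" "n - int N"] by simp
  then show "(Delta ^^ N) (prod_inner F) = (Delta ^^ N) (\<lambda>m n. prod_inner G n m)"
    by (simp add: fun_eq_iff Q_def)
qed

section \<open>Logarithmic fields\<close>

subsection \<open>Sets of exponents bounded below\<close>

text \<open>Exponents are complex numbers, so boundedness below has to be taken within classes modulo $\mathbb Z$:
  \<open>T\<close> lies in finitely many sequences \<open>s - M, s - M + 1, \<dots>\<close>. Keeping track of \<open>S\<close> matters for logarithmic
  fields, whose classes are the same for all vectors while the bound \<open>M\<close> may vary.\<close>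

definition low_in :: "complex set \<Rightarrow> complex set \<Rightarrow> bool"
  where "low_in S T \<longleftrightarrow> (\<exists>M::nat. \<forall>t\<in>T. \<exists>s\<in>S. \<exists>i::nat. t = s + of_nat i - of_nat M)"

definition low :: "complex set \<Rightarrow> bool"
  where "low T \<longleftrightarrow> (\<exists>S. finite S \<and> low_in S T)"

lemma low_in_subset: "low_in S T \<Longrightarrow> T' \<subseteq> T \<Longrightarrow> low_in S T'"
  unfolding low_in_def by blast

lemma low_in_mono: "low_in S T \<Longrightarrow> S \<subseteq> S' \<Longrightarrow> low_in S' T"
  unfolding low_in_def by blast

lemma low_in_Un:
  assumes "low_in S T" "low_in S T'"
  shows "low_in S (T \<union> T')"
proof -
  obtain M where M: "\<And>t. t \<in> T \<Longrightarrow> \<exists>s\<in>S. \<exists>i::nat. t = s + of_nat i - of_nat M"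
    using assms(1) unfolding low_in_def by blast
  obtain M' where M': "\<And>t. t \<in> T' \<Longrightarrow> \<exists>s\<in>S. \<exists>i::nat. t = s + of_nat i - of_nat M'"
    using assms(2) unfolding low_in_def by blast
  have "\<exists>s\<in>S. \<exists>i::nat. t = s + of_nat i - of_nat (M + M')" if "t \<in> T \<union> T'" for t
    using that
  proof
    assume "t \<in> T"
    then obtain s and i :: nat where "s \<in> S" "t = s + of_nat i - of_nat M" using M by blast
    then show ?thesis by (intro bexI [of _ s] exI [of _ "i + M'"]) auto
  next
    assume "t \<in> T'"
    then obtain s and i :: nat where "s \<in> S" "t = s + of_nat i - of_nat M'" using M' by blast
    then show ?thesis by (intro bexI [of _ s] exI [of _ "i + M"]) auto
  qed
  then show ?thesis unfolding low_in_def by blast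
qed

lemma low_in_down:
  assumes "low_in S T" "\<And>t. t \<in> T' \<Longrightarrow> t + of_nat p \<in> T"
  shows "low_in S T'"
proof -
  obtain M where M: "\<And>t. t \<in> T \<Longrightarrow> \<exists>s\<in>S. \<exists>i::nat. t = s + of_nat i - of_nat M"
    using assms(1) unfolding low_in_def by blast
  have "\<exists>s\<in>S. \<exists>i::nat. t = s + of_nat i - of_nat (M + p)" if t: "t \<in> T'" for t
  proof -
    obtain s and i :: nat where "s \<in> S" "t + of_nat p = s + of_nat i - of_nat M"
      using M [OF assms(2) [OF t]] by blast
    then show ?thesis
      by (intro bexI [of _ s] exI [of _ i]) (auto simp: algebra_simps)
  qed
  then show ?thesis unfolding low_in_def by blast
qed

lemma low_in_up:
  assumes "low_in S T" "\<And>t. t \<in> T' \<Longrightarrow> t - 1 \<in> T"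
  shows "low_in S T'"
proof -
  obtain M where M: "\<And>t. t \<in> T \<Longrightarrow> \<exists>s\<in>S. \<exists>i::nat. t = s + of_nat i - of_nat M"
    using assms(1) unfolding low_in_def by blast
  have "\<exists>s\<in>S. \<exists>i::nat. t = s + of_nat i - of_nat M" if t: "t \<in> T'" for t
  proof -
    obtain s and i :: nat where "s \<in> S" "t - 1 = s + of_nat i - of_nat M"
      using M [OF assms(2) [OF t]] by blast
    then show ?thesis
      by (intro bexI [of _ s] exI [of _ "Suc i"]) (auto simp: algebra_simps)
  qed
  then show ?thesis unfolding low_in_def by blast
qed

lemma low_in_plus:
  assumes "low_in S T" "low_in S' T'"
  shows "low_in ((\<lambda>(x, y). x + y) ` (S \<times> S')) {x + y | x y. x \<in> T \<and> y \<in> T'}"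
proof -
  obtain M where M: "\<And>t. t \<in> T \<Longrightarrow> \<exists>s\<in>S. \<exists>i::nat. t = s + of_nat i - of_nat M"
    using assms(1) unfolding low_in_def by blast
  obtain M' where M': "\<And>t. t \<in> T' \<Longrightarrow> \<exists>s\<in>S'. \<exists>i::nat. t = s + of_nat i - of_nat M'"
    using assms(2) unfolding low_in_def by blast
  have "\<exists>s\<in>(\<lambda>(x, y). x + y) ` (S \<times> S'). \<exists>i::nat. x + y = s + of_nat i - of_nat (M + M')"
    if x: "x \<in> T" and y: "y \<in> T'" for x y
  proof -
    obtain s i s' i' where *: "s \<in> S" "x = s + of_nat i - of_nat M" "s' \<in> S'" "y = s' + of_nat i' - of_nat M'"
      using M [OF x] M' [OF y] by blast
    then show ?thesis
      by (intro bexI [of _ "s + s'"] exI [of _ "i + i'"]) (auto simp: image_iff)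
  qed
  then show ?thesis unfolding low_in_def by blast
qed

lemma low_subset: "low T \<Longrightarrow> T' \<subseteq> T \<Longrightarrow> low T'"
  unfolding low_def using low_in_subset by blast

lemma low_up_Un:
  assumes "low T" "\<And>t. t \<in> T' \<Longrightarrow> t \<in> T \<or> t - 1 \<in> T"
  shows "low T'"
proof -
  obtain S where S: "finite S" "low_in S T" using assms(1) unfolding low_def by blast
  have "low_in S {t. t - 1 \<in> T}" by (rule low_in_up [OF S(2)]) simp
  then have "low_in S (T \<union> {t. t - 1 \<in> T})" by (rule low_in_Un [OF S(2)])
  then have "low_in S T'" by (rule low_in_subset) (use assms(2) in blast)
  then show ?thesis unfolding low_def using S(1) by blast
qed

lemma low_plus:
  assumes "low T" "low T'"
  shows "low {x + y | x y. x \<in> T \<and> y \<in> T'}"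
proof -
  obtain S where S: "finite S" "low_in S T" using assms(1) unfolding low_def by blast
  obtain S' where S': "finite S'" "low_in S' T'" using assms(2) unfolding low_def by blast
  show ?thesis unfolding low_def
    by (intro exI conjI, rule finite_imageI [OF finite_cartesian_product [OF S(1) S'(1)]])
      (rule low_in_plus [OF S(2) S'(2)])
qed

lemma low_finite2:
  assumes "low S" "low T"
  shows "finite {x. x \<in> S \<and> e - x \<in> T}"
proof -
  obtain A M where A: "finite A" "\<And>t. t \<in> S \<Longrightarrow> \<exists>s\<in>A. \<exists>i::nat. t = s + of_nat i - of_nat (M::nat)"
    using assms(1) unfolding low_def low_in_def by blast
  obtain B K where B: "finite B" "\<And>t. t \<in> T \<Longrightarrow> \<exists>s\<in>B. \<exists>i::nat. t = s + of_nat i - of_nat (K::nat)"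
    using assms(2) unfolding low_def low_in_def by blast
  define f where "f a b = (\<lambda>i::nat. a + of_nat i - of_nat M) ` {i. \<exists>j::nat. of_nat (i + j) = e - a - b + of_nat (M + K)}" for a b
  have "finite {i. \<exists>j::nat. of_nat (i + j) = (c::complex)}" for c
  proof (cases "\<exists>n::nat. of_nat n = c")
    case True
    then obtain n :: nat where "of_nat n = c" by blast
    then have "{i. \<exists>j::nat. of_nat (i + j) = c} \<subseteq> {..n}"
      using of_nat_eq_iff [where 'a = complex] by (auto simp del: of_nat_add)
    then show ?thesis by (rule finite_subset) simp
  next
    case False
    then have "{i. \<exists>j::nat. of_nat (i + j) = c} = {}" by blast
    then show ?thesis by simp
  qed
  then have "finite (f a b)" for a b unfolding f_def by (intro finite_imageI)
  moreover have "{x. x \<in> S \<and> e - x \<in> T} \<subseteq> (\<Union>a\<in>A. \<Union>b\<in>B. f a b)"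
  proof clarify
    fix x assume x: "x \<in> S" "e - x \<in> T"
    obtain a i b j where *: "a \<in> A" "x = a + of_nat i - of_nat M" "b \<in> B" "e - x = b + of_nat j - of_nat K"
      using A(2) [OF x(1)] B(2) [OF x(2)] by blast
    have "e = b + of_nat j - of_nat K + x" using *(4) by (simp only: diff_eq_eq)
    then have "of_nat (i + j) = e - a - b + of_nat (M + K)" by (simp add: *(2))
    then have "x \<in> f a b" unfolding f_def *(2) by blast
    then show "x \<in> (\<Union>a\<in>A. \<Union>b\<in>B. f a b)" using * by blast
  qed
  ultimately show ?thesis by (meson A(1) B(1) finite_UN finite_subset)
qed

lemma low_finite3:
  assumes "low S" "low T" "low U"
  shows "finite {(x, y). x \<in> S \<and> y \<in> T \<and> e - x - y \<in> U}"
proof -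
  have 1: "finite {u. u \<in> {x + y | x y. x \<in> S \<and> y \<in> T} \<and> e - u \<in> U}"
    by (rule low_finite2 [OF low_plus [OF assms(1,2)] assms(3)])
  have 2: "finite {x. x \<in> S \<and> u - x \<in> T}" for u
    by (rule low_finite2 [OF assms(1,2)])
  have "{(x, y). x \<in> S \<and> y \<in> T \<and> e - x - y \<in> U} \<subseteq>
     (\<lambda>(u, x). (x, u - x)) ` Sigma {u. u \<in> {x + y | x y. x \<in> S \<and> y \<in> T} \<and> e - u \<in> U} (\<lambda>u. {x. x \<in> S \<and> u - x \<in> T})"
  proof (rule subsetI, clarify)
    fix x y assume "x \<in> S" "y \<in> T" "e - x - y \<in> U"
    then show "(x, y) \<in> (\<lambda>(u, x). (x, u - x)) ` Sigma {u. u \<in> {x + y | x y. x \<in> S \<and> y \<in> T} \<and> e - u \<in> U} (\<lambda>u. {x. x \<in> S \<and> u - x \<in> T})"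
      by (intro image_eqI [of _ _ "(x + y, x)"]) (auto simp: diff_diff_eq)
  qed
  then show ?thesis
    by (rule finite_subset) (intro finite_imageI finite_SigmaI 1 2)
qed

definition supp :: "'w::zero lseries \<Rightarrow> complex set"
  where "supp f = {e. \<exists>k. f e k \<noteq> 0}"

definition supp_fst :: "'w::zero lseries2 \<Rightarrow> complex set"
  where "supp_fst F = {e1. \<exists>k1 e2 k2. F e1 k1 e2 k2 \<noteq> 0}"

definition supp_snd :: "'w::zero lseries2 \<Rightarrow> complex set"
  where "supp_snd F = {e2. \<exists>e1 k1 k2. F e1 k1 e2 k2 \<noteq> 0}"

lemma low_nice2:
  assumes "low (supp_fst F)" "low (supp_snd F)"
  shows "nice2 F"
  unfolding nice2_def
proof
  fix e
  show "finite {e1. \<exists>k1 k2. F e1 k1 (e - e1) k2 \<noteq> 0}"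
    by (rule finite_subset [OF _ low_finite2 [OF assms, of e]]) (auto simp: supp_fst_def supp_snd_def)
qed

lemma mult_z12_nonzero:
  "mult_z12 F e1 k1 e2 k2 \<noteq> 0 \<Longrightarrow> F (e1 - 1) k1 e2 k2 \<noteq> 0 \<or> F e1 k1 (e2 - 1) k2 \<noteq> 0"
  by (auto simp: mult_z12_def)

lemma low_in_supp_fst_z12: "low_in S (supp_fst F) \<Longrightarrow> low_in S (supp_fst ((mult_z12 ^^ n) F))"
proof (induction n)
  case (Suc n)
  let ?F = "(mult_z12 ^^ n) F"
  have "low_in S {t. t - 1 \<in> supp_fst ?F}" by (rule low_in_up [OF Suc.IH]) (use Suc in auto)
  then have "low_in S (supp_fst ?F \<union> {t. t - 1 \<in> supp_fst ?F})" by (rule low_in_Un [OF Suc.IH [OF Suc.prems]])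
  then show ?case
    by (rule low_in_subset) (use mult_z12_nonzero [of ?F] in \<open>fastforce simp: supp_fst_def\<close>)
qed simp

lemma low_in_supp_snd_z12: "low_in S (supp_snd F) \<Longrightarrow> low_in S (supp_snd ((mult_z12 ^^ n) F))"
proof (induction n)
  case (Suc n)
  let ?F = "(mult_z12 ^^ n) F"
  have "low_in S {t. t - 1 \<in> supp_snd ?F}" by (rule low_in_up [OF Suc.IH]) (use Suc in auto)
  then have "low_in S (supp_snd ?F \<union> {t. t - 1 \<in> supp_snd ?F})" by (rule low_in_Un [OF Suc.IH [OF Suc.prems]])
  then show ?case
    by (rule low_in_subset) (use mult_z12_nonzero [of ?F] in \<open>fastforce simp: supp_snd_def\<close>)
qed simp

subsection \<open>The space of logarithmic fields\<close>

lemma LFie_parts_bound: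
  fixes S :: "complex set"
  assumes "finite S" "\<And>\<alpha>. \<alpha> \<in> S \<Longrightarrow> f \<alpha> \<in> lseries_space \<alpha>"
  shows "low_in (uminus ` S) {e. \<exists>\<alpha>\<in>S. \<exists>k. f \<alpha> e k \<noteq> 0}"
  using assms
proof (induction S)
  case empty
  then show ?case by (simp add: low_in_def)
next
  case (insert \<alpha> S)
  have 1: "low_in (uminus ` insert \<alpha> S) {e. \<exists>\<alpha>\<in>S. \<exists>k. f \<alpha> e k \<noteq> 0}"
    by (rule low_in_mono [OF insert.IH]) (use insert.prems in auto)
  obtain m where m: "m - \<alpha> \<in> \<int>" "\<And>e k. f \<alpha> e k \<noteq> 0 \<Longrightarrow> \<exists>i::nat. e = of_nat i - m"
    using insert.prems [of \<alpha>] unfolding lseries_space_def by blast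
  obtain z where z: "m = \<alpha> + of_int z" using m(1) by (auto elim!: Ints_cases simp: algebra_simps)
  have "\<exists>i'::nat. e = - \<alpha> + of_nat i' - of_nat (nat z)" if "f \<alpha> e k \<noteq> 0" for e k
  proof -
    obtain i :: nat where i: "e = of_nat i - m" using m(2) \<open>f \<alpha> e k \<noteq> 0\<close> by blast
    define i' where "i' = i + nat (int (nat z) - z)"
    have "int i' = int i + int (nat z) - z" by (simp add: i'_def)
    then have "(of_nat i' :: complex) = of_nat i + of_nat (nat z) - of_int z"
      by (metis (mono_tags) of_int_add of_int_diff of_int_of_nat_eq)
    then have "e = - \<alpha> + of_nat i' - of_nat (nat z)" using i z by simp
    then show ?thesis by blast
  qed
  then have "low_in (uminus ` insert \<alpha> S) {e. \<exists>k. f \<alpha> e k \<noteq> 0}"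
    unfolding low_in_def by (intro exI [of _ "nat z"]) auto
  from low_in_Un [OF 1 this] show ?case
    by (rule low_in_subset) auto
qed

text \<open>Elements of \<open>S\<close> in the class of \<open>- \<alpha>\<close> differ by integers; their real parts give a common bound.\<close>

lemma low_in_class_bound:
  assumes "finite S" "low_in S T"
  shows "\<exists>m. m - \<alpha> \<in> \<int> \<and> (\<forall>e\<in>T. e + \<alpha> \<in> \<int> \<longrightarrow> (\<exists>i::nat. e = of_nat i - m))"
proof -
  obtain M where M: "\<And>t. t \<in> T \<Longrightarrow> \<exists>s\<in>S. \<exists>i::nat. t = s + of_nat i - of_nat (M::nat)"
    using assms(2) unfolding low_in_def by blast
  obtain K :: nat where K: "\<And>s. s \<in> S \<Longrightarrow> \<bar>Re (s + \<alpha>)\<bar> \<le> of_nat K"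
  proof -
    obtain K :: nat where "(\<Sum>s\<in>S. \<bar>Re (s + \<alpha>)\<bar>) \<le> real K" using real_arch_simple by blast
    then have "\<bar>Re (s + \<alpha>)\<bar> \<le> real K" if "s \<in> S" for s
      using member_le_sum [OF that _ assms(1), of "\<lambda>s. \<bar>Re (s + \<alpha>)\<bar>"] by simp
    then show ?thesis by (rule that)
  qed
  have "\<exists>i::nat. e = of_nat i - (\<alpha> + of_nat (M + K))" if "e \<in> T" "e + \<alpha> \<in> \<int>" for e
  proof -
    obtain s and i :: nat where s: "s \<in> S" "e = s + of_nat i - of_nat M" using M \<open>e \<in> T\<close> by blast
    obtain z where z: "e + \<alpha> = of_int z" using \<open>e + \<alpha> \<in> \<int>\<close> by (auto elim: Ints_cases)
    have "real_of_int z = Re (e + \<alpha>)" by (simp only: z) simp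
    also have "\<dots> = Re (s + \<alpha>) + real i - real M" using s by simp
    finally have "real_of_int z \<ge> - real K - real M" using K [OF s(1)] by linarith
    then have "z + int M + int K \<ge> 0" by linarith
    then obtain j where "z + int M + int K = int j" by (metis nonneg_int_cases)
    then have "z = int j - int M - int K" by simp
    then have "e + \<alpha> = of_int (int j - int M - int K)" using z by simp
    then have "e = of_nat j - (\<alpha> + of_nat (M + K))" by (simp add: algebra_simps)
    then show ?thesis by blast
  qed
  then show ?thesis by (intro exI [of _ "\<alpha> + of_nat (M + K)"]) auto
qed

text \<open>The form in which membership in \<open>LFie\<close> is verified: no decomposition into classes has to be given. The
  component in each class is cut out by the condition \<open>e + \<alpha> \<in> \<int>\<close>.\<close>

lemma LFieI:
  fixes a :: "'w::complex_vector lfield"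
  assumes lin: "\<And>e k. clinear (\<lambda>v. a v e k)"
    and fin: "\<And>v e. finite {k. a v e k \<noteq> 0}"
    and S: "finite S" and low: "\<And>v. low_in S (supp (a v))"
  shows "a \<in> LFie"
proof -
(* r chooses one representative of each class modulo the integers that meets S. *)
  define r where "r x = (SOME s. s \<in> S \<and> x - s \<in> \<int>)" for x
  have r: "r x \<in> S \<and> x - r x \<in> \<int>" if "s \<in> S" "x - s \<in> \<int>" for x s
    unfolding r_def by (rule someI [of _ s]) (use that in simp)
  have r_eq: "r x = r y" if "x - y \<in> \<int>" for x y
  proof -
    have "x - s \<in> \<int> \<longleftrightarrow> y - s \<in> \<int>" for s
      using Ints_add [OF that, of "y - s"] Ints_diff [OF _ that, of "x - s"] by auto
    then show ?thesis by (simp add: r_def)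
  qed
  define S' where "S' = uminus ` r ` S"
  define b where "b \<alpha> = (\<lambda>v e k. if e + \<alpha> \<in> \<int> then a v e k else 0)" for \<alpha>
  have fS': "finite S'" using S by (simp add: S'_def)
  have "b \<alpha> \<in> LFie_part \<alpha>" for \<alpha>
    unfolding LFie_part_def
  proof safe
    show "clinear (\<lambda>v. b \<alpha> v e k)" for e k
      using lin [of e k] by (simp add: b_def clinear_iff)
    fix v
    show "b \<alpha> v \<in> lseries_space \<alpha>"
      unfolding lseries_space_def
    proof safe
      show "finite {k. b \<alpha> v e k \<noteq> 0}" for e
        by (rule finite_subset [OF _ fin [of v e]]) (auto simp: b_def)
      obtain m where "m - \<alpha> \<in> \<int>" "\<forall>e\<in>supp (a v). e + \<alpha> \<in> \<int> \<longrightarrow> (\<exists>i::nat. e = of_nat i - m)"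
        using low_in_class_bound [OF S low [of v], of \<alpha>] by blast
      then show "\<exists>m. m - \<alpha> \<in> \<int> \<and> (\<forall>e k. b \<alpha> v e k \<noteq> 0 \<longrightarrow> (\<exists>i::nat. e = of_nat i - m))"
        by (intro exI [of _ m]) (auto simp: b_def supp_def split: if_splits)
    qed
  qed
  moreover have "a v e k = (\<Sum>\<alpha>\<in>S'. b \<alpha> v e k)" for v e k
  proof (cases "a v e k = 0")
    case True
    then have "b \<alpha> v e k = 0" for \<alpha> by (simp add: b_def)
    then show ?thesis using True by simp
  next
    case False
    then obtain M i s where s: "s \<in> S" "e = s + of_nat (i::nat) - of_nat (M::nat)"
      using low [of v] unfolding low_in_def supp_def by blast
    have g: "e - s \<in> \<int>" using s by simp
    have rg: "r e \<in> S \<and> e - r e \<in> \<int>" by (rule r [OF s(1) g])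
    have "- r e \<in> S'" using r_eq [OF g] s(1) by (auto simp: S'_def)
    moreover have "b \<alpha> v e k = 0" if \<alpha>: "\<alpha> \<in> S' - {- r e}" for \<alpha>
    proof (rule ccontr)
      assume "b \<alpha> v e k \<noteq> 0"
      then have g': "e + \<alpha> \<in> \<int>" by (auto simp: b_def split: if_splits)
      obtain t where t: "t \<in> S" "\<alpha> = - r t" using \<alpha> by (auto simp: S'_def)
      have "t - r t \<in> \<int>" using r [OF t(1), of t] by simp
      then have "e - t \<in> \<int>" using g' t(2) Ints_diff [of "e - r t" "t - r t"] by simp
      then have "r e = r t" by (rule r_eq)
      then show False using \<alpha> t by simp
    qed
    ultimately have "(\<Sum>\<alpha>\<in>S'. b \<alpha> v e k) = (\<Sum>\<alpha>\<in>{- r e}. b \<alpha> v e k)"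
      by (intro sum.mono_neutral_right fS') auto
    also have "\<dots> = a v e k" using rg by (simp add: b_def)
    finally show ?thesis by simp
  qed
  ultimately show ?thesis unfolding LFie_def using fS' by blast
qed

lemma LFieE:
  assumes "a \<in> LFie"
  obtains S where "finite S" "\<And>v. low_in S (supp (a v))"
    "\<And>e k. clinear (\<lambda>v. a v e k)" "\<And>v e. finite {k. a v e k \<noteq> 0}"
proof -
  obtain S b where S: "finite S" "\<And>\<alpha>. \<alpha> \<in> S \<Longrightarrow> b \<alpha> \<in> LFie_part \<alpha>"
    "\<And>v e k. a v e k = (\<Sum>\<alpha>\<in>S. b \<alpha> v e k)"
    using assms unfolding LFie_def by blast
  have b: "b \<alpha> v \<in> lseries_space \<alpha>" "clinear (\<lambda>v. b \<alpha> v e k)" if "\<alpha> \<in> S" for \<alpha> v e k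
    using S(2) [OF that] by (simp_all add: LFie_part_def)
  have nz: "\<exists>\<alpha>\<in>S. b \<alpha> v e k \<noteq> 0" if "a v e k \<noteq> 0" for v e k
    using that unfolding S(3) by (meson sum.not_neutral_contains_not_neutral)
  show ?thesis
  proof (rule that [of "uminus ` S"])
    show "finite (uminus ` S)" using S by simp
    show "low_in (uminus ` S) (supp (a v))" for v
    proof (rule low_in_subset)
      show "low_in (uminus ` S) {e. \<exists>\<alpha>\<in>S. \<exists>k. b \<alpha> v e k \<noteq> 0}"
        by (rule LFie_parts_bound [OF S(1)]) (rule b)
      show "supp (a v) \<subseteq> {e. \<exists>\<alpha>\<in>S. \<exists>k. b \<alpha> v e k \<noteq> 0}"
        unfolding supp_def using nz by blast
    qed
    show "clinear (\<lambda>v. a v e k)" for e k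
      unfolding S(3) using b(2)
      by (auto simp: clinear_iff sum.distrib [symmetric] scaleC_sum_right intro!: sum.cong)
    show "finite {k. a v e k \<noteq> 0}" for v e
    proof (rule finite_subset)
      show "{k. a v e k \<noteq> 0} \<subseteq> (\<Union>\<alpha>\<in>S. {k. b \<alpha> v e k \<noteq> 0})" using nz by blast
      show "finite (\<Union>\<alpha>\<in>S. {k. b \<alpha> v e k \<noteq> 0})"
        using S(1) b(1) by (auto simp: lseries_space_def)
    qed
  qed
qed

lemma LFie_classes:
  assumes "a \<in> LFie"
  shows "\<exists>S. finite S \<and> (\<forall>v. low_in S (supp (a v)))"
  using LFieE [OF assms] by metis

lemma LFie_linear: "a \<in> LFie \<Longrightarrow> clinear (\<lambda>v. a v e k)"
  by (erule LFieE)

lemma LFie_finite: "a \<in> LFie \<Longrightarrow> finite {k. a v e k \<noteq> 0}"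
  by (erule LFieE)

lemma LFie_low: "a \<in> LFie \<Longrightarrow> low (supp (a v))"
  by (erule LFieE) (auto simp: low_def)

lemma LFie_add:
  assumes "a \<in> LFie" "b \<in> LFie"
  shows "a + b \<in> LFie"
proof -
  obtain S where S: "finite S" "\<And>v. low_in S (supp (a v))" using LFie_classes [OF assms(1)] by blast
  obtain T where T: "finite T" "\<And>v. low_in T (supp (b v))" using LFie_classes [OF assms(2)] by blast
  show ?thesis
  proof (rule LFieI [of _ "S \<union> T"])
    show "clinear (\<lambda>v. (a + b) v e k)" for e k
      using LFie_linear [OF assms(1), of e k] LFie_linear [OF assms(2), of e k]
      by (simp add: clinear_iff scaleC_add_right algebra_simps)
    show "finite {k. (a + b) v e k \<noteq> 0}" for v e
      by (rule finite_subset [of _ "{k. a v e k \<noteq> 0} \<union> {k. b v e k \<noteq> 0}"])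
        (use LFie_finite [OF assms(1)] LFie_finite [OF assms(2)] in auto)
    show "finite (S \<union> T)" using S T by simp
    fix v
    have "low_in S (supp (a v))" "low_in T (supp (b v))" using S T by blast+
    then have "low_in (S \<union> T) (supp (a v) \<union> supp (b v))"
      by (intro low_in_Un) (erule low_in_mono, blast)+
    then show "low_in (S \<union> T) (supp ((a + b) v))"
    proof (rule low_in_subset)
      show "supp ((a + b) v) \<subseteq> supp (a v) \<union> supp (b v)"
      proof
        fix e assume "e \<in> supp ((a + b) v)"
        then obtain k where "(a + b) v e k \<noteq> 0" unfolding supp_def by blast
        then have "a v e k \<noteq> 0 \<or> b v e k \<noteq> 0" by auto
        then show "e \<in> supp (a v) \<union> supp (b v)" unfolding supp_def by blast
      qed
    qed
  qed
qed

lemma LFie_scaleC: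
  assumes "a \<in> LFie"
  shows "c *\<^sub>C a \<in> LFie"
proof -
  obtain S where S: "finite S" "\<And>v. low_in S (supp (a v))" using LFie_classes [OF assms(1)] by blast
  show ?thesis
  proof (rule LFieI [OF _ _ S(1)])
    show "clinear (\<lambda>v. (c *\<^sub>C a) v e k)" for e k
      using LFie_linear [OF assms(1), of e k]
      by (simp add: clinear_iff scaleC_add_right scaleC_scaleC mult.commute)
    show "finite {k. (c *\<^sub>C a) v e k \<noteq> 0}" for v e
      by (rule finite_subset [OF _ LFie_finite [OF assms(1), of v e]]) auto
    show "low_in S (supp ((c *\<^sub>C a) v))" for v
      by (rule low_in_subset [OF S(2)]) (auto simp: supp_def)
  qed
qed

lemma LFie_0: "0 \<in> LFie"
  by (rule LFieI [of _ "{}"]) (simp_all add: clinear_iff supp_def low_in_def)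

subsection \<open>Locality and products\<close>

definition ab_series :: "'w::complex_vector lfield \<Rightarrow> 'w lfield \<Rightarrow> 'w \<Rightarrow> 'w lseries2"
  where "ab_series a b v e1 k1 e2 k2 = a (b v e2 k2) e1 k1"

lemma z12_ab_eq: "z12_ab N a b v = (mult_z12 ^^ N) (ab_series a b v)"
  unfolding z12_ab_def by (rule arg_cong [where f = "mult_z12 ^^ N"]) (simp add: fun_eq_iff ab_series_def)

lemma z12_ba_eq: "z12_ba N a b v = (mult_z12 ^^ N) (swap12 (ab_series b a v))"
  unfolding z12_ba_def by (rule arg_cong [where f = "mult_z12 ^^ N"]) (simp add: fun_eq_iff ab_series_def swap12_def)

lemma local_of_order_iff:
  "local_of_order N a b \<longleftrightarrow>
    (\<forall>v. (mult_z12 ^^ N) (ab_series a b v) = (mult_z12 ^^ N) (swap12 (ab_series b a v)))"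
  by (simp add: local_of_order_def z12_ab_eq z12_ba_eq)

lemma mult_z12_swap12: "mult_z12 (swap12 F) = - swap12 (mult_z12 F)"
  by (simp add: fun_eq_iff mult_z12_def swap12_def)

lemma mult_z12_pow_swap12: "(mult_z12 ^^ N) (swap12 F) = (- 1) ^ N *\<^sub>C swap12 ((mult_z12 ^^ N) F)"
proof (induction N)
  case (Suc N)
  have "(mult_z12 ^^ Suc N) (swap12 F) = mult_z12 ((- 1) ^ N *\<^sub>C swap12 ((mult_z12 ^^ N) F))"
    by (simp only: funpow.simps o_apply Suc)
  also have "\<dots> = (- 1) ^ N *\<^sub>C mult_z12 (swap12 ((mult_z12 ^^ N) F))"
    by (rule clinear_scaleC [OF clinear_mult_z12])
  finally show ?case by (simp add: mult_z12_swap12)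
qed (simp add: fun_eq_iff)

lemma local_of_order_sym: "local_of_order N a b \<Longrightarrow> local_of_order N b a"
  unfolding local_of_order_iff
proof
  fix v
  assume *: "\<forall>v. (mult_z12 ^^ N) (ab_series a b v) = (mult_z12 ^^ N) (swap12 (ab_series b a v))"
  have "(mult_z12 ^^ N) (swap12 (ab_series a b v)) = (- 1) ^ N *\<^sub>C swap12 ((mult_z12 ^^ N) (ab_series a b v))"
    by (rule mult_z12_pow_swap12)
  also have "\<dots> = (- 1) ^ N *\<^sub>C swap12 ((mult_z12 ^^ N) (swap12 (ab_series b a v)))"
    using * by simp
  also have "\<dots> = (mult_z12 ^^ N) (swap12 (swap12 (ab_series b a v)))"
    by (rule mult_z12_pow_swap12 [symmetric])
  finally show "(mult_z12 ^^ N) (ab_series b a v) = (mult_z12 ^^ N) (swap12 (ab_series a b v))"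
    by (simp only: swap12_swap12)
qed

lemma local_of_order_mono:
  assumes "local_of_order N a b" "N \<le> M"
  shows "local_of_order M a b"
proof -
  obtain j where M: "M = j + N" using assms(2) by (metis le_add_diff_inverse2)
  show ?thesis
    using assms(1) unfolding local_of_order_iff M funpow_add o_apply by simp
qed

lemma mutually_local_sym: "mutually_local a b \<Longrightarrow> mutually_local b a"
  unfolding mutually_local_def using local_of_order_sym by blast

lemma supp_snd_ab: "supp_snd (ab_series a b v) \<subseteq> supp (b v)" if "a \<in> LFie"
  using clinear_0 [OF LFie_linear [OF that]]
  by (auto simp: supp_snd_def supp_def ab_series_def) metis

lemma low_in_supp_ab: "a \<in> LFie \<Longrightarrow> low_in T (supp (b v)) \<Longrightarrow> low_in T (supp_snd (ab_series a b v))"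
  by (erule low_in_subset) (rule supp_snd_ab)

lemma supp_fst_swap12: "supp_fst (swap12 F) = supp_snd F"
  by (auto simp: supp_fst_def supp_snd_def swap12_def)

text \<open>By itself $a(z_1)b(z_2)v$ is bounded below only in $z_2$. By locality
  $z_{12}^N a(z_1)b(z_2)v$ is also bounded below in $z_1$, since $z_{12}^N b(z_2)a(z_1)v$ is. Hence it can
  be restricted to the diagonal.\<close>

lemma local_supports:
  assumes "a \<in> LFie" "b \<in> LFie" "local_of_order N a b"
    and "low_in S (supp (a v))" "low_in T (supp (b v))"
  shows "low_in S (supp_fst ((mult_z12 ^^ N) (ab_series a b v)))"
    and "low_in T (supp_snd ((mult_z12 ^^ N) (ab_series a b v)))"
proof -
  show "low_in T (supp_snd ((mult_z12 ^^ N) (ab_series a b v)))"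
    by (intro low_in_supp_snd_z12 low_in_supp_ab assms)
  have "low_in S (supp_fst ((mult_z12 ^^ N) (swap12 (ab_series b a v))))"
    by (intro low_in_supp_fst_z12, unfold supp_fst_swap12) (intro low_in_supp_ab assms)
  then show "low_in S (supp_fst ((mult_z12 ^^ N) (ab_series a b v)))"
    using assms(3) by (simp add: local_of_order_iff)
qed

lemma local_nice2:
  assumes "a \<in> LFie" "b \<in> LFie" "local_of_order N a b"
  shows "nice2 ((mult_z12 ^^ N) (ab_series a b v))"
proof -
  obtain S where S: "finite S" "\<And>v. low_in S (supp (a v))" using LFie_classes [OF assms(1)] by blast
  obtain T where T: "finite T" "\<And>v. low_in T (supp (b v))" using LFie_classes [OF assms(2)] by blast
  show ?thesis
    using local_supports [OF assms S(2) T(2), of v] S(1) T(1)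
    by (intro low_nice2) (auto simp: low_def)
qed

lemma local_adm: "a \<in> LFie \<Longrightarrow> b \<in> LFie \<Longrightarrow> mutually_local a b \<Longrightarrow> adm (ab_series a b v)"
  unfolding mutually_local_def adm_def using local_nice2 by blast

lemma nth_product_eq:
  assumes "a \<in> LFie" "b \<in> LFie" "mutually_local a b"
  shows "nth_product a n b v = resprod n (ab_series a b v)"
proof -
  define N where "N = (LEAST N. local_of_order N a b)"
  have N: "local_of_order N a b"
    unfolding N_def using assms(3) unfolding mutually_local_def by (rule LeastI_ex)
  have "nth_product a n b v e k = taylor (int N - 1 - n) ((mult_z12 ^^ N) (ab_series a b v)) e k" for e k
    unfolding nth_product_def N_def [symmetric] nth_product_order_def z12_ab_eq D_z1_eq taylor_def
    by (simp add: Let_def)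
  then show ?thesis
    by (simp add: fun_eq_iff resprod_eq [OF local_nice2 [OF assms(1,2) N]])
qed

lemma nth_product_bound:
  assumes "a \<in> LFie" "b \<in> LFie" "local_of_order N a b" "int N \<le> n"
  shows "nth_product a n b = 0"
proof
  fix v
  have "mutually_local a b" using assms(3) by (auto simp: mutually_local_def)
  then show "nth_product a n b v = 0 v"
    using resprod_bound [OF local_nice2 [OF assms(1-3)] assms(4), of v]
    by (simp add: nth_product_eq assms)
qed

definition fin_logs :: "'w::zero lseries2 \<Rightarrow> bool"
  where "fin_logs F \<longleftrightarrow> (\<forall>e1 e2. finite {(k1, k2). F e1 k1 e2 k2 \<noteq> 0})"

lemma fin_logs_mult_z12: "fin_logs F \<Longrightarrow> fin_logs (mult_z12 F)"
  unfolding fin_logs_def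
proof safe
  fix e1 e2
  assume *: "\<forall>e1 e2. finite {(k1, k2). F e1 k1 e2 k2 \<noteq> 0}"
  show "finite {(k1, k2). mult_z12 F e1 k1 e2 k2 \<noteq> 0}"
    by (rule finite_subset [of _ "{(k1, k2). F (e1 - 1) k1 e2 k2 \<noteq> 0} \<union> {(k1, k2). F e1 k1 (e2 - 1) k2 \<noteq> 0}"])
      (use * in \<open>auto simp: mult_z12_def\<close>)
qed

lemma fin_logs_der: "fin_logs F \<Longrightarrow> fin_logs (der F)"
  unfolding fin_logs_def
proof safe
  fix e1 e2
  assume *: "\<forall>e1 e2. finite {(k1, k2). F e1 k1 e2 k2 \<noteq> 0}"
  have "finite ((\<lambda>(k1, k2). (k1 - 1, k2)) ` {(k1, k2). F (e1 + 1) k1 e2 k2 \<noteq> 0} \<union> {(k1, k2). F (e1 + 1) k1 e2 k2 \<noteq> 0})"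
    using * by blast
  then show "finite {(k1, k2). der F e1 k1 e2 k2 \<noteq> 0}"
  proof (rule rev_finite_subset, intro subsetI)
    fix x assume "x \<in> {(k1, k2). der F e1 k1 e2 k2 \<noteq> 0}"
    then obtain a b where x: "x = (a, b)" and d: "der F e1 a e2 b \<noteq> 0" by blast
    let ?S = "{(k1, k2). F (e1 + 1) k1 e2 k2 \<noteq> 0}"
    have "(a, b) \<in> (\<lambda>(k1, k2). (k1 - 1, k2)) ` ?S" if "(a, b) \<notin> ?S"
    proof -
      have "F (e1 + 1) (a + 1) e2 b \<noteq> 0" using d that by (auto simp: der_def)
      then show ?thesis by (intro image_eqI [of _ _ "(a + 1, b)"]) auto
    qed
    then show "x \<in> (\<lambda>(k1, k2). (k1 - 1, k2)) ` ?S \<union> ?S" using x by blast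
  qed
qed

lemma fin_logs_pow: "fin_logs F \<Longrightarrow> fin_logs ((mult_z12 ^^ n) F)"
  "fin_logs F \<Longrightarrow> fin_logs ((der ^^ n) F)"
  by (induction n) (simp_all add: fin_logs_mult_z12 fin_logs_der)

lemma fin_logs_diag:
  assumes "fin_logs F" "nice2 F"
  shows "finite {k. diag F e k \<noteq> 0}"
proof -
  have "{k. diag F e k \<noteq> 0} \<subseteq>
     (\<Union>e1\<in>{e1. \<exists>k1 k2. F e1 k1 (e - e1) k2 \<noteq> 0}. (\<lambda>(k1, k2). k1 + k2) ` {(k1, k2). F e1 k1 (e - e1) k2 \<noteq> 0})"
  proof (rule subsetI, clarify)
    fix k assume "diag F e k \<noteq> 0"
    then obtain k1 where k1: "k1 \<le> k" "Sum_any (\<lambda>e1. F e1 k1 (e - e1) (k - k1)) \<noteq> 0"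
      unfolding diag_def by (metis (no_types, lifting) atMost_iff sum.neutral)
    then obtain e1 where "F e1 k1 (e - e1) (k - k1) \<noteq> 0"
      by (elim Sum_any.not_neutral_obtains_not_neutral)
    then show "k \<in> (\<Union>e1\<in>{e1. \<exists>k1 k2. F e1 k1 (e - e1) k2 \<noteq> 0}. (\<lambda>(k1, k2). k1 + k2) ` {(k1, k2). F e1 k1 (e - e1) k2 \<noteq> 0})"
      using k1(1) by (intro UN_I [of e1] image_eqI [of _ _ "(k1, k - k1)"]) auto
  qed
  then show ?thesis
    by (rule finite_subset) (use assms in \<open>auto simp: fin_logs_def intro!: nice2D\<close>)
qed

lemma fin_logs_ab:
  assumes "a \<in> LFie" "b \<in> LFie"
  shows "fin_logs (ab_series a b v)"
  unfolding fin_logs_def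
proof safe
  fix e1 e2
  have "{(k1, k2). ab_series a b v e1 k1 e2 k2 \<noteq> 0} \<subseteq>
     prod.swap ` Sigma {k2. b v e2 k2 \<noteq> 0} (\<lambda>k2. {k1. a (b v e2 k2) e1 k1 \<noteq> 0})"
    using clinear_0 [OF LFie_linear [OF assms(1)]] by (force simp: ab_series_def)
  then show "finite {(k1, k2). ab_series a b v e1 k1 e2 k2 \<noteq> 0}"
    by (rule finite_subset) (intro finite_imageI finite_SigmaI LFie_finite assms)
qed

lemma supp_der: "e \<in> supp_fst ((der ^^ p) F) \<Longrightarrow> e + of_nat p \<in> supp_fst F"
proof (induction p arbitrary: e)
  case (Suc p)
  then obtain k1 e2 k2 where "der ((der ^^ p) F) e k1 e2 k2 \<noteq> 0" by (auto simp: supp_fst_def)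
  then have "(der ^^ p) F (e + 1) k1 e2 k2 \<noteq> 0 \<or> (der ^^ p) F (e + 1) (k1 + 1) e2 k2 \<noteq> 0"
    by (auto simp: der_def [of "(der ^^ p) F"])
  then have "e + 1 \<in> supp_fst ((der ^^ p) F)" unfolding supp_fst_def by blast
  then show ?case using Suc.IH by (force simp: algebra_simps)
qed simp

lemma supp_snd_der: "e \<in> supp_snd ((der ^^ p) F) \<Longrightarrow> e \<in> supp_snd F"
proof (induction p)
  case (Suc p)
  then obtain e1 k1 k2 where "der ((der ^^ p) F) e1 k1 e k2 \<noteq> 0" by (auto simp: supp_snd_def)
  then have "(der ^^ p) F (e1 + 1) k1 e k2 \<noteq> 0 \<or> (der ^^ p) F (e1 + 1) (k1 + 1) e k2 \<noteq> 0"
    by (auto simp: der_def [of "(der ^^ p) F"])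
  then have "e \<in> supp_snd ((der ^^ p) F)" unfolding supp_snd_def by blast
  then show ?case using Suc.IH by blast
qed simp

lemma taylor_support:
  assumes "low_in S (supp_fst F)" "low_in T (supp_snd F)"
  shows "low_in ((\<lambda>(x, y). x + y) ` (S \<times> T)) (supp (taylor p F))"
proof (cases "p < 0")
  case True
  then show ?thesis by (simp add: supp_def low_in_def)
next
  case False
  let ?G = "(der ^^ nat p) F"
  have 1: "low_in S (supp_fst ?G)"
    by (rule low_in_down [OF assms(1), of _ "nat p"]) (rule supp_der)
  have 2: "low_in T (supp_snd ?G)"
    by (rule low_in_subset [OF assms(2)]) (use supp_snd_der in blast)
  show ?thesis
  proof (rule low_in_subset [OF low_in_plus [OF 1 2]], rule subsetI)
    fix e assume "e \<in> supp (taylor p F)"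
    then obtain k where "diag ?G e k \<noteq> 0" using False by (auto simp: supp_def taylor_def)
    then obtain e1 k1 k2 where "?G e1 k1 (e - e1) k2 \<noteq> 0" by (rule diag_nonzero)
    then have "e1 \<in> supp_fst ?G" "e - e1 \<in> supp_snd ?G" unfolding supp_fst_def supp_snd_def by blast+
    then show "e \<in> {x + y | x y. x \<in> supp_fst ?G \<and> y \<in> supp_snd ?G}"
      by (intro CollectI exI [of _ e1] exI [of _ "e - e1"]) auto
  qed
qed

lemma ab_series_add:
  "a \<in> LFie \<Longrightarrow> b \<in> LFie \<Longrightarrow> ab_series a b (v + w) = ab_series a b v + ab_series a b w"
  by (simp add: fun_eq_iff ab_series_def clinear_add [OF LFie_linear])

lemma ab_series_scaleC:
  "a \<in> LFie \<Longrightarrow> b \<in> LFie \<Longrightarrow> ab_series a b (c *\<^sub>C v) = c *\<^sub>C ab_series a b v"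
  by (simp add: fun_eq_iff ab_series_def clinear_scaleC [OF LFie_linear])

text \<open>The classes of exponents of a product are sums of classes of the two factors, independently of the vector.\<close>

theorem nth_product_LFie:
  assumes "a \<in> LFie" "b \<in> LFie" "mutually_local a b"
  shows "nth_product a n b \<in> LFie"
proof -
  obtain S where S: "finite S" "\<And>v. low_in S (supp (a v))" using LFie_classes [OF assms(1)] by blast
  obtain T where T: "finite T" "\<And>v. low_in T (supp (b v))" using LFie_classes [OF assms(2)] by blast
  obtain N where N: "local_of_order N a b" using assms(3) by (auto simp: mutually_local_def)
  have eq: "nth_product a n b v = taylor (int N - 1 - n) ((mult_z12 ^^ N) (ab_series a b v))" for v
    by (simp add: nth_product_eq assms resprod_eq [OF local_nice2 [OF assms(1,2) N]])
  show ?thesis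
  proof (rule LFieI)
    show "finite ((\<lambda>(x, y). x + y) ` (S \<times> T))" using S T by simp
    show "low_in ((\<lambda>(x, y). x + y) ` (S \<times> T)) (supp (nth_product a n b v))" for v
      unfolding eq
      by (rule taylor_support [OF local_supports(1) [OF assms(1,2) N S(2) T(2)] local_supports(2) [OF assms(1,2) N S(2) T(2)]])
    show "clinear (\<lambda>v. nth_product a n b v e k)" for e k
      using local_adm [OF assms] by (intro clinearI)
        (simp_all add: nth_product_eq assms ab_series_add ab_series_scaleC resprod_add resprod_scaleC)
    show "finite {k. nth_product a n b v e k \<noteq> 0}" for v e
    proof (cases "int N - 1 - n < 0")
      case False
      have "finite {k. diag ((der ^^ nat (int N - 1 - n)) ((mult_z12 ^^ N) (ab_series a b v))) e k \<noteq> 0}"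
        by (intro fin_logs_diag fin_logs_pow fin_logs_ab nice2_der_pow local_nice2 assms N)
      then show ?thesis unfolding eq taylor_def using False by simp
    qed (simp add: eq)
  qed
qed

subsection \<open>Linearity of the products\<close>

lemma swap12_add: "swap12 (F + G) = swap12 F + swap12 G"
  by (simp add: fun_eq_iff swap12_def)

lemma swap12_scaleC: "swap12 (c *\<^sub>C F) = c *\<^sub>C swap12 F"
  by (simp add: fun_eq_iff swap12_def)

lemma ab_series_add_left: "ab_series (a + b) c v = ab_series a c v + ab_series b c v"
  by (simp add: fun_eq_iff ab_series_def)

lemma ab_series_add_right: "a \<in> LFie \<Longrightarrow> ab_series a (b + c) v = ab_series a b v + ab_series a c v"
  by (simp add: fun_eq_iff ab_series_def clinear_add [OF LFie_linear])

lemma ab_series_scaleC_left: "ab_series (d *\<^sub>C a) c v = d *\<^sub>C ab_series a c v"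
  by (simp add: fun_eq_iff ab_series_def)

lemma ab_series_scaleC_right: "a \<in> LFie \<Longrightarrow> ab_series a (d *\<^sub>C c) v = d *\<^sub>C ab_series a c v"
  by (simp add: fun_eq_iff ab_series_def clinear_scaleC [OF LFie_linear])

lemma local_add:
  assumes "a \<in> LFie" "mutually_local a b" "mutually_local a c"
  shows "mutually_local a (b + c)"
proof -
  obtain N M where "local_of_order N a b" "local_of_order M a c"
    using assms by (auto simp: mutually_local_def)
  then have "local_of_order (N + M) a b" "local_of_order (N + M) a c"
    using local_of_order_mono by (metis le_add1, metis le_add2)
  then have "local_of_order (N + M) a (b + c)"
    using assms(1) by (simp add: local_of_order_iff ab_series_add_left ab_series_add_right
        clinear_add [OF mult_z12_pow_linear] swap12_add)
  then show ?thesis by (auto simp: mutually_local_def)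
qed

lemma local_scaleC:
  assumes "a \<in> LFie" "mutually_local a b"
  shows "mutually_local a (c *\<^sub>C b)"
proof -
  obtain N where "local_of_order N a b"
    using assms by (auto simp: mutually_local_def)
  then have "local_of_order N a (c *\<^sub>C b)"
    using assms(1) by (simp add: local_of_order_iff ab_series_scaleC_left ab_series_scaleC_right
        clinear_scaleC [OF mult_z12_pow_linear] swap12_scaleC)
  then show ?thesis by (auto simp: mutually_local_def)
qed

lemma nth_product_add_right:
  assumes "a \<in> LFie" "b \<in> LFie" "c \<in> LFie" "mutually_local a b" "mutually_local a c"
  shows "nth_product a n (b + c) = nth_product a n b + nth_product a n c"
proof
  fix v
  show "nth_product a n (b + c) v = (nth_product a n b + nth_product a n c) v"
    using assms by (simp add: nth_product_eq LFie_add local_add ab_series_add_right resprod_add local_adm)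
qed

lemma nth_product_scaleC_right:
  assumes "a \<in> LFie" "b \<in> LFie" "mutually_local a b"
  shows "nth_product a n (c *\<^sub>C b) = c *\<^sub>C nth_product a n b"
proof
  fix v
  show "nth_product a n (c *\<^sub>C b) v = (c *\<^sub>C nth_product a n b) v"
    using assms by (simp add: nth_product_eq LFie_scaleC local_scaleC ab_series_scaleC_right resprod_scaleC local_adm)
qed

lemma nth_product_add_left:
  assumes "a \<in> LFie" "b \<in> LFie" "c \<in> LFie" "mutually_local a c" "mutually_local b c"
  shows "nth_product (a + b) n c = nth_product a n c + nth_product b n c"
proof
  fix v
  have "mutually_local (a + b) c"
    using local_add [of c a b] assms mutually_local_sym by blast
  then show "nth_product (a + b) n c v = (nth_product a n c + nth_product b n c) v"
    using assms by (simp add: nth_product_eq LFie_add ab_series_add_left resprod_add local_adm)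
qed

lemma nth_product_scaleC_left:
  assumes "a \<in> LFie" "b \<in> LFie" "mutually_local a b"
  shows "nth_product (c *\<^sub>C a) n b = c *\<^sub>C nth_product a n b"
proof
  fix v
  have "mutually_local (c *\<^sub>C a) b"
    using local_scaleC [of b a c] assms mutually_local_sym by blast
  then show "nth_product (c *\<^sub>C a) n b v = (c *\<^sub>C nth_product a n b) v"
    using assms by (simp add: nth_product_eq LFie_scaleC ab_series_scaleC_left resprod_scaleC local_adm)
qed

subsection \<open>The identity field\<close>

lemma id_field_LFie: "id_field \<in> LFie"
proof (rule LFieI [of _ "{0}"])
  show "finite {k. id_field v e k \<noteq> 0}" for v :: 'a and e
    by (rule finite_subset [of _ "{0}"]) (auto simp: id_field_def split: if_splits)
  show "low_in {0} (supp (id_field v))" for v :: 'a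
    unfolding low_in_def by (intro exI [of _ 0]) (auto simp: supp_def id_field_def split: if_splits)
qed (auto simp: clinear_iff id_field_def)

lemma local_id: "a \<in> LFie \<Longrightarrow> local_of_order 0 a id_field"
  by (simp add: local_of_order_iff fun_eq_iff ab_series_def swap12_def id_field_def clinear_0 [OF LFie_linear])

lemma id_mutually_local: "a \<in> LFie \<Longrightarrow> mutually_local a id_field"
  unfolding mutually_local_def using local_id by blast

lemma nth_product_id_right:
  assumes "a \<in> LFie"
  shows "nth_product a (- 1) id_field = a" and "0 \<le> n \<Longrightarrow> nth_product a n id_field = 0"
proof -
  show "nth_product a n id_field = 0" if "0 \<le> n"
    by (rule nth_product_bound [OF assms id_field_LFie local_id]) (use assms that in auto)
  show "nth_product a (- 1) id_field = a"
  proof (intro ext)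
    fix v e k
    have n: "nice2 (ab_series a id_field v)"
      using local_nice2 [OF assms id_field_LFie local_id [OF assms], of v] by simp
    have eq: "nth_product a (- 1) id_field v = diag (ab_series a id_field v)"
      by (simp add: nth_product_eq assms id_field_LFie id_mutually_local resprod_nice2 n)
    have "diag (ab_series a id_field v) e k = (\<Sum>k1\<le>k. Sum_any (\<lambda>e1. if e1 = e then (if k1 = k then a v e1 k1 else 0) else 0))"
      unfolding diag_def
      by (intro sum.cong refl, rule Sum_any.cong)
        (auto simp: ab_series_def id_field_def clinear_0 [OF LFie_linear [OF assms]])
    also have "\<dots> = a v e k" unfolding Sum_any.delta by simp
    finally show "nth_product a (- 1) id_field v e k = a v e k" unfolding eq .
  qed
qed

lemma nth_product_id_left:
  assumes "a \<in> LFie"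
  shows "nth_product id_field n a = (if n = - 1 then a else 0)"
proof (intro ext)
  fix v e k
  have loc: "local_of_order 0 id_field a" by (rule local_of_order_sym [OF local_id [OF assms]])
  then have ml: "mutually_local id_field a" by (auto simp: mutually_local_def)
  have n: "nice2 (ab_series id_field a v)"
    using local_nice2 [OF id_field_LFie assms loc, of v] by simp
  have d: "der (ab_series id_field a v) = 0"
    by (simp add: fun_eq_iff der_def ab_series_def id_field_def)
  have dp: "(der ^^ Suc p) (ab_series id_field a v) = 0" for p
    by (simp only: funpow_Suc_right o_apply d clinear_0 [OF der_pow_linear])
  have dg: "diag (ab_series id_field a v) e k = a v e k"
  proof -
    have "diag (ab_series id_field a v) e k = (\<Sum>k1\<le>k. Sum_any (\<lambda>e1. if e1 = 0 then (if k1 = 0 then a v (e - e1) (k - k1) else 0) else 0))"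
      unfolding diag_def
      by (intro sum.cong refl, rule Sum_any.cong) (auto simp: ab_series_def id_field_def)
    also have "\<dots> = a v e k" unfolding Sum_any.delta by simp
    finally show ?thesis .
  qed
  have eq: "nth_product id_field n a v = taylor (- 1 - n) (ab_series id_field a v)"
    by (simp add: nth_product_eq assms id_field_LFie ml resprod_nice2 n)
  have "taylor (- 1 - n) (ab_series id_field a v) e k = (if n = - 1 then a else 0) v e k"
  proof (cases "n < - 1")
    case True
    then obtain p where "nat (- 1 - n) = Suc p" by (metis Suc_pred' zero_less_nat_eq diff_gt_0_iff_gt)
    then show ?thesis using True dp by (simp add: taylor_def del: funpow.simps)
  qed (auto simp: dg)
  then show "nth_product id_field n a v e k = (if n = - 1 then a else 0) v e k" by (simp only: eq)
qed

section \<open>Three local fields\<close>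

text \<open>The series $a(z_1)b(z_2)c(z_3)v$ and its rearrangements $b(z_2)c(z_3)a(z_1)v$ and $a(z_1)c(z_3)b(z_2)v$,
  always with the variable of \<open>a\<close> first.\<close>

definition tri :: "'w::complex_vector lfield \<Rightarrow> 'w lfield \<Rightarrow> 'w lfield \<Rightarrow> 'w \<Rightarrow> 'w lseries2 lseries"
  where "tri a b c v e1 k1 e2 k2 e3 k3 = a (b (c v e3 k3) e2 k2) e1 k1"

definition tri_bca :: "'w::complex_vector lfield \<Rightarrow> 'w lfield \<Rightarrow> 'w lfield \<Rightarrow> 'w \<Rightarrow> 'w lseries2 lseries"
  where "tri_bca a b c v e1 k1 e2 k2 e3 k3 = b (c (a v e1 k1) e3 k3) e2 k2"

definition tri_acb :: "'w::complex_vector lfield \<Rightarrow> 'w lfield \<Rightarrow> 'w lfield \<Rightarrow> 'w \<Rightarrow> 'w lseries2 lseries"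
  where "tri_acb a b c v e1 k1 e2 k2 e3 k3 = a (c (b v e2 k2) e3 k3) e1 k1"

text \<open>Fixing the second variable, for the exchange of the first and the third.\<close>

definition mid :: "complex \<Rightarrow> nat \<Rightarrow> 'u lseries2 lseries \<Rightarrow> 'u lseries2"
  where "mid e2 k2 F e1 k1 e3 k3 = F e1 k1 e2 k2 e3 k3"

lemma tri_inner: "tri a b c v e1 k1 = map2 (\<lambda>w. a w e1 k1) (ab_series b c v)"
  by (simp add: fun_eq_iff tri_def map2_def ab_series_def)

lemma slice_tri: "slice e3 k3 (tri a b c v) = ab_series a b (c v e3 k3)"
  by (simp add: fun_eq_iff tri_def slice_def ab_series_def)

lemma slice_swap_tri: "slice e3 k3 (swap12 (tri b a c v)) = swap12 (ab_series b a (c v e3 k3))"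
  by (simp add: fun_eq_iff tri_def slice_def ab_series_def swap12_def)

lemma mid_swap_tri: "mid e2 k2 (swap12 (tri b a c v)) = map2 (\<lambda>w. b w e2 k2) (ab_series a c v)"
  by (simp add: fun_eq_iff tri_def mid_def ab_series_def swap12_def map2_def)

lemma mid_bca: "mid e2 k2 (tri_bca a b c v) = map2 (\<lambda>w. b w e2 k2) (swap12 (ab_series c a v))"
  by (simp add: fun_eq_iff tri_bca_def mid_def ab_series_def swap12_def map2_def)

lemma bca_inner: "tri_bca a b c v e1 k1 = ab_series b c (a v e1 k1)"
  by (simp add: fun_eq_iff tri_bca_def ab_series_def)

lemma acb_inner: "tri_acb a b c v e1 k1 = map2 (\<lambda>w. a w e1 k1) (swap12 (ab_series c b v))"
  by (simp add: fun_eq_iff tri_acb_def ab_series_def map2_def swap12_def)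

lemma slice_z12_pow: "slice e3 k3 ((mult_z12 ^^ N) F) = (mult_z12 ^^ N) (slice e3 k3 F)"
  by (induction N) (simp_all add: slice_z12)

lemma mid_z13: "mid e2 k2 (mult_z13 F) = mult_z12 (mid e2 k2 F)"
  by (simp add: fun_eq_iff mid_def mult_z13_def mult_z12_def)

lemma mid_z13_pow: "mid e2 k2 ((mult_z13 ^^ N) F) = (mult_z12 ^^ N) (mid e2 k2 F)"
  by (induction N) (simp_all add: mid_z13)

lemma z23_pow: "(mult_z23 ^^ N) F e k = (mult_z12 ^^ N) (F e k)"
  by (induction N) (simp_all add: mult_z23_def)

lemma slice_ext: "(\<And>e3 k3. slice e3 k3 F = slice e3 k3 G) \<Longrightarrow> F = G"
  by (simp add: fun_eq_iff slice_def)

lemma mid_ext: "(\<And>e2 k2. mid e2 k2 F = mid e2 k2 G) \<Longrightarrow> F = G"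
  by (simp add: fun_eq_iff mid_def)

lemma tri_exchange12:
  assumes "local_of_order N a b"
  shows "(mult_z12 ^^ N) (tri a b c v) = (mult_z12 ^^ N) (swap12 (tri b a c v))"
proof (rule slice_ext)
  fix e3 k3
  show "slice e3 k3 ((mult_z12 ^^ N) (tri a b c v)) = slice e3 k3 ((mult_z12 ^^ N) (swap12 (tri b a c v)))"
    using assms by (simp add: slice_z12_pow slice_tri slice_swap_tri local_of_order_iff)
qed

lemma tri_exchange13:
  assumes "local_of_order N a c" "b \<in> LFie"
  shows "(mult_z13 ^^ N) (swap12 (tri b a c v)) = (mult_z13 ^^ N) (tri_bca a b c v)"
proof (rule mid_ext)
  fix e2 k2
  show "mid e2 k2 ((mult_z13 ^^ N) (swap12 (tri b a c v))) = mid e2 k2 ((mult_z13 ^^ N) (tri_bca a b c v))"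
    using assms by (simp add: mid_z13_pow mid_swap_tri mid_bca local_of_order_iff mult_z12_pow_map2 LFie_linear)
qed

lemma tri_exchange23:
  assumes "local_of_order N b c" "a \<in> LFie"
  shows "(mult_z23 ^^ N) (tri a b c v) = (mult_z23 ^^ N) (tri_acb a b c v)"
proof (intro ext)
  fix e1 k1 e2 k2 e3 k3
  show "(mult_z23 ^^ N) (tri a b c v) e1 k1 e2 k2 e3 k3 = (mult_z23 ^^ N) (tri_acb a b c v) e1 k1 e2 k2 e3 k3"
    using assms by (simp add: z23_pow tri_inner acb_inner local_of_order_iff mult_z12_pow_map2 LFie_linear)
qed

text \<open>Moving \<open>a\<close> to the right past \<open>b\<close> and \<open>c\<close> costs a power of $z_{12}z_{13}$.\<close>

lemma tri_exchange_bca: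
  assumes "local_of_order N a b" "local_of_order N a c" "b \<in> LFie"
  shows "(mult_z12 ^^ N) ((mult_z13 ^^ N) (tri a b c v)) = (mult_z12 ^^ N) ((mult_z13 ^^ N) (tri_bca a b c v))"
proof -
  have "(mult_z12 ^^ N) ((mult_z13 ^^ N) (tri a b c v)) = (mult_z13 ^^ N) ((mult_z12 ^^ N) (tri a b c v))"
    by (rule z12_z13_pow)
  also have "\<dots> = (mult_z13 ^^ N) ((mult_z12 ^^ N) (swap12 (tri b a c v)))"
    by (simp only: tri_exchange12 [OF assms(1)])
  also have "\<dots> = (mult_z12 ^^ N) ((mult_z13 ^^ N) (swap12 (tri b a c v)))"
    by (rule z12_z13_pow [symmetric])
  also have "\<dots> = (mult_z12 ^^ N) ((mult_z13 ^^ N) (tri_bca a b c v))"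
    by (simp only: tri_exchange13 [OF assms(2,3)])
  finally show ?thesis .
qed

subsection \<open>Dong's lemma\<close>

text \<open>Multiplication by $z_{12}$ before taking the product of $z_2$ and $z_3$ acts on a family of
  products \<open>V\<close> by \<open>shift_diff z V\<close>, where \<open>z\<close> is multiplication by the remaining difference of variables.\<close>

definition shift_diff :: "('x \<Rightarrow> 'x) \<Rightarrow> (int \<Rightarrow> 'x::ab_group_add) \<Rightarrow> int \<Rightarrow> 'x"
  where "shift_diff z V n = z (V n) - V (n + 1)"

text \<open>If $(z - E)^N V = 0$ for the shift $E$ and \<open>V n = 0\<close> for large \<open>n\<close>, then each \<open>V n\<close> is killed by a power
  of \<open>z\<close>. The power grows as \<open>n\<close> decreases.\<close>

lemma shift_diff_nilpotent:
  fixes z :: "'x::ab_group_add \<Rightarrow> 'x"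
  assumes z: "\<And>x y. z (x - y) = z x - z y"
    and "\<And>n. (shift_diff z ^^ N) V n = 0" "\<And>n. n0 \<le> n \<Longrightarrow> V n = 0"
  shows "\<exists>M. (z ^^ M) (V n) = 0"
  using assms(2,3)
proof (induction N arbitrary: V n)
  case 0
  then show ?case by (intro exI [of _ 0]) simp
next
  case (Suc N)
  have zpow: "(z ^^ j) (x - y) = (z ^^ j) x - (z ^^ j) y" for j x y
    by (induction j) (simp_all add: z)
  have z0: "(z ^^ j) 0 = 0" for j
    using zpow [of j 0 0] by simp
  have 1: "\<exists>M. (z ^^ M) (shift_diff z V n) = 0" for n
  proof (rule Suc.IH)
    show "(shift_diff z ^^ N) (shift_diff z V) n = 0" for n
      using Suc.prems(1) [of n] by (simp add: funpow_swap1)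
    show "shift_diff z V n = 0" if "n0 \<le> n" for n
      using Suc.prems(2) [of n] Suc.prems(2) [of "n + 1"] that z0 [of 1] by (simp add: shift_diff_def)
  qed
  show ?case
  proof (cases "n0 \<le> n")
    case True
    then show ?thesis using Suc.prems(2) by (intro exI [of _ 0]) simp
  next
    case False
    then have "n \<le> n0" by simp
    then show ?thesis
    proof (induction n rule: int_le_induct)
      case base
      then show ?case using Suc.prems(2) by (intro exI [of _ 0]) simp
    next
      case (step i)
      obtain M2 where M2: "(z ^^ M2) (V i) = 0" using step.IH by blast
      obtain M1 where "(z ^^ M1) (shift_diff z V (i - 1)) = 0" using 1 by blast
      then have M1: "(z ^^ M1) (z (V (i - 1))) = (z ^^ M1) (V i)"
        by (simp add: shift_diff_def zpow)
      have "(z ^^ (M2 + M1 + 1)) (V (i - 1)) = (z ^^ M2) ((z ^^ M1) (z (V (i - 1))))"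
        by (simp only: funpow_add o_apply) simp
      also have "\<dots> = (z ^^ M2) ((z ^^ M1) (V i))" by (simp only: M1)
      also have "\<dots> = (z ^^ M1) ((z ^^ M2) (V i))" by (rule funpow_commute) (rule refl)
      also have "\<dots> = 0" by (simp only: M2 z0)
      finally show ?case by blast
    qed
  qed
qed

lemma res_inner_z12_pow:
  assumes "\<And>e k. adm (F e k)"
  shows "res_inner n ((mult_z12 ^^ N) F) = (shift_diff mult_z12 ^^ N) (\<lambda>n. res_inner n F) n"
proof -
  have adm: "adm ((mult_z12 ^^ N) F e k)" for N e k
    using assms by (induction N arbitrary: e k) (simp_all add: adm_z12_pointwise)
  show ?thesis
    by (induction N arbitrary: n) (simp_all add: res_inner_z12 adm shift_diff_def)
qed

lemma res_inner_z13_pow: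
  assumes "\<And>e k. adm (F e k)"
  shows "res_inner n ((mult_z13 ^^ N) F) = (mult_z12 ^^ N) (res_inner n F) \<and> (\<forall>e k. adm ((mult_z13 ^^ N) F e k))"
  using assms by (induction N) (simp_all add: adm_z13_pointwise res_inner_z13)

lemma adm_tri: "a \<in> LFie \<Longrightarrow> b \<in> LFie \<Longrightarrow> c \<in> LFie \<Longrightarrow> mutually_local b c \<Longrightarrow> adm (tri a b c v e k)"
  by (simp add: tri_inner adm_map2 LFie_linear local_adm)

lemma res_inner_tri:
  assumes "a \<in> LFie" "b \<in> LFie" "c \<in> LFie" "mutually_local b c"
  shows "res_inner n (tri a b c v) = ab_series a (nth_product b n c) v"
  using assms by (simp add: fun_eq_iff res_inner_def tri_inner resprod_map2 LFie_linear local_adm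
      ab_series_def nth_product_eq)

lemma local_of_order_common:
  assumes "mutually_local a b" "mutually_local a c" "mutually_local b c"
  obtains N where "local_of_order N a b" "local_of_order N a c" "local_of_order N b c"
proof -
  obtain N1 N2 N3 where N: "local_of_order N1 a b" "local_of_order N2 a c" "local_of_order N3 b c"
    using assms by (auto simp: mutually_local_def)
  show ?thesis
    by (rule that [of "N1 + N2 + N3"])
      (rule local_of_order_mono [OF N(1)], simp, rule local_of_order_mono [OF N(2)], simp,
       rule local_of_order_mono [OF N(3)], simp)
qed

text \<open>Put $U_n = a(z_1)(b_{(n)}c)(z_2)v$ and let $U'_n$ be the product in the opposite order. Exchanging \<open>a\<close> with
  \<open>b\<close> and \<open>c\<close> shows that $(z_{12} - E)^N z_{12}^N(U_n - U'_n) = 0$ for the shift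
  $E$ of \<open>n\<close>, and $b_{(n)}c = 0$ for large \<open>n\<close>; now apply \<open>shift_diff_nilpotent\<close>.\<close>

theorem Dong:
  assumes F: "a \<in> LFie" "b \<in> LFie" "c \<in> LFie"
    and loc: "mutually_local a b" "mutually_local a c" "mutually_local b c"
  shows "mutually_local a (nth_product b n c)"
proof -
  obtain N where N: "local_of_order N a b" "local_of_order N a c" "local_of_order N b c"
    using loc by (rule local_of_order_common)
(* The power of z12 must not depend on v, so the argument is carried out for functions of v. *)
  define Z where "Z = (\<lambda>(G :: 'a \<Rightarrow> 'a lseries2) v. mult_z12 (G v))"
  define U where "U n v = ab_series a (nth_product b n c) v" for n v
  define U' where "U' n v = swap12 (ab_series (nth_product b n c) a v)" for n v
  define V where "V n v = (mult_z12 ^^ N) (U n v) - (mult_z12 ^^ N) (U' n v)" for n v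
  have Zdiff: "Z (x - y) = Z x - Z y" for x y
    by (simp add: Z_def fun_eq_iff clinear_diff [OF clinear_mult_z12])
  have Zpow: "(Z ^^ M) G v = (mult_z12 ^^ M) (G v)" for M G v
    by (induction M) (simp_all add: Z_def)
  have bca: "res_inner n (tri_bca a b c v) = U' n v" for n v
    using F loc by (simp add: fun_eq_iff res_inner_def bca_inner U'_def swap12_def ab_series_def nth_product_eq)
  have adm_bca: "adm (tri_bca a b c v e k)" for v e k
    using F loc by (simp add: bca_inner local_adm)
  have pow_eq: "(shift_diff mult_z12 ^^ N) (\<lambda>n. (mult_z12 ^^ N) (U n v)) n =
     (shift_diff mult_z12 ^^ N) (\<lambda>n. (mult_z12 ^^ N) (U' n v)) n" for n v
  proof -
    have adm1: "adm ((mult_z13 ^^ N) (tri a b c v) e k)" for e k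
      using res_inner_z13_pow [of "tri a b c v" _ N] adm_tri [OF F loc(3)] by blast
    have adm2: "adm ((mult_z13 ^^ N) (tri_bca a b c v) e k)" for e k
      using res_inner_z13_pow [of "tri_bca a b c v" _ N] adm_bca by blast
    have "(\<lambda>n. (mult_z12 ^^ N) (U n v)) = (\<lambda>n. res_inner n ((mult_z13 ^^ N) (tri a b c v)))"
      using res_inner_z13_pow [of "tri a b c v" _ N] adm_tri [OF F loc(3)]
      by (intro ext) (simp add: U_def res_inner_tri [OF F loc(3)])
    then have "(shift_diff mult_z12 ^^ N) (\<lambda>n. (mult_z12 ^^ N) (U n v)) n =
        res_inner n ((mult_z12 ^^ N) ((mult_z13 ^^ N) (tri a b c v)))"
      by (simp only: res_inner_z12_pow [OF adm1])
    also have "\<dots> = res_inner n ((mult_z12 ^^ N) ((mult_z13 ^^ N) (tri_bca a b c v)))"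
      by (simp only: tri_exchange_bca [OF N(1,2) F(2)])
    also have "\<dots> = (shift_diff mult_z12 ^^ N) (\<lambda>n. res_inner n ((mult_z13 ^^ N) (tri_bca a b c v))) n"
      by (rule res_inner_z12_pow [OF adm2])
    also have "(\<lambda>n. res_inner n ((mult_z13 ^^ N) (tri_bca a b c v))) = (\<lambda>n. (mult_z12 ^^ N) (U' n v))"
      using res_inner_z13_pow [of "tri_bca a b c v" _ N] adm_bca
      by (intro ext) (simp add: bca)
    finally show ?thesis .
  qed
  have sd_diff: "(shift_diff mult_z12 ^^ M) (\<lambda>n. X n - Y n) n =
     (shift_diff mult_z12 ^^ M) X n - (shift_diff mult_z12 ^^ M) Y n" for M n and X Y :: "int \<Rightarrow> 'a lseries2"
    by (induction M arbitrary: n) (simp_all add: shift_diff_def clinear_diff [OF clinear_mult_z12])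
  have sd_Z: "(shift_diff Z ^^ M) W n v = (shift_diff mult_z12 ^^ M) (\<lambda>n. W n v) n" for M W n v
    by (induction M arbitrary: n) (simp_all add: shift_diff_def Z_def)
  have 1: "(shift_diff Z ^^ N) V n = 0" for n
  proof
    fix v
    show "(shift_diff Z ^^ N) V n v = 0 v"
      unfolding sd_Z V_def sd_diff by (simp add: pow_eq)
  qed
  have 2: "V n = 0" if "int N \<le> n" for n
  proof -
    have "nth_product b n c = 0" by (rule nth_product_bound [OF F(2,3) N(3) that])
    then have 0: "U n v = 0" "U' n v = 0" for v
      by (simp_all add: fun_eq_iff U_def U'_def ab_series_def swap12_def clinear_0 [OF LFie_linear [OF F(1)]])
    show ?thesis by (rule ext) (simp add: V_def 0)
  qed
  obtain M where M: "(Z ^^ M) (V n) = 0"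
    using shift_diff_nilpotent [where z = Z, OF Zdiff 1 2] by blast
  have "(mult_z12 ^^ (M + N)) (U n v) = (mult_z12 ^^ (M + N)) (U' n v)" for v
  proof -
    have "(mult_z12 ^^ M) (V n v) = 0" using M Zpow [of M "V n" v] by simp
    then show ?thesis
      by (simp add: V_def clinear_diff [OF mult_z12_pow_linear] mult_z12_pow_pow)
  qed
  then have "local_of_order (M + N) a (nth_product b n c)"
    by (simp add: local_of_order_iff U_def U'_def)
  then show ?thesis by (auto simp: mutually_local_def)
qed

subsection \<open>Supports in three variables\<close>

definition supp3_1 :: "'w::zero lseries2 lseries \<Rightarrow> complex set"
  where "supp3_1 F = {e1. \<exists>k1 e2 k2 e3 k3. F e1 k1 e2 k2 e3 k3 \<noteq> 0}"

definition supp3_2 :: "'w::zero lseries2 lseries \<Rightarrow> complex set"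
  where "supp3_2 F = {e2. \<exists>e1 k1 k2 e3 k3. F e1 k1 e2 k2 e3 k3 \<noteq> 0}"

definition supp3_3 :: "'w::zero lseries2 lseries \<Rightarrow> complex set"
  where "supp3_3 F = {e3. \<exists>e1 k1 e2 k2 k3. F e1 k1 e2 k2 e3 k3 \<noteq> 0}"

lemma supp3I:
  assumes "F e1 k1 e2 k2 e3 k3 \<noteq> 0"
  shows "e1 \<in> supp3_1 F" "e2 \<in> supp3_2 F" "e3 \<in> supp3_3 F"
  using assms unfolding supp3_1_def supp3_2_def supp3_3_def by blast+

lemma z12_nonzero3: "mult_z12 F e1 k1 e2 k2 e3 k3 \<noteq> 0 \<Longrightarrow>
    F (e1 - 1) k1 e2 k2 e3 k3 \<noteq> 0 \<or> F e1 k1 (e2 - 1) k2 e3 (k3::nat) \<noteq> 0"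
  by (auto simp: mult_z12_def)

lemma z13_nonzero3: "mult_z13 F e1 k1 e2 k2 e3 k3 \<noteq> 0 \<Longrightarrow>
    F (e1 - 1) k1 e2 k2 e3 k3 \<noteq> 0 \<or> F e1 k1 e2 k2 (e3 - 1) k3 \<noteq> 0"
  by (auto simp: mult_z13_def)

lemma z23_nonzero3: "mult_z23 F e1 k1 e2 k2 e3 k3 \<noteq> 0 \<Longrightarrow>
    F e1 k1 (e2 - 1) k2 e3 k3 \<noteq> 0 \<or> F e1 k1 e2 k2 (e3 - 1) k3 \<noteq> 0"
  by (auto simp: mult_z23_def mult_z12_def)

lemma low3_step:
  assumes "low (supp3_1 F)"
  shows "low (supp3_1 (mult_z12 F))" "low (supp3_1 (mult_z13 F))" "low (supp3_1 (mult_z23 F))"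
proof -
  show "low (supp3_1 (mult_z12 F))"
  proof (rule low_up_Un [OF assms])
    fix t assume "t \<in> supp3_1 (mult_z12 F)"
    then show "t \<in> supp3_1 F \<or> t - 1 \<in> supp3_1 F"
      unfolding supp3_1_def [of "mult_z12 F"] by (auto dest!: z12_nonzero3 dest: supp3I)
  qed
  show "low (supp3_1 (mult_z13 F))"
  proof (rule low_up_Un [OF assms])
    fix t assume "t \<in> supp3_1 (mult_z13 F)"
    then show "t \<in> supp3_1 F \<or> t - 1 \<in> supp3_1 F"
      unfolding supp3_1_def [of "mult_z13 F"] by (auto dest!: z13_nonzero3 dest: supp3I)
  qed
  show "low (supp3_1 (mult_z23 F))"
  proof (rule low_up_Un [OF assms])
    fix t assume "t \<in> supp3_1 (mult_z23 F)"
    then show "t \<in> supp3_1 F \<or> t - 1 \<in> supp3_1 F"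
      unfolding supp3_1_def [of "mult_z23 F"] by (auto dest!: z23_nonzero3 dest: supp3I)
  qed
qed

lemma low3_step2:
  assumes "low (supp3_2 F)"
  shows "low (supp3_2 (mult_z12 F))" "low (supp3_2 (mult_z13 F))" "low (supp3_2 (mult_z23 F))"
proof -
  show "low (supp3_2 (mult_z12 F))"
  proof (rule low_up_Un [OF assms])
    fix t assume "t \<in> supp3_2 (mult_z12 F)"
    then show "t \<in> supp3_2 F \<or> t - 1 \<in> supp3_2 F"
      unfolding supp3_2_def [of "mult_z12 F"] by (auto dest!: z12_nonzero3 dest: supp3I)
  qed
  show "low (supp3_2 (mult_z13 F))"
  proof (rule low_up_Un [OF assms])
    fix t assume "t \<in> supp3_2 (mult_z13 F)"
    then show "t \<in> supp3_2 F \<or> t - 1 \<in> supp3_2 F"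
      unfolding supp3_2_def [of "mult_z13 F"] by (auto dest!: z13_nonzero3 dest: supp3I)
  qed
  show "low (supp3_2 (mult_z23 F))"
  proof (rule low_up_Un [OF assms])
    fix t assume "t \<in> supp3_2 (mult_z23 F)"
    then show "t \<in> supp3_2 F \<or> t - 1 \<in> supp3_2 F"
      unfolding supp3_2_def [of "mult_z23 F"] by (auto dest!: z23_nonzero3 dest: supp3I)
  qed
qed

lemma low3_step3:
  assumes "low (supp3_3 F)"
  shows "low (supp3_3 (mult_z12 F))" "low (supp3_3 (mult_z13 F))" "low (supp3_3 (mult_z23 F))"
proof -
  show "low (supp3_3 (mult_z12 F))"
  proof (rule low_up_Un [OF assms])
    fix t assume "t \<in> supp3_3 (mult_z12 F)"
    then show "t \<in> supp3_3 F \<or> t - 1 \<in> supp3_3 F"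
      unfolding supp3_3_def [of "mult_z12 F"] by (auto dest!: z12_nonzero3 dest: supp3I)
  qed
  show "low (supp3_3 (mult_z13 F))"
  proof (rule low_up_Un [OF assms])
    fix t assume "t \<in> supp3_3 (mult_z13 F)"
    then show "t \<in> supp3_3 F \<or> t - 1 \<in> supp3_3 F"
      unfolding supp3_3_def [of "mult_z13 F"] by (auto dest!: z13_nonzero3 dest: supp3I)
  qed
  show "low (supp3_3 (mult_z23 F))"
  proof (rule low_up_Un [OF assms])
    fix t assume "t \<in> supp3_3 (mult_z23 F)"
    then show "t \<in> supp3_3 F \<or> t - 1 \<in> supp3_3 F"
      unfolding supp3_3_def [of "mult_z23 F"] by (auto dest!: z23_nonzero3 dest: supp3I)
  qed
qed

lemma low3_pow:
  "low (supp3_1 F) \<Longrightarrow> low (supp3_1 ((mult_z12 ^^ N) F))"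
  "low (supp3_1 F) \<Longrightarrow> low (supp3_1 ((mult_z13 ^^ N) F))"
  "low (supp3_1 F) \<Longrightarrow> low (supp3_1 ((mult_z23 ^^ N) F))"
  "low (supp3_2 F) \<Longrightarrow> low (supp3_2 ((mult_z12 ^^ N) F))"
  "low (supp3_2 F) \<Longrightarrow> low (supp3_2 ((mult_z13 ^^ N) F))"
  "low (supp3_2 F) \<Longrightarrow> low (supp3_2 ((mult_z23 ^^ N) F))"
  "low (supp3_3 F) \<Longrightarrow> low (supp3_3 ((mult_z12 ^^ N) F))"
  "low (supp3_3 F) \<Longrightarrow> low (supp3_3 ((mult_z13 ^^ N) F))"
  "low (supp3_3 F) \<Longrightarrow> low (supp3_3 ((mult_z23 ^^ N) F))"
  by (induction N) (simp_all add: low3_step low3_step2 low3_step3)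

lemma low_nice3:
  assumes "low (supp3_1 F)" "low (supp3_2 F)" "low (supp3_3 F)"
  shows "nice3 F"
  unfolding nice3_def
proof
  fix e
  show "finite {(e1, e2). \<exists>k1 k2 k3. F e1 k1 e2 k2 (e - e1 - e2) k3 \<noteq> 0}"
    by (rule finite_subset [OF _ low_finite3 [OF assms, of e]]) (auto dest: supp3I)
qed

text \<open>Three orderings of the fields bound the exponents of one variable each: the variable of the
  field that is applied first. After multiplication by the differences all orderings agree.\<close>

lemma nice3_tri:
  assumes F: "a \<in> LFie" "b \<in> LFie" "c \<in> LFie"
    and N: "local_of_order N a b" "local_of_order N a c" "local_of_order N b c"
  shows "nice3 (mult_all N (tri a b c v))"
proof (rule low_nice3)
  have z: "a 0 e k = 0" "b 0 e k = 0" "c 0 e k = 0" for e k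
    using F clinear_0 [OF LFie_linear] by blast+
  have "supp3_3 (tri a b c v) \<subseteq> supp (c v)"
    unfolding supp3_3_def supp_def tri_def using z by (auto, metis)
  then have "low (supp3_3 (tri a b c v))" using low_subset LFie_low F by blast
  then show "low (supp3_3 (mult_all N (tri a b c v)))"
    unfolding mult_all_def by (intro low3_pow)
  have "supp3_2 (tri_acb a b c v) \<subseteq> supp (b v)"
    unfolding supp3_2_def supp_def tri_acb_def using z by (auto, metis)
  then have "low (supp3_2 (tri_acb a b c v))" using low_subset LFie_low F by blast
  then show "low (supp3_2 (mult_all N (tri a b c v)))"
    unfolding mult_all_def tri_exchange23 [OF N(3) F(1)] by (intro low3_pow)
  have "supp3_1 (tri_bca a b c v) \<subseteq> supp (a v)"
    unfolding supp3_1_def supp_def tri_bca_def using z by (auto, metis)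
  then have bca: "low (supp3_1 (tri_bca a b c v))" using low_subset LFie_low F by blast
  have "mult_all N (tri a b c v) = (mult_z23 ^^ N) ((mult_z12 ^^ N) ((mult_z13 ^^ N) (tri a b c v)))"
    unfolding mult_all_def by (simp only: z13_z23_pow z12_z23_pow)
  then show "low (supp3_1 (mult_all N (tri a b c v)))"
    unfolding tri_exchange_bca [OF N(1,2) F(2)] using bca by (simp add: low3_pow)
qed

lemma mult_z13_swap12: "mult_z13 (swap12 F) = swap12 (mult_z23 F)"
  by (simp add: fun_eq_iff mult_z13_def swap12_def mult_z23_def mult_z12_def)

lemma mult_z23_swap12: "mult_z23 (swap12 F) = swap12 (mult_z13 F)"
  by (simp add: fun_eq_iff mult_z13_def swap12_def mult_z23_def mult_z12_def)

lemma mult_all_swap12: "mult_all N (swap12 F) = (- 1) ^ N *\<^sub>C swap12 (mult_all N F)"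
proof -
  have 1: "(mult_z23 ^^ N) (swap12 F) = swap12 ((mult_z13 ^^ N) F)" for F :: "'a lseries2 lseries"
    by (induction N) (simp_all add: mult_z23_swap12)
  have 2: "(mult_z13 ^^ N) (swap12 F) = swap12 ((mult_z23 ^^ N) F)" for F :: "'a lseries2 lseries"
    by (induction N) (simp_all add: mult_z13_swap12)
  show ?thesis
    unfolding mult_all_def 1 2 mult_z12_pow_swap12 z13_z23_pow ..
qed

lemma mult_all_tri_swap:
  assumes "local_of_order N a b"
  shows "mult_all N (tri b a c v) = (- 1) ^ N *\<^sub>C swap12 (mult_all N (tri a b c v))"
proof -
  have *: "mult_all N F = (mult_z13 ^^ N) ((mult_z23 ^^ N) ((mult_z12 ^^ N) F))" for F :: "'a lseries2 lseries"
    unfolding mult_all_def by (simp only: z12_z13_pow z12_z23_pow)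
  have "mult_all N (tri b a c v) = mult_all N (swap12 (swap12 (tri b a c v)))" by simp
  also have "\<dots> = (- 1) ^ N *\<^sub>C swap12 (mult_all N (swap12 (tri b a c v)))"
    by (rule mult_all_swap12)
  also have "mult_all N (swap12 (tri b a c v)) = mult_all N (tri a b c v)"
    unfolding * tri_exchange12 [OF assms] ..
  finally show ?thesis .
qed

subsection \<open>The iterate and commutator formulas for fields\<close>

lemma adm_inner_tri:
  assumes F: "a \<in> LFie" "b \<in> LFie" "c \<in> LFie"
    and loc: "mutually_local a b" "mutually_local a c" "mutually_local b c"
  shows "adm_inner (tri a b c v)"
    and "prod_inner (tri a b c v) m n = nth_product a m (nth_product b n c) v"
proof -
  have bc: "nth_product b n c \<in> LFie" "mutually_local a (nth_product b n c)" for n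
    using nth_product_LFie [OF F(2,3) loc(3)] Dong [OF F loc] by auto
  show "adm_inner (tri a b c v)"
    unfolding adm_inner_def
    using adm_tri [OF F loc(3)] by (simp add: res_inner_tri F loc local_adm bc)
  show "prod_inner (tri a b c v) m n = nth_product a m (nth_product b n c) v"
    by (simp add: prod_inner_def res_inner_tri F loc nth_product_eq [OF F(1) bc])
qed

lemma adm_outer_tri:
  assumes F: "a \<in> LFie" "b \<in> LFie" "c \<in> LFie"
    and loc: "mutually_local a b" "mutually_local a c" "mutually_local b c"
  shows "adm_outer (tri a b c v)"
    and "prod_outer (tri a b c v) n k = nth_product (nth_product a n b) k c v"
proof -
  have ab: "nth_product a n b \<in> LFie" "mutually_local (nth_product a n b) c" for n
  proof -
    show "nth_product a n b \<in> LFie" by (rule nth_product_LFie [OF F(1,2) loc(1)])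
    have "mutually_local c (nth_product a n b)"
      by (rule Dong [OF F(3,1,2)]) (use loc mutually_local_sym in blast)+
    then show "mutually_local (nth_product a n b) c" by (rule mutually_local_sym)
  qed
  have res: "res_outer n (tri a b c v) = ab_series (nth_product a n b) c v" for n
    using F loc by (simp add: fun_eq_iff res_outer_def slice_tri ab_series_def [of "nth_product a n b"] nth_product_eq)
  show "adm_outer (tri a b c v)"
    unfolding adm_outer_def
    using F loc by (simp add: slice_tri local_adm res ab)
  show "prod_outer (tri a b c v) n k = nth_product (nth_product a n b) k c v"
    by (simp add: prod_outer_def res nth_product_eq [OF ab(1) F(3) ab(2)])
qed

lemma nth_product_0_left: "b \<in> LFie \<Longrightarrow> nth_product 0 n b = 0"
  using nth_product_scaleC_left [of 0 b 0 n] LFie_0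
    local_of_order_iff [of 0 "0 :: 'a lfield" b] clinear_0 [OF LFie_linear, of b]
  by (auto simp: mutually_local_def fun_eq_iff ab_series_def swap12_def)

lemma nth_product_0_right: "a \<in> LFie \<Longrightarrow> nth_product a n 0 = 0"
  using nth_product_scaleC_right [of a 0 n 0] LFie_0
    local_of_order_iff [of 0 a "0 :: 'a lfield"] clinear_0 [OF LFie_linear, of a]
  by (auto simp: mutually_local_def fun_eq_iff ab_series_def swap12_def)

lemma bounded_snd_nested:
  assumes "a \<in> LFie" "b \<in> LFie" "c \<in> LFie" "mutually_local b c"
  shows "bounded_snd (\<lambda>m n. nth_product a m (nth_product b n c))"
proof -
  obtain N where "local_of_order N b c" using assms by (auto simp: mutually_local_def)
  then have "nth_product b n c = 0" if "int N \<le> n" for n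
    using nth_product_bound [OF assms(2,3)] that by blast
  then show ?thesis
    unfolding bounded_snd_def by (intro exI [of _ "int N"]) (simp add: nth_product_0_right assms)
qed

lemma iter_apply:
  assumes "bounded_snd P" "bounded_fst Q"
  shows "iter P Q n k v = iter (\<lambda>m n. P m n v) (\<lambda>m n. Q m n v) n k"
proof -
  obtain n0 where n0: "\<And>m n. n0 \<le> n \<Longrightarrow> P m n = 0" using assms(1) by (auto simp: bounded_snd_def)
  obtain m0 where m0: "\<And>m n. m0 \<le> m \<Longrightarrow> Q m n = 0" using assms(2) by (auto simp: bounded_fst_def)
  have "iter_left P n k v = iter_left (\<lambda>m n. P m n v) n k"
    using iter_left_sum [of n0 P k "nat (n0 - k)" n] iter_left_sum [of n0 "\<lambda>m n. P m n v" k "nat (n0 - k)" n] n0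
    by (simp add: sum_fun_apply)
  moreover have "iter_right Q n k v = iter_right (\<lambda>m n. Q m n v) n k"
    using iter_right_sum [of m0 Q "nat m0" n k] iter_right_sum [of m0 "\<lambda>m n. Q m n v" "nat m0" n k] m0
    by (simp add: sum_fun_apply)
  ultimately show ?thesis by (simp add: iter_def)
qed

lemma bounded_apply: "bounded_snd P \<Longrightarrow> bounded_snd (\<lambda>m n. P m n v)"
  "bounded_fst Q \<Longrightarrow> bounded_fst (\<lambda>m n. Q m n v)"
  by (auto simp: bounded_snd_def bounded_fst_def fun_eq_iff)

context
  fixes a b c :: "'w::complex_vector lfield"
  assumes F: "a \<in> LFie" "b \<in> LFie" "c \<in> LFie"
    and loc: "mutually_local a b" "mutually_local a c" "mutually_local b c"
begin

lemma bounded_nested_fields: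
  "bounded_snd (\<lambda>m n. nth_product a m (nth_product b n c))"
  "bounded_fst (\<lambda>m n. nth_product b n (nth_product a m c))"
proof -
  show "bounded_snd (\<lambda>m n. nth_product a m (nth_product b n c))"
    by (rule bounded_snd_nested [OF F loc(3)])
  obtain n0 where "\<And>m n. n0 \<le> n \<Longrightarrow> nth_product b m (nth_product a n c) = 0"
    using bounded_snd_nested [OF F(2,1,3) loc(2)] unfolding bounded_snd_def by blast
  then show "bounded_fst (\<lambda>m n. nth_product b n (nth_product a m c))"
    unfolding bounded_fst_def by (intro exI [of _ n0]) simp
qed

lemma field_identities:
  "\<exists>N. (Delta ^^ N) (\<lambda>m n. nth_product a m (nth_product b n c) v) = (Delta ^^ N) (\<lambda>m n. nth_product b n (nth_product a m c) v)"
  "nth_product (nth_product a n b) k c v =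
    iter (\<lambda>m n. nth_product a m (nth_product b n c) v) (\<lambda>m n. nth_product b n (nth_product a m c) v) n k"
proof -
  obtain N where N: "local_of_order N a b" "local_of_order N a c" "local_of_order N b c"
    using loc by (rule local_of_order_common)
  have ba: "mutually_local b a" using loc(1) by (rule mutually_local_sym)
  have PF: "prod_inner (tri a b c v) = (\<lambda>m n. nth_product a m (nth_product b n c) v)"
    by (intro ext) (simp add: adm_inner_tri [OF F loc])
  have PG: "prod_inner (tri b a c v) = (\<lambda>n m. nth_product b n (nth_product a m c) v)"
    by (intro ext) (simp add: adm_inner_tri [OF F(2,1,3) ba loc(3,2)])
  have van: "prod_outer (tri a b c v) n k = 0" if "int N \<le> n" for n k
    using nth_product_bound [OF F(1,2) N(1) that] by (simp add: adm_outer_tri [OF F loc] nth_product_0_left F)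
  have bF: "bounded_snd (prod_inner (tri a b c v))" "bounded_snd (prod_inner (tri b a c v))"
    unfolding PF PG using bounded_apply(1) [OF bounded_snd_nested [OF F loc(3)]]
      bounded_apply(1) [OF bounded_snd_nested [OF F(2,1,3) loc(2)]] by simp_all
  note * = prod_outer_iterate [where ?n0.0 = "int N", OF adm_inner_tri(1) [OF F loc] adm_outer_tri(1) [OF F loc]
      adm_inner_tri(1) [OF F(2,1,3) ba loc(3,2)] nice3_tri [OF F N] mult_all_tri_swap [OF N(1)] bF]
  have 1: "(Delta ^^ N) (prod_inner (tri a b c v)) = (Delta ^^ N) (\<lambda>m n. prod_inner (tri b a c v) n m)"
    by (rule *(1)) (rule van)
  have 2: "prod_outer (tri a b c v) n k = iter (prod_inner (tri a b c v)) (\<lambda>m n. prod_inner (tri b a c v) n m) n k"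
    by (rule *(2)) (rule van)
  show "\<exists>N. (Delta ^^ N) (\<lambda>m n. nth_product a m (nth_product b n c) v) = (Delta ^^ N) (\<lambda>m n. nth_product b n (nth_product a m c) v)"
    using 1 unfolding PF PG by blast
  show "nth_product (nth_product a n b) k c v =
    iter (\<lambda>m n. nth_product a m (nth_product b n c) v) (\<lambda>m n. nth_product b n (nth_product a m c) v) n k"
    using 2 unfolding PF PG adm_outer_tri [OF F loc] .
qed

theorem iterate_formula:
  "nth_product (nth_product a n b) k c =
    iter (\<lambda>m n. nth_product a m (nth_product b n c)) (\<lambda>m n. nth_product b n (nth_product a m c)) n k"
  by (rule ext) (simp add: iter_apply bounded_nested_fields field_identities(2))

theorem commutator_formula:
  assumes van: "\<And>j. 2 \<le> j \<Longrightarrow> nth_product a j b = 0"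
  shows "nth_product a m (nth_product b n c) - nth_product b n (nth_product a m c) =
    nth_product (nth_product a 0 b) (m + n) c + of_int m *\<^sub>C nth_product (nth_product a 1 b) (m + n - 1) c"
proof
  fix v
  define P where "P = (\<lambda>m n. nth_product a m (nth_product b n c) v)"
  define Q where "Q = (\<lambda>m n. nth_product b n (nth_product a m c) v)"
  have it: "iter P Q n k = nth_product (nth_product a n b) k c v" for n k
    unfolding P_def Q_def by (rule field_identities(2) [symmetric])
  have b: "bounded_snd P" "bounded_fst Q"
    unfolding P_def Q_def by (rule bounded_apply(1) [OF bounded_nested_fields(1)])
      (rule bounded_apply(2) [OF bounded_nested_fields(2)])
  obtain N where N: "(Delta ^^ N) P = (Delta ^^ N) Q"
    unfolding P_def Q_def using field_identities(1) by blast
  have "P m n - Q m n = iter P Q 0 (m + n) + of_int m *\<^sub>C iter P Q 1 (m + n - 1)"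
    by (rule commutator_formula_abstract [OF b N]) (simp add: it van nth_product_0_left F)
  then show "(nth_product a m (nth_product b n c) - nth_product b n (nth_product a m c)) v =
    (nth_product (nth_product a 0 b) (m + n) c + of_int m *\<^sub>C nth_product (nth_product a 1 b) (m + n - 1) c) v"
    by (simp add: P_def Q_def it [unfolded P_def Q_def])
qed

end

section \<open>The Jordan decomposition of an automorphism\<close>

subsection \<open>Eigenspace components\<close>

definition eigen_decomp :: "('g::complex_vector \<Rightarrow> 'g) \<Rightarrow> 'g \<Rightarrow> complex set \<Rightarrow> (complex \<Rightarrow> 'g) \<Rightarrow> bool"
  where "eigen_decomp s a C f \<longleftrightarrow> finite C \<and> (\<forall>c\<in>C. s (f c) = c *\<^sub>C f c) \<and> a = (\<Sum>c\<in>C. f c)"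

text \<open>The component of \<open>a\<close> in the eigenspace for \<open>c\<close>, read off from any decomposition of \<open>a\<close> into eigenvectors
  that mentions \<open>c\<close>. It is well defined when \<open>s\<close> is diagonalizable.\<close>

definition eigcomp :: "('g::complex_vector \<Rightarrow> 'g) \<Rightarrow> complex \<Rightarrow> 'g \<Rightarrow> 'g"
  where "eigcomp s c a = (SOME x. \<exists>C f. eigen_decomp s a C f \<and> c \<in> C \<and> x = f c)"

lemma eigen_independent:
  assumes "clinear s" "finite C" "\<And>c. c \<in> C \<Longrightarrow> s (f c) = c *\<^sub>C f c" "(\<Sum>c\<in>C. f c) = 0" "c \<in> C"
  shows "f c = 0"
  using assms(2-5)
proof (induction C arbitrary: f c)
  case (insert d C)
  have "s (\<Sum>c\<in>insert d C. f c) - d *\<^sub>C (\<Sum>c\<in>insert d C. f c) = (\<Sum>c\<in>C. (c - d) *\<^sub>C f c)"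
    using insert.hyps insert.prems(1)
    by (simp add: clinear_add [OF assms(1)] clinear_sum [OF assms(1)] scaleC_add_right scaleC_sum_right
        scaleC_diff_left sum_subtractf)
  then have 1: "(\<Sum>c\<in>C. (c - d) *\<^sub>C f c) = 0"
    using insert.prems(2) by (simp add: clinear_0 [OF assms(1)])
  have 2: "f e = 0" if "e \<in> C" for e
  proof -
    have "(e - d) *\<^sub>C f e = 0"
      by (rule insert.IH [OF _ 1 that])
        (use insert.prems(1) in \<open>simp add: clinear_scaleC [OF assms(1)] scaleC_scaleC mult.commute\<close>)
    then show ?thesis using that insert.hyps by auto
  qed
  then show ?case using insert by auto
qed simp

lemma eigen_decomp_extend:
  assumes "eigen_decomp s a C f" "clinear s" "finite D"
  shows "eigen_decomp s a (C \<union> D) (\<lambda>c. if c \<in> C then f c else 0)"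
proof -
  have "(\<Sum>c\<in>C \<union> D. if c \<in> C then f c else 0) = (\<Sum>c\<in>C. f c)"
    using assms by (intro sum.mono_neutral_cong_right) (auto simp: eigen_decomp_def)
  then show ?thesis using assms by (auto simp: eigen_decomp_def clinear_0)
qed

lemma eigen_decomp_add:
  assumes "eigen_decomp s a C f" "eigen_decomp s b C g" "clinear s"
  shows "eigen_decomp s (a + b) C (\<lambda>c. f c + g c)"
  using assms by (simp add: eigen_decomp_def clinear_add [OF assms(3)] scaleC_add_right sum.distrib)

lemma eigen_decomp_linear:
  assumes "eigen_decomp s a C f" "clinear T" and T: "\<And>x c. s x = c *\<^sub>C x \<Longrightarrow> s (T x) = c *\<^sub>C T x"
  shows "eigen_decomp s (T a) C (\<lambda>c. T (f c))"
proof -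
  have "T a = (\<Sum>c\<in>C. T (f c))" using assms(1) clinear_sum [OF assms(2), of f C] by (simp add: eigen_decomp_def)
  moreover have "\<forall>c\<in>C. s (T (f c)) = c *\<^sub>C T (f c)" using assms(1) T unfolding eigen_decomp_def by blast
  ultimately show ?thesis using assms(1) unfolding eigen_decomp_def by blast
qed

lemma eigen_decomp_unique:
  assumes "clinear s" "eigen_decomp s a C f" "eigen_decomp s a D g" "c \<in> C" "c \<in> D"
  shows "f c = g c"
proof -
  have C: "finite C" and D: "finite D" using assms by (auto simp: eigen_decomp_def)
  have 1: "eigen_decomp s a (C \<union> D) (\<lambda>c. if c \<in> C then f c else 0)"
    by (rule eigen_decomp_extend [OF assms(2,1) D])
  have 2: "eigen_decomp s a (C \<union> D) (\<lambda>c. if c \<in> D then g c else 0)"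
    using eigen_decomp_extend [OF assms(3,1) C] by (simp add: Un_commute)
  have "(if c \<in> C then f c else 0) - (if c \<in> D then g c else 0) = 0"
  proof (rule eigen_independent [OF assms(1), of "C \<union> D" "\<lambda>c. (if c \<in> C then f c else 0) - (if c \<in> D then g c else 0)"])
    show "s ((if c \<in> C then f c else 0) - (if c \<in> D then g c else 0)) =
        c *\<^sub>C ((if c \<in> C then f c else 0) - (if c \<in> D then g c else 0))" if "c \<in> C \<union> D" for c
      using 1 2 that unfolding eigen_decomp_def clinear_diff [OF assms(1)] scaleC_diff_right by metis
    show "(\<Sum>c\<in>C \<union> D. (if c \<in> C then f c else 0) - (if c \<in> D then g c else 0)) = 0"
      using 1 2 unfolding eigen_decomp_def sum_subtractf by simp
  qed (use C D assms in auto)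
  then show ?thesis using assms by simp
qed

locale diag_op =
  fixes s :: "'g::complex_vector \<Rightarrow> 'g"
  assumes diag: "diagonalizable s"
begin

lemma lin: "clinear s"
  using diag by (simp add: diagonalizable_def)

lemma decomp_exists: "\<exists>C f. eigen_decomp s a C f"
proof -
  have "a \<in> cspan {a. \<exists>c. s a = c *\<^sub>C a}" using diag by (simp add: diagonalizable_def)
  then show ?thesis
  proof (induction rule: complex_vector.span_induct_alt)
    case base
    then show ?case by (intro exI [of _ "{}"]) (simp add: eigen_decomp_def)
  next
    case (step d x y)
    then obtain c where c: "s x = c *\<^sub>C x" by blast
    obtain C f where y: "eigen_decomp s y C f" using step by blast
    have "eigen_decomp s (d *\<^sub>C x) {c} (\<lambda>_. d *\<^sub>C x)"
      by (simp add: eigen_decomp_def c clinear_scaleC [OF lin] scaleC_scaleC mult.commute)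
    then have 1: "eigen_decomp s (d *\<^sub>C x) ({c} \<union> C) (\<lambda>e. if e \<in> {c} then d *\<^sub>C x else 0)"
      by (rule eigen_decomp_extend [OF _ lin]) (use y in \<open>simp add: eigen_decomp_def\<close>)
    have 2: "eigen_decomp s y ({c} \<union> C) (\<lambda>e. if e \<in> C then f e else 0)"
      using eigen_decomp_extend [OF y lin, of "{c}"] by (simp add: Un_commute)
    show ?case using eigen_decomp_add [OF 1 2 lin] by blast
  qed
qed

lemma eigcomp_eq:
  assumes "eigen_decomp s a C f" "c \<in> C"
  shows "eigcomp s c a = f c"
proof -
  have "\<exists>C' f'. eigen_decomp s a C' f' \<and> c \<in> C' \<and> eigcomp s c a = f' c"
    unfolding eigcomp_def by (rule someI [of _ "f c"]) (use assms in blast)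
  then obtain C' f' where "eigen_decomp s a C' f'" "c \<in> C'" "eigcomp s c a = f' c" by blast
  then show ?thesis using eigen_decomp_unique [OF lin _ assms(1) _ assms(2)] by simp
qed

lemma decomp_in:
  assumes "finite D"
  shows "\<exists>C f. D \<subseteq> C \<and> eigen_decomp s a C f"
proof -
  obtain C f where "eigen_decomp s a C f" using decomp_exists by blast
  then have "eigen_decomp s a (C \<union> D) (\<lambda>c. if c \<in> C then f c else 0)"
    by (rule eigen_decomp_extend [OF _ lin assms])
  then show ?thesis by blast
qed

lemma eigcomp_eigen: "s (eigcomp s c a) = c *\<^sub>C eigcomp s c a"
proof -
  obtain C f where C: "{c} \<subseteq> C" "eigen_decomp s a C f" using decomp_in [of "{c}"] by blast
  then have "eigcomp s c a = f c" by (intro eigcomp_eq) auto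
  then show ?thesis using C by (simp add: eigen_decomp_def)
qed

lemma eigcomp_commute:
  assumes "clinear T" "\<And>x c. s x = c *\<^sub>C x \<Longrightarrow> s (T x) = c *\<^sub>C T x"
  shows "eigcomp s c (T a) = T (eigcomp s c a)"
proof -
  obtain C f where C: "{c} \<subseteq> C" "eigen_decomp s a C f" using decomp_in [of "{c}"] by blast
  have "eigcomp s c (T a) = T (f c)"
    by (rule eigcomp_eq [OF eigen_decomp_linear [OF C(2) assms]]) (use C in auto)
  moreover have "eigcomp s c a = f c" by (rule eigcomp_eq [OF C(2)]) (use C in auto)
  ultimately show ?thesis by simp
qed

lemma eigcomp_linear: "clinear (eigcomp s c)"
proof (rule clinearI)
  fix a b
  obtain C f where C: "{c} \<subseteq> C" "eigen_decomp s a C f" using decomp_in [of "{c}"] by blast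
  then obtain D g where D: "C \<subseteq> D" "eigen_decomp s b D g" using decomp_in [of C b] by (auto simp: eigen_decomp_def)
  have 1: "eigen_decomp s a D (\<lambda>c. if c \<in> C then f c else 0)"
    using eigen_decomp_extend [OF C(2) lin, of D] D by (simp add: Un_absorb1 eigen_decomp_def)
  have "c \<in> D" using C D by auto
  then show "eigcomp s c (a + b) = eigcomp s c a + eigcomp s c b"
    using eigcomp_eq [OF eigen_decomp_add [OF 1 D(2) lin]] eigcomp_eq [OF 1] eigcomp_eq [OF D(2)] by simp
next
  show "eigcomp s c (d *\<^sub>C x) = d *\<^sub>C eigcomp s c x" for d x
    by (rule eigcomp_commute [where T = "\<lambda>x. d *\<^sub>C x"])
      (simp_all add: clinear_scale clinear_scaleC [OF lin] scaleC_scaleC mult.commute)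
qed

lemma eigcomp_self:
  assumes "s a = c *\<^sub>C a"
  shows "eigcomp s c a = a" and "d \<noteq> c \<Longrightarrow> eigcomp s d a = 0"
proof -
  have *: "eigen_decomp s a {c} (\<lambda>_. a)" using assms by (simp add: eigen_decomp_def)
  show "eigcomp s c a = a" using eigcomp_eq [OF *] by simp
  assume "d \<noteq> c"
  then show "eigcomp s d a = 0"
    using eigcomp_eq [OF eigen_decomp_extend [OF * lin, of "{d}"], of d] by simp
qed

lemma eigcomp_sum: "\<exists>C. finite C \<and> a = (\<Sum>c\<in>C. eigcomp s c a) \<and> (\<forall>c. c \<notin> C \<longrightarrow> eigcomp s c a = 0)"
proof -
  obtain C f where C: "eigen_decomp s a C f" using decomp_exists by blast
  have "a = (\<Sum>c\<in>C. eigcomp s c a)"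
    using C eigcomp_eq [OF C] by (simp add: eigen_decomp_def)
  moreover have "eigcomp s c a = 0" if "c \<notin> C" for c
    using eigcomp_eq [OF eigen_decomp_extend [OF C lin, of "{c}"], of c] that by simp
  ultimately show ?thesis using C by (auto simp: eigen_decomp_def)
qed

lemma linear_eqI:
  assumes "clinear f" "clinear g" "\<And>x c. s x = c *\<^sub>C x \<Longrightarrow> f x = g x"
  shows "f a = g a"
proof -
  obtain C where "finite C" "a = (\<Sum>c\<in>C. eigcomp s c a)" using eigcomp_sum by blast
  then have "f a = (\<Sum>c\<in>C. f (eigcomp s c a))" "g a = (\<Sum>c\<in>C. g (eigcomp s c a))"
    using clinear_sum [OF assms(1), of "\<lambda>c. eigcomp s c a" C] clinear_sum [OF assms(2), of "\<lambda>c. eigcomp s c a" C]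
    by simp_all
  moreover have "f (eigcomp s c a) = g (eigcomp s c a)" for c
    by (rule assms(3) [OF eigcomp_eigen])
  ultimately show ?thesis by simp
qed

end

subsection \<open>Exponentials of nilpotent operators\<close>

lemma funpow_kernel_mono:
  fixes N :: "'a::complex_vector \<Rightarrow> 'a"
  assumes "clinear N" "(N ^^ n) a = 0" "n \<le> j"
  shows "(N ^^ j) a = 0"
proof -
  have "(N ^^ (j - n + n)) a = (N ^^ (j - n)) ((N ^^ n) a)" by (simp only: funpow_add comp_apply)
  also have "\<dots> = 0" by (simp only: assms(2) clinear_0 [OF clinear_funpow [OF assms(1)]])
  finally show ?thesis using assms(3) by simp
qed

lemma exp_nilp_sum:
  assumes "clinear N" "\<And>a. (N ^^ n) a = 0"
  shows "exp_nilp c N a = (\<Sum>j<n. (c ^ j / fact j) *\<^sub>C (N ^^ j) a)"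
  unfolding exp_nilp_def
proof (rule Sum_any.expand_superset)
  have "(N ^^ j) a = 0" if "n \<le> j" for j
    by (rule funpow_kernel_mono [OF assms that])
  then show "{j. (c ^ j / fact j) *\<^sub>C (N ^^ j) a \<noteq> 0} \<subseteq> {..<n}"
    by (auto simp: not_less [symmetric])
qed simp

lemma exp_nilp_linear:
  assumes "clinear N" "\<And>a. (N ^^ n) a = 0"
  shows "clinear (exp_nilp c N)"
  by (rule clinearI) (simp_all add: exp_nilp_sum [OF assms] clinear_add [OF clinear_funpow [OF assms(1)]]
      clinear_scaleC [OF clinear_funpow [OF assms(1)]] scaleC_add_right sum.distrib scaleC_sum_right
      scaleC_scaleC mult.commute)

lemma exp_nilp_add:
  assumes "clinear N" "\<And>a. (N ^^ n) a = 0"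
  shows "exp_nilp c N (exp_nilp d N a) = exp_nilp (c + d) N a"
proof -
  define g where "g i j = ((c ^ i / fact i) * (d ^ j / fact j)) *\<^sub>C (N ^^ (i + j)) a" for i j
  have van: "(N ^^ j) a = 0" if "n \<le> j" for j a
    by (rule funpow_kernel_mono [OF assms that])
  have gz: "i + j < n" if "g i j \<noteq> 0" for i j
    using that van [of "i + j" a] by (fastforce simp: g_def)
  have "exp_nilp c N (exp_nilp d N a) = (\<Sum>i<n. \<Sum>j<n. g i j)"
    by (simp add: exp_nilp_sum [OF assms] clinear_sum [OF clinear_funpow [OF assms(1)]]
        clinear_scaleC [OF clinear_funpow [OF assms(1)]] scaleC_sum_right scaleC_scaleC g_def funpow_add)
  also have "\<dots> = (\<Sum>(i, j)\<in>{..<n} \<times> {..<n}. g i j)"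
    by (simp add: sum.cartesian_product)
  also have "\<dots> = (\<Sum>(i, j)\<in>{(i, j). i + j < n}. g i j)"
    proof (rule sum.mono_neutral_right)
    show "\<forall>x\<in>{..<n} \<times> {..<n} - {(i, j). i + j < n}. (case x of (i, j) \<Rightarrow> g i j) = 0"
      by (auto intro: gz)
  qed auto
  also have "\<dots> = (\<Sum>k<n. \<Sum>i\<le>k. g i (k - i))"
    by (rule sum.triangle_reindex)
  also have "\<dots> = (\<Sum>k<n. ((c + d) ^ k / fact k) *\<^sub>C (N ^^ k) a)"
  proof (rule sum.cong [OF refl])
    fix k
    have "(\<Sum>i\<le>k. g i (k - i)) = (\<Sum>i\<le>k. (c ^ i / fact i) * (d ^ (k - i) / fact (k - i))) *\<^sub>C (N ^^ k) a"
      by (simp add: g_def scaleC_sum_left)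
    also have "(\<Sum>i\<le>k. (c ^ i / fact i) * (d ^ (k - i) / fact (k - i))) = (c + d) ^ k / fact k"
      unfolding binomial_ring sum_divide_distrib
      by (intro sum.cong refl) (simp add: binomial_fact)
    finally show "(\<Sum>i\<le>k. g i (k - i)) = ((c + d) ^ k / fact k) *\<^sub>C (N ^^ k) a" .
  qed
  also have "\<dots> = exp_nilp (c + d) N a" by (rule exp_nilp_sum [OF assms, symmetric])
  finally show ?thesis .
qed

lemma exp_nilp_0: "exp_nilp 0 N a = a"
proof -
  have "exp_nilp 0 N a = (\<Sum>j\<in>{0}. (0 ^ j / fact j) *\<^sub>C (N ^^ j) a)"
    unfolding exp_nilp_def by (rule Sum_any.expand_superset) auto
  then show ?thesis by simp
qed

text \<open>A polynomial with vector coefficients that vanishes at all natural numbers is zero. Comparing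
  the values at $2k$ and $k$ eliminates the top coefficient.\<close>

lemma vector_polynomial_zero:
  fixes w :: "nat \<Rightarrow> 'u::complex_vector"
  assumes "\<And>k::nat. (\<Sum>l<d. of_nat k ^ l *\<^sub>C w l) = 0" "l < d"
  shows "w l = 0"
  using assms
proof (induction d arbitrary: w l)
  case (Suc d)
  have "(\<Sum>l<d. of_nat k ^ l *\<^sub>C ((2 ^ l - 2 ^ d) *\<^sub>C w l)) = 0" for k
  proof -
    have e: "of_nat k ^ l * (2 ^ l - 2 ^ d) = (of_nat (2 * k) ^ l - 2 ^ d * of_nat k ^ l :: complex)" for l
      by (simp add: power_mult_distrib right_diff_distrib mult.commute)
    have "(\<Sum>l<Suc d. of_nat k ^ l *\<^sub>C ((2 ^ l - 2 ^ d) *\<^sub>C w l)) =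
        (\<Sum>l<Suc d. of_nat (2 * k) ^ l *\<^sub>C w l) - 2 ^ d *\<^sub>C (\<Sum>l<Suc d. of_nat k ^ l *\<^sub>C w l)"
      unfolding scaleC_sum_right sum_subtractf [symmetric]
      by (intro sum.cong refl) (simp only: scaleC_scaleC e, simp only: scaleC_diff_left)
    also have "\<dots> = 0" by (simp only: Suc.prems(1)) simp
    finally show ?thesis by simp
  qed
  then have 1: "w l = 0" if "l < d" for l
  proof -
    have "(2 ^ l - 2 ^ d :: complex) *\<^sub>C w l = 0"
      by (rule Suc.IH [OF _ that]) fact
    moreover have "(2 ^ l :: complex) \<noteq> 2 ^ d"
    proof
      assume "(2 ^ l :: complex) = 2 ^ d"
      then have "(of_nat (2 ^ l) :: complex) = of_nat (2 ^ d)" by simp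
      then have "(2::nat) ^ l = 2 ^ d" by (simp only: of_nat_eq_iff)
      then show False using that by simp
    qed
    ultimately show ?thesis by simp
  qed
  have "w d = 0" using Suc.prems(1) [of 1] 1 by simp
  then show ?case using 1 Suc.prems(2) by (cases "l = d") auto
qed simp

lemma cbilinearD:
  assumes "cbilinear f"
  shows "clinear (f a)" "clinear (\<lambda>a. f a b)"
  using assms by (simp_all add: cbilinear_def)

text \<open>If the one-parameter groups of \<open>N\<close> and \<open>N'\<close> are compatible with \<open>\<beta>\<close> at all integral multiples of \<open>c\<close>, then at all
  times, since both sides are polynomial in the time. The linear coefficient is the claim.\<close>

lemma exp_bilinear_derivation:
  fixes \<beta> :: "'g::complex_vector \<Rightarrow> 'g \<Rightarrow> 'u::complex_vector"
  assumes \<beta>: "cbilinear \<beta>" and N: "nilpotent_op N" and N': "nilpotent_op N'" and c: "c \<noteq> 0"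
    and inv: "\<And>k::nat. \<beta> (exp_nilp (of_nat k * c) N a) (exp_nilp (of_nat k * c) N b) = exp_nilp (of_nat k * c) N' (\<beta> a b)"
  shows "\<beta> (N a) b + \<beta> a (N b) = N' (\<beta> a b)"
proof -
  obtain n0 where n0: "\<And>a. (N ^^ n0) a = 0" using N by (auto simp: nilpotent_op_def)
  obtain n1 where n1: "\<And>a. (N' ^^ n1) a = 0" using N' by (auto simp: nilpotent_op_def)
  have lin: "clinear N" "clinear N'" using N N' by (auto simp: nilpotent_op_def)
  define n where "n = 2 + n0 + n1"
  have n: "(N ^^ n) a = 0" "(N' ^^ n) x = 0" for a x
    by (rule funpow_kernel_mono [OF lin(1) n0], simp add: n_def)
      (rule funpow_kernel_mono [OF lin(2) n1], simp add: n_def)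
  define I where "I = {..<n} \<times> {..<n}"
  define X where "X = (\<lambda>(i, j). (c ^ (i + j) / (fact i * fact j)) *\<^sub>C \<beta> ((N ^^ i) a) ((N ^^ j) b))"
  define Y where "Y l = (if l < n then (c ^ l / fact l) *\<^sub>C (N' ^^ l) (\<beta> a b) else 0)" for l
(* w l is the coefficient of k^l in the difference of the two sides of inv. *)
  define w where "w l = (\<Sum>x\<in>{x\<in>I. fst x + snd x = l}. X x) - Y l" for l
  have "(\<Sum>l<2 * n. of_nat k ^ l *\<^sub>C w l) = 0" for k
  proof -
    have "\<beta> (exp_nilp (of_nat k * c) N a) (exp_nilp (of_nat k * c) N b) =
       (\<Sum>i<n. \<Sum>j<n. of_nat k ^ (i + j) *\<^sub>C X (i, j))"
      by (simp add: exp_nilp_sum [OF lin(1) n(1)] clinear_sum [OF cbilinearD(1) [OF \<beta>]] clinear_sum [OF cbilinearD(2) [OF \<beta>]]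
          clinear_scaleC [OF cbilinearD(1) [OF \<beta>]] clinear_scaleC [OF cbilinearD(2) [OF \<beta>]]
          scaleC_sum_right scaleC_scaleC X_def power_mult_distrib power_add)
        (subst sum.swap, simp add: ac_simps)
    also have "\<dots> = (\<Sum>x\<in>I. of_nat k ^ (fst x + snd x) *\<^sub>C X x)"
      by (simp add: sum.cartesian_product I_def case_prod_unfold)
    also have "\<dots> = (\<Sum>l<2 * n. \<Sum>x\<in>{x\<in>I. fst x + snd x = l}. of_nat k ^ (fst x + snd x) *\<^sub>C X x)"
      by (rule sum.group [symmetric]) (auto simp: I_def)
    also have "\<dots> = (\<Sum>l<2 * n. of_nat k ^ l *\<^sub>C (\<Sum>x\<in>{x\<in>I. fst x + snd x = l}. X x))"
      by (simp add: scaleC_sum_right)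
    finally have 1: "\<beta> (exp_nilp (of_nat k * c) N a) (exp_nilp (of_nat k * c) N b) =
        (\<Sum>l<2 * n. of_nat k ^ l *\<^sub>C (\<Sum>x\<in>{x\<in>I. fst x + snd x = l}. X x))" .
    have "exp_nilp (of_nat k * c) N' (\<beta> a b) = (\<Sum>l<n. of_nat k ^ l *\<^sub>C Y l)"
      by (simp add: exp_nilp_sum [OF lin(2) n(2)] Y_def scaleC_scaleC power_mult_distrib)
    also have "\<dots> = (\<Sum>l<2 * n. of_nat k ^ l *\<^sub>C Y l)"
      by (rule sum.mono_neutral_left) (auto simp: Y_def)
    finally show ?thesis
      using 1 inv [of k] by (simp add: w_def scaleC_diff_right sum_subtractf)
  qed
  then have "w 1 = 0" by (rule vector_polynomial_zero) (simp add: n_def)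
  moreover have "{x\<in>I. fst x + snd x = 1} = {(0, 1), (1, 0)}"
    by (auto simp: I_def n_def add_is_1)
  ultimately show ?thesis
    using c by (simp add: w_def X_def Y_def n_def scaleC_add_right [symmetric] add.commute)
qed

subsection \<open>The parts of the Jordan decomposition of an automorphism\<close>

text \<open>By induction on the exponents, $T - c$ and $T - d$ kill \<open>x\<close>, so $cx = dx$.\<close>

lemma coprime_kernels:
  fixes T :: "'a::complex_vector \<Rightarrow> 'a"
  assumes "clinear T" "c \<noteq> d" "((\<lambda>x. T x - c *\<^sub>C x) ^^ m) x = 0" "((\<lambda>x. T x - d *\<^sub>C x) ^^ n) x = 0"
  shows "x = 0"
  using assms(3,4)
proof (induction "m + n" arbitrary: m n x)
  case 0
  then show ?case by simp
next
  case (Suc k)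
  define A where "A = (\<lambda>x. T x - c *\<^sub>C x)"
  define B where "B = (\<lambda>x. T x - d *\<^sub>C x)"
  have AB: "A (B x) = B (A x)" for x
    by (simp add: A_def B_def clinear_diff [OF assms(1)] clinear_scaleC [OF assms(1)]
        scaleC_diff_right scaleC_scaleC algebra_simps)
  have lin: "clinear A" "clinear B"
    unfolding A_def B_def using assms(1)
    by (auto simp: clinear_iff scaleC_add_right scaleC_diff_right scaleC_scaleC algebra_simps)
  have cA: "(A ^^ i) (B x) = B ((A ^^ i) x)" for i x by (induction i) (simp_all add: AB)
  have cB: "(B ^^ i) (A x) = A ((B ^^ i) x)" for i x by (induction i) (simp_all add: AB)
  have pr: "(A ^^ m) x = 0" "(B ^^ n) x = 0" using Suc.prems by (simp_all add: A_def B_def)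
  show ?case
  proof (cases "m = 0 \<or> n = 0")
    case True
    then show ?thesis using pr by auto
  next
    case False
    then obtain m' n' where mn: "m = Suc m'" "n = Suc n'" by (metis not0_implies_Suc)
    have "A x = 0"
    proof (rule Suc.hyps(1))
      show "k = m' + n" using Suc.hyps(2) mn by simp
      show "((\<lambda>x. T x - c *\<^sub>C x) ^^ m') (A x) = 0"
        using pr(1) unfolding mn A_def [symmetric] funpow_Suc_right by simp
      show "((\<lambda>x. T x - d *\<^sub>C x) ^^ n) (A x) = 0"
        unfolding B_def [symmetric] cB pr(2) by (rule clinear_0 [OF lin(1)])
    qed
    moreover have "B x = 0"
    proof (rule Suc.hyps(1))
      show "k = m + n'" using Suc.hyps(2) mn by simp
      show "((\<lambda>x. T x - d *\<^sub>C x) ^^ n') (B x) = 0"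
        using pr(2) unfolding mn B_def [symmetric] funpow_Suc_right by simp
      show "((\<lambda>x. T x - c *\<^sub>C x) ^^ m) (B x) = 0"
        unfolding A_def [symmetric] cA pr(1) by (rule clinear_0 [OF lin(2)])
    qed
    ultimately have "c *\<^sub>C x = d *\<^sub>C x" by (simp add: A_def B_def)
    then have "(c - d) *\<^sub>C x = 0" by (simp add: scaleC_diff_left)
    then show ?thesis using assms(2) by simp
  qed
qed

definition \<tau> :: complex where "\<tau> = - 2 * of_real pi * \<i>"

lemma tau_nonzero: "\<tau> \<noteq> 0" by (simp add: \<tau>_def)

text \<open>The automorphism together with its multiplicative Jordan decomposition. Its semisimple and its unipotent part
  inherit the symmetries of \<open>\<phi>\<close>, because eigenspaces of \<open>\<sigma>\<close> are generalized eigenspaces of \<open>\<phi>\<close>.\<close>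

locale jordan =
  fixes \<phi> \<sigma> N :: "'g::complex_vector \<Rightarrow> 'g"
  assumes jordan: "jordan_decomposition \<phi> \<sigma> N" and phi_lin: "clinear \<phi>" and phi_bij: "bij \<phi>"
begin

sublocale diag_op \<sigma>
  using jordan by unfold_locales (simp add: jordan_decomposition_def)

definition u :: "'g \<Rightarrow> 'g" where "u = exp_nilp \<tau> N"

lemma N_lin: "clinear N" using jordan by (simp add: jordan_decomposition_def nilpotent_op_def)

lemma N_nilp: "\<exists>n. \<forall>a. (N ^^ n) a = 0"
  using jordan by (simp add: jordan_decomposition_def nilpotent_op_def)

lemma sigma_N: "\<sigma> (N a) = N (\<sigma> a)" using jordan by (simp add: jordan_decomposition_def)

lemma phi_eq: "\<phi> a = \<sigma> (u a)" using jordan by (simp add: jordan_decomposition_def u_def \<tau>_def)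

lemma N_pow_lin: "clinear (N ^^ j)" by (rule clinear_funpow [OF N_lin])

lemma sigma_N_pow: "\<sigma> ((N ^^ j) a) = (N ^^ j) (\<sigma> a)"
  by (induction j) (simp_all add: sigma_N)

lemma exp_lin: "clinear (exp_nilp c N)"
  using N_nilp exp_nilp_linear [OF N_lin] by metis

lemma sigma_exp: "\<sigma> (exp_nilp c N a) = exp_nilp c N (\<sigma> a)"
proof -
  obtain n where n: "\<And>a. (N ^^ n) a = 0" using N_nilp by blast
  show ?thesis
    by (simp add: exp_nilp_sum [OF N_lin n] clinear_sum [OF lin] clinear_scaleC [OF lin] sigma_N_pow)
qed

lemma N_exp: "(N ^^ j) (exp_nilp c N a) = exp_nilp c N ((N ^^ j) a)"
proof -
  obtain n where n: "\<And>a. (N ^^ n) a = 0" using N_nilp by blast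
  have "(N ^^ j) ((N ^^ i) a) = (N ^^ i) ((N ^^ j) a)" for i
    by (rule funpow_commute) (rule refl)
  then show ?thesis
    by (simp add: exp_nilp_sum [OF N_lin n] clinear_sum [OF N_pow_lin] clinear_scaleC [OF N_pow_lin])
qed

lemma exp_add: "exp_nilp c N (exp_nilp d N a) = exp_nilp (c + d) N a"
  using N_nilp exp_nilp_add [OF N_lin] by metis

lemma exp_inv: "exp_nilp c N (exp_nilp (- c) N a) = a"
  by (simp add: exp_add exp_nilp_0)

lemma sigma_inj: "\<sigma> x = 0 \<Longrightarrow> x = 0"
proof -
  assume "\<sigma> x = 0"
  then have "\<phi> (exp_nilp (- \<tau>) N x) = 0" using exp_inv [of \<tau> x] by (simp add: phi_eq u_def)
  then have "exp_nilp (- \<tau>) N x = 0"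
    using phi_bij clinear_0 [OF phi_lin] by (metis bij_is_inj injD)
  then show "x = 0" using exp_inv [of \<tau> x] clinear_0 [OF exp_lin] by metis
qed

lemma exp_minus_one:
  assumes "(N ^^ Suc i) a = 0"
  shows "(N ^^ i) (exp_nilp c N a - a) = 0"
proof -
  have van: "(N ^^ j) a = 0" if "Suc i \<le> j" for j
    by (rule funpow_kernel_mono [OF N_lin assms that])
  obtain n where n: "\<And>a. (N ^^ n) a = 0" using N_nilp by blast
  then have n': "(N ^^ Suc n) a = 0" for a by (simp add: clinear_0 [OF N_lin])
  have "(N ^^ i) (exp_nilp c N a) = (\<Sum>j<Suc n. (c ^ j / fact j) *\<^sub>C (N ^^ (i + j)) a)"
    by (simp only: exp_nilp_sum [OF N_lin n'] clinear_sum [OF N_pow_lin] clinear_scaleC [OF N_pow_lin] funpow_add comp_apply)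
  also have "\<dots> = (N ^^ i) a"
    by (subst sum.lessThan_Suc_shift) (simp add: van del: funpow.simps)
  finally show ?thesis by (simp add: clinear_diff [OF N_pow_lin])
qed

lemma phi_eigen:
  assumes "\<sigma> a = c *\<^sub>C a"
  shows "\<phi> a = c *\<^sub>C u a" "\<sigma> (u a) = c *\<^sub>C u a" "\<sigma> (\<phi> a) = c *\<^sub>C \<phi> a"
  using assms by (simp_all add: phi_eq u_def sigma_exp clinear_scaleC [OF exp_lin] clinear_scaleC [OF lin])

text \<open>The operator $T - cd$ acts on \<open>\<beta> a b\<close> as a sum of terms each of which lowers the nilpotency order of
  \<open>a\<close> or of \<open>b\<close>.\<close>

lemma bilinear_generalized_eigen:
  fixes \<beta> :: "'g \<Rightarrow> 'g \<Rightarrow> 'u::complex_vector"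
  assumes \<beta>: "cbilinear \<beta>" and T: "clinear T" and inv: "\<And>a b. \<beta> (\<phi> a) (\<phi> b) = T (\<beta> a b)"
    and "\<sigma> a = c *\<^sub>C a" "\<sigma> b = d *\<^sub>C b" "(N ^^ i) a = 0" "(N ^^ j) b = 0"
  shows "((\<lambda>x. T x - (c * d) *\<^sub>C x) ^^ (i + j)) (\<beta> a b) = 0"
  using assms(4-)
proof (induction "i + j" arbitrary: i j a b)
  case 0
  then show ?case by (simp add: clinear_0 [OF cbilinearD(1) [OF \<beta>]])
next
  case (Suc k)
  define S where "S = (\<lambda>x. T x - (c * d) *\<^sub>C x)"
  have lS: "clinear S"
    unfolding S_def using T by (auto simp: clinear_iff scaleC_add_right scaleC_diff_right scaleC_scaleC algebra_simps)
  show ?case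
  proof (cases "i = 0 \<or> j = 0")
    case True
    then have "\<beta> a b = 0"
      using Suc.prems clinear_0 [OF cbilinearD(1) [OF \<beta>]] clinear_0 [OF cbilinearD(2) [OF \<beta>]] by auto
    then show ?thesis unfolding S_def [symmetric] by (simp only: clinear_0 [OF clinear_funpow [OF lS]])
  next
    case False
    then obtain i' j' where ij: "i = Suc i'" "j = Suc j'" by (metis not0_implies_Suc)
    have N1: "(N ^^ j) (u b) = 0" unfolding u_def N_exp Suc.prems by (rule clinear_0 [OF exp_lin])
    have eig: "\<sigma> (u a - a) = c *\<^sub>C (u a - a)" "\<sigma> (u b) = d *\<^sub>C u b" "\<sigma> (u b - b) = d *\<^sub>C (u b - b)"
      using phi_eigen(2) Suc.prems(1,2) by (simp_all add: clinear_diff [OF lin] scaleC_diff_right)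
    have "S (\<beta> a b) = (c * d) *\<^sub>C (\<beta> (u a - a) (u b) + \<beta> a (u b - b))"
      using phi_eigen(1) [OF Suc.prems(1)] phi_eigen(1) [OF Suc.prems(2)]
      by (simp add: S_def inv [symmetric] clinear_scaleC [OF cbilinearD(1) [OF \<beta>]]
          clinear_scaleC [OF cbilinearD(2) [OF \<beta>]] scaleC_scaleC clinear_diff [OF cbilinearD(1) [OF \<beta>]]
          clinear_diff [OF cbilinearD(2) [OF \<beta>]] scaleC_diff_right mult.commute)
    moreover have "(S ^^ (i' + j)) (\<beta> (u a - a) (u b)) = 0"
      unfolding S_def by (rule Suc.hyps(1))
        (use Suc.hyps(2) ij eig N1 exp_minus_one [of i' a \<tau>, folded u_def] Suc.prems(3) in \<open>simp_all del: funpow.simps\<close>)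
    moreover have "(S ^^ (i + j')) (\<beta> a (u b - b)) = 0"
      unfolding S_def by (rule Suc.hyps(1))
        (use Suc.hyps(2) ij eig Suc.prems(1,3) exp_minus_one [of j' b \<tau>, folded u_def] Suc.prems(4) in \<open>simp_all del: funpow.simps\<close>)
    moreover have "(S ^^ (i + j)) (\<beta> a b) = (S ^^ (i' + j)) (S (\<beta> a b))" "i' + j = i + j'"
      unfolding ij by (simp_all add: funpow_swap1)
    ultimately have "(S ^^ (i + j)) (\<beta> a b) = 0"
      by (simp only: clinear_scaleC [OF clinear_funpow [OF lS]] clinear_add [OF clinear_funpow [OF lS]]) simp
    then show ?thesis by (simp only: S_def)
  qed
qed

text \<open>On the \<open>\<sigma>\<close>-component for \<open>d\<close>, \<open>\<phi>\<close> is \<open>d\<close> times a unipotent operator; by \<open>coprime_kernels\<close> only \<open>d = c\<close> contributes.\<close>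

lemma generalized_eigen:
  assumes "((\<lambda>x. \<phi> x - c *\<^sub>C x) ^^ k) x = 0"
  shows "\<sigma> x = c *\<^sub>C x"
proof -
  define S where "S d = (\<lambda>x. \<phi> x - d *\<^sub>C x)" for d
  have lS: "clinear (S d)" for d
    unfolding S_def using phi_lin by (auto simp: clinear_iff scaleC_add_right scaleC_diff_right scaleC_scaleC algebra_simps)
  have S_eig: "\<sigma> (S d y) = e *\<^sub>C S d y" if "\<sigma> y = e *\<^sub>C y" for d e y
    using that by (simp add: S_def clinear_diff [OF lin] phi_eigen clinear_scaleC [OF lin] scaleC_diff_right scaleC_scaleC mult.commute)
  have Spow_eig: "\<sigma> ((S d ^^ j) y) = e *\<^sub>C (S d ^^ j) y" if "\<sigma> y = e *\<^sub>C y" for d e y j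
    using that by (induction j) (simp_all add: S_eig)
  obtain n where n: "\<And>a. (N ^^ n) a = 0" using N_nilp by blast
  have nil: "(S e ^^ j) y = 0" if "\<sigma> y = e *\<^sub>C y" "(N ^^ j) y = 0" for e y j
    using that
  proof (induction j arbitrary: y)
    case (Suc j)
    have "S e y = e *\<^sub>C (u y - y)" using Suc.prems by (simp add: S_def phi_eigen scaleC_diff_right)
    then have "(N ^^ j) (S e y) = 0"
      using exp_minus_one [OF Suc.prems(2), of \<tau>, folded u_def] by (simp add: clinear_scaleC [OF N_pow_lin])
    then have "(S e ^^ j) (S e y) = 0" by (rule Suc.IH [OF S_eig [OF Suc.prems(1)]])
    then show ?case by (simp add: funpow_swap1)
  qed simp
  have zero: "eigcomp \<sigma> e x = 0" if "e \<noteq> c" for e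
  proof -
    have "(S c ^^ k) (eigcomp \<sigma> e x) = eigcomp \<sigma> e ((S c ^^ k) x)"
      by (rule eigcomp_commute [symmetric]) (simp_all add: clinear_funpow lS Spow_eig)
    also have "\<dots> = 0" using assms by (simp add: S_def clinear_0 [OF eigcomp_linear])
    finally have "(S c ^^ k) (eigcomp \<sigma> e x) = 0" .
    moreover have "(S e ^^ n) (eigcomp \<sigma> e x) = 0" by (rule nil [OF eigcomp_eigen n])
    ultimately show ?thesis using coprime_kernels [OF phi_lin, of c e k _ n] that by (simp add: S_def)
  qed
  obtain C where C: "finite C" "x = (\<Sum>e\<in>C. eigcomp \<sigma> e x)" "\<And>e. e \<notin> C \<Longrightarrow> eigcomp \<sigma> e x = 0" using eigcomp_sum by blast
  have "x = (\<Sum>e\<in>C \<union> {c}. eigcomp \<sigma> e x)"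
    using C by (subst C(2)) (intro sum.mono_neutral_left, auto)
  also have "\<dots> = (\<Sum>e\<in>{c}. eigcomp \<sigma> e x)"
    by (rule sum.mono_neutral_right) (use C zero in auto)
  finally show ?thesis using eigcomp_eigen [of c x] by simp
qed

lemma exp_nat: "exp_nilp (of_nat k * c) N a = (exp_nilp c N ^^ k) a"
  by (induction k) (simp_all add: exp_nilp_0 exp_add [symmetric] algebra_simps)

text \<open>For eigenvectors \<open>a\<close>, \<open>b\<close> of \<open>\<sigma>\<close>, the bracket is a generalized eigenvector of \<open>\<phi>\<close> for the product
  of the eigenvalues, hence an eigenvector of \<open>\<sigma>\<close>.\<close>

theorem sigma_multiplicative:
  assumes br: "cbilinear br" and aut: "\<And>a b. \<phi> (br a b) = br (\<phi> a) (\<phi> b)"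
  shows "\<sigma> (br a b) = br (\<sigma> a) (\<sigma> b)"
proof -
  obtain n where n: "\<And>a. (N ^^ n) a = 0" using N_nilp by blast
  have 1: "\<sigma> (br x y) = br (\<sigma> x) (\<sigma> y)" if "\<sigma> x = c *\<^sub>C x" "\<sigma> y = d *\<^sub>C y" for x y c d
  proof -
    have "((\<lambda>x. \<phi> x - (c * d) *\<^sub>C x) ^^ (n + n)) (br x y) = 0"
      by (rule bilinear_generalized_eigen [OF br phi_lin aut [symmetric] that n n])
    then have "\<sigma> (br x y) = (c * d) *\<^sub>C br x y" by (rule generalized_eigen)
    then show ?thesis using that by (simp add: clinear_scaleC [OF cbilinearD(1) [OF br]] clinear_scaleC [OF cbilinearD(2) [OF br]] scaleC_scaleC mult.commute)
  qed
  have 2: "\<sigma> (br x b) = br (\<sigma> x) (\<sigma> b)" if x: "\<sigma> x = c *\<^sub>C x" for x c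
  proof (rule linear_eqI [where f = "\<lambda>b. \<sigma> (br x b)" and g = "\<lambda>b. br (\<sigma> x) (\<sigma> b)"])
    show "clinear (\<lambda>b. \<sigma> (br x b))" by (rule clinear_compose [OF lin cbilinearD(1) [OF br]])
    show "clinear (\<lambda>b. br (\<sigma> x) (\<sigma> b))" by (rule clinear_compose [OF cbilinearD(1) [OF br] lin])
  qed (rule 1 [OF x])
  show ?thesis
  proof (rule linear_eqI [where f = "\<lambda>a. \<sigma> (br a b)" and g = "\<lambda>a. br (\<sigma> a) (\<sigma> b)"])
    show "clinear (\<lambda>a. \<sigma> (br a b))" by (rule clinear_compose [OF lin cbilinearD(2) [OF br]])
    show "clinear (\<lambda>a. br (\<sigma> a) (\<sigma> b))" by (rule clinear_compose [OF cbilinearD(2) [OF br] lin])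
  qed (rule 2)
qed

text \<open>With \<open>\<sigma>\<close>, also \<open>u\<close> and all its powers are automorphisms, and these are the exponentials of multiples of \<open>N\<close>.\<close>

theorem N_derivation:
  assumes br: "cbilinear br" and aut: "\<And>a b. \<phi> (br a b) = br (\<phi> a) (\<phi> b)"
  shows "N (br a b) = br (N a) b + br a (N b)"
proof -
  have sinj: "x = y" if "\<sigma> x = \<sigma> y" for x y
    using sigma_inj [of "x - y"] that by (simp add: clinear_diff [OF lin])
  have u: "u (br a b) = br (u a) (u b)" for a b
    by (rule sinj) (simp only: sigma_multiplicative [OF br aut] phi_eq [symmetric] aut)
  have "(u ^^ k) (br a b) = br ((u ^^ k) a) ((u ^^ k) b)" for k by (induction k) (simp_all add: u)
  then have "br (exp_nilp (of_nat k * \<tau>) N a) (exp_nilp (of_nat k * \<tau>) N b) = exp_nilp (of_nat k * \<tau>) N (br a b)" for k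
    by (simp only: exp_nat u_def)
  moreover have "nilpotent_op N" using jordan by (simp add: jordan_decomposition_def)
  ultimately show ?thesis
    using exp_bilinear_derivation [OF br _ _ tau_nonzero, of N N a b] by simp
qed

lemma form_eigen:
  assumes form: "cbilinear form" and inv: "\<And>a b. form (\<phi> a) (\<phi> b) = (form a b :: complex)"
    and "\<sigma> a = c *\<^sub>C a" "\<sigma> b = d *\<^sub>C b" "c * d \<noteq> 1"
  shows "form a b = 0"
proof -
  obtain n where n: "\<And>a. (N ^^ n) a = 0" using N_nilp by blast
  have id: "clinear (\<lambda>x::complex. x)" by (simp add: clinear_iff)
  have "((\<lambda>x. x - (c * d) *\<^sub>C x) ^^ (n + n)) (form a b) = 0"
    by (rule bilinear_generalized_eigen [OF form id inv assms(3,4) n n])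
  moreover have "((\<lambda>x. x - (c * d) *\<^sub>C x) ^^ k) x = (1 - c * d) ^ k * x" for k and x :: complex
    by (induction k) (simp_all add: scaleC_complex_def algebra_simps)
  ultimately show ?thesis using assms(5) by simp
qed

theorem form_invariances:
  assumes form: "cbilinear form" and inv: "\<And>a b. form (\<phi> a) (\<phi> b) = (form a b :: complex)"
  shows "form (N a) b = - form a (N b)"
proof -
  have 1: "form (\<sigma> x) (\<sigma> y) = form x y" if "\<sigma> x = c *\<^sub>C x" "\<sigma> y = d *\<^sub>C y" for x y c d
  proof (cases "c * d = 1")
    case True
    then show ?thesis using that
      by (simp add: clinear_scaleC [OF cbilinearD(1) [OF form]] clinear_scaleC [OF cbilinearD(2) [OF form]]
          scaleC_scaleC mult.commute)
  next
    case False
    then show ?thesis using form_eigen [OF form inv that] that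
      by (simp add: clinear_scaleC [OF cbilinearD(1) [OF form]] clinear_scaleC [OF cbilinearD(2) [OF form]])
  qed
  have 2: "form (\<sigma> x) (\<sigma> b) = form x b" if x: "\<sigma> x = c *\<^sub>C x" for x c b
  proof (rule linear_eqI [where f = "\<lambda>b. form (\<sigma> x) (\<sigma> b)" and g = "\<lambda>b. form x b"])
    show "clinear (\<lambda>b. form (\<sigma> x) (\<sigma> b))" by (rule clinear_compose [OF cbilinearD(1) [OF form] lin])
  qed (rule cbilinearD [OF form], rule 1 [OF x])
  have \<sigma>: "form (\<sigma> a) (\<sigma> b) = form a b" for a b
  proof (rule linear_eqI [where f = "\<lambda>a. form (\<sigma> a) (\<sigma> b)" and g = "\<lambda>a. form a b"])
    show "clinear (\<lambda>a. form (\<sigma> a) (\<sigma> b))" by (rule clinear_compose [OF cbilinearD(2) [OF form] lin])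
  qed (rule cbilinearD [OF form], rule 2)
  have u: "form (u a) (u b) = form a b" for a b
    using inv [of a b] by (simp add: phi_eq \<sigma>)
  have "form ((u ^^ k) a) ((u ^^ k) b) = form a b" for k by (induction k) (simp_all add: u)
  then have "form (exp_nilp (of_nat k * \<tau>) N a) (exp_nilp (of_nat k * \<tau>) N b) = form a b" for k
    by (simp only: exp_nat u_def)
  moreover have "exp_nilp c (\<lambda>_. 0) x = x" for c and x :: complex
  proof -
    have z: "((\<lambda>_::complex. 0::complex) ^^ 1) x = 0" for x by simp
    show ?thesis using exp_nilp_sum [OF _ z, of c x] by (simp add: clinear_iff)
  qed
  moreover have "nilpotent_op N" using jordan by (simp add: jordan_decomposition_def)
  moreover have "nilpotent_op (\<lambda>_. 0 :: complex)"
    unfolding nilpotent_op_def by (auto simp: clinear_iff intro!: exI [of _ 1])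
  ultimately have "form (N a) b + form a (N b) = 0"
    using exp_bilinear_derivation [OF form _ _ tau_nonzero, of N "\<lambda>_. 0" a b] by simp
  then show ?thesis by (simp add: eq_neg_iff_add_eq_0)
qed

end

section \<open>Monodromy\<close>

definition \<s> :: complex where "\<s> = 2 * of_real pi * \<i>"

text \<open>The coefficient of $\zeta^k$ in $(\zeta + 2\pi i)^l$.\<close>

definition bcoef :: "nat \<Rightarrow> nat \<Rightarrow> complex"
  where "bcoef l k = of_nat (l choose k) * \<s> ^ (l - k)"

text \<open>\<open>rot\<close> is the monodromy on series, \<open>rot2\<close> the simultaneous monodromy in two variables. As
  $e^{2\pi iD_\zeta}$ is a ring automorphism that commutes with $D_z$, it is compatible with all ingredients
  of the products.\<close>

definition rot :: "'u::complex_vector lseries \<Rightarrow> 'u lseries"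
  where "rot f e k = exp (\<s> * e) *\<^sub>C Sum_any (\<lambda>l. bcoef l k *\<^sub>C f e l)"

definition rot2 :: "'u::complex_vector lseries2 \<Rightarrow> 'u lseries2"
  where "rot2 F e1 k1 e2 k2 = (exp (\<s> * e1) * exp (\<s> * e2)) *\<^sub>C
     Sum_any (\<lambda>l1. Sum_any (\<lambda>l2. (bcoef l1 k1 * bcoef l2 k2) *\<^sub>C F e1 l1 e2 l2))"

lemma tau_s: "\<tau> = - \<s>" by (simp add: \<tau>_def \<s>_def)

lemma s_nonzero: "\<s> \<noteq> 0" by (simp add: \<s>_def)

lemma monodromy_eq: "monodromy a v = rot (a v)"
  by (simp add: fun_eq_iff monodromy_def rot_def bcoef_def \<s>_def)

lemma exp_s_int: "z \<in> \<int> \<Longrightarrow> exp (\<s> * z) = 1"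
proof -
  assume "z \<in> \<int>"
  then obtain n where n: "z = of_int n" by (auto elim: Ints_cases)
  have "exp (\<s> * z) = cis (2 * pi * of_int n)"
    by (simp add: \<s>_def n cis_conv_exp algebra_simps)
  also have "\<dots> = 1" by (rule cis_multiple_2pi) simp
  finally show ?thesis .
qed

lemma exp_s_eq_1:
  assumes "exp (\<s> * z) = 1"
  shows "z \<in> \<int>"
proof -
  define w where "w = \<s> * z"
  have w: "exp w = 1" using assms by (simp only: w_def)
  have re: "Re w = - 2 * pi * Im z" and im: "Im w = 2 * pi * Re z"
    by (simp_all add: w_def \<s>_def)
  have "exp (Re w) = 1" using w norm_exp_eq_Re [of w] by simp
  then have "Re w = 0" by (simp only: exp_eq_one_iff)
  then have "cos (Im w) = 1" using Re_exp [of w] w by simp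
  then obtain n :: int where "Im w = of_int n * 2 * pi" using cos_one_2pi_int by blast
  then have "z = of_int n" using re im \<open>Re w = 0\<close> by (simp add: complex_eq_iff)
  then show ?thesis by simp
qed

lemma exp_s_plus_1: "exp (\<s> * (e + 1)) = exp (\<s> * e)" "exp (\<s> * (e - 1)) = exp (\<s> * e)"
  using exp_s_int [of 1] exp_s_int [of "- 1"]
  by (simp_all add: distrib_left right_diff_distrib exp_add exp_diff)

lemma bcoef_0 [simp]: "l < k \<Longrightarrow> bcoef l k = 0"
  by (simp add: bcoef_def)

lemma bcoef_self [simp]: "bcoef k k = 1"
  by (simp add: bcoef_def)

lemma bcoef_Suc: "of_nat (Suc k) * bcoef (Suc l) (Suc k) = of_nat (Suc l) * bcoef l k"
proof -
  have "of_nat (Suc k) * (of_nat (Suc l choose Suc k) :: complex) = of_nat (Suc l) * of_nat (l choose k)"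
    using Suc_times_binomial_eq [of l k] by (simp only: of_nat_mult [symmetric] mult.commute)
  then show ?thesis by (simp only: bcoef_def mult.assoc [symmetric] diff_Suc_Suc)
qed

lemma bcoef_vandermonde: "(\<Sum>k1\<le>k. bcoef l1 k1 * bcoef l2 (k - k1)) = bcoef (l1 + l2) k"
proof -
  have "bcoef l1 k1 * bcoef l2 (k - k1) = of_nat ((l1 choose k1) * (l2 choose (k - k1))) * \<s> ^ (l1 + l2 - k)"
    if "k1 \<le> k" for k1
  proof (cases "k1 \<le> l1 \<and> k - k1 \<le> l2")
    case True
    then have "l1 + l2 - k = (l1 - k1) + (l2 - (k - k1))" using that by arith
    then show ?thesis by (simp add: bcoef_def power_add)
  next
    case False
    then show ?thesis by (auto simp: bcoef_def not_le)
  qed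
  then have "(\<Sum>k1\<le>k. bcoef l1 k1 * bcoef l2 (k - k1)) =
      of_nat (\<Sum>k1\<le>k. (l1 choose k1) * (l2 choose (k - k1))) * \<s> ^ (l1 + l2 - k)"
    by (simp add: sum_distrib_right)
  also have "(\<Sum>k1\<le>k. (l1 choose k1) * (l2 choose (k - k1))) = (l1 + l2) choose k" by (rule vandermonde)
  finally show ?thesis by (simp add: bcoef_def)
qed

lemma rot_sum:
  assumes "\<And>l. B \<le> l \<Longrightarrow> f e l = 0"
  shows "rot f e k = exp (\<s> * e) *\<^sub>C (\<Sum>l<B. bcoef l k *\<^sub>C f e l)"
  unfolding rot_def
  by (rule arg_cong [where f = "scaleC (exp (\<s> * e))"], rule Sum_any.expand_superset)
    (use assms in \<open>auto simp flip: not_le\<close>)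

lemma rot2_sum:
  assumes "\<And>l1 l2. B \<le> l1 \<or> B \<le> l2 \<Longrightarrow> F e1 l1 e2 l2 = 0"
  shows "rot2 F e1 k1 e2 k2 = (exp (\<s> * e1) * exp (\<s> * e2)) *\<^sub>C
     (\<Sum>l1<B. \<Sum>l2<B. (bcoef l1 k1 * bcoef l2 k2) *\<^sub>C F e1 l1 e2 l2)"
proof -
  have 1: "Sum_any (\<lambda>l2. (bcoef l1 k1 * bcoef l2 k2) *\<^sub>C F e1 l1 e2 l2) =
      (\<Sum>l2<B. (bcoef l1 k1 * bcoef l2 k2) *\<^sub>C F e1 l1 e2 l2)" for l1
    by (rule Sum_any.expand_superset) (use assms in \<open>auto simp flip: not_le\<close>)
  have "Sum_any (\<lambda>l1. \<Sum>l2<B. (bcoef l1 k1 * bcoef l2 k2) *\<^sub>C F e1 l1 e2 l2) =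
     (\<Sum>l1<B. \<Sum>l2<B. (bcoef l1 k1 * bcoef l2 k2) *\<^sub>C F e1 l1 e2 l2)"
  proof (rule Sum_any.expand_superset)
    have *: "(\<Sum>l2<B. (bcoef l1 k1 * bcoef l2 k2) *\<^sub>C F e1 l1 e2 l2) = 0" if "\<not> l1 < B" for l1
      using assms that by simp
    show "{l1. (\<Sum>l2<B. (bcoef l1 k1 * bcoef l2 k2) *\<^sub>C F e1 l1 e2 l2) \<noteq> 0} \<subseteq> {..<B}"
    proof (rule subsetI, rule ccontr)
      fix x assume "x \<in> {l1. (\<Sum>l2<B. (bcoef l1 k1 * bcoef l2 k2) *\<^sub>C F e1 l1 e2 l2) \<noteq> 0}" "x \<notin> {..<B}"
      then show False using * [of x] by simp
    qed
  qed simp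
  then show ?thesis by (simp only: rot2_def 1)
qed

text \<open>A common bound for the powers of the logarithms over finitely many exponents turns the formal
  sums over powers into finite ones that may be exchanged with the sum over the exponents.\<close>

lemma fin_logs_bound:
  assumes "fin_logs F" "finite T"
  shows "\<exists>B. \<forall>(e1, e2)\<in>T. \<forall>l1 l2. B \<le> l1 \<or> B \<le> l2 \<longrightarrow> F e1 l1 e2 l2 = 0"
proof -
  define S where "S = (\<Union>(e1, e2)\<in>T. {(l1, l2). F e1 l1 e2 l2 \<noteq> 0})"
  have "finite S" unfolding S_def using assms by (auto simp: fin_logs_def)
  then have "finite (fst ` S \<union> snd ` S)" by simp
  then obtain B where B: "\<forall>x\<in>fst ` S \<union> snd ` S. x < B"
    using finite_nat_set_iff_bounded by blast
  have "F e1 l1 e2 l2 = 0" if "(e1, e2) \<in> T" "B \<le> l1 \<or> B \<le> l2" for e1 e2 l1 l2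
  proof (rule ccontr)
    assume "F e1 l1 e2 l2 \<noteq> 0"
    then have "(l1, l2) \<in> S" using that(1) unfolding S_def by blast
    then have "l1 < B" "l2 < B" using B by force+
    then show False using that(2) by simp
  qed
  then show ?thesis by blast
qed

lemma fin_logs_bound1:
  assumes "fin_logs F"
  obtains B where "\<And>l1 l2. B \<le> l1 \<or> B \<le> l2 \<Longrightarrow> F e1 l1 e2 l2 = 0"
  using fin_logs_bound [OF assms, of "{(e1, e2)}"] by auto

lemma rot2_diff:
  assumes "fin_logs F" "fin_logs G"
  shows "rot2 (F - G) = rot2 F - rot2 G"
proof (intro ext)
  fix e1 k1 e2 k2
  obtain B where B: "\<And>l1 l2. B \<le> l1 \<or> B \<le> l2 \<Longrightarrow> F e1 l1 e2 l2 = 0" using fin_logs_bound1 [OF assms(1)] by blast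
  obtain B' where B': "\<And>l1 l2. B' \<le> l1 \<or> B' \<le> l2 \<Longrightarrow> G e1 l1 e2 l2 = 0" using fin_logs_bound1 [OF assms(2)] by blast
  have "F e1 l1 e2 l2 = 0" "G e1 l1 e2 l2 = 0" if "B + B' \<le> l1 \<or> B + B' \<le> l2" for l1 l2
    using B B' that by auto
  then show "rot2 (F - G) e1 k1 e2 k2 = (rot2 F - rot2 G) e1 k1 e2 k2"
    by (simp add: rot2_sum [of "B + B'"] scaleC_diff_right sum_subtractf)
qed

lemma rot2_shiftz: "rot2 (shiftz F) = shiftz (rot2 F)"
  by (simp add: fun_eq_iff rot2_def shiftz_def exp_s_plus_1)

lemma rot2_inner_shiftz: "rot2 (inner shiftz F) = inner shiftz (rot2 F)"
  by (simp add: fun_eq_iff rot2_def shiftz_def inner_def exp_s_plus_1)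

lemma fin_logs_shiftz: "fin_logs F \<Longrightarrow> fin_logs (shiftz F)" "fin_logs F \<Longrightarrow> fin_logs (inner shiftz F)"
  by (simp_all add: fin_logs_def shiftz_def inner_def)

lemma rot2_mult_z12: "fin_logs F \<Longrightarrow> rot2 (mult_z12 F) = mult_z12 (rot2 F)"
  by (simp only: mult_z12_eq rot2_diff fin_logs_shiftz rot2_shiftz rot2_inner_shiftz)

lemma rot2_mult_z12_pow: "fin_logs F \<Longrightarrow> rot2 ((mult_z12 ^^ n) F) = (mult_z12 ^^ n) (rot2 F)"
  by (induction n) (simp_all add: rot2_mult_z12 fin_logs_pow)

lemma rot2_der:
  assumes "fin_logs F"
  shows "rot2 (der F) = der (rot2 F)"
proof (intro ext)
  fix e1 k1 e2 k2
  obtain B where B: "\<And>l1 l2. B \<le> l1 \<or> B \<le> l2 \<Longrightarrow> F (e1 + 1) l1 e2 l2 = 0" using fin_logs_bound1 [OF assms(1)] by blast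
  define X where "X l1 l2 = F (e1 + 1) l1 e2 l2" for l1 l2
  define h where "h = exp (\<s> * e1) * exp (\<s> * e2)"
  have d: "der F e1 l1 e2 l2 = (e1 + 1) *\<^sub>C X l1 l2 + of_nat (Suc l1) *\<^sub>C X (Suc l1) l2" for l1 l2
    by (simp add: der_def X_def)
  have "rot2 (der F) e1 k1 e2 k2 = h *\<^sub>C (\<Sum>l1<B. \<Sum>l2<B. (bcoef l1 k1 * bcoef l2 k2) *\<^sub>C der F e1 l1 e2 l2)"
    unfolding h_def by (rule rot2_sum) (auto simp: der_def B)
  also have "(\<Sum>l1<B. \<Sum>l2<B. (bcoef l1 k1 * bcoef l2 k2) *\<^sub>C der F e1 l1 e2 l2) =
     (e1 + 1) *\<^sub>C (\<Sum>l1<B. \<Sum>l2<B. (bcoef l1 k1 * bcoef l2 k2) *\<^sub>C X l1 l2) +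
     (\<Sum>l1<B. \<Sum>l2<B. (of_nat (Suc l1) * bcoef l1 k1 * bcoef l2 k2) *\<^sub>C X (Suc l1) l2)"
    unfolding d scaleC_sum_right sum.distrib [symmetric]
    by (intro sum.cong refl) (simp add: scaleC_add_right scaleC_scaleC ac_simps)
  also have "(\<Sum>l1<B. \<Sum>l2<B. (of_nat (Suc l1) * bcoef l1 k1 * bcoef l2 k2) *\<^sub>C X (Suc l1) l2) =
     (\<Sum>l1<B. \<Sum>l2<B. (of_nat (Suc k1) * bcoef (Suc l1) (Suc k1) * bcoef l2 k2) *\<^sub>C X (Suc l1) l2)"
    by (simp only: bcoef_Suc)
  also have "\<dots> = (\<Sum>l1<Suc B. \<Sum>l2<B. (of_nat (Suc k1) * bcoef l1 (Suc k1) * bcoef l2 k2) *\<^sub>C X l1 l2)"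
    by (subst sum.lessThan_Suc_shift) simp
  also have "\<dots> = of_nat (Suc k1) *\<^sub>C (\<Sum>l1<B. \<Sum>l2<B. (bcoef l1 (Suc k1) * bcoef l2 k2) *\<^sub>C X l1 l2)"
    by (simp add: X_def B scaleC_sum_right scaleC_scaleC mult.assoc)
  finally have 1: "rot2 (der F) e1 k1 e2 k2 = h *\<^sub>C ((e1 + 1) *\<^sub>C (\<Sum>l1<B. \<Sum>l2<B. (bcoef l1 k1 * bcoef l2 k2) *\<^sub>C X l1 l2) +
      of_nat (Suc k1) *\<^sub>C (\<Sum>l1<B. \<Sum>l2<B. (bcoef l1 (Suc k1) * bcoef l2 k2) *\<^sub>C X l1 l2))" .
  have "rot2 F (e1 + 1) k e2 k2 = h *\<^sub>C (\<Sum>l1<B. \<Sum>l2<B. (bcoef l1 k * bcoef l2 k2) *\<^sub>C X l1 l2)" for k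
    unfolding h_def X_def using rot2_sum [of B F "e1 + 1" e2 k k2] B by (simp add: exp_s_plus_1)
  then have "der (rot2 F) e1 k1 e2 k2 = (e1 + 1) *\<^sub>C h *\<^sub>C (\<Sum>l1<B. \<Sum>l2<B. (bcoef l1 k1 * bcoef l2 k2) *\<^sub>C X l1 l2) +
      of_nat (Suc k1) *\<^sub>C h *\<^sub>C (\<Sum>l1<B. \<Sum>l2<B. (bcoef l1 (Suc k1) * bcoef l2 k2) *\<^sub>C X l1 l2)"
    by (simp add: der_def)
  then show "rot2 (der F) e1 k1 e2 k2 = der (rot2 F) e1 k1 e2 k2"
    unfolding 1 by (simp only: scaleC_add_right scaleC_scaleC mult.commute)
qed

lemma rot2_der_pow: "fin_logs F \<Longrightarrow> rot2 ((der ^^ n) F) = (der ^^ n) (rot2 F)"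
  by (induction n) (simp_all add: rot2_der fin_logs_pow)

lemma rot2_swap12:
  assumes "fin_logs F"
  shows "rot2 (swap12 F) = swap12 (rot2 F)"
proof (intro ext)
  fix e2 k2 e1 k1
  obtain B where B: "\<And>l1 l2. B \<le> l1 \<or> B \<le> l2 \<Longrightarrow> F e1 l1 e2 l2 = 0" using fin_logs_bound1 [OF assms(1)] by blast
  have "rot2 (swap12 F) e2 k2 e1 k1 = (exp (\<s> * e2) * exp (\<s> * e1)) *\<^sub>C
     (\<Sum>l1<B. \<Sum>l2<B. (bcoef l1 k2 * bcoef l2 k1) *\<^sub>C F e1 l2 e2 l1)"
    using rot2_sum [of B "swap12 F" e2 e1 k2 k1] B by (simp add: swap12_def disj_commute)
  also have "\<dots> = rot2 F e1 k1 e2 k2"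
    using rot2_sum [of B F e1 e2 k1 k2] B by (subst sum.swap) (simp add: mult.commute)
  finally show "rot2 (swap12 F) e2 k2 e1 k1 = swap12 (rot2 F) e2 k2 e1 k1"
    by (simp add: swap12_def)
qed

lemma nice2_rot2: "nice2 F \<Longrightarrow> nice2 (rot2 F)"
proof (rule nice2_mono, assumption)
  fix e1 k1 e2 k2
  assume "rot2 F e1 k1 e2 k2 \<noteq> 0"
  then have "Sum_any (\<lambda>l1. Sum_any (\<lambda>l2. (bcoef l1 k1 * bcoef l2 k2) *\<^sub>C F e1 l1 e2 l2)) \<noteq> 0"
    by (simp add: rot2_def)
  then show "\<exists>k1 k2. F e1 k1 e2 k2 \<noteq> 0"
    by (elim Sum_any.not_neutral_obtains_not_neutral) auto
qed

text \<open>On the diagonal $(\zeta + 2\pi i)^{l_1}(\zeta + 2\pi i)^{l_2} = (\zeta + 2\pi i)^{l_1+l_2}$, which is \<open>bcoef_vandermonde\<close>.\<close>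

lemma diag_rot2:
  assumes "fin_logs F" "nice2 F"
  shows "diag (rot2 F) = rot (diag F)"
proof (intro ext)
  fix e k
  define T where "T = {e1. \<exists>k1 k2. F e1 k1 (e - e1) k2 \<noteq> 0}"
  have T: "finite T" unfolding T_def by (rule nice2D [OF assms(2)])
  obtain B where Bf: "\<forall>(e1, e2)\<in>(\<lambda>e1. (e1, e - e1)) ` T. \<forall>l1 l2. B \<le> l1 \<or> B \<le> l2 \<longrightarrow> F e1 l1 e2 l2 = 0"
    using fin_logs_bound [OF assms(1) finite_imageI [OF T]] by blast
  have B: "F e1 l1 (e - e1) l2 = 0" if l: "B \<le> l1 \<or> B \<le> l2" for e1 l1 l2
  proof (cases "e1 \<in> T")
    case True
    then show ?thesis using Bf l by auto
  next
    case False
    then show ?thesis by (simp add: T_def)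
  qed
  define g where "g l1 l2 = (\<Sum>e1\<in>T. F e1 l1 (e - e1) l2)" for l1 l2
  have g0: "g l1 l2 = 0" if "B \<le> l1 \<or> B \<le> l2" for l1 l2
    using that by (simp add: g_def B)
  have g1: "l1 < B \<and> l2 < B" if "g l1 l2 \<noteq> 0" for l1 l2
    using g0 [of l1 l2] that by (simp add: not_le [symmetric]) blast
  have expo: "exp (\<s> * e1) * exp (\<s> * (e - e1)) = exp (\<s> * e)" for e1
    by (simp add: exp_add [symmetric] algebra_simps)
  have r: "rot2 F e1 k1 (e - e1) k2 = exp (\<s> * e) *\<^sub>C
      (\<Sum>l1<B. \<Sum>l2<B. (bcoef l1 k1 * bcoef l2 k2) *\<^sub>C F e1 l1 (e - e1) l2)" for e1 k1 k2
    unfolding expo [of e1, symmetric] by (rule rot2_sum) (rule B)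
  have "diag (rot2 F) e k = (\<Sum>k1\<le>k. \<Sum>e1\<in>T. rot2 F e1 k1 (e - e1) (k - k1))"
    unfolding diag_def
  proof (intro sum.cong refl Sum_any.expand_superset T subsetI, clarify)
    fix k1 e1 assume *: "rot2 F e1 k1 (e - e1) (k - k1) \<noteq> 0"
    show "e1 \<in> T"
    proof (rule ccontr)
      assume "e1 \<notin> T"
      then have "F e1 l1 (e - e1) l2 = 0" for l1 l2 by (auto simp: T_def)
      then show False using * by (simp add: rot2_def)
    qed
  qed
  also have "\<dots> = (\<Sum>k1\<le>k. \<Sum>e1\<in>T. exp (\<s> * e) *\<^sub>C (\<Sum>l1<B. \<Sum>l2<B. (bcoef l1 k1 * bcoef l2 (k - k1)) *\<^sub>C F e1 l1 (e - e1) l2))"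
    by (intro sum.cong refl r)
  also have "\<dots> = exp (\<s> * e) *\<^sub>C (\<Sum>k1\<le>k. \<Sum>e1\<in>T. \<Sum>l1<B. \<Sum>l2<B. (bcoef l1 k1 * bcoef l2 (k - k1)) *\<^sub>C F e1 l1 (e - e1) l2)"
    by (simp only: scaleC_sum_right)
  also have "(\<Sum>k1\<le>k. \<Sum>e1\<in>T. \<Sum>l1<B. \<Sum>l2<B. (bcoef l1 k1 * bcoef l2 (k - k1)) *\<^sub>C F e1 l1 (e - e1) l2) =
      (\<Sum>k1\<le>k. \<Sum>l1<B. \<Sum>e1\<in>T. \<Sum>l2<B. (bcoef l1 k1 * bcoef l2 (k - k1)) *\<^sub>C F e1 l1 (e - e1) l2)"
    by (intro sum.cong refl sum.swap)
  also have "\<dots> = (\<Sum>k1\<le>k. \<Sum>l1<B. \<Sum>l2<B. (bcoef l1 k1 * bcoef l2 (k - k1)) *\<^sub>C g l1 l2)"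
    unfolding g_def scaleC_sum_right by (intro sum.cong refl sum.swap)
  also have "\<dots> = (\<Sum>l1<B. \<Sum>k1\<le>k. \<Sum>l2<B. (bcoef l1 k1 * bcoef l2 (k - k1)) *\<^sub>C g l1 l2)"
    by (rule sum.swap)
  also have "\<dots> = (\<Sum>l1<B. \<Sum>l2<B. \<Sum>k1\<le>k. (bcoef l1 k1 * bcoef l2 (k - k1)) *\<^sub>C g l1 l2)"
    by (intro sum.cong refl sum.swap)
  also have "\<dots> = (\<Sum>l1<B. \<Sum>l2<B. bcoef (l1 + l2) k *\<^sub>C g l1 l2)"
    by (simp only: scaleC_sum_left [symmetric] bcoef_vandermonde)
  also have "\<dots> = (\<Sum>(l1, l2)\<in>{..<B} \<times> {..<B}. bcoef (l1 + l2) k *\<^sub>C g l1 l2)"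
    by (simp add: sum.cartesian_product)
  also have "\<dots> = (\<Sum>(l1, l2)\<in>{(i, j). i + j < B + B}. bcoef (l1 + l2) k *\<^sub>C g l1 l2)"
  proof (rule sum.mono_neutral_left)
    show "finite {(i, j). i + j < B + B}"
      by (rule finite_subset [of _ "{..<B + B} \<times> {..<B + B}"]) auto
    show "\<forall>x\<in>{(i, j). i + j < B + B} - {..<B} \<times> {..<B}. (case x of (l1, l2) \<Rightarrow> bcoef (l1 + l2) k *\<^sub>C g l1 l2) = 0"
      using g1 by auto
  qed auto
  also have "\<dots> = (\<Sum>l<B + B. \<Sum>l1\<le>l. bcoef (l1 + (l - l1)) k *\<^sub>C g l1 (l - l1))"
    by (rule sum.triangle_reindex)
  also have "\<dots> = (\<Sum>l<B + B. bcoef l k *\<^sub>C diag F e l)"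
  proof (intro sum.cong refl)
    fix l
    have "diag F e l = (\<Sum>l1\<le>l. g l1 (l - l1))"
      unfolding diag_def g_def
      by (intro sum.cong refl Sum_any.expand_superset T) (auto simp: T_def)
    then show "(\<Sum>l1\<le>l. bcoef (l1 + (l - l1)) k *\<^sub>C g l1 (l - l1)) = bcoef l k *\<^sub>C diag F e l"
      by (simp add: scaleC_sum_right)
  qed
  also have "exp (\<s> * e) *\<^sub>C (\<Sum>l<B + B. bcoef l k *\<^sub>C diag F e l) = rot (diag F) e k"
  proof (rule rot_sum [symmetric])
    fix l assume l: "B + B \<le> l"
    have "diag F e l = (\<Sum>l1\<le>l. g l1 (l - l1))"
      unfolding diag_def g_def
      by (intro sum.cong refl Sum_any.expand_superset T) (auto simp: T_def)
    also have "\<dots> = 0" using l by (intro sum.neutral ballI g0) auto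
    finally show "diag F e l = 0" .
  qed
  finally show "diag (rot2 F) e k = rot (diag F) e k" .
qed

lemma rot_scaleC:
  assumes "\<And>e. finite {k. f e k \<noteq> 0}"
  shows "rot (c *\<^sub>C f) = c *\<^sub>C rot f"
proof (intro ext)
  fix e k
  have "Sum_any (\<lambda>l. c *\<^sub>C bcoef l k *\<^sub>C f e l) = c *\<^sub>C Sum_any (\<lambda>l. bcoef l k *\<^sub>C f e l)"
    by (rule clinear_Sum_any [OF clinear_scale, symmetric]) (rule finite_subset [OF _ assms [of e]], auto)
  then show "rot (c *\<^sub>C f) e k = (c *\<^sub>C rot f) e k"
    by (simp add: rot_def scaleC_scaleC mult.commute)
qed

lemma monodromy_LFie:
  assumes "a \<in> LFie"
  shows "monodromy a \<in> LFie"
proof -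
  obtain S where S: "finite S" "\<And>v. low_in S (supp (a v))" using LFie_classes [OF assms] by blast
  have fin: "finite {l. bcoef l k *\<^sub>C a v e l \<noteq> 0}" for v e k
    by (rule finite_subset [OF _ LFie_finite [OF assms, of v e]]) auto
  show ?thesis
  proof (rule LFieI [OF _ _ S(1)])
    show "clinear (\<lambda>v. monodromy a v e k)" for e k
    proof (rule clinearI)
      show "monodromy a (v + w) e k = monodromy a v e k + monodromy a w e k" for v w
        unfolding monodromy_eq rot_def clinear_add [OF LFie_linear [OF assms]] scaleC_add_right
          Sum_any.distrib [OF fin fin] by (rule refl)
      show "monodromy a (c *\<^sub>C v) e k = c *\<^sub>C monodromy a v e k" for c v
      proof -
        have "a (c *\<^sub>C v) = c *\<^sub>C a v" by (simp add: fun_eq_iff clinear_scaleC [OF LFie_linear [OF assms]])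
        then show ?thesis using rot_scaleC [of "a v" c] LFie_finite [OF assms] by (simp add: monodromy_eq)
      qed
    qed
    show "finite {k. monodromy a v e k \<noteq> 0}" for v e
    proof -
      obtain B where "\<forall>l\<in>{k. a v e k \<noteq> 0}. l < B" using LFie_finite [OF assms, of v e] finite_nat_set_iff_bounded by blast
      then have B: "a v e l = 0" if "B \<le> l" for l using that by force
      have eq: "rot (a v) e k = exp (\<s> * e) *\<^sub>C (\<Sum>l<B. bcoef l k *\<^sub>C a v e l)" for k
        by (rule rot_sum) (rule B)
      have "monodromy a v e k = 0" if "B \<le> k" for k
        unfolding monodromy_eq eq using that by simp
      then have "{k. monodromy a v e k \<noteq> 0} \<subseteq> {..<B}" by (auto simp flip: not_le)
      then show ?thesis by (rule finite_subset) simp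
    qed
    show "low_in S (supp (monodromy a v))" for v
    proof (rule low_in_subset [OF S(2)], rule subsetI)
      fix e assume "e \<in> supp (monodromy a v)"
      then obtain k where "Sum_any (\<lambda>l. bcoef l k *\<^sub>C a v e l) \<noteq> 0" by (auto simp: supp_def monodromy_eq rot_def)
      then show "e \<in> supp (a v)"
        by (elim Sum_any.not_neutral_obtains_not_neutral) (auto simp: supp_def)
    qed
  qed
qed

lemma ab_series_monodromy:
  assumes "a \<in> LFie" "b \<in> LFie"
  shows "ab_series (monodromy a) (monodromy b) v = rot2 (ab_series a b v)"
proof (intro ext)
  fix e1 k1 e2 k2
  obtain B where B: "\<And>l1 l2. B \<le> l1 \<or> B \<le> l2 \<Longrightarrow> ab_series a b v e1 l1 e2 l2 = 0"
    using fin_logs_bound1 [OF fin_logs_ab [OF assms]] by blast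
  obtain C where "\<forall>l\<in>{k. b v e2 k \<noteq> 0}. l < C" using LFie_finite [OF assms(2), of v e2] finite_nat_set_iff_bounded by blast
  then have C: "b v e2 l = 0" if "B + C \<le> l" for l using that by force
  have D: "ab_series a b v e1 l1 e2 l2 = 0" if "B + C \<le> l1 \<or> B + C \<le> l2" for l1 l2
    using B that by auto
  define w where "w = (\<Sum>l2<B + C. bcoef l2 k2 *\<^sub>C b v e2 l2)"
  have aw: "a w e1 l1 = (\<Sum>l2<B + C. bcoef l2 k2 *\<^sub>C ab_series a b v e1 l1 e2 l2)" for l1
    unfolding w_def clinear_sum [OF LFie_linear [OF assms(1)]] clinear_scaleC [OF LFie_linear [OF assms(1)]]
    by (simp add: ab_series_def)
  have eq: "rot (b v) e2 k2 = exp (\<s> * e2) *\<^sub>C w"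
    unfolding w_def by (rule rot_sum) (rule C)
  have eq2: "rot2 (ab_series a b v) e1 k1 e2 k2 = (exp (\<s> * e1) * exp (\<s> * e2)) *\<^sub>C
     (\<Sum>l1<B + C. \<Sum>l2<B + C. (bcoef l1 k1 * bcoef l2 k2) *\<^sub>C ab_series a b v e1 l1 e2 l2)"
    by (rule rot2_sum) (rule D)
  have "ab_series (monodromy a) (monodromy b) v e1 k1 e2 k2 = monodromy a (exp (\<s> * e2) *\<^sub>C w) e1 k1"
    unfolding ab_series_def monodromy_eq [of b] eq ..
  also have "\<dots> = exp (\<s> * e2) *\<^sub>C monodromy a w e1 k1"
    by (rule clinear_scaleC [OF LFie_linear [OF monodromy_LFie [OF assms(1)]]])
  also have "monodromy a w e1 k1 = exp (\<s> * e1) *\<^sub>C (\<Sum>l1<B + C. bcoef l1 k1 *\<^sub>C a w e1 l1)"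
    unfolding monodromy_eq by (rule rot_sum) (simp add: aw D)
  also have "exp (\<s> * e2) *\<^sub>C exp (\<s> * e1) *\<^sub>C (\<Sum>l1<B + C. bcoef l1 k1 *\<^sub>C a w e1 l1) = rot2 (ab_series a b v) e1 k1 e2 k2"
    unfolding eq2 aw scaleC_scaleC scaleC_sum_right
    by (intro sum.cong refl) (simp add: mult_ac)
  finally show "ab_series (monodromy a) (monodromy b) v e1 k1 e2 k2 = rot2 (ab_series a b v) e1 k1 e2 k2" .
qed

lemma fin_logs_swap12: "fin_logs F \<Longrightarrow> fin_logs (swap12 F)"
  unfolding fin_logs_def
proof safe
  fix e1 e2
  assume *: "\<forall>e1 e2. finite {(k1, k2). F e1 k1 e2 k2 \<noteq> 0}"
  have "{(k1, k2). swap12 F e1 k1 e2 k2 \<noteq> 0} \<subseteq> prod.swap ` {(k1, k2). F e2 k1 e1 k2 \<noteq> 0}"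
    by (force simp: swap12_def)
  then show "finite {(k1, k2). swap12 F e1 k1 e2 k2 \<noteq> 0}"
    by (rule finite_subset) (use * in blast)
qed

text \<open>Multiplication by $z_{12}$, the derivative and the restriction to the diagonal all commute with monodromy.\<close>

theorem nth_product_monodromy:
  assumes "a \<in> LFie" "b \<in> LFie" "mutually_local a b"
  shows "mutually_local (monodromy a) (monodromy b)"
    and "nth_product (monodromy a) n (monodromy b) = monodromy (nth_product a n b)"
proof -
  obtain N where N: "local_of_order N a b" using assms(3) by (auto simp: mutually_local_def)
  have fl: "fin_logs (ab_series a b v)" "fin_logs (ab_series b a v)" for v
    by (simp_all add: fin_logs_ab assms)
  have "(mult_z12 ^^ N) (rot2 (ab_series a b v)) = (mult_z12 ^^ N) (swap12 (rot2 (ab_series b a v)))" for v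
  proof -
    have "(mult_z12 ^^ N) (rot2 (ab_series a b v)) = rot2 ((mult_z12 ^^ N) (ab_series a b v))"
      by (simp only: rot2_mult_z12_pow fl)
    also have "\<dots> = rot2 ((mult_z12 ^^ N) (swap12 (ab_series b a v)))"
      using N by (simp add: local_of_order_iff)
    also have "\<dots> = (mult_z12 ^^ N) (swap12 (rot2 (ab_series b a v)))"
      by (simp only: rot2_mult_z12_pow fl fin_logs_swap12 rot2_swap12)
    finally show ?thesis .
  qed
  then have N': "local_of_order N (monodromy a) (monodromy b)"
    by (simp add: local_of_order_iff ab_series_monodromy assms)
  then show ml: "mutually_local (monodromy a) (monodromy b)" by (auto simp: mutually_local_def)
  show "nth_product (monodromy a) n (monodromy b) = monodromy (nth_product a n b)"
  proof
    fix v
    note nN = local_nice2 [OF assms(1,2) N, of v]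
    have nN': "nice2 ((mult_z12 ^^ N) (rot2 (ab_series a b v)))"
      using nice2_rot2 [OF nN] by (simp only: rot2_mult_z12_pow fl)
    define p where "p = nat (int N - 1 - n)"
    let ?G = "(der ^^ p) ((mult_z12 ^^ N) (ab_series a b v))"
    have G: "fin_logs ?G" "nice2 ?G" by (simp_all add: fin_logs_pow fl nice2_der_pow nN)
    have "nth_product (monodromy a) n (monodromy b) v = taylor (int N - 1 - n) ((mult_z12 ^^ N) (rot2 (ab_series a b v)))"
      by (simp add: nth_product_eq monodromy_LFie assms ml ab_series_monodromy resprod_eq [OF nN'])
    also have "\<dots> = rot (taylor (int N - 1 - n) ((mult_z12 ^^ N) (ab_series a b v)))"
    proof (cases "int N - 1 - n < 0")
      case True
      then show ?thesis by (simp add: fun_eq_iff rot_def)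
    next
      case False
      have "diag ((der ^^ p) ((mult_z12 ^^ N) (rot2 (ab_series a b v)))) = diag (rot2 ?G)"
        by (simp only: rot2_mult_z12_pow rot2_der_pow fin_logs_pow fl)
      also have "\<dots> = rot (diag ?G)" by (rule diag_rot2 [OF G])
      finally show ?thesis
        unfolding taylor_def p_def [symmetric] using False
        by (simp only: if_False rot_scaleC [OF fin_logs_diag [OF G]])
    qed
    also have "\<dots> = monodromy (nth_product a n b) v"
      by (simp add: monodromy_eq nth_product_eq assms resprod_eq [OF nN])
    finally show "nth_product (monodromy a) n (monodromy b) v = monodromy (nth_product a n b) v" .
  qed
qed

subsection \<open>Fields with unipotent monodromy\<close>

text \<open>The hypothesis says that $g(\zeta) = \sum_l g_l\zeta^l$ satisfies $g(\zeta + 2\pi i) = \mu g(\zeta)$. Comparing top coefficients gives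
  $\mu = 1$, comparing the next ones gives degree 0.\<close>

lemma unipotent_rot:
  assumes fin: "finite {l. g l \<noteq> 0}" and rel: "\<And>k. Sum_any (\<lambda>l. bcoef l k *\<^sub>C g l) = \<mu> *\<^sub>C g k"
    and "g l \<noteq> 0"
  shows "\<mu> = 1 \<and> l = 0"
proof -
  define d where "d = Max {l. g l \<noteq> 0}"
  have d: "g d \<noteq> 0" "\<And>l. d < l \<Longrightarrow> g l = 0"
    using Max_in [OF fin] Max_ge [OF fin] assms(3) unfolding d_def by (auto simp flip: not_le)
  have "Sum_any (\<lambda>l. bcoef l d *\<^sub>C g l) = (\<Sum>l\<in>{d}. bcoef l d *\<^sub>C g l)"
    by (rule Sum_any.expand_superset) (use d in \<open>auto, metis bcoef_0 linorder_neqE_nat\<close>)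
  then have "\<mu> *\<^sub>C g d = 1 *\<^sub>C g d" using rel [of d] by simp
  then have \<mu>: "\<mu> = 1" using d(1) complex_vector.scale_cancel_right by blast
  have "d = 0"
  proof (rule ccontr)
    assume "d \<noteq> 0"
    then obtain e where e: "d = Suc e" by (metis not0_implies_Suc)
    have "Sum_any (\<lambda>l. bcoef l e *\<^sub>C g l) = (\<Sum>l\<in>{e, d}. bcoef l e *\<^sub>C g l)"
    proof (rule Sum_any.expand_superset)
      have "bcoef l e *\<^sub>C g l = 0" if "l \<notin> {e, d}" for l
        using that d(2) [of l] by (cases "l < e") (auto simp: e)
      then show "{l. bcoef l e *\<^sub>C g l \<noteq> 0} \<subseteq> {e, d}" by blast
    qed simp
    then have "bcoef d e *\<^sub>C g d = 0" using rel [of e] \<mu> e by simp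
    then show False using d(1) e s_nonzero by (simp add: bcoef_def del: of_nat_Suc)
  qed
  moreover have "l \<le> d" using d(2) assms(3) by (metis not_le)
  ultimately show ?thesis using \<mu> by simp
qed

text \<open>With \<open>x l\<close> read as $N^l x$, this is $e^{-(\zeta+2\pi i)N}x = e^{-2\pi iN}e^{-\zeta N}x$.\<close>

lemma rot_alternating:
  fixes x :: "nat \<Rightarrow> 'w::complex_vector"
  assumes x0: "\<And>l. n \<le> l \<Longrightarrow> x l = 0"
  shows "Sum_any (\<lambda>l. bcoef l k *\<^sub>C ((- 1) ^ l / fact l) *\<^sub>C x l) =
    (\<Sum>i<n. ((- \<s>) ^ i / fact i) *\<^sub>C ((- 1) ^ k / fact k) *\<^sub>C x (k + i))"
proof -
  define h where "h l = ((- 1) ^ l / fact l) *\<^sub>C x l" for l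
  have h0: "h l = 0" if "n \<le> l" for l using that by (simp add: h_def x0)
  have "Sum_any (\<lambda>l. bcoef l k *\<^sub>C h l) = (\<Sum>l\<in>{0 + k..<n + k}. bcoef l k *\<^sub>C h l)"
  proof (rule Sum_any.expand_superset)
    have "bcoef l k *\<^sub>C h l = 0" if "l \<notin> {0 + k..<n + k}" for l
      using that h0 [of l] by (cases "l < k") auto
    then show "{l. bcoef l k *\<^sub>C h l \<noteq> 0} \<subseteq> {0 + k..<n + k}" by blast
  qed simp
  also have "\<dots> = (\<Sum>i<n. bcoef (i + k) k *\<^sub>C h (i + k))"
    by (simp only: sum.shift_bounds_nat_ivl atLeast0LessThan)
  also have "\<dots> = (\<Sum>i<n. ((- \<s>) ^ i / fact i) *\<^sub>C ((- 1) ^ k / fact k) *\<^sub>C x (k + i))"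
  proof (intro sum.cong refl)
    fix i
    have "bcoef (i + k) k * ((- 1) ^ (i + k) / fact (i + k)) = ((- \<s>) ^ i / fact i) * ((- 1) ^ k / fact k)"
      by (simp add: bcoef_def binomial_fact power_add power_minus [of \<s>] field_simps)
    then show "bcoef (i + k) k *\<^sub>C h (i + k) = ((- \<s>) ^ i / fact i) *\<^sub>C ((- 1) ^ k / fact k) *\<^sub>C x (k + i)"
      by (simp only: h_def scaleC_scaleC add.commute [of k i])
  qed
  finally show ?thesis by (simp only: h_def)
qed

text \<open>The coefficients \<open>f j k\<close> are those of $z^\gamma\zeta^k$ in the field of $N^ja$. Subtracting the expected
  solution $e^{-\zeta N}$ leaves a polynomial in $\zeta$ without constant term that is quasi-periodic, by induction on
  the nilpotency order; it vanishes by \<open>unipotent_rot\<close>.\<close>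

lemma log_form_abstract:
  fixes f :: "nat \<Rightarrow> nat \<Rightarrow> 'w::complex_vector"
  assumes fin: "\<And>j. finite {l. f j l \<noteq> 0}" and van: "\<And>j k. n \<le> j \<Longrightarrow> f j k = 0"
    and rel: "\<And>j k. Sum_any (\<lambda>l. bcoef l k *\<^sub>C f j l) = \<mu> *\<^sub>C (\<Sum>i<n. ((- \<s>) ^ i / fact i) *\<^sub>C f (j + i) k)"
  shows "f j k = (if \<mu> = 1 then ((- 1) ^ k / fact k) *\<^sub>C f (j + k) 0 else 0)"
proof (induction "n - j" arbitrary: j k rule: less_induct)
  case less
  show ?case
  proof (cases "n \<le> j")
    case True
    then show ?thesis by (simp add: van)
  next
    case False
    then obtain n' where n': "n = Suc n'" by (metis le0 not0_implies_Suc)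
    have IH: "f (j + Suc i) k = (if \<mu> = 1 then ((- 1) ^ k / fact k) *\<^sub>C f (j + Suc i + k) 0 else 0)" for i k
      by (rule less) (use False in simp)
    have split: "(\<Sum>i<n. ((- \<s>) ^ i / fact i) *\<^sub>C f (j + i) k) =
        f j k + (\<Sum>i<n'. ((- \<s>) ^ Suc i / fact (Suc i)) *\<^sub>C f (j + Suc i) k)" for k
      unfolding n' by (subst sum.lessThan_Suc_shift) simp
    show ?thesis
    proof (cases "\<mu> = 1")
      case False
      have "Sum_any (\<lambda>l. bcoef l k *\<^sub>C f j l) = \<mu> *\<^sub>C f j k" for k
        unfolding rel split using False IH by simp
      then have "f j k = 0" using unipotent_rot [OF fin] False by blast
      then show ?thesis using False by simp
    next
      case True
      define h where "h k = ((- 1) ^ k / fact k) *\<^sub>C f (j + k) 0" for k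
      define g where "g k = f j k - h k" for k
      have h0: "h k = 0" if "n \<le> k" for k using that by (simp add: h_def van)
      have finh: "finite {l. h l \<noteq> 0}"
        by (rule finite_subset [of _ "{..<n}"]) (use h0 in \<open>auto simp flip: not_le\<close>)
      have fing: "finite {l. g l \<noteq> 0}"
        by (rule finite_subset [of _ "{l. f j l \<noteq> 0} \<union> {l. h l \<noteq> 0}"]) (use fin finh in \<open>auto simp: g_def\<close>)
      have bfin: "finite {l. bcoef l k *\<^sub>C x l \<noteq> 0}" if "finite {l. x l \<noteq> 0}" for k and x :: "nat \<Rightarrow> 'w"
        by (rule finite_subset [OF _ that]) auto
      have sumh: "Sum_any (\<lambda>l. bcoef l k *\<^sub>C h l) = h k + (\<Sum>i<n'. ((- \<s>) ^ Suc i / fact (Suc i)) *\<^sub>C f (j + Suc i) k)" for k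
      proof -
        have "Sum_any (\<lambda>l. bcoef l k *\<^sub>C h l) = (\<Sum>i<n. ((- \<s>) ^ i / fact i) *\<^sub>C ((- 1) ^ k / fact k) *\<^sub>C f (j + (k + i)) 0)"
          unfolding h_def by (rule rot_alternating) (simp add: van)
        also have "\<dots> = h k + (\<Sum>i<n'. ((- \<s>) ^ Suc i / fact (Suc i)) *\<^sub>C ((- 1) ^ k / fact k) *\<^sub>C f (j + Suc i + k) 0)"
          unfolding n' by (subst sum.lessThan_Suc_shift) (simp add: h_def ac_simps)
        finally show ?thesis using IH True by simp
      qed
      have "Sum_any (\<lambda>l. bcoef l k *\<^sub>C g l) = 1 *\<^sub>C g k" for k
      proof -
        have "Sum_any (\<lambda>l. bcoef l k *\<^sub>C g l) + Sum_any (\<lambda>l. bcoef l k *\<^sub>C h l) = Sum_any (\<lambda>l. bcoef l k *\<^sub>C f j l)"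
          by (subst Sum_any.distrib [OF bfin [OF fing] bfin [OF finh], symmetric])
            (simp add: g_def scaleC_diff_right)
        then show ?thesis
          unfolding rel split sumh using True by (simp add: g_def algebra_simps)
      qed
      moreover have "g 0 = 0" by (simp add: g_def h_def)
      ultimately have "g k = 0" using unipotent_rot [OF fing, of 1] by metis
      then show ?thesis using True by (simp add: g_def h_def)
    qed
  qed
qed

lemma graded_partD: "a \<in> graded_part \<sigma> m \<Longrightarrow> \<sigma> a = exp (- \<s> * m) *\<^sub>C a"
  by (simp add: graded_part_def \<s>_def)

lemma graded_part_iff: "a \<in> graded_part \<sigma> m \<longleftrightarrow> \<sigma> a = exp (- \<s> * m) *\<^sub>C a"
  by (simp add: graded_part_def \<s>_def)

context jordan
begin

lemma graded_N_pow: "a \<in> graded_part \<sigma> m \<Longrightarrow> (N ^^ j) a \<in> graded_part \<sigma> m"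
  by (simp add: graded_part_iff sigma_N_pow clinear_scaleC [OF N_pow_lin])

text \<open>A field with the monodromy prescribed by \<open>\<phi>\<close> is determined by its part without logarithms, which
  moreover has exponents in a single class.\<close>

lemma twisted_log_form:
  assumes lin: "clinear X" and LF: "\<And>a. X a \<in> LFie" and mono: "\<And>a. X (\<phi> a) = monodromy (X a)"
    and a: "a \<in> graded_part \<sigma> m"
  shows "X a v e k = (if e + m \<in> \<int> then ((- 1) ^ k / fact k) *\<^sub>C X ((N ^^ k) a) v e 0 else 0)"
proof -
  obtain n where n: "\<And>a. (N ^^ n) a = 0" using N_nilp by blast
  define \<mu> where "\<mu> = exp (- \<s> * (m + e))"
  have lin': "clinear (\<lambda>a. X a v e k)" for k
    using lin by (simp add: clinear_iff)
  define f where "f j k = X ((N ^^ j) a) v e k" for j k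
  have rel: "Sum_any (\<lambda>l. bcoef l k *\<^sub>C f j l) = \<mu> *\<^sub>C (\<Sum>i<n. ((- \<s>) ^ i / fact i) *\<^sub>C f (j + i) k)" for j k
  proof -
    have "exp (\<s> * e) *\<^sub>C Sum_any (\<lambda>l. bcoef l k *\<^sub>C f j l) = X (\<phi> ((N ^^ j) a)) v e k"
      unfolding mono monodromy_eq rot_def f_def ..
    also have "\<phi> ((N ^^ j) a) = exp (- \<s> * m) *\<^sub>C u ((N ^^ j) a)"
      by (rule phi_eigen(1)) (rule graded_partD [OF graded_N_pow [OF a]])
    also have "u ((N ^^ j) a) = (\<Sum>i<n. ((- \<s>) ^ i / fact i) *\<^sub>C (N ^^ (j + i)) a)"
      unfolding u_def exp_nilp_sum [OF N_lin n] tau_s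
      by (simp only: comp_apply [symmetric, of "N ^^ _"] funpow_add [symmetric] add.commute)
    also have "X (exp (- \<s> * m) *\<^sub>C (\<Sum>i<n. ((- \<s>) ^ i / fact i) *\<^sub>C (N ^^ (j + i)) a)) v e k =
        exp (- \<s> * m) *\<^sub>C (\<Sum>i<n. ((- \<s>) ^ i / fact i) *\<^sub>C f (j + i) k)"
      by (simp only: clinear_scaleC [OF lin'] clinear_sum [OF lin'] f_def)
    finally have *: "exp (\<s> * e) *\<^sub>C Sum_any (\<lambda>l. bcoef l k *\<^sub>C f j l) =
       exp (- \<s> * m) *\<^sub>C (\<Sum>i<n. ((- \<s>) ^ i / fact i) *\<^sub>C f (j + i) k)" .
    have "exp (\<s> * e) *\<^sub>C Sum_any (\<lambda>l. bcoef l k *\<^sub>C f j l) =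
       exp (\<s> * e) *\<^sub>C \<mu> *\<^sub>C (\<Sum>i<n. ((- \<s>) ^ i / fact i) *\<^sub>C f (j + i) k)"
    proof -
      have "exp (\<s> * e) * \<mu> = exp (- \<s> * m)"
        unfolding \<mu>_def mult_exp_exp by (rule arg_cong [where f = exp]) (simp add: algebra_simps)
      then show ?thesis unfolding * scaleC_scaleC by simp
    qed
    then show ?thesis by (simp only: scaleC_cancel exp_not_eq_zero simp_thms)
  qed
  have "f 0 k = (if \<mu> = 1 then ((- 1) ^ k / fact k) *\<^sub>C f (0 + k) 0 else 0)"
  proof (rule log_form_abstract [OF _ _ rel])
    show "finite {l. f j l \<noteq> 0}" for j unfolding f_def by (rule LFie_finite [OF LF])
    show "f j k = 0" if "n \<le> j" for j k
      unfolding f_def funpow_kernel_mono [OF N_lin n that] by (rule clinear_0 [OF lin'])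
  qed
  moreover have "\<mu> = 1 \<longleftrightarrow> e + m \<in> \<int>"
  proof -
    have "\<mu> = 1 \<longleftrightarrow> - (m + e) \<in> \<int>"
      unfolding \<mu>_def minus_mult_commute using exp_s_int [of "- (m + e)"] exp_s_eq_1 [of "- (m + e)"] by blast
    also have "\<dots> \<longleftrightarrow> e + m \<in> \<int>"
      by (metis Ints_minus add.commute minus_minus)
    finally show ?thesis .
  qed
  ultimately show ?thesis by (simp add: f_def)
qed

end

section \<open>Operator product expansions and commutators of modes\<close>

subsection \<open>Series cut below an exponent\<close>

text \<open>\<open>cut \<alpha> F\<close> keeps the exponents $-\alpha - 1, -\alpha - 2, \dots$ of $z_1$. For a combination \<open>F\<close> of
  derivatives of delta functions this is half of the formal distribution, expanded in $|z_1| > |z_2|$, and it is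
  admissible although \<open>F\<close> is not. \<open>corner\<close> is the boundary term of \<open>cut\<close> under $z_{12}$.\<close>

definition below :: "complex \<Rightarrow> complex \<Rightarrow> bool"
  where "below \<alpha> e \<longleftrightarrow> (\<exists>i::nat. e = - \<alpha> - 1 - of_nat i)"

definition cut :: "complex \<Rightarrow> 'u::complex_vector lseries2 \<Rightarrow> 'u lseries2"
  where "cut \<alpha> F e1 k1 e2 k2 = (if below \<alpha> e1 then F e1 k1 e2 k2 else 0)"

definition corner :: "complex \<Rightarrow> 'u::complex_vector lseries2 \<Rightarrow> 'u lseries2"
  where "corner \<alpha> F e1 k1 e2 k2 = (if e1 = - \<alpha> then F (- \<alpha> - 1) k1 e2 k2 else 0)"

lemma below_step: "below \<alpha> (e - 1) \<longleftrightarrow> below \<alpha> e \<or> e = - \<alpha>"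
proof
  assume "below \<alpha> (e - 1)"
  then obtain i :: nat where i: "e - 1 = - \<alpha> - 1 - of_nat i" by (auto simp: below_def)
  show "below \<alpha> e \<or> e = - \<alpha>"
  proof (cases i)
    case 0
    then show ?thesis using i by simp
  next
    case (Suc j)
    then have "e = - \<alpha> - 1 - of_nat j" using i by (simp add: algebra_simps)
    then show ?thesis by (auto simp: below_def)
  qed
next
  assume "below \<alpha> e \<or> e = - \<alpha>"
  then show "below \<alpha> (e - 1)"
  proof
    assume "below \<alpha> e"
    then obtain i :: nat where "e = - \<alpha> - 1 - of_nat i" by (auto simp: below_def)
    then show ?thesis unfolding below_def by (intro exI [of _ "Suc i"]) simp
  qed (auto simp: below_def intro: exI [of _ 0])
qed

lemma not_below: "\<not> below \<alpha> (- \<alpha>)"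
proof
  assume "below \<alpha> (- \<alpha>)"
  then obtain i :: nat where "- \<alpha> = - \<alpha> - 1 - of_nat i" by (auto simp: below_def)
  then have "of_nat (Suc i) = (0::complex)" by (simp add: algebra_simps)
  then show False by (simp only: of_nat_eq_0_iff)
qed

lemma z12_cut: "mult_z12 (cut \<alpha> F) = cut \<alpha> (mult_z12 F) + corner \<alpha> F"
  using not_below by (auto simp: fun_eq_iff mult_z12_def cut_def corner_def below_step)

definition fin_fst :: "'u::complex_vector lseries2 \<Rightarrow> bool"
  where "fin_fst F \<longleftrightarrow> finite (supp_fst F)"

lemma fin_fst_nice2: "fin_fst F \<Longrightarrow> nice2 F"
  unfolding nice2_def fin_fst_def supp_fst_def
proof
  fix e assume "finite {e1. \<exists>k1 e2 k2. F e1 k1 e2 k2 \<noteq> 0}"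
  then show "finite {e1. \<exists>k1 k2. F e1 k1 (e - e1) k2 \<noteq> 0}" by (rule rev_finite_subset) blast
qed

lemma fin_fst_add: "fin_fst F \<Longrightarrow> fin_fst G \<Longrightarrow> fin_fst (F + G)"
  unfolding fin_fst_def
proof -
  assume "finite (supp_fst F)" "finite (supp_fst G)"
  then have "finite (supp_fst F \<union> supp_fst G)" by blast
  then show "finite (supp_fst (F + G))"
    by (rule rev_finite_subset) (auto simp: supp_fst_def, metis add.left_neutral)
qed

lemma fin_fst_z12: "fin_fst F \<Longrightarrow> fin_fst (mult_z12 F)"
  unfolding fin_fst_def
proof -
  assume "finite (supp_fst F)"
  then have "finite (supp_fst F \<union> (\<lambda>x. x + 1) ` supp_fst F)" by blast
  then show "finite (supp_fst (mult_z12 F))"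
  proof (rule rev_finite_subset, intro subsetI)
    fix e assume "e \<in> supp_fst (mult_z12 F)"
    then obtain k1 e2 k2 where "mult_z12 F e k1 e2 k2 \<noteq> 0" by (auto simp: supp_fst_def)
    then have "F (e - 1) k1 e2 k2 \<noteq> 0 \<or> F e k1 (e2 - 1) k2 \<noteq> 0" by (rule mult_z12_nonzero)
    then have "e - 1 \<in> supp_fst F \<or> e \<in> supp_fst F" unfolding supp_fst_def by blast
    then show "e \<in> supp_fst F \<union> (\<lambda>x. x + 1) ` supp_fst F"
      by (auto intro: image_eqI [of _ _ "e - 1"])
  qed
qed

lemma fin_fst_corner: "fin_fst (corner \<alpha> F)"
  unfolding fin_fst_def by (rule finite_subset [of _ "{- \<alpha>}"]) (auto simp: supp_fst_def corner_def split: if_splits)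

lemma fin_fst_z12_pow_cut: "fin_fst ((mult_z12 ^^ n) (cut \<alpha> F) - cut \<alpha> ((mult_z12 ^^ n) F))"
proof (induction n)
  case 0
  then show ?case by (simp add: fin_fst_def supp_fst_def)
next
  case (Suc n)
  have eq: "(mult_z12 ^^ Suc n) (cut \<alpha> F) - cut \<alpha> ((mult_z12 ^^ Suc n) F) =
     mult_z12 ((mult_z12 ^^ n) (cut \<alpha> F) - cut \<alpha> ((mult_z12 ^^ n) F)) + corner \<alpha> ((mult_z12 ^^ n) F)"
    using z12_cut [of \<alpha> "(mult_z12 ^^ n) F"] by (simp add: clinear_diff [OF clinear_mult_z12])
  show ?case unfolding eq by (rule fin_fst_add [OF fin_fst_z12 [OF Suc] fin_fst_corner])
qed

lemma diag_corner: "diag (corner \<alpha> F) e k = (\<Sum>k1\<le>k. F (- \<alpha> - 1) k1 (e + \<alpha>) (k - k1))"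
proof -
  have "diag (corner \<alpha> F) e k = (\<Sum>k1\<le>k. Sum_any (\<lambda>e1. if e1 = - \<alpha> then F (- \<alpha> - 1) k1 (e - e1) (k - k1) else 0))"
    unfolding diag_def corner_def ..
  then show ?thesis unfolding Sum_any.delta by simp
qed

text \<open>A series killed by $z_{12}$ is a multiple of the delta function, and only its 0-th product is non-zero.\<close>

lemma resprod_cut:
  assumes "mult_z12 F = 0"
  shows "adm (cut \<alpha> F)" "resprod 0 (cut \<alpha> F) = diag (corner \<alpha> F)" "0 < n \<Longrightarrow> resprod n (cut \<alpha> F) = 0"
proof -
  have c0: "cut \<alpha> 0 = 0" by (simp add: fun_eq_iff cut_def)
  have eq: "mult_z12 (cut \<alpha> F) = corner \<alpha> F" by (simp only: z12_cut assms c0 add_0)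
  have nice: "nice2 (corner \<alpha> F)" by (rule fin_fst_nice2 [OF fin_fst_corner])
  show adm: "adm (cut \<alpha> F)" using nice2_imp_adm [OF nice] adm_mult_z12 [of "cut \<alpha> F"] by (simp add: eq)
  have "resprod n (cut \<alpha> F) = taylor (- n) (corner \<alpha> F)" for n
    using resprod_mult_z12 [OF adm, of "n - 1"] by (simp add: eq resprod_nice2 nice)
  then show "resprod 0 (cut \<alpha> F) = diag (corner \<alpha> F)" "0 < n \<Longrightarrow> resprod n (cut \<alpha> F) = 0"
    by simp_all
qed

text \<open>Such a series depends on the two exponents only through their sum, within a class modulo $\mathbb Z$.\<close>

lemma constant_along_lines:
  assumes "mult_z12 B = 0"
  shows "B (e1 + of_int z) k1 e2 k2 = B e1 k1 (e2 + of_int z) k2"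
proof -
  have *: "B (x - 1) k1 y k2 = B x k1 (y - 1) k2" for x y
    using fun_cong [OF fun_cong [OF fun_cong [OF fun_cong [OF assms, of x], of k1], of y], of k2]
    by (simp add: mult_z12_def)
  show ?thesis
  proof (induction z arbitrary: e2 rule: int_induct [where k = 0])
    case (step1 i)
    have "B (e1 + of_int (i + 1)) k1 e2 k2 = B (e1 + of_int i) k1 (e2 + 1) k2"
      using * [of "e1 + of_int i + 1" "e2 + 1"] by (simp add: algebra_simps)
    then show ?case using step1.IH [of "e2 + 1"] by (simp add: algebra_simps)
  next
    case (step2 i)
    have "B (e1 + of_int (i - 1)) k1 e2 k2 = B (e1 + of_int i) k1 (e2 - 1) k2"
      using * [of "e1 + of_int i" "e2"] by (simp add: algebra_simps)
    then show ?case using step2.IH [of "e2 - 1"] by (simp add: algebra_simps)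
  qed simp
qed

text \<open>If \<open>n\<close> is the order of the pole of \<open>H\<close>, the \<open>n\<close>-th product of \<open>H\<close> is the 0-th product of
  $B = z_{12}^nH$. The latter reads off the coefficients of \<open>B\<close> at $z_1^{-\alpha-1}$, and by
  \<open>constant_along_lines\<close> these are all coefficients.\<close>

lemma residue_kills_top_order:
  assumes supp: "\<And>e1 k1 e2 k2. e1 + \<alpha> \<notin> \<int> \<Longrightarrow> (mult_z12 ^^ n) H e1 k1 e2 k2 = 0"
    and top: "(mult_z12 ^^ Suc n) H = 0" and adm: "adm (cut \<alpha> H)"
    and res: "resprod (int n) (cut \<alpha> H) = 0"
  shows "(mult_z12 ^^ n) H e1 0 e2 0 = 0"
proof -
  define B where "B = (mult_z12 ^^ n) H"
  have B: "mult_z12 B = 0" using top by (simp add: B_def)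
  define G where "G = (mult_z12 ^^ n) (cut \<alpha> H) - cut \<alpha> B"
  have G: "nice2 G" unfolding G_def B_def by (rule fin_fst_nice2 [OF fin_fst_z12_pow_cut])
  have "resprod (int n) (cut \<alpha> H) = resprod 0 ((mult_z12 ^^ n) (cut \<alpha> H))"
    by (simp add: resprod_mult_z12_pow adm)
  also have "(mult_z12 ^^ n) (cut \<alpha> H) = G + cut \<alpha> B" by (simp add: G_def)
  also have "resprod 0 (G + cut \<alpha> B) = resprod 0 G + resprod 0 (cut \<alpha> B)"
    by (rule resprod_add [OF nice2_imp_adm [OF G] resprod_cut(1) [OF B]])
  also have "\<dots> = diag (corner \<alpha> B)" by (simp add: resprod_nice2 G resprod_cut(2) [OF B])
  finally have d: "0 = diag (corner \<alpha> B)" unfolding res .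
  have z: "B (- \<alpha> - 1) 0 (e + \<alpha>) 0 = 0" for e
    using diag_corner [of \<alpha> B e 0] by (simp add: d [symmetric])
  show ?thesis
  proof (cases "e1 + \<alpha> \<in> \<int>")
    case False
    then show ?thesis by (rule supp)
  next
    case True
    then obtain i where i: "e1 + \<alpha> = of_int i" by (auto elim: Ints_cases)
    then have g: "e1 = (- \<alpha> - 1) + of_int (i + 1)" by (simp add: algebra_simps)
    have "B e1 0 e2 0 = B (- \<alpha> - 1) 0 (e2 + of_int (i + 1)) 0"
      unfolding g by (rule constant_along_lines [OF B])
    also have "\<dots> = 0" using z [of "e2 + of_int (i + 1) - \<alpha>"] by simp
    finally show ?thesis by (simp only: B_def)
  qed
qed

subsection \<open>Normal ordering\<close>

lemma low_UN:
  assumes "finite I" "\<And>i. i \<in> I \<Longrightarrow> low (T i)"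
  shows "low (\<Union>i\<in>I. T i)"
  using assms
proof (induction I)
  case empty
  then show ?case by (auto simp: low_def low_in_def)
next
  case (insert i I)
  obtain S where S: "finite S" "low_in S (T i)" using insert.prems [of i] by (auto simp: low_def)
  obtain S' where S': "finite S'" "low_in S' (\<Union>i\<in>I. T i)" using insert by (auto simp: low_def)
  have "low_in (S \<union> S') (T i \<union> (\<Union>i\<in>I. T i))"
    by (intro low_in_Un low_in_mono [OF S(2)] low_in_mono [OF S'(2)]) auto
  moreover have "finite (S \<union> S')" using S(1) S'(1) by simp
  ultimately have "low (T i \<union> (\<Union>i\<in>I. T i))" unfolding low_def by blast
  then show ?case by simp
qed

lemma low_above: "low {- \<alpha> + of_nat i | i::nat. True}"
  unfolding low_def low_in_def by (intro exI [of _ "{- \<alpha>}"] conjI exI [of _ 0]) auto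

lemma low_Un: "low A \<Longrightarrow> low B \<Longrightarrow> low (A \<union> B)"
  using low_UN [of "{True, False}" "\<lambda>x. if x then A else B"] by (simp add: Un_commute)

text \<open>Without the cut commutator, the modes of \<open>a\<close> with exponent below $-\alpha$ stand to the right of \<open>b\<close> and the
  others to the left: this is the normally ordered product, whose exponents are bounded below in both variables.\<close>

lemma normal_ordering:
  assumes F: "a \<in> LFie" "b \<in> LFie" and supp: "\<And>v e k. e + \<alpha> \<notin> \<int> \<Longrightarrow> a v e k = 0"
  shows "nice2 (ab_series a b v - cut \<alpha> (ab_series a b v - swap12 (ab_series b a v)))" (is "nice2 ?P")
proof (rule low_nice2)
  have z: "a 0 e k = 0" "b 0 e k = 0" for e k
    using F clinear_0 [OF LFie_linear] by blast+
  have P: "?P e1 k1 e2 k2 = (if below \<alpha> e1 then b (a v e1 k1) e2 k2 else a (b v e2 k2) e1 k1)" for e1 k1 e2 k2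
    by (simp add: cut_def ab_series_def swap12_def)
  have above: "e \<in> {- \<alpha> + of_nat i | i::nat. True}" if "\<not> below \<alpha> e" "e + \<alpha> \<in> \<int>" for e
  proof -
    obtain i where i: "e + \<alpha> = of_int i" using \<open>e + \<alpha> \<in> \<int>\<close> by (auto elim: Ints_cases)
    have "0 \<le> i"
    proof (rule ccontr)
      assume "\<not> 0 \<le> i"
      define j where "j = nat (- 1 - i)"
      have "i = - 1 - int j" using \<open>\<not> 0 \<le> i\<close> by (simp add: j_def)
      then have "e + \<alpha> = of_int (- 1 - int j)" using i by simp
      then have "e = of_int (- 1 - int j) - \<alpha>" by (simp only: eq_diff_eq)
      then have "e = - \<alpha> - 1 - of_nat j" by simp
      then show False using \<open>\<not> below \<alpha> e\<close> by (auto simp: below_def)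
    qed
    then obtain j where "i = int j" by (metis nonneg_int_cases)
    then have "e = - \<alpha> + of_nat j" using i by (simp add: algebra_simps)
    then show ?thesis by blast
  qed
  have "low ({- \<alpha> + of_nat i | i::nat. True} \<union> supp (a v))"
    by (intro low_Un low_above LFie_low [OF F(1)])
  then show "low (supp_fst ?P)"
  proof (rule low_subset, intro subsetI)
    fix e assume "e \<in> supp_fst ?P"
    then obtain k1 e2 k2 where *: "?P e k1 e2 k2 \<noteq> 0" unfolding supp_fst_def by blast
    show "e \<in> {- \<alpha> + of_nat i | i::nat. True} \<union> supp (a v)"
    proof (cases "below \<alpha> e")
      case True
      then have "a v e k1 \<noteq> 0" using * z unfolding P by auto
      then show ?thesis by (auto simp: supp_def)
    next
      case False
      then have "a (b v e2 k2) e k1 \<noteq> 0" using * unfolding P by simp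
      then have "e + \<alpha> \<in> \<int>" using supp by blast
      then show ?thesis using above [OF False] by blast
    qed
  qed
  define I where "I = Sigma {x. x \<in> supp (a v) \<and> - \<alpha> - 1 - x \<in> {- 0 + of_nat i | i::nat. True}} (\<lambda>x. {k. a v x k \<noteq> 0})"
  have I: "finite I"
    unfolding I_def by (intro finite_SigmaI low_finite2 LFie_low F low_above LFie_finite)
  have "low (\<Union>i\<in>I. supp (b (a v (fst i) (snd i))))"
    by (intro low_UN I LFie_low F)
  then have "low ((\<Union>i\<in>I. supp (b (a v (fst i) (snd i)))) \<union> supp (b v))"
    by (intro low_Un LFie_low [OF F(2)])
  then show "low (supp_snd ?P)"
  proof (rule low_subset, intro subsetI)
    fix e assume "e \<in> supp_snd ?P"
    then obtain e1 k1 k2 where *: "?P e1 k1 e k2 \<noteq> 0" unfolding supp_snd_def by blast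
    show "e \<in> (\<Union>i\<in>I. supp (b (a v (fst i) (snd i)))) \<union> supp (b v)"
    proof (cases "below \<alpha> e1")
      case True
      then have b: "b (a v e1 k1) e k2 \<noteq> 0" using * unfolding P by simp
      then have "a v e1 k1 \<noteq> 0" using z by auto
      moreover obtain i :: nat where "e1 = - \<alpha> - 1 - of_nat i" using True by (auto simp: below_def)
      ultimately have "(e1, k1) \<in> I" unfolding I_def by (auto simp: supp_def)
      moreover have "e \<in> supp (b (a v e1 k1))" using b unfolding supp_def by blast
      ultimately show ?thesis by force
    next
      case False
      then have "a (b v e k2) e1 k1 \<noteq> 0" using * unfolding P by simp
      then have "b v e k2 \<noteq> 0" using z by auto
      then show ?thesis unfolding supp_def by blast
    qed
  qed
qed

text \<open>The normally ordered product is regular on the diagonal and does not contribute to products with \<open>n \<ge> 0\<close>.\<close>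

lemma nth_product_commutator:
  assumes F: "a \<in> LFie" "b \<in> LFie" "mutually_local a b" and supp: "\<And>v e k. e + \<alpha> \<notin> \<int> \<Longrightarrow> a v e k = 0"
  shows "adm (cut \<alpha> (ab_series a b v - swap12 (ab_series b a v)))" (is "adm ?C")
    and "0 \<le> n \<Longrightarrow> nth_product a n b v = resprod n (cut \<alpha> (ab_series a b v - swap12 (ab_series b a v)))"
proof -
  let ?P = "ab_series a b v - ?C"
  have P: "nice2 ?P" by (rule normal_ordering [OF F(1,2) supp])
  have ab: "adm (ab_series a b v)" by (rule local_adm [OF F])
  have C: "?C = ab_series a b v - ?P" by simp
  show adm: "adm ?C" by (subst C) (rule adm_diff [OF ab nice2_imp_adm [OF P]])
  assume "0 \<le> n"
  have "nth_product a n b v = resprod n (?P + ?C)" by (simp add: nth_product_eq F)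
  also have "\<dots> = resprod n ?P + resprod n ?C" by (rule resprod_add [OF nice2_imp_adm [OF P] adm])
  also have "resprod n ?P = 0" using P \<open>0 \<le> n\<close> by (simp only: resprod_nice2) simp
  also have "0 + resprod n ?C = resprod n ?C" by (rule add_0)
  finally show "nth_product a n b v = resprod n ?C" .
qed

subsection \<open>The operator product expansion of affine fields\<close>

text \<open>The coefficient of $\zeta_1^{k_1}\zeta_2^{k_2}$ in $e^{-\zeta_1 - \zeta_2}$; it appears when both factors have the form
  found in \<open>twisted_log_form\<close>.\<close>

definition alt_fact :: "nat \<Rightarrow> nat \<Rightarrow> complex"
  where "alt_fact k1 k2 = (- 1) ^ (k1 + k2) / (fact k1 * fact k2)"

lemma alt_fact_sum: "(\<Sum>k1\<le>k. alt_fact k1 (k - k1) *\<^sub>C x k1) =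
    ((- 1) ^ k / fact k) *\<^sub>C (\<Sum>k1\<le>k. of_nat (k choose k1) *\<^sub>C x k1)"
  unfolding scaleC_sum_right scaleC_scaleC
  by (intro sum.cong refl arg_cong2 [where f = scaleC]) (simp add: alt_fact_def binomial_fact)

text \<open>Fields labelled by elements of the Lie algebra and of the form dictated by \<open>\<phi>\<close>. Both directions of the
  theorem work in this setting: it does not refer to where the fields come from.\<close>

locale affine_fields = jordan \<phi> \<sigma> N for \<phi> \<sigma> N :: "'g::complex_vector \<Rightarrow> 'g" +
  fixes br :: "'g \<Rightarrow> 'g \<Rightarrow> 'g" and form :: "'g \<Rightarrow> 'g \<Rightarrow> complex" and \<kappa> :: complex
    and X :: "'g \<Rightarrow> 'w::complex_vector lfield"
  assumes br: "cbilinear br" and aut: "\<And>a b. \<phi> (br a b) = br (\<phi> a) (\<phi> b)"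
    and form: "cbilinear form" and form_inv: "\<And>a b. form (\<phi> a) (\<phi> b) = form a b"
    and X_lin: "clinear X" and X_LFie: "\<And>a. X a \<in> LFie"
    and X_log: "\<And>a m v e k. a \<in> graded_part \<sigma> m \<Longrightarrow>
      X a v e k = (if e + m \<in> \<int> then ((- 1) ^ k / fact k) *\<^sub>C X ((N ^^ k) a) v e 0 else 0)"
begin

lemma br_graded:
  assumes "a \<in> graded_part \<sigma> m" "b \<in> graded_part \<sigma> n"
  shows "br a b \<in> graded_part \<sigma> (m + n)"
proof -
  have "\<sigma> (br a b) = (exp (- \<s> * m) * exp (- \<s> * n)) *\<^sub>C br a b"
    using assms by (simp add: graded_part_iff sigma_multiplicative [OF br aut] clinear_scaleC [OF cbilinearD(1) [OF br]]
        clinear_scaleC [OF cbilinearD(2) [OF br]] scaleC_scaleC mult.commute)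
  also have "exp (- \<s> * m) * exp (- \<s> * n) = exp (- \<s> * (m + n))"
    unfolding mult_exp_exp by (simp add: algebra_simps)
  finally show ?thesis by (simp add: graded_part_iff)
qed

lemma form_graded:
  assumes "a \<in> graded_part \<sigma> m" "b \<in> graded_part \<sigma> n" "form a b \<noteq> 0"
  shows "m + n \<in> \<int>"
proof (rule ccontr)
  assume *: "m + n \<notin> \<int>"
  have "exp (- \<s> * m) * exp (- \<s> * n) = exp (\<s> * (- (m + n)))"
    unfolding mult_exp_exp by (simp add: algebra_simps)
  moreover have "- (m + n) \<notin> \<int>" using * by (metis Ints_minus minus_minus)
  ultimately have "exp (- \<s> * m) * exp (- \<s> * n) \<noteq> 1" using exp_s_eq_1 by metis
  then have "form a b = 0"
    by (rule form_eigen [OF form form_inv graded_partD [OF assms(1)] graded_partD [OF assms(2)]])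
  then show False using assms(3) by simp
qed

lemma N_br: "(N ^^ k) (br a b) = (\<Sum>i\<le>k. of_nat (k choose i) *\<^sub>C br ((N ^^ i) a) ((N ^^ (k - i)) b))"
proof (induction k)
  case (Suc k)
  define e where "e i j = br ((N ^^ i) a) ((N ^^ j) b)" for i j
  have Ne: "N (e i j) = e (Suc i) j + e i (Suc j)" for i j
    by (simp add: e_def N_derivation [OF br aut])
  have "(N ^^ Suc k) (br a b) = N (\<Sum>i\<le>k. of_nat (k choose i) *\<^sub>C e i (k - i))"
    by (simp only: funpow.simps o_apply Suc e_def)
  also have "\<dots> = (\<Sum>i\<le>k. of_nat (k choose i) *\<^sub>C e (Suc i) (k - i)) + (\<Sum>i\<le>k. of_nat (k choose i) *\<^sub>C e i (Suc (k - i)))"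
    by (simp add: clinear_sum [OF N_lin] clinear_scaleC [OF N_lin] Ne scaleC_add_right sum.distrib)
  also have "(\<Sum>i\<le>k. of_nat (k choose i) *\<^sub>C e i (Suc (k - i))) = (\<Sum>i\<le>Suc k. of_nat (k choose i) *\<^sub>C e i (Suc k - i))"
    by (simp add: Suc_diff_le)
  also have "\<dots> = e 0 (Suc k) + (\<Sum>i\<le>k. of_nat (k choose Suc i) *\<^sub>C e (Suc i) (k - i))"
    by (subst sum.atMost_Suc_shift) simp
  also have "(\<Sum>i\<le>k. of_nat (k choose i) *\<^sub>C e (Suc i) (k - i)) + (e 0 (Suc k) + (\<Sum>i\<le>k. of_nat (k choose Suc i) *\<^sub>C e (Suc i) (k - i)))
     = e 0 (Suc k) + (\<Sum>i\<le>k. of_nat (Suc k choose Suc i) *\<^sub>C e (Suc i) (k - i))"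
    by (simp add: scaleC_add_left sum.distrib)
  also have "\<dots> = (\<Sum>i\<le>Suc k. of_nat (Suc k choose i) *\<^sub>C e i (Suc k - i))"
    by (subst sum.atMost_Suc_shift) (simp del: binomial_Suc_Suc)
  finally show ?case by (simp only: e_def)
qed simp

lemma N_form: "form ((N ^^ i) a) ((N ^^ j) b) = (- 1) ^ j * form ((N ^^ (i + j)) a) b"
proof (induction j arbitrary: i)
  case (Suc j)
  have "form ((N ^^ i) a) ((N ^^ Suc j) b) = - form ((N ^^ Suc i) a) ((N ^^ j) b)"
    using form_invariances [OF form form_inv, of "(N ^^ i) a" "(N ^^ j) b"] by simp
  then show ?case using Suc.IH [of "Suc i"] by simp
qed simp

lemma X_app_lin: "clinear (\<lambda>a. X a v e k)"
  using X_lin by (simp add: clinear_iff)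

lemma X_supp: "a \<in> graded_part \<sigma> m \<Longrightarrow> e + m \<notin> \<int> \<Longrightarrow> X a v e k = 0"
  using X_log by simp

text \<open>The commutator $[a(z_1), b(z_2)]$ expected from the relations of the affinization. The part
  \<open>brs\<close> is the field of $[a,b]$ times a delta function. The central part is $\kappa$ times the derivative in $z_2$ of
  \<open>fms\<close>, a delta function twisted by $z^{-N}$; the derivative produces the factor $m + N$ of the
  cocycle, as seen in \<open>inner_der_fms\<close>.\<close>

definition brs :: "complex \<Rightarrow> 'g \<Rightarrow> 'g \<Rightarrow> 'w \<Rightarrow> 'w lseries2"
  where "brs \<alpha> a b v e1 k1 e2 k2 = (if e1 + \<alpha> \<in> \<int>
     then alt_fact k1 k2 *\<^sub>C X (br ((N ^^ k1) a) ((N ^^ k2) b)) v (e1 + e2 + 1) 0 else 0)"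

definition fms :: "'g \<Rightarrow> 'g \<Rightarrow> 'w \<Rightarrow> 'w lseries2"
  where "fms a b v e1 k1 e2 k2 = (if e1 + e2 = - 1
     then (alt_fact k1 k2 * form ((N ^^ k1) a) ((N ^^ k2) b)) *\<^sub>C v else 0)"

definition exps :: "complex \<Rightarrow> 'g \<Rightarrow> 'g \<Rightarrow> 'w \<Rightarrow> 'w lseries2"
  where "exps \<alpha> a b v e1 k1 e2 k2 = brs \<alpha> a b v e1 k1 e2 k2 +
    (if e1 + \<alpha> \<in> \<int> then \<kappa> *\<^sub>C inner der (fms a b v) e1 k1 e2 k2 else 0)"

abbreviation comm :: "'g \<Rightarrow> 'g \<Rightarrow> 'w \<Rightarrow> 'w lseries2"
  where "comm a b v \<equiv> ab_series (X a) (X b) v - swap12 (ab_series (X b) (X a) v)"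

lemma inner_der_fms: "inner der (fms a b v) e1 k1 e2 k2 = (if e1 + e2 = - 2
   then (alt_fact k1 k2 * form ((- 1 - e1) *\<^sub>C (N ^^ k1) a + (N ^^ Suc k1) a) ((N ^^ k2) b)) *\<^sub>C v else 0)"
proof (cases "e1 + e2 = - 2")
  case True
  then have g2: "e2 = - 2 - e1" by (simp add: algebra_simps)
  have g: "e1 + (e2 + 1) = - 1" using True by (simp add: algebra_simps)
  have f: "form ((N ^^ k1) a) ((N ^^ Suc k2) b) = - form ((N ^^ Suc k1) a) ((N ^^ k2) b)"
    using form_invariances [OF form form_inv, of "(N ^^ k1) a" "(N ^^ k2) b"] by simp
  have af: "of_nat (k2 + 1) * alt_fact k1 (k2 + 1) = - alt_fact k1 k2"
    by (simp add: alt_fact_def field_simps del: of_nat_Suc)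
  have "inner der (fms a b v) e1 k1 e2 k2 = ((e2 + 1) * (alt_fact k1 k2 * form ((N ^^ k1) a) ((N ^^ k2) b)) +
      of_nat (k2 + 1) * (alt_fact k1 (k2 + 1) * form ((N ^^ k1) a) ((N ^^ (k2 + 1)) b))) *\<^sub>C v"
    unfolding inner_def der_def fms_def by (simp only: g refl if_True scaleC_add_left scaleC_scaleC distrib_right mult_1_left scaleC_one)
  also have "(e2 + 1) * (alt_fact k1 k2 * form ((N ^^ k1) a) ((N ^^ k2) b)) +
      of_nat (k2 + 1) * (alt_fact k1 (k2 + 1) * form ((N ^^ k1) a) ((N ^^ (k2 + 1)) b)) =
     alt_fact k1 k2 * form ((- 1 - e1) *\<^sub>C (N ^^ k1) a + (N ^^ Suc k1) a) ((N ^^ k2) b)"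
  proof -
    have "of_nat (k2 + 1) * (alt_fact k1 (k2 + 1) * form ((N ^^ k1) a) ((N ^^ (k2 + 1)) b)) =
       alt_fact k1 k2 * form ((N ^^ Suc k1) a) ((N ^^ k2) b)"
      unfolding mult.assoc [symmetric] af using f by simp
    then show ?thesis
      by (simp only: clinear_add [OF cbilinearD(2) [OF form]] clinear_scaleC [OF cbilinearD(2) [OF form]] g2 scaleC_complex_def)
        (simp add: algebra_simps)
  qed
  finally show ?thesis using True by simp
next
  case False
  have "e1 + (e2 + 1) \<noteq> - 1"
  proof
    assume h: "e1 + (e2 + 1) = - 1"
    have "e1 + e2 = e1 + (e2 + 1) - 1" by simp
    also have "\<dots> = - 2" unfolding h by simp
    finally show False using False by simp
  qed
  then show ?thesis using False by (simp add: inner_def der_def fms_def)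
qed

lemma z12_brs: "mult_z12 (brs \<alpha> a b v) = 0"
proof (intro ext)
  fix e1 k1 e2 k2
  have 1: "e1 - 1 + \<alpha> \<in> \<int> \<longleftrightarrow> e1 + \<alpha> \<in> \<int>"
    using Ints_add [of "e1 - 1 + \<alpha>" 1] Ints_diff [of "e1 + \<alpha>" 1] by (auto simp: algebra_simps)
  have 2: "e1 - 1 + e2 + 1 = e1 + (e2 - 1) + 1" by simp
  show "mult_z12 (brs \<alpha> a b v) e1 k1 e2 k2 = 0 e1 k1 e2 k2"
    by (simp only: mult_z12_def brs_def 1 2) simp
qed

lemma z12_fms: "mult_z12 (fms a b v) = 0"
proof (intro ext)
  fix e1 e2 :: complex and k1 k2 :: nat
  have "e1 - 1 + e2 = e1 + (e2 - 1)" by simp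
  then show "mult_z12 (fms a b v) e1 k1 e2 k2 = 0 e1 k1 e2 k2"
    by (simp only: mult_z12_def fms_def) simp
qed

lemma z12_inner_der: "mult_z12 (inner der F) = inner der (mult_z12 F) + F"
  by (simp add: fun_eq_iff mult_z12_def inner_def der_def scaleC_distribs algebra_simps)

lemma cut_exps: "cut \<alpha> (exps \<alpha> a b v) = cut \<alpha> (brs \<alpha> a b v) + \<kappa> *\<^sub>C inner der (cut \<alpha> (fms a b v))"
proof (intro ext)
  fix e1 k1 e2 k2
  have "e1 + \<alpha> \<in> \<int>" if "below \<alpha> e1" using that by (auto simp: below_def)
  then show "cut \<alpha> (exps \<alpha> a b v) e1 k1 e2 k2 = (cut \<alpha> (brs \<alpha> a b v) + \<kappa> *\<^sub>C inner der (cut \<alpha> (fms a b v))) e1 k1 e2 k2"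
    by (simp add: cut_def exps_def inner_def der_def)
qed

lemma diag_corner_brs:
  assumes "a \<in> graded_part \<sigma> \<alpha>" "b \<in> graded_part \<sigma> \<beta>"
  shows "diag (corner \<alpha> (brs \<alpha> a b v)) = X (br a b) v"
proof (intro ext)
  fix e k
  have "diag (corner \<alpha> (brs \<alpha> a b v)) e k = (\<Sum>k1\<le>k. alt_fact k1 (k - k1) *\<^sub>C X (br ((N ^^ k1) a) ((N ^^ (k - k1)) b)) v e 0)"
    unfolding diag_corner brs_def by (intro sum.cong refl) simp
  also have "\<dots> = ((- 1) ^ k / fact k) *\<^sub>C X ((N ^^ k) (br a b)) v e 0"
    by (simp only: alt_fact_sum N_br clinear_sum [OF X_app_lin] clinear_scaleC [OF X_app_lin])
  also have "\<dots> = X (br a b) v e k"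
    using X_log [OF br_graded [OF assms], of v e k] X_supp [OF graded_N_pow [OF br_graded [OF assms]], of e k v 0]
    by (auto split: if_splits)
  finally show "diag (corner \<alpha> (brs \<alpha> a b v)) e k = X (br a b) v e k" .
qed

lemma diag_corner_fms: "diag (corner \<alpha> (fms a b v)) = form a b *\<^sub>C id_field v"
proof (intro ext)
  fix e k
  have alt: "(\<Sum>k1\<le>k. of_nat (k choose k1) * (- 1) ^ (k - k1) :: complex) = (if k = 0 then 1 else 0)"
    using binomial_ring [of "1::complex" "- 1" k] by (simp add: power_0_left)
  have "diag (corner \<alpha> (fms a b v)) e k = (if e = 0 then (\<Sum>k1\<le>k. alt_fact k1 (k - k1) *\<^sub>C (form ((N ^^ k1) a) ((N ^^ (k - k1)) b) *\<^sub>C v)) else 0)"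
    unfolding diag_corner fms_def by (auto simp: scaleC_scaleC algebra_simps intro!: sum.cong)
  also have "(\<Sum>k1\<le>k. alt_fact k1 (k - k1) *\<^sub>C (form ((N ^^ k1) a) ((N ^^ (k - k1)) b) *\<^sub>C v)) =
      ((- 1) ^ k / fact k) *\<^sub>C ((\<Sum>k1\<le>k. of_nat (k choose k1) * (- 1) ^ (k - k1)) * form ((N ^^ k) a) b) *\<^sub>C v"
    using alt_fact_sum [of k "\<lambda>k1. ((- 1) ^ (k - k1) * form ((N ^^ k) a) b) *\<^sub>C v"]
    by (simp add: N_form scaleC_scaleC scaleC_sum_left [symmetric] sum_distrib_right mult.assoc)
  finally show "diag (corner \<alpha> (fms a b v)) e k = (form a b *\<^sub>C id_field v) e k"
    unfolding alt by (auto simp: id_field_def)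
qed

lemma der_id_field: "der (c *\<^sub>C id_field v) = 0"
  by (auto simp: fun_eq_iff der_def id_field_def)

text \<open>The expected commutator has the expected products: the delta function gives the 0-th product
  $[a,b]$ and its derivative the first product $\kappa(a|b)$.\<close>

lemma resprod_exps:
  assumes "a \<in> graded_part \<sigma> \<alpha>" "b \<in> graded_part \<sigma> \<beta>"
  shows "adm (cut \<alpha> (exps \<alpha> a b v))"
    and "resprod 0 (cut \<alpha> (exps \<alpha> a b v)) = X (br a b) v"
    and "resprod 1 (cut \<alpha> (exps \<alpha> a b v)) = (\<kappa> * form a b) *\<^sub>C id_field v"
    and "2 \<le> n \<Longrightarrow> resprod n (cut \<alpha> (exps \<alpha> a b v)) = 0"
proof -
  define E where "E = cut \<alpha> (fms a b v)"
  define e0 where "e0 = corner \<alpha> (fms a b v)"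
  have c0: "cut \<alpha> 0 = 0" by (simp add: fun_eq_iff cut_def)
  have zE: "mult_z12 E = e0" unfolding E_def z12_cut z12_fms c0 e0_def by (rule add_0)
  have e0: "nice2 e0" unfolding e0_def by (rule fin_fst_nice2 [OF fin_fst_corner])
  have zz: "(mult_z12 ^^ 2) (inner der E) = mult_z12 (inner der e0) + e0"
    by (simp add: numeral_2_eq_2 z12_inner_der clinear_add [OF clinear_mult_z12] zE)
  have nz: "nice2 (mult_z12 (inner der e0))" by (intro nice2_mult_z12 nice2_inner_der e0)
  have n2: "nice2 ((mult_z12 ^^ 2) (inner der E))"
    unfolding zz by (intro nice2_add nz e0)
  have admE: "adm (inner der E)" unfolding adm_def using n2 by blast
  have adm1: "adm (cut \<alpha> (brs \<alpha> a b v))" by (rule resprod_cut(1) [OF z12_brs])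
  show "adm (cut \<alpha> (exps \<alpha> a b v))"
    unfolding cut_exps E_def [symmetric] by (intro adm_add adm1 adm_scaleC admE)
  have split: "resprod n (cut \<alpha> (exps \<alpha> a b v)) = resprod n (cut \<alpha> (brs \<alpha> a b v)) + \<kappa> *\<^sub>C resprod n (inner der E)" for n
    unfolding cut_exps E_def [symmetric]
    by (simp only: resprod_add [OF adm1 adm_scaleC [OF admE]] resprod_scaleC [OF admE])
  have rE: "resprod n (inner der E) = taylor (1 - n) (mult_z12 (inner der e0)) + taylor (1 - n) e0" for n
    using resprod_eq [OF n2, of n] unfolding zz by (simp add: taylor_add [OF nz e0])
  have d: "diag e0 = form a b *\<^sub>C id_field v" unfolding e0_def by (rule diag_corner_fms)
  have r0: "resprod 0 (inner der E) = 0"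
  proof -
    have "resprod 0 (inner der E) = diag (inner der e0) + diag (der e0)"
      using rE [of 0] taylor_mult_z12 [OF nice2_inner_der [OF e0], of 1] by simp
    also have "\<dots> = der (diag e0)" unfolding der_diag [OF e0] by (rule add.commute)
    also have "\<dots> = 0" unfolding d by (rule der_id_field)
    finally show ?thesis .
  qed
  have r1: "resprod 1 (inner der E) = form a b *\<^sub>C id_field v"
    using rE [of 1] d by (simp only: diff_self taylor_0 diag_mult_z12 [OF nice2_inner_der [OF e0]] add_0)
  have r2: "resprod n (inner der E) = 0" if "2 \<le> n" for n
    unfolding rE using that by simp
  show "resprod 0 (cut \<alpha> (exps \<alpha> a b v)) = X (br a b) v"
    unfolding split r0 resprod_cut(2) [OF z12_brs] diag_corner_brs [OF assms] by (simp only: scaleC_zero_right add_0_right)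
  show "resprod 1 (cut \<alpha> (exps \<alpha> a b v)) = (\<kappa> * form a b) *\<^sub>C id_field v"
    unfolding split r1 resprod_cut(3) [OF z12_brs, of 1, simplified] by (simp only: scaleC_scaleC add_0)
  show "2 \<le> n \<Longrightarrow> resprod n (cut \<alpha> (exps \<alpha> a b v)) = 0"
    unfolding split using r2 resprod_cut(3) [OF z12_brs, of n] by simp
qed

lemma z12_exps: "(mult_z12 ^^ 2) (exps \<alpha> a b v) = 0"
proof -
  define G where "G e1 k1 e2 k2 = (if e1 + \<alpha> \<in> \<int> then fms a b v e1 k1 e2 k2 else 0)" for e1 k1 e2 k2
  have zG: "mult_z12 G = 0"
  proof (intro ext)
    fix e1 e2 :: complex and k1 k2 :: nat
    have 1: "e1 - 1 + \<alpha> \<in> \<int> \<longleftrightarrow> e1 + \<alpha> \<in> \<int>"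
      using Ints_add [of "e1 - 1 + \<alpha>" 1] Ints_diff [of "e1 + \<alpha>" 1] by (auto simp: algebra_simps)
    have 2: "e1 - 1 + e2 = e1 + (e2 - 1)" by simp
    show "mult_z12 G e1 k1 e2 k2 = 0 e1 k1 e2 k2"
      by (simp only: mult_z12_def G_def fms_def 1 2) simp
  qed
  have id0: "inner der 0 = 0" by (rule clinear_0 [OF clinear_inner [OF clinear_der]])
  have "exps \<alpha> a b v = brs \<alpha> a b v + \<kappa> *\<^sub>C inner der G"
    by (intro ext) (simp add: exps_def G_def inner_def der_def)
  then have "mult_z12 (exps \<alpha> a b v) = mult_z12 (brs \<alpha> a b v) + \<kappa> *\<^sub>C mult_z12 (inner der G)"
    by (simp only: clinear_add [OF clinear_mult_z12] clinear_scaleC [OF clinear_mult_z12])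
  also have "\<dots> = \<kappa> *\<^sub>C G" by (simp only: z12_brs z12_inner_der zG id0 add_0)
  finally have "mult_z12 (mult_z12 (exps \<alpha> a b v)) = \<kappa> *\<^sub>C mult_z12 G"
    by (simp only: clinear_scaleC [OF clinear_mult_z12])
  then show ?thesis by (simp only: numeral_2_eq_2 funpow.simps o_apply id_apply zG scaleC_zero_right)
qed

text \<open>Both the commutator and its expected value are determined by their parts without logarithms,
  i.e. by commutators of modes.\<close>

lemma comm_log:
  assumes "a \<in> graded_part \<sigma> \<alpha>" "b \<in> graded_part \<sigma> \<beta>"
  shows "comm a b v e1 k1 e2 k2 = (if e1 + \<alpha> \<in> \<int> \<and> e2 + \<beta> \<in> \<int>
    then alt_fact k1 k2 *\<^sub>C comm ((N ^^ k1) a) ((N ^^ k2) b) v e1 0 e2 0 else 0)"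
proof -
  have z: "X a 0 e k = 0" for a e k by (rule clinear_0 [OF LFie_linear [OF X_LFie]])
  have af: "alt_fact k1 k2 = ((- 1) ^ k1 / fact k1) * ((- 1) ^ k2 / fact k2)"
    by (simp add: alt_fact_def power_add)
  show ?thesis
    by (simp add: ab_series_def swap12_def X_log [OF assms(1), of _ _ k1] X_log [OF assms(2), of _ _ k2] z af
        clinear_scaleC [OF LFie_linear [OF X_LFie]] scaleC_scaleC scaleC_diff_right mult.commute)
qed

lemma exps_log:
  assumes "a \<in> graded_part \<sigma> \<alpha>" "b \<in> graded_part \<sigma> \<beta>"
  shows "exps \<alpha> a b v e1 k1 e2 k2 = (if e1 + \<alpha> \<in> \<int> \<and> e2 + \<beta> \<in> \<int>
    then alt_fact k1 k2 *\<^sub>C exps \<alpha> ((N ^^ k1) a) ((N ^^ k2) b) v e1 0 e2 0 else 0)"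
proof -
  have gr: "(N ^^ k1) a \<in> graded_part \<sigma> \<alpha>" "(N ^^ Suc k1) a \<in> graded_part \<sigma> \<alpha>" "(N ^^ k2) b \<in> graded_part \<sigma> \<beta>"
    using graded_N_pow assms by blast+
  have a0: "alt_fact 0 0 = 1" by (simp add: alt_fact_def)
  have *: "exps \<alpha> a b v e1 k1 e2 k2 = alt_fact k1 k2 *\<^sub>C exps \<alpha> ((N ^^ k1) a) ((N ^^ k2) b) v e1 0 e2 0"
    by (simp add: exps_def brs_def inner_der_fms a0 scaleC_add_right scaleC_scaleC ac_simps)
  have z: "exps \<alpha> ((N ^^ k1) a) ((N ^^ k2) b) v e1 0 e2 0 = 0" if "\<not> (e1 + \<alpha> \<in> \<int> \<and> e2 + \<beta> \<in> \<int>)"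
  proof (cases "e1 + \<alpha> \<in> \<int>")
    case False
    then show ?thesis by (simp add: exps_def brs_def)
  next
    case True
    then have b: "e2 + \<beta> \<notin> \<int>" using that by blast
    have "e1 + e2 + 1 + (\<alpha> + \<beta>) \<notin> \<int>"
    proof
      assume "e1 + e2 + 1 + (\<alpha> + \<beta>) \<in> \<int>"
      then have "e1 + e2 + 1 + (\<alpha> + \<beta>) - (e1 + \<alpha>) - 1 \<in> \<int>" using True by (intro Ints_diff) auto
      then show False using b by (simp add: algebra_simps)
    qed
    then have 1: "X (br ((N ^^ k1) a) ((N ^^ k2) b)) v (e1 + e2 + 1) 0 = 0"
      by (rule X_supp [OF br_graded [OF gr(1,3)]])
    have 2: "form x y = 0" if "e1 + e2 = - 2" "x \<in> graded_part \<sigma> \<alpha>" "y \<in> graded_part \<sigma> \<beta>" for x y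
    proof (rule ccontr)
      assume "form x y \<noteq> 0"
      then have ab: "\<alpha> + \<beta> \<in> \<int>" using form_graded that by blast
      have "e2 + \<beta> = (\<alpha> + \<beta>) - (e1 + \<alpha>) - 2" using that(1) by (simp add: algebra_simps eq_neg_iff_add_eq_0)
      also have "\<dots> \<in> \<int>" using ab True by (intro Ints_diff) auto
      finally show False using b by simp
    qed
    show ?thesis
      using 1 2 gr by (simp add: exps_def brs_def inner_der_fms clinear_add [OF cbilinearD(2) [OF form]]
          clinear_scaleC [OF cbilinearD(2) [OF form]])
  qed
  show ?thesis
  proof (cases "e1 + \<alpha> \<in> \<int> \<and> e2 + \<beta> \<in> \<int>")
    case True
    show ?thesis unfolding if_P [OF True] by (rule *)
  next
    case False
    show ?thesis unfolding if_not_P [OF False] * z [OF False] by (rule scaleC_zero_right)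
  qed
qed

definition mode_commutators :: "'g \<Rightarrow> 'g \<Rightarrow> complex \<Rightarrow> complex \<Rightarrow> bool"
  where "mode_commutators a b m n \<longleftrightarrow> (\<forall>v.
    X a (X b v (- 1 - n) 0) (- 1 - m) 0 - X b (X a v (- 1 - m) 0) (- 1 - n) 0 =
    X (br a b) v (- 1 - (m + n)) 0 + (if m = - n then (\<kappa> * form (m *\<^sub>C a + N a) b) *\<^sub>C v else 0))"

lemma mode_commutators_iff:
  assumes "- 1 - m + \<alpha> \<in> \<int>"
  shows "mode_commutators a b m n \<longleftrightarrow> (\<forall>v. comm a b v (- 1 - m) 0 (- 1 - n) 0 = exps \<alpha> a b v (- 1 - m) 0 (- 1 - n) 0)"
proof -
  have a0: "alt_fact 0 0 = 1" by (simp add: alt_fact_def)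
  have 1: "(- 1 - m) + (- 1 - n) = - 2 \<longleftrightarrow> m = - n"
  proof -
    have gen: "- 2 - x = - 2 \<longleftrightarrow> x = 0" for x :: complex by simp
    have "(- 1 - m) + (- 1 - n) = - 2 - (m + n)" by simp
    then have "(- 1 - m) + (- 1 - n) = - 2 \<longleftrightarrow> m + n = 0" by (simp only: gen)
    then show ?thesis by (simp only: eq_neg_iff_add_eq_0 [of m n])
  qed
  have 2: "(- 1 - m) + (- 1 - n) + 1 = - 1 - (m + n)" "- 1 - (- 1 - m) = m" by simp_all
  have "exps \<alpha> a b v (- 1 - m) 0 (- 1 - n) 0 =
     X (br a b) v (- 1 - (m + n)) 0 + (if m = - n then (\<kappa> * form (m *\<^sub>C a + N a) b) *\<^sub>C v else 0)" for v
    unfolding exps_def brs_def inner_der_fms 1 2 using assms by (simp add: a0 scaleC_scaleC)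
  then show ?thesis
    unfolding mode_commutators_def by (simp add: ab_series_def swap12_def)
qed

definition ope :: "'g \<Rightarrow> 'g \<Rightarrow> bool"
  where "ope a b \<longleftrightarrow> mutually_local (X a) (X b) \<and> nth_product (X a) 0 (X b) = X (br a b) \<and>
    nth_product (X a) 1 (X b) = (\<kappa> * form a b) *\<^sub>C id_field \<and> (\<forall>n\<ge>2. nth_product (X a) n (X b) = 0)"

text \<open>The commutator of the fields equals its expected value, which $z_{12}^2$ kills; the
  products are those of the cut commutator.\<close>

theorem commutators_imp_ope:
  assumes a: "a \<in> graded_part \<sigma> \<alpha>" and b: "b \<in> graded_part \<sigma> \<beta>"
    and comm: "\<And>i j m n. m - \<alpha> \<in> \<int> \<Longrightarrow> n - \<beta> \<in> \<int> \<Longrightarrow> mode_commutators ((N ^^ i) a) ((N ^^ j) b) m n"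
  shows "ope a b"
proof -
  have eq: "comm a b v = exps \<alpha> a b v" for v
  proof (intro ext)
    fix e1 k1 e2 k2
    have *: "comm ((N ^^ k1) a) ((N ^^ k2) b) v e1 0 e2 0 = exps \<alpha> ((N ^^ k1) a) ((N ^^ k2) b) v e1 0 e2 0"
      if "e1 + \<alpha> \<in> \<int>" "e2 + \<beta> \<in> \<int>"
    proof -
      have "- 1 - (e1 + \<alpha>) \<in> \<int>" "- 1 - (e2 + \<beta>) \<in> \<int>" using that by (auto intro: Ints_diff)
      then have "mode_commutators ((N ^^ k1) a) ((N ^^ k2) b) (- 1 - e1) (- 1 - e2)"
        by (intro comm) (simp_all add: algebra_simps)
      then show ?thesis using that by (subst (asm) mode_commutators_iff) auto
    qed
    show "comm a b v e1 k1 e2 k2 = exps \<alpha> a b v e1 k1 e2 k2"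
      unfolding comm_log [OF a b] exps_log [OF a b] by (rule if_cong [OF refl _ refl]) (simp only: *)
  qed
  have loc: "local_of_order 2 (X a) (X b)"
    unfolding local_of_order_iff
  proof
    fix v
    have "(mult_z12 ^^ 2) (ab_series (X a) (X b) v) - (mult_z12 ^^ 2) (swap12 (ab_series (X b) (X a) v)) = 0"
      by (simp only: clinear_diff [OF mult_z12_pow_linear, symmetric] eq z12_exps)
    then show "(mult_z12 ^^ 2) (ab_series (X a) (X b) v) = (mult_z12 ^^ 2) (swap12 (ab_series (X b) (X a) v))"
      by (simp only: right_minus_eq)
  qed
  then have ml: "mutually_local (X a) (X b)" by (auto simp: mutually_local_def)
  have np: "nth_product (X a) n (X b) v = resprod n (cut \<alpha> (exps \<alpha> a b v))" if "0 \<le> n" for n v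
    unfolding eq [symmetric]
    by (rule nth_product_commutator(2) [OF X_LFie X_LFie ml _ that]) (rule X_supp [OF a])
  show ?thesis
    unfolding ope_def
  proof (intro conjI allI impI)
    show "nth_product (X a) 0 (X b) = X (br a b)"
      by (rule ext) (simp only: np order_refl resprod_exps [OF a b])
    show "nth_product (X a) 1 (X b) = (\<kappa> * form a b) *\<^sub>C id_field"
      by (rule ext) (simp only: np zero_le_one resprod_exps [OF a b] scaleC_fun_apply)
    show "nth_product (X a) n (X b) = 0" if "2 \<le> n" for n
    proof
      fix v
      have "0 \<le> n" using that by simp
      then show "nth_product (X a) n (X b) v = 0 v"
        by (simp only: np resprod_exps(4) [OF a b that] zero_fun_apply)
    qed
  qed (rule ml)
qed

text \<open>The difference \<open>H\<close> of the commutator and its expected value is killed by a power of $z_{12}$, and its cut has vanishing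
  products. By \<open>residue_kills_top_order\<close> the power can be lowered step by step to zero. This has to be done
  simultaneously for all \<open>(N ^^ i) a\<close> and \<open>(N ^^ j) b\<close>: the lemma controls the parts without logarithms only, and the remaining
  coefficients for \<open>a\<close>, \<open>b\<close> are such parts for iterates.\<close>

theorem ope_imp_commutators:
  assumes a: "a \<in> graded_part \<sigma> \<alpha>" and b: "b \<in> graded_part \<sigma> \<beta>"
    and ope: "\<And>i j. ope ((N ^^ i) a) ((N ^^ j) b)"
  shows "mode_commutators a b \<alpha> \<beta>"
proof -
  have "comm a b v (- 1 - \<alpha>) 0 (- 1 - \<beta>) 0 = exps \<alpha> a b v (- 1 - \<alpha>) 0 (- 1 - \<beta>) 0" for v
  proof -
    define H where "H i j = comm ((N ^^ i) a) ((N ^^ j) b) v - exps \<alpha> ((N ^^ i) a) ((N ^^ j) b) v" for i j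
    have gr: "(N ^^ i) a \<in> graded_part \<sigma> \<alpha>" "(N ^^ j) b \<in> graded_part \<sigma> \<beta>" for i j
      by (rule graded_N_pow [OF a], rule graded_N_pow [OF b])
    have H_log: "H i j e1 k1 e2 k2 = alt_fact k1 k2 *\<^sub>C H (i + k1) (j + k2) e1 0 e2 0"
      and H_supp: "e1 + \<alpha> \<notin> \<int> \<Longrightarrow> H i j e1 k1 e2 k2 = 0" for i j e1 k1 e2 k2
    proof -
      have pw: "(N ^^ k1) ((N ^^ i) a) = (N ^^ (i + k1)) a" "(N ^^ k2) ((N ^^ j) b) = (N ^^ (j + k2)) b" for i j k1 k2
        by (simp_all only: add.commute [of i k1] add.commute [of j k2] funpow_add o_apply)
      have log: "H i j e1 k1 e2 k2 = (if e1 + \<alpha> \<in> \<int> \<and> e2 + \<beta> \<in> \<int> then alt_fact k1 k2 *\<^sub>C H (i + k1) (j + k2) e1 0 e2 0 else 0)"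
        for i j k1 k2
      proof (cases "e1 + \<alpha> \<in> \<int> \<and> e2 + \<beta> \<in> \<int>")
        case True
        show ?thesis
          using comm_log [OF gr, of i j v e1 k1 e2 k2] exps_log [OF gr, of i j v e1 k1 e2 k2]
          unfolding if_P [OF True] pw by (simp only: H_def minus_apply scaleC_diff_right)
      next
        case False
        show ?thesis
          using comm_log [OF gr, of i j v e1 k1 e2 k2] exps_log [OF gr, of i j v e1 k1 e2 k2]
          unfolding if_not_P [OF False] by (simp only: H_def minus_apply diff_self)
      qed
      show "H i j e1 k1 e2 k2 = alt_fact k1 k2 *\<^sub>C H (i + k1) (j + k2) e1 0 e2 0"
      proof (cases "e1 + \<alpha> \<in> \<int> \<and> e2 + \<beta> \<in> \<int>")
        case True
        show ?thesis using log [of i j k1 k2] unfolding if_P [OF True] .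
      next
        case False
        show ?thesis
          using log [of i j k1 k2] log [of "i + k1" "j + k2" 0 0] unfolding if_not_P [OF False]
          by (simp only: scaleC_zero_right)
      qed
      show "H i j e1 k1 e2 k2 = 0" if "e1 + \<alpha> \<notin> \<int>"
        using log [of i j k1 k2] that by (simp only: simp_thms if_False)
    qed
    have Hz: "(mult_z12 ^^ n) (H i j) e1 k1 e2 k2 = alt_fact k1 k2 *\<^sub>C (mult_z12 ^^ n) (H (i + k1) (j + k2)) e1 0 e2 0" for n i j e1 k1 e2 k2
    proof (induction n arbitrary: e1 e2)
      case 0
      show ?case unfolding funpow_0 by (rule H_log)
    next
      case (Suc n)
      then show ?case
        by (simp only: funpow.simps o_apply mult_z12_def scaleC_diff_right)
    qed
    have Hz_supp: "(mult_z12 ^^ n) (H i j) e1 k1 e2 k2 = 0" if "e1 + \<alpha> \<notin> \<int>" for n i j e1 k1 e2 k2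
      using that
    proof (induction n arbitrary: e1 e2)
      case (Suc n)
      have "e1 - 1 + \<alpha> \<notin> \<int>" using Suc.prems Ints_add [of "e1 - 1 + \<alpha>" 1] by (auto simp: algebra_simps)
      then show ?case using Suc by (simp add: mult_z12_def)
    qed (simp add: H_supp)
    obtain M where M: "local_of_order M (X a) (X b)" using ope [of 0 0] by (auto simp: ope_def mutually_local_def)
    have "local_of_order (M + 2) (X a) (X b)" by (rule local_of_order_mono [OF M]) simp
    then have "(mult_z12 ^^ (M + 2)) (ab_series (X a) (X b) v) = (mult_z12 ^^ (M + 2)) (swap12 (ab_series (X b) (X a) v))"
      unfolding local_of_order_iff ..
    from right_minus_eq [THEN iffD2, OF this] have c0: "(mult_z12 ^^ (M + 2)) (comm a b v) = 0"
      unfolding clinear_diff [OF mult_z12_pow_linear] .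
    have e0: "(mult_z12 ^^ (M + 2)) (exps \<alpha> a b v) = 0"
      unfolding funpow_add o_apply z12_exps by (rule clinear_0 [OF mult_z12_pow_linear])
    have H00: "H 0 0 = comm a b v - exps \<alpha> a b v" by (simp only: H_def funpow_0)
    have start0: "(mult_z12 ^^ (M + 2)) (H 0 0) = 0"
      unfolding H00
      by (rule trans [OF clinear_diff [OF mult_z12_pow_linear]]) (unfold c0 e0, rule diff_self)
    have start: "(mult_z12 ^^ (M + 2)) (H i j) e1 0 e2 0 = 0" for i j e1 e2
    proof -
      have "alt_fact i j *\<^sub>C (mult_z12 ^^ (M + 2)) (H i j) e1 0 e2 0 = 0"
        using Hz [of "M + 2" 0 0 e1 i e2 j] start0 by (simp del: funpow.simps)
      then show ?thesis by (simp add: alt_fact_def)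
    qed
    have step: "(mult_z12 ^^ n) (H i j) e1 0 e2 0 = 0"
      if IH: "\<And>i j e1 e2. (mult_z12 ^^ Suc n) (H i j) e1 0 e2 0 = 0" for n i j e1 e2
    proof (rule residue_kills_top_order)
      show "(mult_z12 ^^ n) (H i j) e1 k1 e2 k2 = 0" if "e1 + \<alpha> \<notin> \<int>" for e1 k1 e2 k2
        using that by (rule Hz_supp)
      show "(mult_z12 ^^ Suc n) (H i j) = 0"
      proof (intro ext)
        fix e1 k1 e2 k2
        show "(mult_z12 ^^ Suc n) (H i j) e1 k1 e2 k2 = 0 e1 k1 e2 k2"
          unfolding Hz [of "Suc n" i j] IH by simp
      qed
      let ?a = "(N ^^ i) a" and ?b = "(N ^^ j) b"
      have ml: "mutually_local (X ?a) (X ?b)" using ope [of i j] by (simp add: ope_def)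
      have nc: "adm (cut \<alpha> (comm ?a ?b v))"
        by (rule nth_product_commutator(1) [OF X_LFie X_LFie ml]) (rule X_supp [OF gr(1)])
      have nc2: "nth_product (X ?a) (int n) (X ?b) v = resprod (int n) (cut \<alpha> (comm ?a ?b v))"
        by (rule nth_product_commutator(2) [OF X_LFie X_LFie ml _ of_nat_0_le_iff]) (rule X_supp [OF gr(1)])
      note re = resprod_exps [OF gr(1) gr(2), where v = v]
      have cut: "cut \<alpha> (H i j) = cut \<alpha> (comm ?a ?b v) - cut \<alpha> (exps \<alpha> ?a ?b v)"
        by (simp add: fun_eq_iff cut_def H_def)
      show "adm (cut \<alpha> (H i j))" unfolding cut by (rule adm_diff [OF nc re(1)])
      have "resprod (int n) (cut \<alpha> (H i j)) = nth_product (X ?a) (int n) (X ?b) v - resprod (int n) (cut \<alpha> (exps \<alpha> ?a ?b v))"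
        unfolding cut nc2 by (rule resprod_diff [OF nc re(1)])
      also have "\<dots> = 0"
      proof -
        have o: "nth_product (X ?a) 0 (X ?b) = X (br ?a ?b)" "nth_product (X ?a) 1 (X ?b) = (\<kappa> * form ?a ?b) *\<^sub>C id_field"
          "2 \<le> k \<Longrightarrow> nth_product (X ?a) k (X ?b) = 0" for k
          using ope [of i j] unfolding ope_def by blast+
        consider "n = 0" | "n = 1" | "2 \<le> int n" by linarith
        then show ?thesis
        proof cases
          case 1
          show ?thesis unfolding 1 of_nat_0 re(2) o(1) by (rule diff_self)
        next
          case 2
          show ?thesis unfolding 2 of_nat_1 re(3) o(2) scaleC_fun_apply by (rule diff_self)
        next
          case 3
          show ?thesis unfolding re(4) [OF 3] o(3) [OF 3] by (simp add: fun_eq_iff)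
        qed
      qed
      finally show "resprod (int n) (cut \<alpha> (H i j)) = 0" .
    qed
    have "\<forall>i j e1 e2. (mult_z12 ^^ (M + 2 - n)) (H i j) e1 0 e2 0 = 0" if "n \<le> M + 2" for n
      using that
    proof (induction n)
      case 0
      then show ?case using start by simp
    next
      case (Suc n)
      then have "M + 2 - n = Suc (M + 2 - Suc n)" by simp
      then show ?case using Suc step [of "M + 2 - Suc n"] by auto
    qed
    from this [of "M + 2"] have "H 0 0 (- 1 - \<alpha>) 0 (- 1 - \<beta>) 0 = 0" by simp
    then show ?thesis by (simp add: H_def)
  qed
  then show ?thesis by (subst mode_commutators_iff [where \<alpha> = \<alpha>]) simp_all
qed

end

section \<open>Modules over affinizations\<close>

text \<open>The action of $\sum_m x_mt^m + cK$ that is determined by operators \<open>A a m\<close> for $at^m$ and the scalar $\kappa$ for $K$.\<close>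

definition loop_part :: "('g::complex_vector \<Rightarrow> 'i \<Rightarrow> 'u::complex_vector \<Rightarrow> 'u) \<Rightarrow> ('i \<Rightarrow>\<^sub>0 'g) \<Rightarrow> 'u \<Rightarrow> 'u"
  where "loop_part A p v = (\<Sum>m\<in>Poly_Mapping.keys p. A (Poly_Mapping.lookup p m) m v)"

definition loop_action ::
  "('g::complex_vector \<Rightarrow> 'i \<Rightarrow> 'u::complex_vector \<Rightarrow> 'u) \<Rightarrow> complex \<Rightarrow> ('i \<Rightarrow>\<^sub>0 'g) \<times> complex \<Rightarrow> 'u \<Rightarrow> 'u"
  where "loop_action A \<kappa> X v = loop_part A (fst X) v + (\<kappa> * snd X) *\<^sub>C v"

text \<open>The sets \<open>S m\<close> of coefficients allowed at $t^m$ are the graded parts in the twisted case and everything in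
  the untwisted case. The operators act on a subspace \<open>G\<close> only, since products of fields behave well
  only for local fields. The relations are assumed for generators $at^m$.\<close>

locale loop_rep =
  fixes br :: "'g::complex_vector \<Rightarrow> 'g \<Rightarrow> 'g" and \<omega> :: "'i::ab_group_add \<Rightarrow> 'g \<Rightarrow> 'i \<Rightarrow> 'g \<Rightarrow> complex"
    and \<kappa> :: complex and S :: "'i \<Rightarrow> 'g set" and G :: "'u::complex_vector set"
    and A :: "'g \<Rightarrow> 'i \<Rightarrow> 'u \<Rightarrow> 'u"
  assumes S: "\<And>m. csubspace (S m)" and S_br: "\<And>a b m n. a \<in> S m \<Longrightarrow> b \<in> S n \<Longrightarrow> br a b \<in> S (m + n)"
    and G: "csubspace G" and A_closed: "\<And>a m v. a \<in> S m \<Longrightarrow> v \<in> G \<Longrightarrow> A a m v \<in> G"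
    and A_add: "\<And>a b m v. a \<in> S m \<Longrightarrow> b \<in> S m \<Longrightarrow> v \<in> G \<Longrightarrow> A (a + b) m v = A a m v + A b m v"
    and A_scale: "\<And>c a m v. a \<in> S m \<Longrightarrow> v \<in> G \<Longrightarrow> A (c *\<^sub>C a) m v = c *\<^sub>C A a m v"
    and A_add_vec: "\<And>a m v w. a \<in> S m \<Longrightarrow> v \<in> G \<Longrightarrow> w \<in> G \<Longrightarrow> A a m (v + w) = A a m v + A a m w"
    and A_scale_vec: "\<And>c a m v. a \<in> S m \<Longrightarrow> v \<in> G \<Longrightarrow> A a m (c *\<^sub>C v) = c *\<^sub>C A a m v"
    and A_comm: "\<And>a b m n v. a \<in> S m \<Longrightarrow> b \<in> S n \<Longrightarrow> v \<in> G \<Longrightarrow>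
      A a m (A b n v) - A b n (A a m v) = A (br a b) (m + n) v + (\<kappa> * \<omega> m a n b) *\<^sub>C v"
begin

definition loops :: "('i \<Rightarrow>\<^sub>0 'g) set"
  where "loops = {p. \<forall>m. Poly_Mapping.lookup p m \<in> S m}"

lemma loopsD: "p \<in> loops \<Longrightarrow> Poly_Mapping.lookup p m \<in> S m"
  by (simp add: loops_def)

lemma S_0: "0 \<in> S m" by (rule complex_vector.subspace_0 [OF S])

lemma G_0: "0 \<in> G" by (rule complex_vector.subspace_0 [OF G])

lemma G_sum: "(\<And>i. i \<in> I \<Longrightarrow> f i \<in> G) \<Longrightarrow> sum f I \<in> G"
  by (rule complex_vector.subspace_sum [OF G])

lemma A_0: "v \<in> G \<Longrightarrow> A 0 m v = 0"
  using A_scale [of 0 m v 0] S_0 by simp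

lemma A_0_vec: "a \<in> S m \<Longrightarrow> A a m 0 = 0"
  using A_scale_vec [of a m 0 0] G_0 by simp

lemma A_sum_vec:
  assumes "a \<in> S m" "\<And>i. i \<in> I \<Longrightarrow> f i \<in> G"
  shows "A a m (sum f I) = (\<Sum>i\<in>I. A a m (f i))"
  using assms(2)
proof (induction I rule: infinite_finite_induct)
  case (insert i I)
  then have "A a m (f i + sum f I) = A a m (f i) + A a m (sum f I)"
    by (intro A_add_vec assms(1) G_sum) auto
  then show ?case using insert by simp
qed (simp_all add: A_0_vec [OF assms(1)])

lemma loop_part_superset:
  assumes "v \<in> G" "finite K" "Poly_Mapping.keys p \<subseteq> K"
  shows "loop_part A p v = (\<Sum>m\<in>K. A (Poly_Mapping.lookup p m) m v)"
  unfolding loop_part_def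
  by (rule sum.mono_neutral_left [OF assms(2,3)]) (simp add: in_keys_iff A_0 [OF assms(1)])

lemma loop_part_add:
  assumes "p \<in> loops" "q \<in> loops" "v \<in> G"
  shows "loop_part A (p + q) v = loop_part A p v + loop_part A q v"
proof -
  let ?K = "Poly_Mapping.keys p \<union> Poly_Mapping.keys q"
  have "loop_part A (p + q) v = (\<Sum>m\<in>?K. A (Poly_Mapping.lookup (p + q) m) m v)"
    by (rule loop_part_superset [OF assms(3) _ Poly_Mapping.keys_add]) simp
  also have "\<dots> = (\<Sum>m\<in>?K. A (Poly_Mapping.lookup p m) m v + A (Poly_Mapping.lookup q m) m v)"
    by (simp only: lookup_add A_add [OF loopsD [OF assms(1)] loopsD [OF assms(2)] assms(3)])
  also have "\<dots> = loop_part A p v + loop_part A q v"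
    using loop_part_superset [OF assms(3), of ?K p] loop_part_superset [OF assms(3), of ?K q]
    by (simp add: sum.distrib)
  finally show ?thesis .
qed

lemma loop_part_scale:
  assumes "p \<in> loops" "v \<in> G"
  shows "loop_part A (c *\<^sub>C p) v = c *\<^sub>C loop_part A p v"
proof -
  have "loop_part A (c *\<^sub>C p) v = (\<Sum>m\<in>Poly_Mapping.keys p. A (Poly_Mapping.lookup (c *\<^sub>C p) m) m v)"
    by (rule loop_part_superset [OF assms(2)]) (auto simp: in_keys_iff lookup_scaleC)
  also have "\<dots> = c *\<^sub>C loop_part A p v"
    by (simp only: lookup_scaleC A_scale [OF loopsD [OF assms(1)] assms(2)] loop_part_def scaleC_sum_right)
  finally show ?thesis .
qed

lemma loop_part_single: "v \<in> G \<Longrightarrow> loop_part A (Poly_Mapping.single m a) v = A a m v"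
  using loop_part_superset [of v "{m}" "Poly_Mapping.single m a"] by simp

lemma loop_part_0: "loop_part A 0 v = 0"
  by (simp add: loop_part_def)

lemma single_loops: "a \<in> S m \<Longrightarrow> Poly_Mapping.single m a \<in> loops"
  using S_0 by (simp add: loops_def lookup_single when_def)

lemma sum_loops: "(\<And>i. i \<in> I \<Longrightarrow> f i \<in> loops) \<Longrightarrow> sum f I \<in> loops"
  unfolding loops_def mem_Collect_eq lookup_sum by (intro allI complex_vector.subspace_sum [OF S]) blast

lemma loop_part_sum:
  assumes "\<And>i. i \<in> I \<Longrightarrow> f i \<in> loops" "v \<in> G"
  shows "loop_part A (sum f I) v = (\<Sum>i\<in>I. loop_part A (f i) v)"
  using assms(1)
proof (induction I rule: infinite_finite_induct)
  case (insert i I)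
  then have "loop_part A (f i + sum f I) v = loop_part A (f i) v + loop_part A (sum f I) v"
    by (intro loop_part_add assms(2) sum_loops) auto
  then show ?case using insert by simp
qed (simp_all add: loop_part_0)

lemma loop_part_closed: "p \<in> loops \<Longrightarrow> v \<in> G \<Longrightarrow> loop_part A p v \<in> G"
  unfolding loop_part_def by (intro G_sum A_closed loopsD)

lemma loop_part_add_vec:
  assumes "p \<in> loops" "v \<in> G" "w \<in> G"
  shows "loop_part A p (v + w) = loop_part A p v + loop_part A p w"
  by (simp only: loop_part_def A_add_vec [OF loopsD [OF assms(1)] assms(2,3)] sum.distrib)

lemma loop_part_scale_vec:
  assumes "p \<in> loops" "v \<in> G"
  shows "loop_part A p (c *\<^sub>C v) = c *\<^sub>C loop_part A p v"
  by (simp only: loop_part_def A_scale_vec [OF loopsD [OF assms(1)] assms(2)] scaleC_sum_right)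

lemma loop_part_bracket:
  assumes p: "p \<in> loops" and q: "q \<in> loops" and v: "v \<in> G"
  shows "loop_part A p (loop_part A q v) - loop_part A q (loop_part A p v) =
    loop_action A \<kappa> (loop_bracket br \<omega> (p, c) (q, d)) v"
proof -
  let ?x = "Poly_Mapping.lookup p" and ?y = "Poly_Mapping.lookup q"
  let ?P = "Poly_Mapping.keys p" and ?Q = "Poly_Mapping.keys q"
  have 1: "loop_part A p (loop_part A q v) = (\<Sum>m\<in>?P. \<Sum>n\<in>?Q. A (?x m) m (A (?y n) n v))"
    unfolding loop_part_def by (intro sum.cong refl A_sum_vec loopsD p A_closed q v)
  have "loop_part A q (loop_part A p v) = (\<Sum>n\<in>?Q. \<Sum>m\<in>?P. A (?y n) n (A (?x m) m v))"
    unfolding loop_part_def by (intro sum.cong refl A_sum_vec loopsD p A_closed q v)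
  then have 2: "loop_part A q (loop_part A p v) = (\<Sum>m\<in>?P. \<Sum>n\<in>?Q. A (?y n) n (A (?x m) m v))"
    by (subst sum.swap)
  have 3: "loop_part A (\<Sum>m\<in>?P. \<Sum>n\<in>?Q. Poly_Mapping.single (m + n) (br (?x m) (?y n))) v =
      (\<Sum>m\<in>?P. \<Sum>n\<in>?Q. A (br (?x m) (?y n)) (m + n) v)"
    by (simp add: loop_part_sum sum_loops single_loops S_br loopsD p q v loop_part_single)
  show ?thesis
    unfolding 1 2 sum_subtractf [symmetric] A_comm [OF loopsD [OF p] loopsD [OF q] v] sum.distrib
    by (simp add: loop_action_def loop_bracket_def 3 sum_distrib_left scaleC_sum_left)
qed

definition carrier where "carrier = {X. fst X \<in> loops}"

lemma loop_action_closed: "X \<in> carrier \<Longrightarrow> v \<in> G \<Longrightarrow> loop_action A \<kappa> X v \<in> G"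
  unfolding loop_action_def carrier_def
  by (auto intro!: complex_vector.subspace_add [OF G] complex_vector.subspace_scale [OF G] loop_part_closed)

lemma loop_action_vec:
  assumes "X \<in> carrier" "v \<in> G"
  shows "w \<in> G \<Longrightarrow> loop_action A \<kappa> X (v + w) = loop_action A \<kappa> X v + loop_action A \<kappa> X w"
    and "loop_action A \<kappa> X (c *\<^sub>C v) = c *\<^sub>C loop_action A \<kappa> X v"
  using assms
  by (simp_all add: loop_action_def carrier_def loop_part_add_vec loop_part_scale_vec scaleC_add_right scaleC_scaleC mult.commute)

lemma loop_action_add:
  assumes "X \<in> carrier" "Y \<in> carrier" "v \<in> G"
  shows "loop_action A \<kappa> (X + Y) v = loop_action A \<kappa> X v + loop_action A \<kappa> Y v"
  using assms by (simp add: loop_action_def carrier_def loop_part_add scaleC_add_left distrib_left)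

lemma loop_action_scale:
  assumes "X \<in> carrier" "v \<in> G"
  shows "loop_action A \<kappa> (c *\<^sub>C X) v = c *\<^sub>C loop_action A \<kappa> X v"
  using assms by (simp add: loop_action_def carrier_def scaleC_prod_def loop_part_scale scaleC_add_right scaleC_scaleC
      scaleC_complex_def mult.left_commute)

theorem loop_action_bracket:
  assumes X: "X \<in> carrier" and Y: "Y \<in> carrier" and v: "v \<in> G"
  shows "loop_action A \<kappa> (loop_bracket br \<omega> X Y) v =
    loop_action A \<kappa> X (loop_action A \<kappa> Y v) - loop_action A \<kappa> Y (loop_action A \<kappa> X v)"
proof -
  have XY: "fst X \<in> loops" "fst Y \<in> loops" using X Y by (simp_all add: carrier_def)
  have "loop_action A \<kappa> (loop_bracket br \<omega> X Y) v =
     loop_part A (fst X) (loop_part A (fst Y) v) - loop_part A (fst Y) (loop_part A (fst X) v)"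
    using loop_part_bracket [OF XY v, of "snd X" "snd Y"] by simp
  also have "\<dots> = loop_action A \<kappa> X (loop_action A \<kappa> Y v) - loop_action A \<kappa> Y (loop_action A \<kappa> X v)"
    by (simp add: loop_action_def loop_part_add_vec loop_part_scale_vec loop_part_closed XY v
        complex_vector.subspace_scale [OF G v] scaleC_add_right scaleC_scaleC mult.commute)
  finally show ?thesis .
qed

lemma loop_action_elem: "v \<in> G \<Longrightarrow> loop_action A \<kappa> (loop_elem a m) v = A a m v"
  by (simp add: loop_action_def loop_part_single)

lemma loop_action_central: "loop_action A \<kappa> central_elem v = \<kappa> *\<^sub>C v"
  by (simp add: loop_action_def loop_part_0)

lemma lie_module_loop_action: "G = UNIV \<Longrightarrow> lie_module carrier (loop_bracket br \<omega>) (loop_action A \<kappa>)"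
  unfolding lie_module_def clinear_iff
  by (simp add: loop_action_vec loop_action_add loop_action_scale loop_action_bracket)

end

lemma loop_bracket_elems:
  assumes "cbilinear br" "\<omega> m 0 n b = 0" "\<omega> m a n 0 = 0"
  shows "loop_bracket br \<omega> (loop_elem a m) (loop_elem b n) = (Poly_Mapping.single (m + n) (br a b), \<omega> m a n b)"
proof -
  have "br 0 b = 0" "br a 0 = 0"
    using clinear_0 [OF cbilinearD(1) [OF assms(1)]] clinear_0 [OF cbilinearD(2) [OF assms(1)]] by auto
  then show ?thesis
    using assms by (cases "a = 0"; cases "b = 0") (simp_all add: loop_bracket_def)
qed

lemma loop_bracket_central: "loop_bracket br \<omega> central_elem X = 0"
  by (simp add: loop_bracket_def prod_eq_iff)

lemma loop_elem_add: "loop_elem (a + b) m = loop_elem a m + loop_elem b m"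
  by (simp add: single_add prod_eq_iff)

lemma loop_elem_scaleC: "loop_elem (c *\<^sub>C a) m = c *\<^sub>C loop_elem a m"
  by (simp add: scaleC_prod_def scaleC_complex_def poly_mapping_eq_iff fun_eq_iff lookup_scaleC lookup_single when_def)

lemma lie_moduleD:
  assumes "lie_module L br \<rho>" "x \<in> L"
  shows "clinear (\<rho> x)" "y \<in> L \<Longrightarrow> \<rho> (x + y) v = \<rho> x v + \<rho> y v" "\<rho> (c *\<^sub>C x) v = c *\<^sub>C \<rho> x v"
    "y \<in> L \<Longrightarrow> \<rho> (br x y) v = \<rho> x (\<rho> y v) - \<rho> y (\<rho> x v)"
  using assms unfolding lie_module_def by blast+

subsection \<open>Words\<close>

lemma word_eval_superset:
  assumes "finite K" "Poly_Mapping.keys p \<subseteq> K"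
  shows "word_eval \<rho> v p = (\<Sum>w\<in>K. Poly_Mapping.lookup p w *\<^sub>C foldr \<rho> w v)"
  unfolding word_eval_def by (rule sum.mono_neutral_left [OF assms]) (simp add: in_keys_iff)

lemma word_eval_linear:
  fixes \<rho> :: "'l \<Rightarrow> 'v::complex_vector \<Rightarrow> 'v"
  shows "clinear (word_eval \<rho> v)"
proof (rule clinearI)
  fix p q :: "'l list \<Rightarrow>\<^sub>0 complex"
  let ?K = "Poly_Mapping.keys p \<union> Poly_Mapping.keys q"
  have "word_eval \<rho> v (p + q) = (\<Sum>w\<in>?K. Poly_Mapping.lookup (p + q) w *\<^sub>C foldr \<rho> w v)"
    by (rule word_eval_superset [OF _ Poly_Mapping.keys_add]) simp
  then show "word_eval \<rho> v (p + q) = word_eval \<rho> v p + word_eval \<rho> v q"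
    using word_eval_superset [of ?K p \<rho> v] word_eval_superset [of ?K q \<rho> v]
    by (simp add: lookup_add scaleC_add_left sum.distrib)
next
  fix c and p :: "'l list \<Rightarrow>\<^sub>0 complex"
  have "word_eval \<rho> v (c *\<^sub>C p) = (\<Sum>w\<in>Poly_Mapping.keys p. Poly_Mapping.lookup (c *\<^sub>C p) w *\<^sub>C foldr \<rho> w v)"
    by (rule word_eval_superset) (auto simp: in_keys_iff lookup_scaleC)
  then show "word_eval \<rho> v (c *\<^sub>C p) = c *\<^sub>C word_eval \<rho> v p"
    by (simp add: lookup_scaleC scaleC_complex_def scaleC_scaleC word_eval_def scaleC_sum_right)
qed

lemma word_eval_word: "word_eval \<rho> v (word w) = foldr \<rho> w v"
  by (simp add: word_eval_def scaleC_one)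

section \<open>The universal affine vertex algebra\<close>

locale affine_va =
  fixes br :: "'g::complex_vector \<Rightarrow> 'g \<Rightarrow> 'g" and form :: "'g \<Rightarrow> 'g \<Rightarrow> complex" and \<kappa> :: complex
    and vac :: "'v::complex_vector" and pr :: "int \<Rightarrow> 'v \<Rightarrow> 'v \<Rightarrow> 'v"
    and \<rho>V :: "(int \<Rightarrow>\<^sub>0 'g) \<times> complex \<Rightarrow> 'v \<Rightarrow> 'v"
  assumes br: "cbilinear br" and form: "cbilinear form"
    and uava: "universal_affine_vertex_algebra br form \<kappa> vac pr \<rho>V"
begin

abbreviation \<iota> :: "'g \<Rightarrow> 'v" where "\<iota> \<equiv> affine_incl \<rho>V vac"

abbreviation relations where "relations \<equiv> induced_relations (affine_bracket br form)
      {X. \<forall>m<0. Poly_Mapping.lookup (fst X) m = 0} (\<lambda>X. \<kappa> * snd X)"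

lemma
  shows V_module: "lie_module UNIV (affine_bracket br form) \<rho>V"
    and V_surj: "surj (word_eval \<rho>V vac)"
    and V_kernel: "{p. word_eval \<rho>V vac p = 0} = cspan relations"
    and pr_incl: "pr m (\<iota> a) v = \<rho>V (loop_elem a m) v"
  using uava unfolding universal_affine_vertex_algebra_def is_induced_module_def by blast+

lemma
  shows pr_bilinear: "cbilinear (pr n)"
    and pr_field: "\<exists>M. \<forall>n\<ge>M. pr n u w = 0"
    and pr_vac: "pr n vac w = (if n = - 1 then w else 0)"
    and borcherds: "Sum_any (\<lambda>j::nat. (of_int m gchoose j) *\<^sub>C pr (m + k - int j) (pr (n + int j) u v) w) =
      Sum_any (\<lambda>j::nat. ((- 1) ^ j * (of_int n gchoose j)) *\<^sub>C pr (m + n - int j) u (pr (k + int j) v w)) -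
      Sum_any (\<lambda>j::nat. ((- 1) ^ j * ((- 1) powi n) * (of_int n gchoose j)) *\<^sub>C pr (n + k - int j) v (pr (m + int j) u w))"
  using uava unfolding universal_affine_vertex_algebra_def vertex_algebra_def by meson+

lemma pr_linear: "clinear (pr n u)" "clinear (\<lambda>u. pr n u w)"
  using cbilinearD [OF pr_bilinear] by blast+

text \<open>The Borcherds identity with $m = 0$, whose left hand side has one term.\<close>

lemma pr_iterate: "pr k (pr n u v) w =
    Sum_any (\<lambda>j::nat. ((- 1) ^ j * (of_int n gchoose j)) *\<^sub>C pr (n - int j) u (pr (k + int j) v w)) -
    Sum_any (\<lambda>j::nat. ((- 1) ^ j * ((- 1) powi n) * (of_int n gchoose j)) *\<^sub>C pr (n + k - int j) v (pr (int j) u w))"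
proof -
  have "Sum_any (\<lambda>j::nat. (of_int 0 gchoose j :: complex) *\<^sub>C pr (0 + k - int j) (pr (n + int j) u v) w) =
     (\<Sum>j\<in>{0}. (of_int 0 gchoose j :: complex) *\<^sub>C pr (0 + k - int j) (pr (n + int j) u v) w)"
  proof (rule Sum_any.expand_superset)
    have "(of_int 0 gchoose j :: complex) = 0" if "j \<noteq> 0" for j :: nat
      using that by (cases j) simp_all
    then show "{j. (of_int 0 gchoose j :: complex) *\<^sub>C pr (0 + k - int j) (pr (n + int j) u v) w \<noteq> 0} \<subseteq> {0}"
      by auto
  qed simp
  also have "\<dots> = pr k (pr n u v) w" by (simp add: scaleC_one)
  finally show ?thesis using borcherds [of 0 k n u v w] by simp
qed

lemma V_linear: "clinear (\<rho>V X)"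
  and V_add: "\<rho>V (X + Y) v = \<rho>V X v + \<rho>V Y v"
  and V_scale: "\<rho>V (c *\<^sub>C X) v = c *\<^sub>C \<rho>V X v"
  and V_bracket: "\<rho>V (affine_bracket br form X Y) v = \<rho>V X (\<rho>V Y v) - \<rho>V Y (\<rho>V X v)"
  using lie_moduleD [OF V_module UNIV_I] by blast+

lemma V_add_linear: "clinear (\<lambda>X. \<rho>V X v)"
  by (rule clinearI) (rule V_add, rule V_scale)

lemma vacuum_relation:
  assumes "\<And>m. m < 0 \<Longrightarrow> Poly_Mapping.lookup (fst X) m = 0"
  shows "\<rho>V X vac = (\<kappa> * snd X) *\<^sub>C vac"
proof -
  have "word ([] @ [X]) - (\<kappa> * snd X) *\<^sub>C word [] \<in> relations"
    unfolding induced_relations_def using assms by blast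
  then have "word_eval \<rho>V vac (word ([] @ [X]) - (\<kappa> * snd X) *\<^sub>C word []) = 0"
    using V_kernel complex_vector.span_base by blast
  then show ?thesis
    by (simp add: clinear_diff [OF word_eval_linear] clinear_scaleC [OF word_eval_linear] word_eval_word)
qed

lemma vacuum_killed: "0 \<le> m \<Longrightarrow> \<rho>V (loop_elem a m) vac = 0"
  using vacuum_relation [of "loop_elem a m"] by (simp add: lookup_single when_def)

lemma V_word_sum: obtains p where "v = (\<Sum>w\<in>Poly_Mapping.keys p. Poly_Mapping.lookup p w *\<^sub>C foldr \<rho>V w vac)"
  using V_surj unfolding surj_def word_eval_def by blast

lemma V_word_induct:
  assumes P: "csubspace P" and "vac \<in> P" "\<And>X v. v \<in> P \<Longrightarrow> \<rho>V X v \<in> P"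
  shows "v \<in> P"
proof -
  obtain p where p: "v = (\<Sum>w\<in>Poly_Mapping.keys p. Poly_Mapping.lookup p w *\<^sub>C foldr \<rho>V w vac)" by (rule V_word_sum)
  have "foldr \<rho>V w vac \<in> P" for w by (induction w) (simp_all add: assms)
  then show ?thesis
    unfolding p by (intro complex_vector.subspace_sum [OF P] complex_vector.subspace_scale [OF P])
qed

lemma V_central: "\<rho>V central_elem v = \<kappa> *\<^sub>C v"
proof -
  have "v \<in> {v. \<rho>V central_elem v = \<kappa> *\<^sub>C v}"
  proof (rule V_word_induct)
    show "csubspace {v. \<rho>V central_elem v = \<kappa> *\<^sub>C v}"
      by (simp add: complex_vector.subspace_def clinear_0 [OF V_linear] clinear_add [OF V_linear] clinear_scaleC [OF V_linear]
          scaleC_add_right scaleC_scaleC mult.commute)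
    show "vac \<in> {v. \<rho>V central_elem v = \<kappa> *\<^sub>C v}" using vacuum_relation [of central_elem] by simp
    fix X v assume v: "v \<in> {v. \<rho>V central_elem v = \<kappa> *\<^sub>C v}"
    have "\<rho>V (affine_bracket br form central_elem X) v = 0"
      unfolding affine_bracket_def loop_bracket_central by (rule clinear_0 [OF V_add_linear])
    then show "\<rho>V X v \<in> {v. \<rho>V central_elem v = \<kappa> *\<^sub>C v}"
      using v V_bracket [of central_elem X v] by (simp add: clinear_scaleC [OF V_linear])
  qed
  then show ?thesis by simp
qed

text \<open>The central element acts by $\kappa$ on the vacuum and commutes with everything, hence acts by
  $\kappa$ everywhere; so the module structure is given by the fields of the generators.\<close>

lemma V_expand: "\<rho>V X v = loop_action (\<lambda>a m. pr m (\<iota> a)) \<kappa> X v"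
proof -
  have p: "p = (\<Sum>m\<in>Poly_Mapping.keys p. Poly_Mapping.single m (Poly_Mapping.lookup p m))" for p :: "int \<Rightarrow>\<^sub>0 'g"
    by (rule poly_mapping_eqI) (simp add: lookup_sum lookup_single when_def in_keys_iff)
  have "X = (fst X, 0) + snd X *\<^sub>C central_elem"
    by (simp add: prod_eq_iff scaleC_prod_def scaleC_complex_def poly_mapping_eq_iff fun_eq_iff lookup_scaleC)
  also have "(fst X, 0) = (\<Sum>m\<in>Poly_Mapping.keys (fst X). loop_elem (Poly_Mapping.lookup (fst X) m) m)"
    using p [of "fst X"] by (simp add: prod_eq_iff fst_sum snd_sum)
  finally have "\<rho>V X v = \<rho>V ((\<Sum>m\<in>Poly_Mapping.keys (fst X). loop_elem (Poly_Mapping.lookup (fst X) m) m) + snd X *\<^sub>C central_elem) v"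
    by (rule arg_cong [where f = "\<lambda>X. \<rho>V X v"])
  also have "\<dots> = loop_action (\<lambda>a m. pr m (\<iota> a)) \<kappa> X v"
    by (simp add: V_add V_scale clinear_sum [OF V_add_linear] V_central loop_action_def loop_part_def pr_incl scaleC_scaleC mult.commute)
  finally show ?thesis .
qed

text \<open>The vertex algebra is generated from the vacuum by products with elements of the Lie algebra.
  Properties of \<open>Y v\<close> are extended from generators to all \<open>v\<close> by this rule.\<close>

theorem V_induct:
  assumes P: "csubspace P" and "vac \<in> P" and step: "\<And>a m v. v \<in> P \<Longrightarrow> pr m (\<iota> a) v \<in> P"
  shows "v \<in> P"
proof (rule V_word_induct [OF P \<open>vac \<in> P\<close>])
  fix X :: "(int \<Rightarrow>\<^sub>0 'g) \<times> complex" and v assume v: "v \<in> P"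
  have "(\<Sum>m\<in>Poly_Mapping.keys (fst X). pr m (\<iota> (Poly_Mapping.lookup (fst X) m)) v) \<in> P"
    by (rule complex_vector.subspace_sum [OF P]) (rule step [OF v])
  then have "loop_action (\<lambda>a m. pr m (\<iota> a)) \<kappa> X v \<in> P"
    unfolding loop_action_def loop_part_def
    by (rule complex_vector.subspace_add [OF P _ complex_vector.subspace_scale [OF P v]])
  then show "\<rho>V X v \<in> P" by (simp only: V_expand [of X v])
qed

lemma incl_linear: "clinear \<iota>"
  unfolding affine_incl_def
  by (rule clinearI) (simp_all only: loop_elem_add loop_elem_scaleC V_add V_scale)

text \<open>$a_{(n)}b = [at^n, bt^{-1}]\mathbf 1$ for $n \ge 0$, as $at^n$ kills the vacuum.\<close>

lemma pr_incl_incl: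
  shows "pr 0 (\<iota> a) (\<iota> b) = \<iota> (br a b)" and "pr 1 (\<iota> a) (\<iota> b) = (\<kappa> * form a b) *\<^sub>C vac"
    and "2 \<le> n \<Longrightarrow> pr n (\<iota> a) (\<iota> b) = 0"
proof -
  have "form 0 b = 0" "form a 0 = 0"
    using clinear_0 [OF cbilinearD(1) [OF form]] clinear_0 [OF cbilinearD(2) [OF form]] by auto
  then have bracket: "affine_bracket br form (loop_elem a n) (loop_elem b (- 1)) =
      loop_elem (br a b) (n - 1) + (if n = 1 then form a b else 0) *\<^sub>C central_elem" for n
    unfolding affine_bracket_def
    by (subst loop_bracket_elems [OF br]) (auto simp: scaleC_prod_def scaleC_complex_def poly_mapping_eq_iff fun_eq_iff lookup_scaleC)
  have *: "pr n (\<iota> a) (\<iota> b) = \<rho>V (loop_elem (br a b) (n - 1)) vac + (if n = 1 then \<kappa> * form a b else 0) *\<^sub>C vac" if "0 \<le> n" for n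
  proof -
    have "pr n (\<iota> a) (\<iota> b) = \<rho>V (affine_bracket br form (loop_elem a n) (loop_elem b (- 1))) vac"
      unfolding V_bracket pr_incl vacuum_killed [OF that] clinear_0 [OF V_linear] by (simp add: affine_incl_def)
    then show ?thesis
      unfolding bracket V_add V_scale V_central by (simp add: scaleC_scaleC mult.commute)
  qed
  show "pr 0 (\<iota> a) (\<iota> b) = \<iota> (br a b)" unfolding * [OF order_refl] by (simp add: affine_incl_def)
  show "pr 1 (\<iota> a) (\<iota> b) = (\<kappa> * form a b) *\<^sub>C vac" using * [of 1] vacuum_killed [of 0] by simp
  show "2 \<le> n \<Longrightarrow> pr n (\<iota> a) (\<iota> b) = 0" using * [of n] vacuum_killed [of "n - 1"] by simp
qed

end

section \<open>From twisted modules to restricted modules\<close>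

context jordan
begin

lemma graded_part_subspace: "csubspace (graded_part \<sigma> m)"
  by (simp add: complex_vector.subspace_def graded_part_iff clinear_0 [OF lin] clinear_add [OF lin] clinear_scaleC [OF lin]
      scaleC_add_right scaleC_scaleC mult.commute)

end

lemma field_truncation:
  assumes "a \<in> LFie"
  shows "\<exists>L::int. \<forall>i\<ge>L. a v (- 1 - (m + of_int i)) 0 = 0"
proof -
  obtain S where S: "finite S" "low_in S (supp (a v))" using LFie_classes [OF assms] by blast
  obtain m' where m': "m' - m \<in> \<int>" and b: "\<And>e. e \<in> supp (a v) \<Longrightarrow> e + m \<in> \<int> \<Longrightarrow> \<exists>i::nat. e = of_nat i - m'"
    using low_in_class_bound [OF S, of m] by blast
  obtain L where L: "m' - m = of_int L" using m' by (auto elim: Ints_cases)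
  have "a v (- 1 - (m + of_int i)) 0 = 0" if "L \<le> i" for i
  proof (rule ccontr)
    assume "a v (- 1 - (m + of_int i)) 0 \<noteq> 0"
    then have "- 1 - (m + of_int i) \<in> supp (a v)" by (auto simp: supp_def)
    moreover have "- 1 - (m + of_int i) + m = of_int (- 1 - i)" by simp
    then have "- 1 - (m + of_int i) + m \<in> \<int>" by (metis Ints_of_int)
    ultimately obtain j :: nat where "- 1 - (m + of_int i) = of_nat j - m'" using b by blast
    then have "m' - m = of_nat j + 1 + of_int i" by (simp add: algebra_simps)
    then have "of_int L = (of_int (int j + 1 + i) :: complex)" unfolding L by simp
    then have "L = int j + 1 + i" by (simp only: of_int_eq_iff)
    then show False using that by simp
  qed
  then show ?thesis by blast
qed

context affine_fields
begin

text \<open>The coefficient of $z^{-1-m}$ in $Y(e^{\zeta N}a, z)$ is constant in $\zeta$, since $e^{\zeta N}$ cancels the logarithms of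
  \<open>X_log\<close>. On coefficients this is $\sum_j \binom kj(-1)^{k-j} = 0$ for $k > 0$.\<close>

lemma mode_constant:
  assumes a: "a \<in> graded_part \<sigma> m"
  shows "(\<Sum>j\<le>k. (1 / fact j) *\<^sub>C X ((N ^^ j) a) v (- 1 - m) (k - j)) = (if k = 0 then X a v (- 1 - m) 0 else 0)"
proof -
  let ?x = "X ((N ^^ k) a) v (- 1 - m) 0"
  have "(\<Sum>j\<le>k. (1 / fact j) *\<^sub>C X ((N ^^ j) a) v (- 1 - m) (k - j)) =
     (\<Sum>j\<le>k. (1 / fact k * (of_nat (k choose j) * (- 1) ^ (k - j))) *\<^sub>C ?x)"
  proof (intro sum.cong refl)
    fix j assume "j \<in> {..k}"
    then have j: "j \<le> k" by simp
    have "(N ^^ (k - j)) ((N ^^ j) a) = (N ^^ k) a"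
      using funpow_add [of "k - j" j N] j by simp
    moreover have "- 1 - m + m \<in> \<int>" by simp
    ultimately have "X ((N ^^ j) a) v (- 1 - m) (k - j) = ((- 1) ^ (k - j) / fact (k - j)) *\<^sub>C ?x"
      using X_log [OF graded_N_pow [OF a, of j], where v = v and e = "- 1 - m" and k = "k - j"] by (simp only: if_True)
    moreover have "1 / fact j * ((- 1) ^ (k - j) / fact (k - j)) = 1 / fact k * (of_nat (k choose j) * (- 1 :: complex) ^ (k - j))"
      using binomial_fact [OF j, where 'a = complex] by simp
    ultimately show "(1 / fact j) *\<^sub>C X ((N ^^ j) a) v (- 1 - m) (k - j) = (1 / fact k * (of_nat (k choose j) * (- 1) ^ (k - j))) *\<^sub>C ?x"
      by (simp only: scaleC_scaleC)
  qed
  also have "\<dots> = (1 / fact k * (1 + - 1) ^ k) *\<^sub>C ?x"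
    unfolding scaleC_sum_left [symmetric] sum_distrib_left [symmetric] using binomial_ring [of "1::complex" "- 1" k] by simp
  finally show ?thesis by (simp add: power_0_left scaleC_one)
qed

lemma mode_loop_rep:
  assumes "\<And>a b m n. a \<in> graded_part \<sigma> m \<Longrightarrow> b \<in> graded_part \<sigma> n \<Longrightarrow> mode_commutators a b m n"
  shows "loop_rep br (\<lambda>m a n b. if m = - n then form (m *\<^sub>C a + N a) b else 0) \<kappa> (graded_part \<sigma>) UNIV
    (\<lambda>a m v. X a v (- 1 - m) 0)"
proof
  fix a b m n v
  assume "a \<in> graded_part \<sigma> m" "b \<in> graded_part \<sigma> n"
  then show "X a (X b v (- 1 - n) 0) (- 1 - m) 0 - X b (X a v (- 1 - m) 0) (- 1 - n) 0 =
      X (br a b) v (- 1 - (m + n)) 0 + (\<kappa> * (if m = - n then form (m *\<^sub>C a + N a) b else 0)) *\<^sub>C v"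
    using assms [of a m b n] by (simp add: mode_commutators_def)
qed (simp_all add: graded_part_subspace br_graded clinear_add [OF X_app_lin] clinear_scaleC [OF X_app_lin]
    clinear_add [OF LFie_linear [OF X_LFie]] clinear_scaleC [OF LFie_linear [OF X_LFie]])

theorem mode_module:
  assumes "\<And>a b m n. a \<in> graded_part \<sigma> m \<Longrightarrow> b \<in> graded_part \<sigma> n \<Longrightarrow> mode_commutators a b m n"
  shows "\<exists>\<rho>. restricted_twisted_affine_module br form \<sigma> N \<kappa> \<rho> \<and> (\<forall>a m v. \<rho> (loop_elem a m) v = X a v (- 1 - m) 0)"
proof -
  let ?A = "\<lambda>a m v. X a v (- 1 - m) 0"
  interpret R: loop_rep br "\<lambda>m a n b. if m = - n then form (m *\<^sub>C a + N a) b else 0" \<kappa> "graded_part \<sigma>" UNIV ?A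
    by (rule mode_loop_rep [OF assms])
  have "R.carrier = twisted_carrier \<sigma>"
    by (simp add: R.carrier_def R.loops_def twisted_carrier_def)
  then have "lie_module (twisted_carrier \<sigma>) (twisted_bracket br form N) (loop_action ?A \<kappa>)"
    using R.lie_module_loop_action by (simp add: twisted_bracket_def)
  then have "restricted_twisted_affine_module br form \<sigma> N \<kappa> (loop_action ?A \<kappa>)"
    unfolding restricted_twisted_affine_module_def
    by (simp add: R.loop_action_elem R.loop_action_central field_truncation [OF X_LFie])
  then show ?thesis
    by (intro exI [of _ "loop_action ?A \<kappa>"]) (simp add: R.loop_action_elem)
qed

end

text \<open>Compatibility of \<open>\<phi>V\<close> with \<open>\<phi>\<close> on generators determines \<open>\<phi>V\<close>.\<close>

locale affine_orbifold = affine_va br form \<kappa> vac pr \<rho>V + jordan \<phi> \<sigma> N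
  for br :: "'g::complex_vector \<Rightarrow> 'g \<Rightarrow> 'g" and form \<kappa> and vac :: "'v::complex_vector" and pr \<rho>V and \<phi> \<sigma> N :: "'g \<Rightarrow> 'g" +
  fixes \<phi>V :: "'v \<Rightarrow> 'v"
  assumes aut: "\<And>a b. \<phi> (br a b) = br (\<phi> a) (\<phi> b)" and form_inv: "\<And>a b. form (\<phi> a) (\<phi> b) = form a b"
    and phiV: "va_automorphism vac pr \<phi>V" and phiV_incl: "\<And>a. \<phi>V (\<iota> a) = \<iota> (\<phi> a)"
begin

lemma
  fixes Y :: "'v \<Rightarrow> 'w::complex_vector lfield"
  assumes Y: "twisted_module vac pr \<phi>V Y"
  shows Y_LFie: "Y x \<in> LFie" and Y_linear: "clinear Y" and Y_vac: "Y vac = id_field"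
    and Y_local: "mutually_local (Y x) (Y y)" and Y_monodromy: "Y (\<phi>V x) = monodromy (Y x)"
    and Y_product: "Y (pr n x y) = nth_product (Y x) n (Y y)"
proof -
  show "clinear Y"
    using Y unfolding twisted_module_def clinear_iff by (simp add: fun_eq_iff)
qed (use Y in \<open>auto simp: twisted_module_def local_collection_def\<close>)

lemma twisted_module_fields:
  fixes Y :: "'v \<Rightarrow> 'w::complex_vector lfield"
  assumes "twisted_module vac pr \<phi>V Y"
  shows "affine_fields \<phi> \<sigma> N br form (\<lambda>a. Y (\<iota> a))"
proof -
  have lin: "clinear (\<lambda>a. Y (\<iota> a))"
    using incl_linear Y_linear [OF assms] by (simp add: clinear_iff)
  show ?thesis
  proof
    show "Y (\<iota> a) v e k = (if e + m \<in> \<int> then ((- 1) ^ k / fact k) *\<^sub>C Y (\<iota> ((N ^^ k) a)) v e 0 else 0)"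
      if "a \<in> graded_part \<sigma> m" for a m v e k
      by (rule twisted_log_form [OF lin _ _ that]) (simp_all add: Y_LFie [OF assms] Y_monodromy [OF assms] flip: phiV_incl)
  qed (auto simp: clinear_add [OF lin] clinear_scaleC [OF lin] Y_LFie [OF assms] intro: br aut form form_inv)
qed

theorem restricted_module_of_twisted_module:
  fixes Y :: "'v \<Rightarrow> 'w::complex_vector lfield"
  assumes Y: "twisted_module vac pr \<phi>V Y"
  shows "\<exists>\<rho>. restricted_twisted_affine_module br form \<sigma> N \<kappa> \<rho> \<and> acts_by_modes Y \<iota> \<sigma> N \<rho>"
proof -
  interpret affine_fields \<phi> \<sigma> N br form \<kappa> "\<lambda>a. Y (\<iota> a)" by (rule twisted_module_fields [OF Y])
  have "ope a b" for a b
    unfolding ope_def Y_product [OF Y, symmetric]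
    by (simp add: Y_local [OF Y] pr_incl_incl clinear_scaleC [OF Y_linear [OF Y]] clinear_0 [OF Y_linear [OF Y]] Y_vac [OF Y])
  then obtain \<rho> where "restricted_twisted_affine_module br form \<sigma> N \<kappa> \<rho>" and "\<And>a m v. \<rho> (loop_elem a m) v = Y (\<iota> a) v (- 1 - m) 0"
    using mode_module ope_imp_commutators by meson
  then show ?thesis
    by (auto simp: acts_by_modes_def mode_series_def Y_exp_def mode_constant)
qed

end

section \<open>The fields of a restricted module\<close>

lemma exp_s_class: "exp (- \<s> * n) = exp (- \<s> * m) \<longleftrightarrow> n - m \<in> \<int>"
proof -
  have "exp (- \<s> * m) = exp (- \<s> * n) * exp (\<s> * (n - m))"
    unfolding mult_exp_exp by (simp add: algebra_simps)
  then have "exp (- \<s> * n) = exp (- \<s> * m) \<longleftrightarrow> exp (\<s> * (n - m)) = 1" by auto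
  then show ?thesis using exp_s_int exp_s_eq_1 by blast
qed

text \<open>Every non-zero complex number has a logarithm, so every eigenvector of \<open>\<sigma>\<close> has a degree.\<close>

lemma exp_s_surj:
  assumes "c \<noteq> 0"
  shows "\<exists>m. c = exp (- \<s> * m)"
proof -
  obtain r a where c: "c = rcis r a" using rcis_Ex by blast
  obtain r a where r: "0 < r" "c = of_real r * exp (\<i> * of_real a)"
  proof (cases "0 < r")
    case True
    then show ?thesis using that [of r a] c by (simp add: rcis_def cis_conv_exp)
  next
    case False
    then have "0 < - r" using c assms by (cases "r = 0") (auto simp: rcis_def)
    moreover have "c = of_real (- r) * exp (\<i> * of_real (a + pi))"
      using c by (simp add: rcis_def cis_conv_exp distrib_left exp_add)
    ultimately show ?thesis using that by blast
  qed
  have "c = exp (of_real (ln r)) * exp (\<i> * of_real a)"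
    using r(2) exp_of_real [of "ln r", where 'a = complex] exp_ln [OF r(1)] by simp
  also have "\<dots> = exp (- \<s> * (- (of_real (ln r) + \<i> * of_real a) / \<s>))"
    unfolding mult_exp_exp using s_nonzero by (intro arg_cong [where f = exp]) simp
  finally show ?thesis by blast
qed

context jordan
begin

lemma eigen_graded:
  assumes "\<sigma> a = c *\<^sub>C a"
  obtains m where "a \<in> graded_part \<sigma> m"
proof (cases "c = 0")
  case True
  then have "a = 0" using assms sigma_inj by simp
  then show ?thesis using that complex_vector.subspace_0 [OF graded_part_subspace] by blast
next
  case False
  then show ?thesis using that assms exp_s_surj by (metis graded_part_iff)
qed

lemma graded_induct:
  assumes add: "\<And>a b. P a \<Longrightarrow> P b \<Longrightarrow> P (a + b)" and graded: "\<And>a m. a \<in> graded_part \<sigma> m \<Longrightarrow> P a"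
  shows "P a"
proof -
  obtain C where C: "finite C" "a = (\<Sum>c\<in>C. eigcomp \<sigma> c a)" using eigcomp_sum by metis
  have P: "P (eigcomp \<sigma> c a)" for c
    by (rule eigen_graded [OF eigcomp_eigen]) (rule graded)
  have P0: "P 0" using graded complex_vector.subspace_0 [OF graded_part_subspace] by blast
  have "P (\<Sum>c\<in>D. eigcomp \<sigma> c a)" if "finite D" for D
    using that by (induction D) (simp_all add: P0 add P)
  then show ?thesis using C by metis
qed

lemma phi_graded:
  assumes n: "\<And>a. (N ^^ n) a = 0" and a: "a \<in> graded_part \<sigma> m"
  shows "\<phi> a = exp (- \<s> * m) *\<^sub>C (\<Sum>i<n. ((- \<s>) ^ i / fact i) *\<^sub>C (N ^^ i) a)"
  using phi_eigen(1) [OF graded_partD [OF a]] unfolding u_def exp_nilp_sum [OF N_lin n] tau_s .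

end

context affine_fields
begin

lemma ope_add_left:
  assumes "ope a c" "ope b c"
  shows "ope (a + b) c"
proof -
  have loc: "mutually_local (X a) (X c)" "mutually_local (X b) (X c)" using assms by (simp_all add: ope_def)
  have X: "X (a + b) = X a + X b" by (rule clinear_add [OF X_lin])
  have "mutually_local (X c) (X a + X b)"
    by (intro local_add X_LFie mutually_local_sym [OF loc(1)] mutually_local_sym [OF loc(2)])
  then have "mutually_local (X a + X b) (X c)" by (rule mutually_local_sym)
  moreover have "nth_product (X a + X b) n (X c) = nth_product (X a) n (X c) + nth_product (X b) n (X c)" for n
    by (rule nth_product_add_left [OF X_LFie X_LFie X_LFie loc])
  ultimately show ?thesis
    using assms unfolding ope_def X
    by (simp add: clinear_add [OF cbilinearD(2) [OF br]] clinear_add [OF cbilinearD(2) [OF form]] clinear_add [OF X_lin]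
        distrib_left scaleC_add_left)
qed

lemma ope_add_right:
  assumes "ope c a" "ope c b"
  shows "ope c (a + b)"
proof -
  have loc: "mutually_local (X c) (X a)" "mutually_local (X c) (X b)" using assms by (simp_all add: ope_def)
  have X: "X (a + b) = X a + X b" by (rule clinear_add [OF X_lin])
  have "mutually_local (X c) (X a + X b)" by (rule local_add [OF X_LFie loc])
  moreover have "nth_product (X c) n (X a + X b) = nth_product (X c) n (X a) + nth_product (X c) n (X b)" for n
    by (rule nth_product_add_right [OF X_LFie X_LFie X_LFie loc])
  ultimately show ?thesis
    using assms unfolding ope_def X
    by (simp add: clinear_add [OF cbilinearD(1) [OF br]] clinear_add [OF cbilinearD(1) [OF form]] clinear_add [OF X_lin]
        distrib_left scaleC_add_left)
qed

text \<open>The operator product expansion is bilinear, so it may be verified on homogeneous elements.\<close>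

lemma ope_of_graded:
  assumes "\<And>a b m n. a \<in> graded_part \<sigma> m \<Longrightarrow> b \<in> graded_part \<sigma> n \<Longrightarrow> ope a b"
  shows "ope a b"
proof (rule graded_induct [of "\<lambda>a. ope a b"])
  show "ope a b" if a: "a \<in> graded_part \<sigma> m" for a m
    by (rule graded_induct [of "\<lambda>b. ope a b"]) (rule ope_add_right assms [OF a], assumption+)+
qed (rule ope_add_left)

text \<open>The converse of \<open>twisted_log_form\<close>.\<close>

lemma X_monodromy: "X (\<phi> a) = monodromy (X a)"
proof (intro ext)
  fix v e k
  obtain n where n: "\<And>a. (N ^^ n) a = 0" using N_nilp by blast
  have X0: "X a v e l = 0" if "n \<le> l" for a l
  proof -
    have "csubspace {a. X a v e l = 0}"
      by (simp add: complex_vector.subspace_def clinear_0 [OF X_app_lin] clinear_add [OF X_app_lin] clinear_scaleC [OF X_app_lin])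
    show ?thesis
    proof (rule graded_induct [of "\<lambda>a. X a v e l = 0"])
      show "X a v e l = 0" if "a \<in> graded_part \<sigma> m" for a m
        using X_log [OF that, of v e l] funpow_kernel_mono [OF N_lin n \<open>n \<le> l\<close>] clinear_0 [OF X_app_lin] by simp
    qed (simp add: clinear_add [OF X_app_lin])
  qed
  have mono: "monodromy (X a) v e k = exp (\<s> * e) *\<^sub>C (\<Sum>l<n. bcoef l k *\<^sub>C X a v e l)" for a
    unfolding monodromy_eq by (rule rot_sum) (rule X0)
  show "X (\<phi> a) v e k = monodromy (X a) v e k"
  proof (rule linear_eqI)
    show "clinear (\<lambda>a. X (\<phi> a) v e k)" by (rule clinear_compose [OF X_app_lin phi_lin])
    show "clinear (\<lambda>a. monodromy (X a) v e k)"
      unfolding mono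
      by (rule clinearI)
        (simp_all add: clinear_add [OF X_app_lin] clinear_scaleC [OF X_app_lin] scaleC_add_right sum.distrib
          scaleC_sum_right scaleC_scaleC mult.left_commute mult.commute)
    fix x c assume "\<sigma> x = c *\<^sub>C x"
    then obtain m where x: "x \<in> graded_part \<sigma> m" by (rule eigen_graded)
    define y where "y l = X ((N ^^ l) x) v e 0" for l
    have L: "X (\<phi> x) v e k = exp (- \<s> * m) *\<^sub>C (\<Sum>i<n. ((- \<s>) ^ i / fact i) *\<^sub>C X ((N ^^ i) x) v e k)"
      unfolding phi_graded [OF n x] by (simp only: clinear_scaleC [OF X_app_lin] clinear_sum [OF X_app_lin])
    have y: "X ((N ^^ i) x) v e l = (if e + m \<in> \<int> then ((- 1) ^ l / fact l) *\<^sub>C y (l + i) else 0)" for i l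
      unfolding X_log [OF graded_N_pow [OF x, of i], where v = v and e = e and k = l] y_def by (simp add: funpow_add)
    show "X (\<phi> x) v e k = monodromy (X x) v e k"
    proof (cases "e + m \<in> \<int>")
      case True
      have "- e - m = - (e + m)" by simp
      then have "- e - m \<in> \<int>" using True by (metis Ints_minus)
      then have e: "exp (- \<s> * m) = exp (\<s> * e)" using exp_s_class [of "- e" m] by simp
      have "Sum_any (\<lambda>l. bcoef l k *\<^sub>C X x v e l) = Sum_any (\<lambda>l. bcoef l k *\<^sub>C ((- 1) ^ l / fact l) *\<^sub>C y l)"
        using y [of 0] True by simp
      also have "\<dots> = (\<Sum>i<n. ((- \<s>) ^ i / fact i) *\<^sub>C ((- 1) ^ k / fact k) *\<^sub>C y (k + i))"
        by (rule rot_alternating) (simp add: y_def funpow_kernel_mono [OF N_lin n] clinear_0 [OF X_app_lin])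
      finally have "monodromy (X x) v e k = exp (\<s> * e) *\<^sub>C (\<Sum>i<n. ((- \<s>) ^ i / fact i) *\<^sub>C ((- 1) ^ k / fact k) *\<^sub>C y (k + i))"
        unfolding monodromy_eq rot_def by (rule arg_cong)
      then show ?thesis unfolding L e y if_P [OF True] by (rule sym)
    next
      case False
      have "X x v e l = 0" for l using y [of 0 l] False by simp
      then show ?thesis unfolding L mono y if_not_P [OF False] by simp
    qed
  qed
qed

end

lemma low_in_negative_modes:
  assumes "\<And>t. t \<in> T \<Longrightarrow> \<exists>i::int. - 1 - t = m + of_int i \<and> i < int M"
  shows "low_in {- m} T"
  unfolding low_in_def
proof (intro exI ballI)
  fix t assume "t \<in> T"
  then obtain i :: int where i: "- 1 - t = m + of_int i" "i < int M" using assms by blast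
  define j where "j = nat (int M - 1 - i)"
  have "int j = int M - 1 - i" using i(2) by (simp add: j_def)
  then have "(of_int (int j) :: complex) = of_int (int M - 1 - i)" by (rule arg_cong)
  then have "(of_nat j :: complex) = of_nat M - 1 - of_int i" by simp
  moreover have "t = - 1 - (- 1 - t)" by simp
  then have "t = - 1 - (m + of_int i)" unfolding i(1) .
  ultimately have "t = - m + of_nat j - of_nat M" by simp
  then show "\<exists>s\<in>{- m}. \<exists>j::nat. t = s + of_nat j - of_nat M" by blast
qed

text \<open>For a restricted module, the fields \<open>X a\<close> are built from the action of the $at^m$; the
  power $\zeta^k$ carries $(-N)^k/k!$ by \<open>twisted_log_form\<close>.\<close>

locale restricted_module = affine_orbifold br form \<kappa> vac pr \<rho>V \<phi> \<sigma> N \<phi>V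
  for br :: "'g::complex_vector \<Rightarrow> 'g \<Rightarrow> 'g" and form \<kappa> and vac :: "'v::complex_vector" and pr \<rho>V
    and \<phi> \<sigma> N :: "'g \<Rightarrow> 'g" and \<phi>V +
  fixes \<rho> :: "(complex \<Rightarrow>\<^sub>0 'g) \<times> complex \<Rightarrow> 'w::complex_vector \<Rightarrow> 'w"
  assumes restricted: "restricted_twisted_affine_module br form \<sigma> N \<kappa> \<rho>"
begin

text \<open>For \<open>a\<close> that is not homogeneous, its component of the degree of \<open>m\<close> acts.\<close>

definition mode :: "'g \<Rightarrow> complex \<Rightarrow> 'w \<Rightarrow> 'w"
  where "mode a m v = \<rho> (loop_elem (eigcomp \<sigma> (exp (- \<s> * m)) a) m) v"

definition X :: "'g \<Rightarrow> 'w lfield"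
  where "X a v e k = ((- 1) ^ k / fact k) *\<^sub>C mode ((N ^^ k) a) (- 1 - e) v"

lemma rho_module: "lie_module (twisted_carrier \<sigma>) (twisted_bracket br form N) \<rho>"
  and rho_truncated: "a \<in> graded_part \<sigma> m \<Longrightarrow> \<exists>L::int. \<forall>i\<ge>L. \<rho> (loop_elem a (m + of_int i)) v = 0"
  and rho_central: "\<rho> central_elem v = \<kappa> *\<^sub>C v"
  using restricted unfolding restricted_twisted_affine_module_def by blast+

lemma elem_carrier: "a \<in> graded_part \<sigma> m \<Longrightarrow> loop_elem a m \<in> twisted_carrier \<sigma>"
  using complex_vector.subspace_0 [OF graded_part_subspace]
  by (simp add: twisted_carrier_def lookup_single when_def)

lemma comp_graded: "eigcomp \<sigma> (exp (- \<s> * m)) a \<in> graded_part \<sigma> m"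
  unfolding graded_part_iff by (rule eigcomp_eigen)

lemma graded_shift: "a \<in> graded_part \<sigma> m \<Longrightarrow> n - m \<in> \<int> \<Longrightarrow> a \<in> graded_part \<sigma> n"
  using exp_s_class [of n m] by (simp add: graded_part_iff)

lemma mode_graded: "a \<in> graded_part \<sigma> m \<Longrightarrow> mode a m v = \<rho> (loop_elem a m) v"
  unfolding mode_def graded_part_iff by (simp only: eigcomp_self(1))

lemma mode_linear: "clinear (mode a m)" and mode_add_linear: "clinear (\<lambda>a. mode a m v)"
proof -
  note D = lie_moduleD [OF rho_module elem_carrier [OF comp_graded]]
  show "clinear (mode a m)"
    using D(1) unfolding mode_def .
  show "clinear (\<lambda>a. mode a m v)"
    unfolding mode_def
    by (rule clinearI)
      (simp_all only: clinear_add [OF eigcomp_linear] clinear_scaleC [OF eigcomp_linear] loop_elem_add loop_elem_scaleC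
        D(2) [OF elem_carrier [OF comp_graded]] D(3))
qed

lemma mode_other:
  assumes a: "a \<in> graded_part \<sigma> m" and n: "n - m \<notin> \<int>"
  shows "mode a n v = 0"
proof -
  have "exp (- \<s> * n) \<noteq> exp (- \<s> * m)" using n exp_s_class by blast
  then have "eigcomp \<sigma> (exp (- \<s> * n)) a = 0" using eigcomp_self(2) [OF graded_partD [OF a]] by blast
  then show ?thesis
    using clinear_0 [OF mode_add_linear, of n v] eigcomp_linear [THEN clinear_0]
    by (simp add: mode_def)
qed

lemma X_app_linear: "clinear (\<lambda>a. X a v e k)" and X_vec_linear: "clinear (\<lambda>v. X a v e k)"
  unfolding X_def
  by (simp_all add: clinear_iff clinear_add [OF N_pow_lin] clinear_scaleC [OF N_pow_lin] clinear_add [OF mode_add_linear]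
      clinear_scaleC [OF mode_add_linear] clinear_add [OF mode_linear] clinear_scaleC [OF mode_linear]
      scaleC_add_right scaleC_scaleC mult.commute)

lemma X_linear: "clinear X"
  using X_app_linear by (simp add: clinear_iff fun_eq_iff)

lemma X_mode: "X a v (- 1 - m) 0 = mode a m v"
  by (simp add: X_def scaleC_one)

lemma X_log_form:
  assumes a: "a \<in> graded_part \<sigma> m"
  shows "X a v e k = (if e + m \<in> \<int> then ((- 1) ^ k / fact k) *\<^sub>C X ((N ^^ k) a) v e 0 else 0)"
proof (cases "e + m \<in> \<int>")
  case False
  have "- 1 - e - m \<notin> \<int>"
  proof
    assume int: "- 1 - e - m \<in> \<int>"
    have "- 1 - (- 1 - e - m) \<in> \<int>" by (rule Ints_diff [OF _ int]) simp
    then show False using False by (simp add: algebra_simps)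
  qed
  then have "mode ((N ^^ k) a) (- 1 - e) v = 0" by (rule mode_other [OF graded_N_pow [OF a]])
  then show ?thesis using False by (simp add: X_def)
qed (simp add: X_def scaleC_one)

text \<open>Only the finitely many \<open>(N ^^ k) a\<close> with \<open>k < n\<close> enter, so restrictedness gives one bound for the exponents.\<close>

lemma X_graded_LFie:
  assumes a: "a \<in> graded_part \<sigma> m"
  shows "X a \<in> LFie"
proof (rule LFieI [OF X_vec_linear])
  obtain n where n: "\<And>a. (N ^^ n) a = 0" using N_nilp by blast
  have X0: "X a v e k = 0" if "n \<le> k" for v e k
    unfolding X_def funpow_kernel_mono [OF N_lin n that] clinear_0 [OF mode_add_linear] by simp
  show "finite {k. X a v e k \<noteq> 0}" for v e
    by (rule finite_subset [of _ "{..<n}"]) (use X0 in \<open>auto simp flip: not_le\<close>)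
  show "low_in {- m} (supp (X a v))" for v
  proof -
    have "\<forall>k. \<exists>L::int. \<forall>i\<ge>L. \<rho> (loop_elem ((N ^^ k) a) (m + of_int i)) v = 0"
      by (rule allI, rule rho_truncated [OF graded_N_pow [OF a]])
    from choice [OF this] obtain L :: "nat \<Rightarrow> int"
      where L: "\<And>k i. L k \<le> i \<Longrightarrow> \<rho> (loop_elem ((N ^^ k) a) (m + of_int i)) v = 0" by blast
    show ?thesis
    proof (rule low_in_negative_modes [where M = "\<Sum>k<n. nat (L k)"])
      fix t assume "t \<in> supp (X a v)"
      then obtain k where k: "X a v t k \<noteq> 0" by (auto simp: supp_def)
      then have "k < n" using X0 by (meson not_le)
      have "t + m \<in> \<int>" using k X_log_form [OF a, of v t k] by (auto split: if_splits)
      then obtain z where "t + m = of_int z" by (auto elim: Ints_cases)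
      then have t: "- 1 - t = m + of_int (- 1 - z)" by (simp add: algebra_simps)
      have "mode ((N ^^ k) a) (- 1 - t) v \<noteq> 0" using k by (auto simp: X_def)
      moreover have "(N ^^ k) a \<in> graded_part \<sigma> (- 1 - t)"
        by (rule graded_shift [OF graded_N_pow [OF a]]) (simp add: t)
      ultimately have "\<rho> (loop_elem ((N ^^ k) a) (m + of_int (- 1 - z))) v \<noteq> 0"
        using mode_graded t by metis
      then have "- 1 - z < L k" using L by (meson not_le)
      also have "\<dots> \<le> int (nat (L k))" by simp
      also have "\<dots> \<le> int (\<Sum>k<n. nat (L k))"
        unfolding of_nat_le_iff by (rule member_le_sum) (simp_all add: \<open>k < n\<close>)
      finally show "\<exists>i. - 1 - t = m + of_int i \<and> i < int (\<Sum>k<n. nat (L k))" using t by blast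
    qed
  qed
qed simp

sublocale F: affine_fields \<phi> \<sigma> N br form \<kappa> X
proof
  show "X a \<in> LFie" for a
    by (rule graded_induct [of "\<lambda>a. X a \<in> LFie"]) (simp_all add: clinear_add [OF X_linear] LFie_add X_graded_LFie)
  show "X a v e k = (if e + m \<in> \<int> then ((- 1) ^ k / fact k) *\<^sub>C X ((N ^^ k) a) v e 0 else 0)"
    if "a \<in> graded_part \<sigma> m" for a m v e k by (rule X_log_form [OF that])
qed (auto simp: clinear_add [OF X_linear] clinear_scaleC [OF X_linear] intro: br aut form form_inv)

lemma F_commutators:
  assumes a: "a \<in> graded_part \<sigma> m" and b: "b \<in> graded_part \<sigma> n"
  shows "F.mode_commutators a b m n"
proof -
  let ?f = "if m = - n then form (m *\<^sub>C a + N a) b else 0"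
  have ab: "br a b \<in> graded_part \<sigma> (m + n)" by (rule F.br_graded [OF a b])
  have f0: "form 0 b = 0" "form x 0 = 0" for x
    using clinear_0 [OF cbilinearD(1) [OF form]] clinear_0 [OF cbilinearD(2) [OF form]] by auto
  have "twisted_bracket br form N (loop_elem a m) (loop_elem b n) = (Poly_Mapping.single (m + n) (br a b), ?f)"
    unfolding twisted_bracket_def by (rule loop_bracket_elems [OF br]) (simp_all add: f0 clinear_0 [OF N_lin])
  also have "\<dots> = loop_elem (br a b) (m + n) + ?f *\<^sub>C central_elem"
    by (simp add: scaleC_prod_def scaleC_complex_def poly_mapping_eq_iff fun_eq_iff lookup_scaleC)
  finally have bracket: "twisted_bracket br form N (loop_elem a m) (loop_elem b n) = loop_elem (br a b) (m + n) + ?f *\<^sub>C central_elem" .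
  have K: "central_elem \<in> twisted_carrier \<sigma>" "?f *\<^sub>C central_elem \<in> twisted_carrier \<sigma>"
    using complex_vector.subspace_0 [OF graded_part_subspace]
    by (simp_all add: twisted_carrier_def scaleC_prod_def lookup_scaleC)
  have "\<rho> (loop_elem a m) (\<rho> (loop_elem b n) v) - \<rho> (loop_elem b n) (\<rho> (loop_elem a m) v) =
      \<rho> (loop_elem (br a b) (m + n)) v + (\<kappa> * ?f) *\<^sub>C v" for v
    unfolding lie_moduleD(4) [OF rho_module elem_carrier [OF a] elem_carrier [OF b], symmetric] bracket
      lie_moduleD(2) [OF rho_module elem_carrier [OF ab] K(2)] lie_moduleD(3) [OF rho_module K(1)] rho_central
    by (simp add: scaleC_scaleC mult.commute)
  then show ?thesis
    unfolding F.mode_commutators_def X_mode mode_graded [OF a] mode_graded [OF b] mode_graded [OF ab] by simp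
qed

lemma F_ope: "F.ope a b"
proof (rule F.ope_of_graded)
  fix a b m n assume a: "a \<in> graded_part \<sigma> m" and b: "b \<in> graded_part \<sigma> n"
  show "F.ope a b"
    by (rule F.commutators_imp_ope [OF a b])
      (rule F_commutators [OF graded_shift [OF graded_N_pow [OF a]] graded_shift [OF graded_N_pow [OF b]]])
qed

lemma acts_by_X: 
  assumes "\<And>a. Y (\<iota> a) = X a"
  shows "acts_by_modes Y \<iota> \<sigma> N \<rho>"
  unfolding acts_by_modes_def mode_series_def Y_exp_def assms
  by (auto simp: F.mode_constant X_mode mode_graded)

end

section \<open>From restricted modules to twisted modules\<close>

lemma monodromy_add:
  fixes a b :: "'w::complex_vector lfield"
  assumes "a \<in> LFie" "b \<in> LFie"
  shows "monodromy (a + b) = monodromy a + monodromy b"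
proof (intro ext)
  fix v e k
  have fin: "finite {l. bcoef l k *\<^sub>C f v e l \<noteq> 0}" if "f \<in> LFie" for f :: "'w lfield"
    by (rule finite_subset [OF _ LFie_finite [OF that, of v e]]) auto
  show "monodromy (a + b) v e k = (monodromy a + monodromy b) v e k"
    by (simp add: monodromy_eq rot_def scaleC_add_right Sum_any.distrib [OF fin [OF assms(1)] fin [OF assms(2)]])
qed

lemma monodromy_scaleC:
  assumes "a \<in> LFie"
  shows "monodromy (c *\<^sub>C a) = c *\<^sub>C monodromy a"
  by (rule ext) (simp add: monodromy_eq rot_scaleC LFie_finite [OF assms])

lemma monodromy_id: "monodromy (id_field :: 'w::complex_vector lfield) = id_field"
proof (intro ext)
  fix v :: 'w and e k
  have "Sum_any (\<lambda>l. bcoef l k *\<^sub>C id_field v e l) = (\<Sum>l\<in>{0}. bcoef l k *\<^sub>C id_field v e l)"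
    by (rule Sum_any.expand_superset) (auto simp: id_field_def)
  then show "monodromy id_field v e k = id_field v e k"
    by (cases k) (auto simp: monodromy_eq rot_def id_field_def scaleC_one)
qed

context restricted_module
begin

text \<open>Only fields local to all \<open>X a\<close> can be multiplied by them. By Dong's lemma \<open>G\<close> is stable under these products.\<close>

definition G :: "'w lfield set"
  where "G = {c \<in> LFie. \<forall>a. mutually_local (X a) c}"

lemma G_LFie: "c \<in> G \<Longrightarrow> c \<in> LFie" and G_local: "c \<in> G \<Longrightarrow> mutually_local (X a) c"
  by (simp_all add: G_def)

lemma id_G: "id_field \<in> G"
  by (simp add: G_def id_field_LFie id_mutually_local F.X_LFie)

lemma local_0: "a \<in> LFie \<Longrightarrow> mutually_local a 0"
  using local_scaleC [OF _ id_mutually_local, of a 0] by simp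

lemma G_subspace: "csubspace G"
  unfolding complex_vector.subspace_def
  by (auto simp: G_def LFie_0 LFie_add LFie_scaleC local_0 F.X_LFie intro: local_add local_scaleC)

lemma X_local: "mutually_local (X a) (X b)"
  and X_products: "nth_product (X a) 0 (X b) = X (br a b)"
    "nth_product (X a) 1 (X b) = (\<kappa> * form a b) *\<^sub>C id_field" "2 \<le> n \<Longrightarrow> nth_product (X a) n (X b) = 0"
  using F_ope [of a b] unfolding F.ope_def by blast+

lemma G_product: "c \<in> G \<Longrightarrow> nth_product (X a) m c \<in> G"
  by (simp add: G_def nth_product_LFie F.X_LFie Dong X_local)

sublocale R: loop_rep br "\<lambda>m a n b. if m = - n then of_int m * form a b else 0" \<kappa> "\<lambda>_. UNIV" G
  "\<lambda>a m c. nth_product (X a) m c"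
proof
  fix a b :: 'g and m n :: int and v :: "'w lfield"
  assume v: "v \<in> G"
  note F = F.X_LFie G_LFie [OF v] G_local [OF v]
  show "nth_product (X a) m v \<in> G" by (rule G_product [OF v])
  show "nth_product (X (a + b)) m v = nth_product (X a) m v + nth_product (X b) m v"
    unfolding clinear_add [OF X_linear] by (rule nth_product_add_left [OF F(1,1,2,3,3)])
  show "nth_product (X (c *\<^sub>C a)) m v = c *\<^sub>C nth_product (X a) m v" for c
    unfolding clinear_scaleC [OF X_linear] by (rule nth_product_scaleC_left [OF F])
  show "nth_product (X a) m (v + w) = nth_product (X a) m v + nth_product (X a) m w" if w: "w \<in> G" for w
    by (rule nth_product_add_right [OF F(1,2) G_LFie [OF w] F(3) G_local [OF w]])
  show "nth_product (X a) m (c *\<^sub>C v) = c *\<^sub>C nth_product (X a) m v" for c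
    by (rule nth_product_scaleC_right [OF F])
  have id: "of_int m *\<^sub>C nth_product ((\<kappa> * form a b) *\<^sub>C id_field) (m + n - 1) v =
      (\<kappa> * (if m = - n then of_int m * form a b else 0)) *\<^sub>C v"
  proof -
    have "mutually_local id_field v" by (rule mutually_local_sym [OF id_mutually_local [OF F(2)]])
    moreover have "m + n - 1 = - 1 \<longleftrightarrow> m = - n" by auto
    ultimately show ?thesis
      by (simp add: nth_product_scaleC_left [OF id_field_LFie F(2)] nth_product_id_left [OF F(2)] scaleC_scaleC mult.left_commute)
  qed
  have "nth_product (X a) m (nth_product (X b) n v) - nth_product (X b) n (nth_product (X a) m v) =
      nth_product (nth_product (X a) 0 (X b)) (m + n) v + of_int m *\<^sub>C nth_product (nth_product (X a) 1 (X b)) (m + n - 1) v"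
    by (rule commutator_formula [OF F(1,1,2) X_local F(3,3)]) (rule X_products(3))
  then show "nth_product (X a) m (nth_product (X b) n v) - nth_product (X b) n (nth_product (X a) m v) =
      nth_product (X (br a b)) (m + n) v + (\<kappa> * (if m = - n then of_int m * form a b else 0)) *\<^sub>C v"
    unfolding X_products(1,2) id .
qed (simp_all add: G_subspace)

definition act :: "(int \<Rightarrow>\<^sub>0 'g) \<times> complex \<Rightarrow> 'w lfield \<Rightarrow> 'w lfield"
  where "act = loop_action (\<lambda>a m. nth_product (X a) m) \<kappa>"

lemma act_carrier: "Z \<in> R.carrier"
  by (simp add: R.carrier_def R.loops_def)

lemma act_G: "c \<in> G \<Longrightarrow> act Z c \<in> G"
  unfolding act_def by (rule R.loop_action_closed [OF act_carrier])

lemma act_vec: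
  assumes "c \<in> G"
  shows "d \<in> G \<Longrightarrow> act Z (c + d) = act Z c + act Z d" and "act Z (r *\<^sub>C c) = r *\<^sub>C act Z c"
  unfolding act_def using R.loop_action_vec [OF act_carrier assms] by blast+

lemma act_lie:
  assumes "c \<in> G"
  shows "act (Z + Z') c = act Z c + act Z' c" and "act (r *\<^sub>C Z) c = r *\<^sub>C act Z c"
    and "act (affine_bracket br form Z Z') c = act Z (act Z' c) - act Z' (act Z c)"
  unfolding act_def affine_bracket_def
  by (rule R.loop_action_add [OF act_carrier act_carrier assms] R.loop_action_scale [OF act_carrier assms]
      R.loop_action_bracket [OF act_carrier act_carrier assms])+

lemma act_elem: "c \<in> G \<Longrightarrow> act (loop_elem a m) c = nth_product (X a) m c"
  unfolding act_def by (rule R.loop_action_elem)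

lemma act_id:
  assumes "\<forall>m<0. Poly_Mapping.lookup (fst Z) m = 0"
  shows "act Z id_field = (\<kappa> * snd Z) *\<^sub>C id_field"
proof -
  have "nth_product (X (Poly_Mapping.lookup (fst Z) m)) m id_field = 0" for m
  proof (cases "m < 0")
    case True
    then show ?thesis
      using assms nth_product_id_right(2) R.A_0 [OF id_G] by simp
  next
    case False
    then show ?thesis by (intro nth_product_id_right(2) F.X_LFie) simp
  qed
  then show ?thesis by (simp add: act_def loop_action_def loop_part_def)
qed

lemma act_neg: "c \<in> G \<Longrightarrow> act Z (- c) = - act Z c"
  using act_vec(2) [of c Z "- 1"] by (simp add: complex_vector.scale_minus_left scaleC_one)

lemma act_diff: "c \<in> G \<Longrightarrow> d \<in> G \<Longrightarrow> act Z (c - d) = act Z c - act Z d"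
  using act_vec(1) [of c "- d" Z] act_neg [of d Z] complex_vector.subspace_neg [OF G_subspace] by simp

lemma word_G: "c \<in> G \<Longrightarrow> foldr act w c \<in> G"
  by (induction w) (simp_all add: act_G)

lemma word_vec:
  assumes "c \<in> G"
  shows "d \<in> G \<Longrightarrow> foldr act w (c + d) = foldr act w c + foldr act w d"
    and "d \<in> G \<Longrightarrow> foldr act w (c - d) = foldr act w c - foldr act w d"
    and "foldr act w (r *\<^sub>C c) = r *\<^sub>C foldr act w c"
  by (induction w) (simp_all add: act_vec act_diff word_G assms)

text \<open>The defining relations of the vertex algebra hold for the identity field in place of the vacuum. Those of
  the affinization hold on all of \<open>G\<close>; those of the vacuum hold since $a_{(m)}I = 0$ for $m \ge 0$.\<close>

lemma relations_killed:
  assumes "r \<in> relations"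
  shows "word_eval act id_field r = 0"
proof -
  note W = clinear_diff [OF word_eval_linear] clinear_scaleC [OF word_eval_linear] word_eval_word
  note g = word_G [OF id_G]
  have 1: "word_eval act id_field (word (u @ [x + y] @ w) - word (u @ [x] @ w) - word (u @ [y] @ w)) = 0" for u x y w
    by (simp add: W act_lie(1) [OF g] word_vec(1) [OF act_G [OF g] act_G [OF g]])
  have 2: "word_eval act id_field (word (u @ [c *\<^sub>C x] @ w) - c *\<^sub>C word (u @ [x] @ w)) = 0" for u c x w
    by (simp add: W act_lie(2) [OF g] word_vec(3) [OF act_G [OF g]])
  have 3: "word_eval act id_field (word (u @ [x, y] @ w) - word (u @ [y, x] @ w) - word (u @ [affine_bracket br form x y] @ w)) = 0" for u x y w
    by (simp add: W act_lie(3) [OF g] word_vec(2) [OF act_G [OF act_G [OF g]] act_G [OF act_G [OF g]]])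
  have 4: "word_eval act id_field (word (u @ [x]) - (\<kappa> * snd x) *\<^sub>C word u) = 0" if "\<forall>m<0. Poly_Mapping.lookup (fst x) m = 0" for u x
    by (simp add: W act_id [OF that] word_vec(3) [OF id_G])
  from assms show ?thesis
    unfolding induced_relations_def by (elim UnE CollectE exE conjE; hypsubst) (simp_all only: 1 2 3 4 mem_Collect_eq)
qed

lemma word_eval_well_defined:
  assumes "word_eval \<rho>V vac p = word_eval \<rho>V vac q"
  shows "word_eval act id_field p = word_eval act id_field q"
proof -
  have "word_eval \<rho>V vac (p - q) = 0" using assms by (simp add: clinear_diff [OF word_eval_linear])
  then have "p - q \<in> cspan relations" using V_kernel by blast
  then have "word_eval act id_field (p - q) = 0"
  proof (induction rule: complex_vector.span_induct_alt)
    case base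
    show ?case by (rule clinear_0 [OF word_eval_linear])
  next
    case (step c x y)
    then show ?case
      by (simp add: clinear_add [OF word_eval_linear] clinear_scaleC [OF word_eval_linear] relations_killed)
  qed
  then show ?thesis by (simp add: clinear_diff [OF word_eval_linear])
qed

text \<open>\<open>v\<close> is written as a combination of words applied to the vacuum, and these words are applied to the identity
  field. By \<open>word_eval_well_defined\<close> the result depends on \<open>v\<close> only.\<close>

definition Y :: "'v \<Rightarrow> 'w lfield"
  where "Y v = word_eval act id_field (SOME p. word_eval \<rho>V vac p = v)"

lemma Y_eval: "Y (word_eval \<rho>V vac p) = word_eval act id_field p"
  unfolding Y_def by (rule word_eval_well_defined) (rule someI [where x = p], rule refl)

lemma Y_lin: "clinear Y"
proof -
  have ex: "\<exists>p. v = word_eval \<rho>V vac p" for v using V_surj by (auto simp: surj_def)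
  show ?thesis
  proof (rule clinearI)
    fix v w c
    obtain p q where pq: "v = word_eval \<rho>V vac p" "w = word_eval \<rho>V vac q" using ex by blast
    show "Y (v + w) = Y v + Y w"
      unfolding pq clinear_add [OF word_eval_linear, symmetric] Y_eval by (rule refl)
    show "Y (c *\<^sub>C v) = c *\<^sub>C Y v"
      unfolding pq clinear_scaleC [OF word_eval_linear, symmetric] Y_eval by (rule refl)
  qed
qed

lemma Y_word: "Y (foldr \<rho>V w vac) = foldr act w id_field"
  using Y_eval [of "word w"] by (simp only: word_eval_word)

lemma Y_G: "Y v \<in> G"
proof -
  obtain p where p: "v = (\<Sum>w\<in>Poly_Mapping.keys p. Poly_Mapping.lookup p w *\<^sub>C foldr \<rho>V w vac)" by (rule V_word_sum)
  have "Y v = (\<Sum>w\<in>Poly_Mapping.keys p. Poly_Mapping.lookup p w *\<^sub>C foldr act w id_field)"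
    unfolding p clinear_sum [OF Y_lin] clinear_scaleC [OF Y_lin] Y_word ..
  also have "\<dots> \<in> G"
    by (rule complex_vector.subspace_sum [OF G_subspace])
      (rule complex_vector.subspace_scale [OF G_subspace word_G [OF id_G]])
  finally show ?thesis .
qed

lemma Y_act: "Y (\<rho>V Z v) = act Z (Y v)"
proof -
  obtain p where p: "v = (\<Sum>w\<in>Poly_Mapping.keys p. Poly_Mapping.lookup p w *\<^sub>C foldr \<rho>V w vac)" by (rule V_word_sum)
  have act_0: "act Z 0 = 0" using act_vec(2) [OF id_G, of Z 0] by simp
  have *: "Y (\<rho>V Z (\<Sum>w\<in>K. Poly_Mapping.lookup p w *\<^sub>C foldr \<rho>V w vac)) = act Z (Y (\<Sum>w\<in>K. Poly_Mapping.lookup p w *\<^sub>C foldr \<rho>V w vac))"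
    if "finite K" for K
    using that
  proof (induction K)
    case empty
    show ?case unfolding sum.empty clinear_0 [OF V_linear] clinear_0 [OF Y_lin] act_0 ..
  next
    case (insert w K)
    have word: "Y (\<rho>V Z (foldr \<rho>V w vac)) = act Z (Y (foldr \<rho>V w vac))"
      using Y_word [of "Z # w"] Y_word [of w] by simp
    show ?case
      unfolding sum.insert [OF insert.hyps] clinear_add [OF V_linear] clinear_scaleC [OF V_linear] clinear_add [OF Y_lin]
        clinear_scaleC [OF Y_lin] act_vec(1) [OF complex_vector.subspace_scale [OF G_subspace Y_G] Y_G] act_vec(2) [OF Y_G]
        word insert.IH ..
  qed
  show ?thesis unfolding p by (rule *) simp
qed

lemma Y_vacuum: "Y vac = id_field"
  using Y_word [of "[]"] by simp

lemma Y_product_incl: "Y (pr m (\<iota> a) v) = nth_product (X a) m (Y v)"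
  unfolding pr_incl Y_act by (rule act_elem [OF Y_G])

lemma Y_incl: "Y (\<iota> a) = X a"
  using Y_act [of "loop_elem a (- 1)" vac]
  by (simp add: affine_incl_def Y_vacuum act_elem [OF id_G] nth_product_id_right(1) F.X_LFie)

lemma Y_in_LFie: "Y v \<in> LFie"
  by (rule G_LFie [OF Y_G])

lemma Y_mutually_local: "mutually_local (Y v) (Y w)"
proof -
  have "w \<in> {w. mutually_local (Y v) (Y w)}"
  proof (rule V_induct)
    show "csubspace {w. mutually_local (Y v) (Y w)}"
      unfolding complex_vector.subspace_def
      by (auto simp: clinear_0 [OF Y_lin] clinear_add [OF Y_lin] clinear_scaleC [OF Y_lin] local_0 Y_in_LFie
          intro: local_add local_scaleC)
    show "vac \<in> {w. mutually_local (Y v) (Y w)}"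
      by (simp add: Y_vacuum id_mutually_local Y_in_LFie)
    show "pr m (\<iota> a) w \<in> {w. mutually_local (Y v) (Y w)}" if "w \<in> {w. mutually_local (Y v) (Y w)}" for a m w
      using that mutually_local_sym [OF G_local [OF Y_G]]
      by (simp add: Y_product_incl Dong Y_in_LFie F.X_LFie G_local [OF Y_G])
  qed
  then show ?thesis by simp
qed

lemma Y_iter:
  assumes "\<And>m n. Y (P m n) = P' m n" "\<And>m n. Y (Q m n) = Q' m n"
    and "\<exists>n0. \<forall>m n. n0 \<le> n \<longrightarrow> P m n = 0" "\<exists>n0. \<forall>m n. n0 \<le> m \<longrightarrow> Q m n = 0"
  shows "Y (iter P Q n k) = iter P' Q' n k"
proof -
  obtain p q where p: "\<And>m n. p \<le> n \<Longrightarrow> P m n = 0" and q: "\<And>m n. q \<le> m \<Longrightarrow> Q m n = 0" using assms(3,4) by blast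
  have "finite {j::nat. P (n - int j) (k + int j) \<noteq> 0}"
  proof (rule finite_subset)
    show "{j::nat. P (n - int j) (k + int j) \<noteq> 0} \<subseteq> {..<nat (p - k)}"
      using p by (auto simp: not_less [symmetric] intro: ccontr)
  qed simp
  then have f1: "finite {j::nat. ((- 1) ^ j * (of_int n gchoose j)) *\<^sub>C P (n - int j) (k + int j) \<noteq> 0}"
    by (rule rev_finite_subset) auto
  have "finite {j::nat. Q (int j) (n + k - int j) \<noteq> 0}"
  proof (rule finite_subset)
    show "{j::nat. Q (int j) (n + k - int j) \<noteq> 0} \<subseteq> {..<nat q}"
      using q by (auto simp: not_less [symmetric] intro: ccontr)
  qed simp
  then have f2: "finite {j::nat. ((- 1) ^ j * ((- 1) powi n) * (of_int n gchoose j)) *\<^sub>C Q (int j) (n + k - int j) \<noteq> 0}"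
    by (rule rev_finite_subset) auto
  show ?thesis
    unfolding iter_def iter_left_def iter_right_def clinear_diff [OF Y_lin] clinear_Sum_any [OF Y_lin f1] clinear_Sum_any [OF Y_lin f2]
      clinear_scaleC [OF Y_lin] assms(1,2) ..
qed

text \<open>By induction on \<open>x\<close>: the iterate formula holds in the vertex algebra and for fields, and expresses products with
  $a_{(n)}x$ through products with \<open>a\<close> and with \<open>x\<close>.\<close>

theorem Y_products: "Y (pr k x w) = nth_product (Y x) k (Y w)"
proof -
  have "x \<in> {x. \<forall>k w. Y (pr k x w) = nth_product (Y x) k (Y w)}"
  proof (rule V_induct)
    show "csubspace {x. \<forall>k w. Y (pr k x w) = nth_product (Y x) k (Y w)}"
      unfolding complex_vector.subspace_def
      by (auto simp: clinear_0 [OF pr_linear(2)] clinear_add [OF pr_linear(2)] clinear_scaleC [OF pr_linear(2)]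
          clinear_0 [OF Y_lin] clinear_add [OF Y_lin] clinear_scaleC [OF Y_lin] nth_product_0_left Y_in_LFie
          nth_product_add_left nth_product_scaleC_left Y_mutually_local)
    show "vac \<in> {x. \<forall>k w. Y (pr k x w) = nth_product (Y x) k (Y w)}"
      by (auto simp: pr_vac Y_vacuum nth_product_id_left Y_in_LFie clinear_0 [OF Y_lin])
    fix a n x assume x: "x \<in> {x. \<forall>k w. Y (pr k x w) = nth_product (Y x) k (Y w)}"
    have "Y (pr k (pr n (\<iota> a) x) w) = nth_product (Y (pr n (\<iota> a) x)) k (Y w)" for k w
    proof -
      have V: "pr k (pr n (\<iota> a) x) w = iter (\<lambda>m n. pr m (\<iota> a) (pr n x w)) (\<lambda>m n. pr n x (pr m (\<iota> a) w)) n k"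
        unfolding pr_iterate iter_def iter_left_def iter_right_def ..
      have Y: "Y (iter (\<lambda>m n. pr m (\<iota> a) (pr n x w)) (\<lambda>m n. pr n x (pr m (\<iota> a) w)) n k) =
        iter (\<lambda>m n. nth_product (X a) m (nth_product (Y x) n (Y w)))
         (\<lambda>m n. nth_product (Y x) n (nth_product (X a) m (Y w))) n k"
      proof (rule Y_iter)
        show "\<exists>n0. \<forall>m n. n0 \<le> n \<longrightarrow> pr m (\<iota> a) (pr n x w) = 0"
          using pr_field [of x w] clinear_0 [OF pr_linear(1)] by metis
        show "\<exists>n0. \<forall>m n. n0 \<le> m \<longrightarrow> pr n x (pr m (\<iota> a) w) = 0"
          using pr_field [of "\<iota> a" w] clinear_0 [OF pr_linear(1)] by metis
      qed (use x in \<open>simp_all add: Y_product_incl\<close>)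
      show ?thesis
        unfolding V Y Y_product_incl
        by (rule iterate_formula [OF F.X_LFie Y_in_LFie Y_in_LFie G_local [OF Y_G] G_local [OF Y_G] Y_mutually_local, symmetric])
    qed
    then show "pr n (\<iota> a) x \<in> {x. \<forall>k w. Y (pr k x w) = nth_product (Y x) k (Y w)}" by blast
  qed
  then show ?thesis by blast
qed

theorem Y_twisted: "Y (\<phi>V v) = monodromy (Y v)"
proof -
  have lin: "clinear \<phi>V" and v0: "\<phi>V vac = vac" and hom: "\<And>n v w. \<phi>V (pr n v w) = pr n (\<phi>V v) (\<phi>V w)"
    using phiV by (simp_all add: va_automorphism_def)
  have "v \<in> {v. Y (\<phi>V v) = monodromy (Y v)}"
  proof (rule V_induct)
    have 0: "monodromy (0 :: 'w lfield) = 0" using monodromy_scaleC [OF id_field_LFie, of 0] by simp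
    show "csubspace {v. Y (\<phi>V v) = monodromy (Y v)}"
      unfolding complex_vector.subspace_def
      by (auto simp: clinear_0 [OF lin] clinear_add [OF lin] clinear_scaleC [OF lin] clinear_0 [OF Y_lin] clinear_add [OF Y_lin]
          clinear_scaleC [OF Y_lin] 0 monodromy_add monodromy_scaleC Y_in_LFie)
    show "vac \<in> {v. Y (\<phi>V v) = monodromy (Y v)}" by (simp add: v0 Y_vacuum monodromy_id)
    show "pr m (\<iota> a) v \<in> {v. Y (\<phi>V v) = monodromy (Y v)}" if "v \<in> {v. Y (\<phi>V v) = monodromy (Y v)}" for a m v
      using that nth_product_monodromy(2) [OF F.X_LFie Y_in_LFie G_local [OF Y_G]]
      by (simp add: hom phiV_incl Y_product_incl F.X_monodromy)
  qed
  then show ?thesis by simp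
qed

theorem twisted_module_of_restricted_module: "twisted_module vac pr \<phi>V Y \<and> acts_by_modes Y \<iota> \<sigma> N \<rho>"
proof
  have "clinear (\<lambda>a. Y a v e k)" for v e k using Y_lin by (simp add: clinear_iff)
  then show "twisted_module vac pr \<phi>V Y"
    unfolding twisted_module_def local_collection_def
    using Y_in_LFie Y_vacuum Y_mutually_local Y_twisted Y_products by blast
  show "acts_by_modes Y \<iota> \<sigma> N \<rho>" by (rule acts_by_X) (rule Y_incl)
qed

end

context affine_orbifold
begin

text \<open>The modes determine the fields of \<open>a\<close> by \<open>twisted_log_form\<close>, and these generate.\<close>

theorem twisted_module_unique:
  fixes Y Y' :: "'v \<Rightarrow> 'w::complex_vector lfield"
  assumes Y: "twisted_module vac pr \<phi>V Y" "acts_by_modes Y \<iota> \<sigma> N \<rho>"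
    and Y': "twisted_module vac pr \<phi>V Y'" "acts_by_modes Y' \<iota> \<sigma> N \<rho>"
  shows "Y = Y'"
proof -
  have field: "Z (\<iota> x) v e k = (if e + m \<in> \<int> then ((- 1) ^ k / fact k) *\<^sub>C \<rho> (loop_elem ((N ^^ k) x) (- 1 - e)) v else 0)"
    if Z: "twisted_module vac pr \<phi>V Z" "acts_by_modes Z \<iota> \<sigma> N \<rho>" and x: "x \<in> graded_part \<sigma> m"
    for Z :: "'v \<Rightarrow> 'w lfield" and x m v e k
  proof -
    interpret Z: affine_fields \<phi> \<sigma> N br form \<kappa> "\<lambda>a. Z (\<iota> a)" by (rule twisted_module_fields [OF Z(1)])
    have "Z (\<iota> ((N ^^ k) x)) v e 0 = \<rho> (loop_elem ((N ^^ k) x) (- 1 - e)) v" if g: "e + m \<in> \<int>"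
    proof -
      have "- 1 - e - m = - 1 - (e + m)" by simp
      also have "\<dots> \<in> \<int>" by (rule Ints_diff [OF _ g]) simp
      finally have "- 1 - e - m \<in> \<int>" .
      then have "exp (- \<s> * (- 1 - e)) = exp (- \<s> * m)" using exp_s_class by blast
      then have "(N ^^ k) x \<in> graded_part \<sigma> (- 1 - e)"
        using graded_N_pow [OF x, of k] by (simp only: graded_part_iff)
      then have "mode_series Z \<iota> N ((N ^^ k) x) (- 1 - e) v 0 = \<rho> (loop_elem ((N ^^ k) x) (- 1 - e)) v"
        using Z(2) unfolding acts_by_modes_def by simp
      then show ?thesis by (simp add: mode_series_def Y_exp_def scaleC_one)
    qed
    then show ?thesis using Z.X_log [OF x, of v e k] by simp
  qed
  have incl: "Y (\<iota> a) = Y' (\<iota> a)" for a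
  proof (intro ext)
    fix v e k
    show "Y (\<iota> a) v e k = Y' (\<iota> a) v e k"
    proof (rule linear_eqI)
      show "clinear (\<lambda>a. Y (\<iota> a) v e k)" "clinear (\<lambda>a. Y' (\<iota> a) v e k)"
        using Y_linear [OF Y(1)] Y_linear [OF Y'(1)] incl_linear by (simp_all add: clinear_iff)
      fix x c assume "\<sigma> x = c *\<^sub>C x"
      then obtain m where x: "x \<in> graded_part \<sigma> m" by (rule eigen_graded)
      show "Y (\<iota> x) v e k = Y' (\<iota> x) v e k" unfolding field [OF Y x] field [OF Y' x] ..
    qed
  qed
  have "v \<in> {v. Y v = Y' v}" for v
  proof (rule V_induct)
    show "csubspace {v. Y v = Y' v}"
      by (simp add: complex_vector.subspace_def clinear_0 [OF Y_linear] clinear_add [OF Y_linear] clinear_scaleC [OF Y_linear] Y(1) Y'(1))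
  qed (simp_all add: Y_vac Y_product Y(1) Y'(1) incl)
  then show ?thesis by auto
qed

end

theorem theorem6p3:
  fixes br :: "'g::complex_vector \<Rightarrow> 'g \<Rightarrow> 'g"
    and form :: "'g \<Rightarrow> 'g \<Rightarrow> complex"
    and \<phi> \<sigma> N :: "'g \<Rightarrow> 'g"
    and \<kappa> :: complex
    and vac :: "'v::complex_vector"
    and pr :: "int \<Rightarrow> 'v \<Rightarrow> 'v \<Rightarrow> 'v"
    and \<rho>V :: "(int \<Rightarrow>\<^sub>0 'g) \<times> complex \<Rightarrow> 'v \<Rightarrow> 'v"
    and \<phi>V :: "'v \<Rightarrow> 'v"
  assumes "lie_algebra br"
    and "finite_dimensional TYPE('g)"
    and "lie_simple br \<or> lie_abelian br"
    and "invariant_form br form"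
    and "nondegenerate form"
    and "lie_simple br \<longrightarrow> normalized_form br form"
    and "lie_automorphism br \<phi>"
    and "\<forall>a b. form (\<phi> a) (\<phi> b) = form a b"
    and "jordan_decomposition \<phi> \<sigma> N"
    and "universal_affine_vertex_algebra br form \<kappa> vac pr \<rho>V"
    and "va_automorphism vac pr \<phi>V"
    and "\<forall>a. \<phi>V (affine_incl \<rho>V vac a) = affine_incl \<rho>V vac (\<phi> a)"
  shows "(\<forall>Y :: 'v \<Rightarrow> 'w::complex_vector lfield. twisted_module vac pr \<phi>V Y \<longrightarrow>
        (\<exists>\<rho>. restricted_twisted_affine_module br form \<sigma> N \<kappa> \<rho> \<and>
             acts_by_modes Y (affine_incl \<rho>V vac) \<sigma> N \<rho>)) \<and>
    (\<forall>\<rho> :: (complex \<Rightarrow>\<^sub>0 'g) \<times> complex \<Rightarrow> 'w \<Rightarrow> 'w.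
        restricted_twisted_affine_module br form \<sigma> N \<kappa> \<rho> \<longrightarrow>
        (\<exists>!Y :: 'v \<Rightarrow> 'w lfield. twisted_module vac pr \<phi>V Y \<and>
             acts_by_modes Y (affine_incl \<rho>V vac) \<sigma> N \<rho>))"
proof -
  interpret affine_orbifold br form \<kappa> vac pr \<rho>V \<phi> \<sigma> N \<phi>V
  proof (intro affine_orbifold.intro affine_va.intro jordan.intro affine_orbifold_axioms.intro)
    show "cbilinear br" "cbilinear form" "clinear \<phi>" "bij \<phi>" "\<phi> (br a b) = br (\<phi> a) (\<phi> b)" for a b
      using assms(1,4,7) by (simp_all add: lie_algebra_def invariant_form_def lie_automorphism_def)
  qed (use assms in blast)+
  show ?thesis
  proof (intro conjI allI impI)
    fix \<rho> :: "(complex \<Rightarrow>\<^sub>0 'g) \<times> complex \<Rightarrow> 'w \<Rightarrow> 'w"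
    assume "restricted_twisted_affine_module br form \<sigma> N \<kappa> \<rho>"
    then interpret restricted_module br form \<kappa> vac pr \<rho>V \<phi> \<sigma> N \<phi>V \<rho>
      by unfold_locales
    show "\<exists>!Y :: 'v \<Rightarrow> 'w lfield. twisted_module vac pr \<phi>V Y \<and> acts_by_modes Y \<iota> \<sigma> N \<rho>"
      using twisted_module_of_restricted_module twisted_module_unique by blast
  qed (rule restricted_module_of_twisted_module)
qed

end
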